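(* Let $T>0$ and let $f:\mathbb{R}\rightarrow\mathbb{R}$ be a convex function such that its right derivative $f'_{+}$ is bounded and the process $f'_{-}(B_{\cdot})$ belongs to $M_{\omega}^{2}(0,T)$, where $f'_-$ is the left derivative of $f$. Then, for all $t\in[0,T]$, quasi-surely, $$f(B_{t})= f(0)+\int_{0}^{t}f'_{-}(B_{s})\,dB_{s}+\frac12\int_{-\infty}^{\infty}L_{t}^{a}\,f''(da),$$ where $f''$ denotes the measure $\mu$ on $\mathcal{B}(\mathbb{R})$ defined by $\mu[a,b)=f'_{-}(b)-f'_{-}(a)$ for all $a<b$.
   Context: Setting. Fix reals $0\le\underline\sigma\le\overline\sigma$ and put $G(\alpha)=\frac12(\overline\sigma^2\alpha^+-\underline\sigma^2\alpha^-)$, $\alpha\in\mathbb{R}$. Let $\Omega=C_0(\mathbb{R}^+)$ be the space of real continuous functions $\omega$ on $[0,\infty)$ with $\omega_0=0$, with the topology of locally uniform convergence and Borel $\sigma$-algebra $\mathcal{B}(\Omega)$; $B_t(\omega)=\omega_t$ is the coordinate process; $\Omega_t=\{\omega_{\cdot\wedge t}:\omega\in\Omega\}$, $\mathcal F_t=\mathcal B(\Omega_t)$; $L_b(\Omega_t)$ is the space of bounded real $\mathcal{B}(\Omega_t)$-measurable functions. $\hat{\mathbb{E}}$ is Peng's $G$-expectation: the sublinear expectation (monotone, constant preserving, subadditive, positively homogeneous), defined on cylinder functions $\varphi(\omega_{t_1},\dots,\omega_{t_d})$ with $\varphi$ bounded Lipschitz and on their completion, under which $B$ is a $G$-Brownian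 motion, i.e. $B_0=0$, and for all $t,s\ge0$ the increment $B_{t+s}-B_t$ is $G$-normally distributed $\mathcal{N}(0,[\underline\sigma^2s,\overline\sigma^2s])$ and independent from $(B_{t_1},\dots,B_{t_n})$ for all $0\le t_1\le\dots\le t_n\le t$. Here $\xi\sim\mathcal{N}(0,[\underline\sigma^2,\overline\sigma^2])$ means that for every bounded Lipschitz $\varphi$, $u(t,x)=\hat{\mathbb{E}}[\varphi(x+\sqrt t\,\xi)]$ is the unique viscosity solution of $\partial_tu=G(\partial^2_{xx}u)$, $u(0,\cdot)=\varphi$; and $Y$ is independent from $X$ if $\hat{\mathbb{E}}[\varphi(X,Y)]=\hat{\mathbb{E}}[\hat{\mathbb{E}}[\varphi(x,Y)]_{x=X}]$ for all bounded Lipschitz $\varphi$. There is a weakly compact family $\mathcal{P}$ of probability measures on $(\Omega,\mathcal{B}(\Omega))$ with $\hat{\mathbb{E}}[\cdot]=\sup_{P\in\mathcal{P}}E_P[\cdot]$; this formula is used for all measurable functions. A set $A\in\mathcal B(\Omega)$ is polar if $\hat c(A):=\sup_{P\in\mathcal{P}}P(A)=0$; "quasi-surely" (q.s.) means outside a polar set. $\mathbb{L}^p$ is the space of (q.s. classes of) measurable $X$ with $\|X\|_p=\hat{\mathbb{E}}[|X|^p]^{1/p}<\infty$. $\langle B\rangle_t=\lim\sum_i(B_{t_{i+1}}-B_{t_i})^2=B_t^2-2\int_0^tB_sdB_s$ (limit in $\mathbb{L}^2$ along partitions of $[0,t]$ with mesh tending to $0$) is the quadratic variation process, continuous and increasing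 q.s. Stochastic integral. $M_{b,0}(0,T)$ is the set of processes $\eta_t=\sum_{j=0}^{n-1}\xi_j1_{[t_j,t_{j+1})}(t)$ with $0=t_0<\dots<t_n=T$, $\xi_j\in L_b(\Omega_{t_j})$; for such $\eta$, $\int_0^T\eta_sdB_s=\sum_j\xi_j(B_{t_{j+1}}-B_{t_j})$. $M_*^p(0,T)$ and $\widetilde M_*^p(0,T)$ are the completions of $M_{b,0}(0,T)$ under the norms $(\hat{\mathbb{E}}[\int_0^T|\eta_t|^pdt])^{1/p}$ and $(\hat{\mathbb{E}}[\int_0^T|\eta_t|^pd\langle B\rangle_t])^{1/p}$; $M_*^p(0,T)\subset\widetilde M_*^p(0,T)$. The stochastic integral extends continuously, with values in $\mathbb{L}^2$, to $\widetilde M^2_*(0,T)$ (hence to $M^2_*(0,T)$). $M_\omega^p(0,T)$ is the space of processes $\eta=(\eta_t)_{t\in[0,T]}$ for which there is an increasing sequence of stopping times $\sigma_m\uparrow T$ q.s. (possibly depending on $\eta$) such that $\eta1_{[0,\sigma_m]}\in M_*^p(0,T)$ for all $m$ and $\hat c(\int_0^T|\eta_s|^pds<\infty)=1$; for $\eta\in M_\omega^2(0,T)$ the stochastic integral is defined by localization along $(\sigma_m)$. Local time. $L^a_t=\lim_{\varepsilon\to0}\frac1{2\varepsilon}\int_0^t1_{(a-\varepsilon,a+\varepsilon)}(B_s)d\langle B\rangle_s$ (limit in $\mathbb{L}^2$), equivalently $L^a_t=|B_t-a|-|a|-\int_0^t\mathrm{sgn}(B_s-a)dB_s$ q.s.,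 where $\mathrm{sgn}(x)=1,0,-1$ for $x>0$, $x=0$, $x<0$ and $\mathrm{sgn}(B_\cdot-a)\in\widetilde M_*^2(0,T)$. $(a,t)\mapsto L^a_t$ is taken in its jointly continuous modification (which exists). *)

theory Defs
  imports "HOL-Probability.Probability"
begin

section \<open>The path space\<close>

text \<open>
  \<open>\<Omega>\<close> is the space of continuous functions on \<open>[0, \<infinity>)\<close> that start in 0.  A path is represented by
  its extension by 0 to the negative half line, so that the correspondence is one to one.
\<close>

typedef path = "{w :: real \<Rightarrow> real. continuous_on UNIV w \<and> (\<forall>t\<le>0. w t = 0)}"
  by (rule exI[of _ "\<lambda>_. 0"]) simp

definition B :: "real \<Rightarrow> path \<Rightarrow> real" where
  "B t w = Rep_path w t"

text \<open>The topology of locally uniform convergence; \<open>borel :: path measure\<close> is then \<open>\<B>(\<Omega>)\<close>.\<close>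

instantiation path :: topological_space
begin

definition open_path :: "path set \<Rightarrow> bool" where
  "open_path U \<longleftrightarrow>
     (\<forall>w\<in>U. \<exists>r\<ge>0. \<exists>e>0. \<forall>w'. (\<forall>s\<in>{0..r}. \<bar>B s w' - B s w\<bar> < e) \<longrightarrow> w' \<in> U)"

instance
proof
  show "open (UNIV :: path set)"
    unfolding open_path_def by (auto intro: exI[of _ 0] exI[of _ 1])
next
  fix S U :: "path set"
  assume S: "open S" and U: "open U"
  show "open (S \<inter> U)"
    unfolding open_path_def
  proof
    fix w assume w: "w \<in> S \<inter> U"
    obtain r e where 1: "r \<ge> 0" "e > 0" "\<And>w'. (\<forall>s\<in>{0..r}. \<bar>B s w' - B s w\<bar> < e) \<Longrightarrow> w' \<in> S"
      using S w unfolding open_path_def by blast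
    obtain r' e' where 2: "r' \<ge> 0" "e' > 0" "\<And>w'. (\<forall>s\<in>{0..r'}. \<bar>B s w' - B s w\<bar> < e') \<Longrightarrow> w' \<in> U"
      using U w unfolding open_path_def by blast
    have "w' \<in> S \<inter> U" if "\<forall>s\<in>{0..max r r'}. \<bar>B s w' - B s w\<bar> < min e e'" for w'
    proof
      show "w' \<in> S" using that by (intro 1(3)) (force simp: le_max_iff_disj)
      show "w' \<in> U" using that by (intro 2(3)) (force simp: le_max_iff_disj)
    qed
    moreover have "max r r' \<ge> 0" "min e e' > 0" using 1 2 by auto
    ultimately show "\<exists>r\<ge>0. \<exists>e>0. \<forall>w'. (\<forall>s\<in>{0..r}. \<bar>B s w' - B s w\<bar> < e) \<longrightarrow> w' \<in> S \<inter> U"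
      by blast
  qed
next
  fix K :: "path set set"
  assume K: "\<forall>S\<in>K. open S"
  show "open (\<Union>K)"
    unfolding open_path_def
  proof
    fix w assume "w \<in> \<Union>K"
    then obtain S where S: "S \<in> K" "w \<in> S" by blast
    then obtain r e where "r \<ge> 0" "e > 0" "\<forall>w'. (\<forall>s\<in>{0..r}. \<bar>B s w' - B s w\<bar> < e) \<longrightarrow> w' \<in> S"
      using K unfolding open_path_def by blast
    then show "\<exists>r\<ge>0. \<exists>e>0. \<forall>w'. (\<forall>s\<in>{0..r}. \<bar>B s w' - B s w\<bar> < e) \<longrightarrow> w' \<in> \<Union>K"
      using S(1) by blast
  qed
qed

end

definition stop_path :: "real \<Rightarrow> path \<Rightarrow> path" where
  "stop_path t w = Abs_path (\<lambda>s. Rep_path w (min s t))"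

text \<open>
  \<open>\<B>(\<Omega>\<^sub>t)\<close>, pulled back to \<open>\<Omega>\<close> along the stopping map: a function on \<open>\<Omega>\<^sub>t\<close> is regarded as the
  function on \<open>\<Omega>\<close> that sees only the stopped path.
\<close>

definition path_filtration :: "real \<Rightarrow> path measure" where
  "path_filtration t = vimage_algebra UNIV (stop_path t) borel"

definition L_b :: "real \<Rightarrow> (path \<Rightarrow> real) set" where
  "L_b t = {X. X \<in> borel_measurable (path_filtration t) \<and> bounded (range X)}"


section \<open>Upper expectation, capacity, quasi-sure statements\<close>

text \<open>
  The upper expectation \<open>sup\<^sub>P E\<^sub>P[X]\<close> appears in two versions: real valued, for bounded \<open>X\<close>, and
  \<open>[0, \<infinity>]\<close>-valued, for nonnegative \<open>X\<close>.
\<close>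

definition upper_exp :: "'a measure set \<Rightarrow> ('a \<Rightarrow> real) \<Rightarrow> real" where
  "upper_exp \<P> X = (SUP P\<in>\<P>. \<integral>w. X w \<partial>P)"

definition upper_nn_exp :: "'a measure set \<Rightarrow> ('a \<Rightarrow> ennreal) \<Rightarrow> ennreal" where
  "upper_nn_exp \<P> X = (SUP P\<in>\<P>. \<integral>\<^sup>+w. X w \<partial>P)"

definition capacity :: "'a measure set \<Rightarrow> 'a set \<Rightarrow> ennreal" where
  "capacity \<P> A = (SUP P\<in>\<P>. emeasure P A)"

definition quasi_surely :: "'a::topological_space measure set \<Rightarrow> ('a \<Rightarrow> bool) \<Rightarrow> bool" where
  "quasi_surely \<P> Q \<longleftrightarrow> (\<exists>A\<in>sets borel. capacity \<P> A = 0 \<and> (\<forall>w. w \<notin> A \<longrightarrow> Q w))"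

text \<open>The \<open>p\<close>-th power of the norm of \<open>\<L>\<^sup>p\<close>, which suffices to express convergence.\<close>

definition Lp_norm_pow :: "'a measure set \<Rightarrow> real \<Rightarrow> ('a \<Rightarrow> real) \<Rightarrow> ennreal" where
  "Lp_norm_pow \<P> p X = upper_nn_exp \<P> (\<lambda>w. ennreal (\<bar>X w\<bar> powr p))"

definition prob_measures :: "'a::topological_space measure set" where
  "prob_measures = {P. sets P = sets borel \<and> prob_space P}"

definition weak_topology :: "'a::topological_space measure topology" where
  "weak_topology = topology_generated_by
     {{P \<in> prob_measures. (\<integral>w. h w \<partial>P) \<in> U} | h (U :: real set).
        continuous_on UNIV h \<and> bounded (range h) \<and> open U}"


section \<open>G-Brownian motion\<close>

definition G_fun :: "real \<Rightarrow> real \<Rightarrow> real \<Rightarrow> real" where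
  "G_fun vl vh \<alpha> = 1/2 * (vh * max \<alpha> 0 - vl * max (- \<alpha>) 0)"

definition C12 :: "(real \<Rightarrow> real \<Rightarrow> real) \<Rightarrow> (real \<Rightarrow> real \<Rightarrow> real) \<Rightarrow> (real \<Rightarrow> real \<Rightarrow> real) \<Rightarrow>
    (real \<Rightarrow> real \<Rightarrow> real) \<Rightarrow> bool" where
  "C12 v vt vx vxx \<longleftrightarrow>
     (\<forall>t>0. \<forall>x. ((\<lambda>s. v s x) has_real_derivative vt t x) (at t) \<and>
        (v t has_real_derivative vx t x) (at x) \<and>
        (vx t has_real_derivative vxx t x) (at x)) \<and>
     (\<forall>h\<in>{v, vt, vx, vxx}. continuous_on ({0<..} \<times> UNIV) (\<lambda>(t, x). h t x))"

text \<open>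
  Viscosity solutions on \<open>[0, \<infinity>) \<times> \<real>\<close> of \<open>\<partial>\<^sub>t u = G(\<partial>\<^sub>x\<^sub>x u)\<close>, \<open>u(0, \<cdot>) = \<phi>\<close>, with test functions
  touching from above (subsolution) and from below (supersolution).
\<close>

definition viscosity_solution ::
  "(real \<Rightarrow> real) \<Rightarrow> (real \<Rightarrow> real) \<Rightarrow> (real \<Rightarrow> real \<Rightarrow> real) \<Rightarrow> bool" where
  "viscosity_solution G \<phi> u \<longleftrightarrow>
     continuous_on ({0..} \<times> UNIV) (\<lambda>(t, x). u t x) \<and>
     (\<forall>x. u 0 x = \<phi> x) \<and>
     (\<forall>v vt vx vxx t x. C12 v vt vx vxx \<and> t > 0 \<and> v t x = u t x \<longrightarrow>
        ((\<forall>s>0. \<forall>y. u s y \<le> v s y) \<longrightarrow> vt t x \<le> G (vxx t x)) \<and>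
        ((\<forall>s>0. \<forall>y. v s y \<le> u s y) \<longrightarrow> vt t x \<ge> G (vxx t x)))"

text \<open>
  \<open>\<xi> \<sim> N(0, [vl, vh])\<close>.  The function below is bounded, and within the bounded functions the
  viscosity solution is unique; without a growth restriction it is not.
\<close>

definition G_normal :: "'a measure set \<Rightarrow> real \<Rightarrow> real \<Rightarrow> ('a \<Rightarrow> real) \<Rightarrow> bool" where
  "G_normal \<P> vl vh \<xi> \<longleftrightarrow>
     (\<forall>\<phi> :: real \<Rightarrow> real. bounded (range \<phi>) \<and> (\<exists>K. K-lipschitz_on UNIV \<phi>) \<longrightarrow>
        viscosity_solution (G_fun vl vh) \<phi> (\<lambda>t x. upper_exp \<P> (\<lambda>w. \<phi> (x + sqrt t * \<xi> w))))"

text \<open>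
  Bounded Lipschitz functions on \<open>\<real>\<^sup>n \<times> \<real>\<close>: the vector is a function on indices, of which, by the
  Lipschitz condition, only the first \<open>n\<close> matter.
\<close>

definition bounded_lipschitz :: "nat \<Rightarrow> ((nat \<Rightarrow> real) \<Rightarrow> real \<Rightarrow> real) \<Rightarrow> bool" where
  "bounded_lipschitz n \<phi> \<longleftrightarrow>
     (\<exists>C. \<forall>x y. \<bar>\<phi> x y\<bar> \<le> C) \<and>
     (\<exists>K. \<forall>x y x' y'. \<bar>\<phi> x y - \<phi> x' y'\<bar> \<le> K * ((\<Sum>i<n. \<bar>x i - x' i\<bar>) + \<bar>y - y'\<bar>))"

definition independent_from ::
  "'a measure set \<Rightarrow> ('a \<Rightarrow> real) \<Rightarrow> nat \<Rightarrow> (nat \<Rightarrow> 'a \<Rightarrow> real) \<Rightarrow> bool" where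
  "independent_from \<P> Y n X \<longleftrightarrow>
     (\<forall>\<phi>. bounded_lipschitz n \<phi> \<longrightarrow>
        upper_exp \<P> (\<lambda>w. \<phi> (\<lambda>i. X i w) (Y w)) =
        upper_exp \<P> (\<lambda>w. upper_exp \<P> (\<lambda>w'. \<phi> (\<lambda>i. X i w) (Y w'))))"

text \<open>
  \<open>\<P>\<close> is a weakly compact family representing the G-expectation.  Sublinearity, monotonicity and
  preservation of constants come with the representation, and \<open>B 0 = 0\<close> with the path space.
\<close>

definition G_expectation :: "real \<Rightarrow> real \<Rightarrow> path measure set \<Rightarrow> bool" where
  "G_expectation \<sigma>l \<sigma>h \<P> \<longleftrightarrow>
     \<P> \<noteq> {} \<and> compactin weak_topology \<P> \<and>
     (\<forall>t\<ge>0. \<forall>s\<ge>0.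
        G_normal \<P> (\<sigma>l\<^sup>2 * s) (\<sigma>h\<^sup>2 * s) (\<lambda>w. B (t + s) w - B t w) \<and>
        (\<forall>n \<tau>. (\<forall>i<n. 0 \<le> \<tau> i \<and> \<tau> i \<le> t) \<and> (\<forall>i j. i \<le> j \<and> j < n \<longrightarrow> \<tau> i \<le> \<tau> j) \<longrightarrow>
           independent_from \<P> (\<lambda>w. B (t + s) w - B t w) n (\<lambda>i. B (\<tau> i))))"


section \<open>Stochastic integral\<close>

definition simple_data :: "real \<Rightarrow> nat \<Rightarrow> (nat \<Rightarrow> real) \<Rightarrow> (nat \<Rightarrow> path \<Rightarrow> real) \<Rightarrow> bool" where
  "simple_data T n \<tau> \<xi> \<longleftrightarrow>
     \<tau> 0 = 0 \<and> \<tau> n = T \<and> (\<forall>j<n. \<tau> j < \<tau> (Suc j)) \<and> (\<forall>j<n. \<xi> j \<in> L_b (\<tau> j))"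

definition simple_process ::
  "nat \<Rightarrow> (nat \<Rightarrow> real) \<Rightarrow> (nat \<Rightarrow> path \<Rightarrow> real) \<Rightarrow> real \<Rightarrow> path \<Rightarrow> real" where
  "simple_process n \<tau> \<xi> t w = (\<Sum>j<n. \<xi> j w * indicator {\<tau> j..<\<tau> (Suc j)} t)"

definition simple_integral ::
  "nat \<Rightarrow> (nat \<Rightarrow> real) \<Rightarrow> (nat \<Rightarrow> path \<Rightarrow> real) \<Rightarrow> path \<Rightarrow> real" where
  "simple_integral n \<tau> \<xi> w = (\<Sum>j<n. \<xi> j w * (B (\<tau> (Suc j)) w - B (\<tau> j) w))"

definition M_b0 :: "real \<Rightarrow> (real \<Rightarrow> path \<Rightarrow> real) set" where
  "M_b0 T = {simple_process n \<tau> \<xi> | n \<tau> \<xi>. simple_data T n \<tau> \<xi>}"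

definition measurable_process :: "real \<Rightarrow> (real \<Rightarrow> path \<Rightarrow> real) \<Rightarrow> bool" where
  "measurable_process T \<eta> \<longleftrightarrow>
     (\<lambda>(t, w). \<eta> t w) \<in> borel_measurable (restrict_space borel {0..T} \<Otimes>\<^sub>M borel)"

text \<open>The \<open>p\<close>-th power of the norm of \<open>M\<^sub>*\<^sup>p(0, T)\<close>.\<close>

definition M_norm_pow :: "path measure set \<Rightarrow> real \<Rightarrow> real \<Rightarrow> (real \<Rightarrow> path \<Rightarrow> real) \<Rightarrow> ennreal" where
  "M_norm_pow \<P> p T \<eta> =
     upper_nn_exp \<P> (\<lambda>w. \<integral>\<^sup>+t\<in>{0..T}. ennreal (\<bar>\<eta> t w\<bar> powr p) \<partial>lborel)"

text \<open>The completion of \<open>M_b0 T\<close>, realized as a space of processes.\<close>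

definition M_star :: "path measure set \<Rightarrow> real \<Rightarrow> real \<Rightarrow> (real \<Rightarrow> path \<Rightarrow> real) set" where
  "M_star \<P> p T = {\<eta>. measurable_process T \<eta> \<and>
     (\<exists>\<theta>. (\<forall>k. \<theta> k \<in> M_b0 T) \<and> (\<lambda>k. M_norm_pow \<P> p T (\<lambda>t w. \<theta> k t w - \<eta> t w)) \<longlonglongrightarrow> 0)}"

text \<open>
  \<open>I\<close> is a version of the integral of \<open>\<eta> \<in> M\<^sub>*\<^sup>2(0, T)\<close> over \<open>[0, T]\<close>, the continuous extension from
  simple processes.
\<close>

definition has_stoch_integral ::
  "path measure set \<Rightarrow> real \<Rightarrow> (real \<Rightarrow> path \<Rightarrow> real) \<Rightarrow> (path \<Rightarrow> real) \<Rightarrow> bool" where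
  "has_stoch_integral \<P> T \<eta> I \<longleftrightarrow>
     \<eta> \<in> M_star \<P> 2 T \<and> I \<in> borel_measurable borel \<and>
     (\<exists>n \<tau> \<xi>. (\<forall>k. simple_data T (n k) (\<tau> k) (\<xi> k)) \<and>
        (\<lambda>k. M_norm_pow \<P> 2 T (\<lambda>t w. simple_process (n k) (\<tau> k) (\<xi> k) t w - \<eta> t w)) \<longlonglongrightarrow> 0 \<and>
        (\<lambda>k. Lp_norm_pow \<P> 2 (\<lambda>w. simple_integral (n k) (\<tau> k) (\<xi> k) w - I w)) \<longlonglongrightarrow> 0)"

definition cut_off :: "(path \<Rightarrow> real) \<Rightarrow> (real \<Rightarrow> path \<Rightarrow> real) \<Rightarrow> real \<Rightarrow> path \<Rightarrow> real" where
  "cut_off \<sigma> \<eta> t w = \<eta> t w * indicator {0..\<sigma> w} t"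

definition localizing ::
  "path measure set \<Rightarrow> real \<Rightarrow> real \<Rightarrow> (real \<Rightarrow> path \<Rightarrow> real) \<Rightarrow> (nat \<Rightarrow> path \<Rightarrow> real) \<Rightarrow> bool" where
  "localizing \<P> p T \<eta> \<sigma> \<longleftrightarrow>
     (\<forall>m. stopping_time path_filtration (\<sigma> m) \<and> (\<forall>w. 0 \<le> \<sigma> m w)) \<and>
     quasi_surely \<P> (\<lambda>w. incseq (\<lambda>m. \<sigma> m w) \<and> (\<lambda>m. \<sigma> m w) \<longlonglongrightarrow> T) \<and>
     (\<forall>m. cut_off (\<sigma> m) \<eta> \<in> M_star \<P> p T)"

definition M_omega :: "path measure set \<Rightarrow> real \<Rightarrow> real \<Rightarrow> (real \<Rightarrow> path \<Rightarrow> real) set" where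
  "M_omega \<P> p T = {\<eta>. measurable_process T \<eta> \<and>
     (\<exists>\<sigma>. localizing \<P> p T \<eta> \<sigma>) \<and>
     capacity \<P> {w. (\<integral>\<^sup>+t\<in>{0..T}. ennreal (\<bar>\<eta> t w\<bar> powr p) \<partial>lborel) < \<infinity>} = 1}"

text \<open>
  \<open>X\<close> is a version of the integral of \<open>\<eta> \<in> M\<^sub>\<omega>\<^sup>2(0, T)\<close> over \<open>[0, t]\<close>, where \<open>t \<le> T\<close>: it agrees with the
  integral of the cut-off process as long as \<open>t \<le> \<sigma>\<^sub>m\<close>.  The limit clause adds something only for
  \<open>t = T\<close>, on the paths with \<open>\<sigma>\<^sub>m < T\<close> for all \<open>m\<close>.
\<close>

definition has_local_stoch_integral ::
  "path measure set \<Rightarrow> real \<Rightarrow> real \<Rightarrow> (real \<Rightarrow> path \<Rightarrow> real) \<Rightarrow> (path \<Rightarrow> real) \<Rightarrow> bool" where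
  "has_local_stoch_integral \<P> T t \<eta> X \<longleftrightarrow>
     \<eta> \<in> M_omega \<P> 2 T \<and> X \<in> borel_measurable borel \<and>
     (\<exists>\<sigma> Y. localizing \<P> 2 T \<eta> \<sigma> \<and>
        (\<forall>m. has_stoch_integral \<P> t (cut_off (\<sigma> m) \<eta>) (Y m)) \<and>
        (\<forall>m. quasi_surely \<P> (\<lambda>w. t \<le> \<sigma> m w \<longrightarrow> X w = Y m w)) \<and>
        quasi_surely \<P> (\<lambda>w. (\<lambda>m. Y m w) \<longlonglongrightarrow> X w))"


section \<open>Quadratic variation and local time\<close>

text \<open>\<open>Q\<close> is a version of the quadratic variation process with continuous increasing paths.\<close>

definition quadratic_variation :: "path measure set \<Rightarrow> (real \<Rightarrow> path \<Rightarrow> real) \<Rightarrow> bool" where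
  "quadratic_variation \<P> Q \<longleftrightarrow>
     (\<forall>t\<ge>0. Q t \<in> borel_measurable borel \<and>
        (\<forall>e>0. \<exists>d>0. \<forall>n \<tau>.
           \<tau> 0 = 0 \<and> \<tau> n = t \<and> (\<forall>i<n. \<tau> i \<le> \<tau> (Suc i) \<and> \<tau> (Suc i) - \<tau> i < d) \<longrightarrow>
           Lp_norm_pow \<P> 2 (\<lambda>w. (\<Sum>i<n. (B (\<tau> (Suc i)) w - B (\<tau> i) w)\<^sup>2) - Q t w) < e)) \<and>
     quasi_surely \<P> (\<lambda>w. continuous_on {0..} (\<lambda>t. Q t w) \<and> mono_on {0..} (\<lambda>t. Q t w))"

definition qv_integral ::
  "(real \<Rightarrow> path \<Rightarrow> real) \<Rightarrow> real \<Rightarrow> (real \<Rightarrow> path \<Rightarrow> real) \<Rightarrow> path \<Rightarrow> real" where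
  "qv_integral Q t \<eta> w = (LINT s:{0..t}|interval_measure (\<lambda>s. Q (max 0 s) w). \<eta> s w)"

text \<open>\<open>L a t\<close> is the local time at level \<open>a\<close> and time \<open>t\<close>, in a jointly continuous version.\<close>

definition local_time ::
  "path measure set \<Rightarrow> (real \<Rightarrow> path \<Rightarrow> real) \<Rightarrow> (real \<Rightarrow> real \<Rightarrow> path \<Rightarrow> real) \<Rightarrow> bool" where
  "local_time \<P> Q L \<longleftrightarrow>
     (\<forall>a. \<forall>t\<ge>0. L a t \<in> borel_measurable borel \<and>
        ((\<lambda>\<epsilon>. Lp_norm_pow \<P> 2 (\<lambda>w.
            1 / (2 * \<epsilon>) * qv_integral Q t (\<lambda>s w. indicator {a - \<epsilon><..<a + \<epsilon>} (B s w)) w - L a t w))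
          \<longlongrightarrow> 0) (at_right 0)) \<and>
     quasi_surely \<P> (\<lambda>w. continuous_on (UNIV \<times> {0..}) (\<lambda>(a, t). L a t w))"


section \<open>Derivatives of convex functions\<close>

abbreviation left_deriv :: "(real \<Rightarrow> real) \<Rightarrow> real \<Rightarrow> real" where
  "left_deriv f x \<equiv> vector_derivative f (at_left x)"

abbreviation right_deriv :: "(real \<Rightarrow> real) \<Rightarrow> real \<Rightarrow> real" where
  "right_deriv f x \<equiv> vector_derivative f (at_right x)"

definition second_deriv_measure :: "(real \<Rightarrow> real) \<Rightarrow> real measure" where
  "second_deriv_measure f = (THE \<mu>. sets \<mu> = sets borel \<and>
     (\<forall>a b. a < b \<longrightarrow> emeasure \<mu> {a..<b} = ennreal (left_deriv f b - left_deriv f a)))"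

end

theory Submission
  imports Defs
begin

text \<open>
  Quasi-sure statements reduce to almost sure statements under every single \<open>P \<in> \<P>\<close>.  Comparing the
  G-heat equation with polynomial supersolutions and testing independence with products of Lipschitz
  functions shows that under \<open>P\<close> the coordinate process is a martingale with \<open>d\<langle>B\<rangle> \<le> C dt\<close>, which gives
  the isometry \<open>E (\<integral>\<theta> dB)\<^sup>2 = E \<integral>\<theta>\<^sup>2 d\<langle>B\<rangle>\<close> for elementary integrands.  The convex function is mollified with
  the indicator of \<open>(-\<epsilon>, \<epsilon>)\<close>, because the \<open>d\<langle>B\<rangle>\<close>-integral of the second derivative of the mollified function
  is then exactly \<open>\<integral>L\<^sub>\<epsilon>(a) f''(da)\<close>, where \<open>L\<^sub>\<epsilon>(a)\<close> are the quotients that define the local time.  Since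
  the limits of these quotients are finite, \<open>d\<langle>B\<rangle>\<close> does not charge the level sets of the paths; so the
  countably many discontinuities of \<open>f'\<close> do not matter, neither in Ito's formula for the mollified function
  nor in the limit \<open>\<epsilon> \<rightarrow> 0\<close>, where a uniform bound on \<open>E L\<^sub>\<epsilon>(a)\<close> from Ito's formula for \<open>\<bar>x - a\<bar>\<close> allows
  to integrate over \<open>a\<close>.
\<close>

section \<open>The path space\<close>

text \<open>The family \<open>\<P>\<close> may be uncountable, so null sets found under different
  measures cannot be united; the failure of the formula is therefore shown to be one Borel event
  that does not depend on \<open>P\<close>. Independence is an identity of upper expectations for
  bounded Lipschitz functions of finitely many coordinates, so under \<open>P\<close> it yields
  inequalities for cylinder functions, which have to be carried over to the filtration. Integrands
  are approximated in a norm with respect to dt, whereas errors are measured by the isometry with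
  respect to d\<langle>B\<rangle>; this is where the domination by dt enters. As
  \<open>\<sigma>l = 0\<close> is allowed, a path may rest at a level for a time of positive length,
  so level sets can be negligible for d\<langle>B\<rangle> only. The mollified function need not
  have a second derivative at the shifted kinks of \<open>f\<close>; its Taylor remainders are
  trapped between bounds for the second derivative on coarse time cells. They converge in
  \<open>L^1\<close>, the stochastic integrals in \<open>L^2\<close>, so that distances are compared
  through squares of \<open>L^1\<close> norms.\<close>

lemma continuous_B: "continuous_on UNIV (\<lambda>s. B s w)"
  using Rep_path[of w] unfolding B_def by simp

lemma continuous_on_B [continuous_intros]:
  "continuous_on A h \<Longrightarrow> continuous_on A (\<lambda>x. B (h x) w)"
  using continuous_on_compose2[OF continuous_B[of w]] by blast

lemma B_nonpos: "s \<le> 0 \<Longrightarrow> B s w = 0"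
  using Rep_path[of w] unfolding B_def by simp

lemma B_0 [simp]: "B 0 w = 0"
  by (simp add: B_nonpos)

lemma B_stop_path: "0 \<le> t \<Longrightarrow> B s (stop_path t w) = B (min s t) w"
proof -
  assume t: "0 \<le> t"
  have "continuous_on UNIV (\<lambda>s. B (min s t) w)"
    by (rule continuous_on_B) (intro continuous_intros)
  moreover have "\<forall>s\<le>0. B (min s t) w = 0"
    by (simp add: B_nonpos)
  ultimately show ?thesis
    unfolding B_def stop_path_def by (subst Abs_path_inverse) auto
qed

definition half_spaces :: "real set \<Rightarrow> path set set" where
  "half_spaces S = {{w. B s w \<le> c} | s c. s \<in> S}"

text \<open>The tubes around rational step functions form a countable substitute for a base; each of them
  is determined by countably many coordinates.\<close>

definition tube :: "nat \<Rightarrow> nat \<Rightarrow> nat \<Rightarrow> rat list \<Rightarrow> path set" where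
  "tube N M k l = {w. \<forall>s\<in>{0..real N} \<inter> \<rat>. \<bar>B s w - real_of_rat (l ! nat \<lfloor>s * real k\<rfloor>)\<bar> \<le> 1 / real (Suc M)}"

lemma tube_in_sigma_half_spaces: "tube N M k l \<in> sigma_sets UNIV (half_spaces {0..})"
proof -
  define S where "S = sigma UNIV (half_spaces {0..})"
  have S: "space S = UNIV" "sets S = sigma_sets UNIV (half_spaces {0..})"
    unfolding S_def by auto
  have meas: "B s \<in> borel_measurable S" if "s \<ge> 0" for s
    using that by (intro borel_measurable_iff_le[THEN iffD2])
      (auto simp: S half_spaces_def intro!: sigma_sets.Basic)
  have "{w \<in> space S. \<bar>B s w - real_of_rat (l ! nat \<lfloor>s * real k\<rfloor>)\<bar> \<le> 1 / real (Suc M)} \<in> sets S"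
    if "s \<ge> 0" for s
    by (intro borel_measurable_le borel_measurable_abs borel_measurable_diff meas that borel_measurable_const)
  moreover have "countable ({0..real N} \<inter> \<rat>)"
    using countable_rat by (rule countable_Int2)
  ultimately have "{w \<in> space S. \<forall>s\<in>{0..real N} \<inter> \<rat>. \<bar>B s w - real_of_rat (l ! nat \<lfloor>s * real k\<rfloor>)\<bar> \<le> 1 / real (Suc M)} \<in> sets S"
    by (intro sets.sets_Collect_countable_All') auto
  then show ?thesis unfolding tube_def S by simp
qed

text \<open>Rationals are dense in the open interval, hence in its closure. A degenerate interval
  has empty interior; there the rationality of the left end point gives the claim.\<close>

lemma le_on_rats:
  fixes h :: "real \<Rightarrow> real"
  assumes h: "continuous_on {a..b} h" and le: "\<And>x. x \<in> {a..b} \<inter> \<rat> \<Longrightarrow> h x \<le> c"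
    and a: "a \<in> \<rat>" and x: "x \<in> {a..b}"
  shows "h x \<le> c"
proof (cases "a < b")
  case True
  have cl: "closure ({a<..<b} \<inter> \<rat>) = {a..b}"
    using True closure_open_Int_superset[of "{a<..<b}" "\<rat>"] by (simp add: Rats_closure_real)
  show ?thesis
    by (rule continuous_le_on_closure[of "{a<..<b} \<inter> \<rat>" h]) (use h le x in \<open>auto simp: cl\<close>)
next
  case False
  then have "x = a" using x by auto
  then show ?thesis using le[of a] a x by auto
qed

text \<open>By uniform continuity on \<open>{0..real N}\<close> a step function with rational values
  on a fine grid follows the path within the radius of the tube. Two paths in one tube are close at
  rational times and, by continuity, at all times.\<close>

lemma tube_nbhd:
  assumes "open U" "w \<in> U"
  shows "\<exists>N M k l. w \<in> tube N M k l \<and> tube N M k l \<subseteq> U"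
proof -
  obtain r e where re: "r \<ge> 0" "e > 0" and U: "\<And>w'. (\<forall>s\<in>{0..r}. \<bar>B s w' - B s w\<bar> < e) \<Longrightarrow> w' \<in> U"
    using assms unfolding open_path_def by blast
  obtain N where N: "r \<le> real N" using real_arch_simple by blast
  \<comment> \<open>Two paths in one tube may differ by twice its radius, hence
    \<open>e / 2\<close>.\<close>
  obtain M where M: "inverse (real (Suc M)) < e / 2" using reals_Archimedean[of "e/2"] re by auto
  define d where "d = 1 / real (Suc M)"
  have d: "d > 0" "2 * d < e" using M unfolding d_def by (auto simp: field_simps)
  have "uniformly_continuous_on {0..real N} (\<lambda>s. B s w)"
    by (intro compact_uniformly_continuous continuous_intros) auto
  then obtain h where h: "h > 0" "\<And>x y. x \<in> {0..real N} \<Longrightarrow> y \<in> {0..real N} \<Longrightarrow> \<bar>y - x\<bar> < h \<Longrightarrow> \<bar>B y w - B x w\<bar> < d / 2"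
    unfolding uniformly_continuous_on_def dist_real_def using d by (metis half_gt_zero)
  obtain k where k: "inverse (real (Suc k)) < h" using reals_Archimedean[OF h(1)] by auto
  define K where "K = Suc k"
  have "\<exists>q. \<bar>real_of_rat q - B (real i / real K) w\<bar> < d / 2" for i
  proof -
    obtain q where "B (real i / real K) w < of_rat q" "of_rat q < B (real i / real K) w + d / 2"
      using of_rat_dense[of "B (real i / real K) w" "B (real i / real K) w + d / 2"] d by auto
    then show ?thesis by (intro exI[of _ q]) auto
  qed
  then obtain q where q: "\<And>i::nat. \<bar>real_of_rat (q i) - B (real i / real K) w\<bar> < d / 2" by metis
  \<comment> \<open>The index \<open>N * K\<close> is reached at the right end point
    \<open>s = real N\<close>, so the list has one entry more than there are cells.\<close>
  define l where "l = map q [0..<Suc (N * K)]"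
  have "w \<in> tube N M K l"
    unfolding tube_def
  proof safe
    fix s :: real assume s: "s \<in> {0..real N}"
    define i where "i = nat \<lfloor>s * real K\<rfloor>"
    have i: "real i \<le> s * real K" "s * real K < real i + 1"
      using s unfolding i_def by (auto simp: of_nat_nat)
    have "real i \<le> real N * real K" using i s by (meson atLeastAtMost_iff mult_right_mono of_nat_0_le_iff order_trans)
    then have iN: "i \<le> N * K" by (metis of_nat_le_iff of_nat_mult)
    have K: "real K > 0" unfolding K_def by simp
    have "\<bar>s - real i / real K\<bar> < h"
    proof -
      have "s - real i / real K = (s * real K - real i) / real K" using K by (simp add: field_simps)
      then have "0 \<le> s - real i / real K" "s - real i / real K < 1 / real K" using i K by (simp_all add: divide_strict_right_mono)
      then show ?thesis using k unfolding K_def by (simp add: inverse_eq_divide)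
    qed
    moreover have "real i / real K \<in> {0..real N}" using i K s \<open>real i \<le> real N * real K\<close> by (auto simp: field_simps)
    ultimately have "\<bar>B s w - B (real i / real K) w\<bar> < d / 2" using h(2) s by blast
    moreover have "l ! i = q i" using iN unfolding l_def by (simp add: nth_map_upt del: upt_Suc)
    ultimately have "\<bar>B s w - real_of_rat (l ! i)\<bar> < d" using q[of i] by (simp only: abs_less_iff) linarith
    then show "\<bar>B s w - real_of_rat (l ! nat \<lfloor>s * real K\<rfloor>)\<bar> \<le> 1 / real (Suc M)"
      unfolding i_def d_def by simp
  qed
  moreover have "tube N M K l \<subseteq> U"
  proof
    fix w' assume w': "w' \<in> tube N M K l"
    have rat: "\<bar>B s w' - B s w\<bar> \<le> 2 * d" if "s \<in> {0..real N} \<inter> \<rat>" for s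
    proof -
      have "\<bar>B s w' - real_of_rat (l ! nat \<lfloor>s * real K\<rfloor>)\<bar> \<le> d"
        using w' that unfolding tube_def d_def by blast
      moreover have "\<bar>B s w - real_of_rat (l ! nat \<lfloor>s * real K\<rfloor>)\<bar> \<le> d"
        using \<open>w \<in> tube N M K l\<close> that unfolding tube_def d_def by blast
      ultimately show ?thesis by linarith
    qed
    have "continuous_on {0..real N} (\<lambda>s. \<bar>B s w' - B s w\<bar>)"
      by (intro continuous_intros)
    then have le: "\<bar>B s w' - B s w\<bar> \<le> 2 * d" if "s \<in> {0..real N}" for s
      by (rule le_on_rats[where b = "real N"]) (use rat that in auto)
    show "w' \<in> U"
    proof (rule U, rule ballI)
      fix s assume "s \<in> {0..r}"
      then show "\<bar>B s w' - B s w\<bar> < e" using le[of s] N d by simp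
    qed
  qed
  ultimately show ?thesis by blast
qed

lemma open_B_vimage: "open V \<Longrightarrow> open {w. B s w \<in> V}"
proof (cases "s \<ge> 0")
  case True
  assume V: "open V"
  show ?thesis
    unfolding open_path_def
  proof
    fix w assume "w \<in> {w. B s w \<in> V}"
    then obtain e where "e > 0" "\<And>y. \<bar>y - B s w\<bar> < e \<Longrightarrow> y \<in> V"
      using V unfolding open_dist dist_real_def by auto
    then show "\<exists>r\<ge>0. \<exists>e>0. \<forall>w'. (\<forall>s\<in>{0..r}. \<bar>B s w' - B s w\<bar> < e) \<longrightarrow> w' \<in> {w. B s w \<in> V}"
      using True by (intro exI[of _ s]) auto
  qed
next
  case False
  then show ?thesis by (cases "0 \<in> V") (auto simp: B_nonpos)
qed

lemma measurable_B [measurable]: "B s \<in> borel_measurable borel"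
proof (rule borel_measurableI)
  fix S :: "real set" assume "open S"
  then have "open {w. B s w \<in> S}" by (rule open_B_vimage)
  then show "B s -` S \<inter> space borel \<in> sets borel" by (simp add: vimage_def)
qed

text \<open>There are countably many tubes and an open set is the union of the tubes inside it, so
  locally uniform convergence generates no more sets than the coordinates do.\<close>

lemma sets_borel_path: "sets (borel :: path measure) = sigma_sets UNIV (half_spaces {0..})"
proof
  have "U \<in> sigma_sets UNIV (half_spaces {0..})" if U: "open U" for U :: "path set"
  proof -
    interpret sigma_algebra UNIV "sigma_sets UNIV (half_spaces {0..})"
      by (rule sigma_algebra_sigma_sets) auto
    define T where "T = (\<lambda>(N, M, k, l). tube N M k l)"
    have "U = (\<Union>x\<in>{x. T x \<subseteq> U}. T x)"
    proof (intro set_eqI iffI)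
      fix w assume "w \<in> U"
      then obtain N M k l where "w \<in> tube N M k l" "tube N M k l \<subseteq> U" using tube_nbhd[OF U] by blast
      then show "w \<in> (\<Union>x\<in>{x. T x \<subseteq> U}. T x)"
        by (intro UN_I[of "(N, M, k, l)"]) (auto simp: T_def)
    qed blast
    also have "\<dots> \<in> sigma_sets UNIV (half_spaces {0..})"
      by (intro countable_UN') (auto simp: T_def tube_in_sigma_half_spaces)
    finally show ?thesis .
  qed
  then show "sets (borel :: path measure) \<subseteq> sigma_sets UNIV (half_spaces {0..})"
    unfolding borel_def by (subst sets_measure_of) (auto intro!: sigma_sets_mono)
  have "{w. B s w \<le> c} \<in> sets borel" for s c by measurable
  then show "sigma_sets UNIV (half_spaces {0..}) \<subseteq> sets borel"
    using sets.sigma_sets_subset[of "half_spaces {0..}" "borel :: path measure"]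
    unfolding half_spaces_def space_borel by blast
qed

lemma measurable_stop_path: "0 \<le> t \<Longrightarrow> stop_path t \<in> measurable borel borel"
proof (rule measurable_sigma_sets[OF sets_borel_path])
  fix A assume t: "0 \<le> t" and "A \<in> half_spaces {0..}"
  then obtain s c where "A = {w. B s w \<le> c}" by (auto simp: half_spaces_def)
  then have "stop_path t -` A \<inter> space borel = {w. B (min s t) w \<le> c}" using B_stop_path[OF t] by auto
  also have "\<dots> \<in> sets borel" by measurable
  finally show "stop_path t -` A \<inter> space borel \<in> sets borel" .
qed auto

lemma space_path_filtration [simp]: "space (path_filtration t) = UNIV"
  by (simp add: path_filtration_def)

lemma sets_path_filtration:
  "sets (path_filtration t) = {stop_path t -` A | A. A \<in> sets borel}"
  unfolding path_filtration_def by (subst sets_vimage_algebra2) auto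

lemma sets_path_filtration_subset: "0 \<le> t \<Longrightarrow> sets (path_filtration t) \<subseteq> sets borel"
  using measurable_sets[OF measurable_stop_path[of t]] by (auto simp: sets_path_filtration)

text \<open>Generation by coordinates is the form in which the approximation by cylinder functions
  can run an induction over the sigma-algebra.\<close>

lemma sets_path_filtration_eq:
  assumes t: "0 \<le> t"
  shows "sets (path_filtration t) = sigma_sets UNIV (half_spaces {0..t})"
proof
  show "sigma_sets UNIV (half_spaces {0..t}) \<subseteq> sets (path_filtration t)"
  proof -
    have "A \<in> sets (path_filtration t)" if "A \<in> half_spaces {0..t}" for A
    proof -
      from that obtain s c where "s \<in> {0..t}" "A = {w. B s w \<le> c}" by (auto simp: half_spaces_def)
      then have "A = stop_path t -` {w. B s w \<le> c}" using B_stop_path[OF t] by auto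
      moreover have "{w. B s w \<le> c} \<in> sets borel" by measurable
      ultimately show ?thesis unfolding sets_path_filtration by blast
    qed
    then show ?thesis
      using sets.sigma_sets_subset[of "half_spaces {0..t}" "path_filtration t"] by auto
  qed
  show "sets (path_filtration t) \<subseteq> sigma_sets UNIV (half_spaces {0..t})"
  proof
    interpret S: sigma_algebra UNIV "sigma_sets UNIV (half_spaces {0..t})"
      by (rule sigma_algebra_sigma_sets) auto
    fix A assume "A \<in> sets (path_filtration t)"
    then obtain A' where A: "A = stop_path t -` A'" and A': "A' \<in> sigma_sets UNIV (half_spaces {0..})"
      unfolding sets_path_filtration sets_borel_path by blast
    from A' show "A \<in> sigma_sets UNIV (half_spaces {0..t})"
      unfolding A
    proof induction
      case (Basic a)
      then obtain s c where "s \<ge> 0" "a = {w. B s w \<le> c}" by (auto simp: half_spaces_def)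
      then have "stop_path t -` a = {w. B (min s t) w \<le> c}" using B_stop_path[OF t] by auto
      then show ?case using \<open>s \<ge> 0\<close> t by (intro sigma_sets.Basic) (auto simp: half_spaces_def)
    next
      case (Compl a)
      then show ?case using S.compl_sets[OF Compl.IH] by (simp add: vimage_Diff)
    next
      case (Union a)
      then show ?case by (auto simp: vimage_UN)
    qed simp
  qed
qed

lemma measurable_path_filtration_borel:
  "X \<in> measurable (path_filtration t) N \<Longrightarrow> 0 \<le> t \<Longrightarrow> X \<in> measurable borel N"
  using sets_path_filtration_subset[of t] by (auto simp: measurable_def)

lemma sets_path_filtration_mono: "0 \<le> s \<Longrightarrow> s \<le> t \<Longrightarrow> sets (path_filtration s) \<subseteq> sets (path_filtration t)"
  by (auto simp: sets_path_filtration_eq half_spaces_def intro!: sigma_sets_mono')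

lemma measurable_path_filtration_mono:
  "X \<in> measurable (path_filtration s) N \<Longrightarrow> 0 \<le> s \<Longrightarrow> s \<le> t \<Longrightarrow> X \<in> measurable (path_filtration t) N"
  using sets_path_filtration_mono[of s t] by (auto simp: measurable_def)

lemma measurable_B_path_filtration: "0 \<le> s \<Longrightarrow> s \<le> t \<Longrightarrow> B s \<in> borel_measurable (path_filtration t)"
proof (rule borel_measurable_iff_le[THEN iffD2], rule allI)
  fix c assume "0 \<le> s" "s \<le> t"
  then show "{w \<in> space (path_filtration t). B s w \<le> c} \<in> sets (path_filtration t)"
    by (auto simp: sets_path_filtration_eq half_spaces_def intro!: sigma_sets.Basic)
qed

section \<open>Moments of G-normal variables\<close>

text \<open>The polynomial solution of \<open>\<partial>\<^sub>t v = c/2 \<partial>\<^sub>x\<^sub>x v\<close> with initial value \<open>\<alpha> x + \<beta> x^2 + \<gamma> x^4\<close>.\<close>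

definition heat_poly :: "real \<Rightarrow> real \<Rightarrow> real \<Rightarrow> real \<Rightarrow> real \<Rightarrow> real \<Rightarrow> real" where
  "heat_poly c \<alpha> \<beta> \<gamma> t x = \<alpha> * x + \<beta> * (x^2 + c * t) + \<gamma> * (x^4 + 6 * c * x^2 * t + 3 * c^2 * t^2)"

text \<open>The constant \<open>m\<close> will be the largest excess of the viscosity solution over
  the polynomial; lifted by it, the polynomial touches from above.\<close>

lemma C12_heat_poly:
  "C12 (\<lambda>t x. heat_poly c \<alpha> \<beta> \<gamma> t x + m)
     (\<lambda>t x. \<beta> * c + \<gamma> * (6 * c * x^2 + 6 * c^2 * t))
     (\<lambda>t x. \<alpha> + 2 * \<beta> * x + \<gamma> * (4 * x^3 + 12 * c * x * t))
     (\<lambda>t x. 2 * \<beta> + \<gamma> * (12 * x^2 + 12 * c * t))"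
  unfolding C12_def heat_poly_def
  by (auto intro!: derivative_eq_intros continuous_intros simp: case_prod_beta algebra_simps power2_eq_square power3_eq_cube)

text \<open>The quadratic term beats the linear one in space and grows linearly in time, so a
  bounded function can exceed the polynomial only inside a compact box. This replaces growth
  conditions or penalisation in the comparison below.\<close>

lemma heat_poly_coercive:
  assumes "\<beta> > 0" "\<gamma> \<ge> 0" "c > 0"
  shows "\<exists>R>0. \<forall>t\<ge>0. \<forall>x. \<bar>x\<bar> > R \<or> t > R \<longrightarrow> heat_poly c \<alpha> \<beta> \<gamma> t x > M"
proof -
  \<comment> \<open>Half of \<open>\<beta> * x^2\<close> is spent on completing the square with
    \<open>\<alpha> * x\<close>, which costs \<open>\<alpha>^2 / (2 * \<beta>)\<close>; the other
    half together with \<open>\<beta> * c * t\<close> has to reach \<open>D\<close>.\<close>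
  define D where "D = \<bar>M\<bar> + 1 + \<alpha>^2 / (2 * \<beta>)"
  \<comment> \<open>The fractions are the thresholds for \<open>x^2\<close> and for
    \<open>t\<close>; the summand 1 ensures that \<open>\<bar>x\<bar> > R\<close> implies
    \<open>x^2 \<ge> R\<close>.\<close>
  define R where "R = 1 + 2 * D / \<beta> + D / (\<beta> * c)"
  have "\<alpha>^2 / (2 * \<beta>) \<ge> 0" using assms by simp
  then have D: "D > 0" "D > M + \<alpha>^2 / (2 * \<beta>)" unfolding D_def by linarith+
  have "2 * D / \<beta> \<ge> 0" "D / (\<beta> * c) \<ge> 0" using D(1) assms by simp_all
  then have R: "R \<ge> 1" "R \<ge> 2 * D / \<beta>" "R \<ge> D / (\<beta> * c)"
    unfolding R_def by linarith+
  show ?thesis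
  proof (intro exI[of _ R] conjI allI impI)
    show "R > 0" using R by simp
    fix t x :: real assume t: "0 \<le> t" and tx: "\<bar>x\<bar> > R \<or> t > R"
    have "\<alpha> * x + \<beta> * x^2 / 2 + \<alpha>^2 / (2 * \<beta>) = (\<beta> * x + \<alpha>)^2 / (2 * \<beta>)"
      using assms by (simp add: field_simps power2_eq_square)
    then have 1: "\<alpha> * x + \<beta> * x^2 / 2 + \<alpha>^2 / (2 * \<beta>) \<ge> 0" using assms by simp
    have 2: "\<gamma> * (x^4 + 6 * c * x^2 * t + 3 * c^2 * t^2) \<ge> 0" using assms t by (intro mult_nonneg_nonneg add_nonneg_nonneg) auto
    have 3: "\<beta> * x^2 / 2 + \<beta> * (c * t) \<ge> D" 
      using tx
    proof
      assume x: "\<bar>x\<bar> > R"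
      then have "R * 1 \<le> \<bar>x\<bar> * \<bar>x\<bar>" using R by (intro mult_mono) auto
      then have "R \<le> x^2" by (simp add: power2_eq_square abs_mult_self_eq)
      then have "2 * D / \<beta> \<le> x^2" using R by simp
      then have "D \<le> \<beta> * x^2 / 2" using assms by (simp add: field_simps)
      moreover have "\<beta> * (c * t) \<ge> 0" using assms t by simp
      ultimately show ?thesis by simp
    next
      assume "t > R"
      then have "D / (\<beta> * c) \<le> t" using R by simp
      then have "D \<le> \<beta> * (c * t)" using assms by (simp add: field_simps)
      moreover have "\<beta> * x^2 / 2 \<ge> 0" using assms by simp
      ultimately show ?thesis by linarith
    qed
    have "heat_poly c \<alpha> \<beta> \<gamma> t x \<ge> D - \<alpha>^2 / (2 * \<beta>)"
      unfolding heat_poly_def using 1 2 3 by (simp add: algebra_simps)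
    then show "heat_poly c \<alpha> \<beta> \<gamma> t x > M" using D by linarith
  qed
qed

text \<open>At a positive maximum of \<open>u - v\<close> the lifted polynomial is a test function
  from above. It satisfies \<open>v_t = c/2 * v_xx\<close> with \<open>v_xx > 0\<close>, while the
  subsolution property demands \<open>v_t \<le> vh/2 * v_xx\<close>; this contradicts
  \<open>vh < c\<close>. Because of the strict inequality no doubling of variables is
  needed.\<close>

lemma viscosity_solution_le_heat_poly:
  assumes vis: "viscosity_solution (G_fun vl vh) \<phi> u"
    and M: "\<And>t x. \<bar>u t x\<bar> \<le> M"
    and c: "0 < c" "vh < c" and \<beta>: "\<beta> > 0" and \<gamma>: "\<gamma> \<ge> 0"
    and \<phi>: "\<And>x. \<phi> x \<le> \<alpha> * x + \<beta> * x^2 + \<gamma> * x^4"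
    and t: "t \<ge> 0"
  shows "u t x \<le> heat_poly c \<alpha> \<beta> \<gamma> t x"
proof (rule ccontr)
  define v where "v = heat_poly c \<alpha> \<beta> \<gamma>"
  assume "\<not> u t x \<le> heat_poly c \<alpha> \<beta> \<gamma> t x"
  then have gt: "u t x > v t x" unfolding v_def by simp
  obtain R where "R > 0" and *: "\<forall>t\<ge>0. \<forall>x. \<bar>x\<bar> > R \<or> t > R \<longrightarrow> v t x > M"
    using heat_poly_coercive[OF \<beta> \<gamma> c(1), of M \<alpha>, folded v_def] by (elim exE conjE)
  note R = \<open>R > 0\<close> *[rule_format]
  have in_box: "\<bar>y\<bar> \<le> R \<and> s \<le> R" if "s \<ge> 0" "u s y \<ge> v s y" for s y
    using R(2)[of s y] that M[of s y] by linarith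
  define K where "K = {0..R} \<times> {-R..R}"
  have "compact K" unfolding K_def by (intro compact_Times) auto
  moreover have "(t, x) \<in> K" using in_box[OF t, of x] gt t unfolding K_def by auto
  moreover have "continuous_on K (\<lambda>(s, y). u s y - v s y)"
  proof -
    have "continuous_on K (\<lambda>z. (\<lambda>(t, x). u t x) z)"
      using vis unfolding viscosity_solution_def K_def by (auto intro: continuous_on_subset)
    moreover have "continuous_on K (\<lambda>z. v (fst z) (snd z))"
      unfolding v_def heat_poly_def by (intro continuous_intros)
    ultimately show ?thesis by (auto simp: case_prod_beta intro!: continuous_intros)
  qed
  ultimately obtain z where z: "z \<in> K" "\<And>y. y \<in> K \<Longrightarrow> (\<lambda>(s, y). u s y - v s y) y \<le> (\<lambda>(s, y). u s y - v s y) z"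
    using continuous_attains_sup[of K "\<lambda>(s, y). u s y - v s y"] by blast
  obtain t0 x0 where z0: "z = (t0, x0)" by (cases z)
  define m where "m = u t0 x0 - v t0 x0"
  have m_max: "u s y - v s y \<le> m" if "(s, y) \<in> K" for s y
    using z(2)[OF that] unfolding z0 m_def by simp
  have m: "m > 0" using m_max[OF \<open>(t, x) \<in> K\<close>] gt by simp
  have le: "u s y \<le> v s y + m" if "s \<ge> 0" for s y
  proof (cases "(s, y) \<in> K")
    case False
    then have "\<not> (u s y \<ge> v s y)" using in_box[of s y] that unfolding K_def by auto
    then show ?thesis using m by simp
  qed (use m_max in force)
  have t0: "t0 \<ge> 0" using z(1) unfolding z0 K_def by auto
  \<comment> \<open>The test function condition speaks of positive times only; at time 0 the initial
    value lies below the polynomial, so the maximum is not there.\<close>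
  have "t0 \<noteq> 0"
  proof
    assume "t0 = 0"
    moreover have "u 0 x0 = \<phi> x0" using vis unfolding viscosity_solution_def by blast
    moreover have "v 0 x0 = \<alpha> * x0 + \<beta> * x0^2 + \<gamma> * x0^4" unfolding v_def heat_poly_def by simp
    ultimately show False using \<phi>[of x0] m unfolding m_def by simp
  qed
  then have t0: "t0 > 0" using t0 by simp
  have "v t0 x0 + m = u t0 x0" unfolding m_def by simp
  moreover note C12_heat_poly[of c \<alpha> \<beta> \<gamma> m, folded v_def]
  ultimately have "\<beta> * c + \<gamma> * (6 * c * x0^2 + 6 * c^2 * t0) \<le> G_fun vl vh (2 * \<beta> + \<gamma> * (12 * x0^2 + 12 * c * t0))"
    using vis t0 le unfolding viscosity_solution_def by (smt (verit, best))
  moreover have pos: "2 * \<beta> + \<gamma> * (12 * x0^2 + 12 * c * t0) > 0"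
    using \<beta> \<gamma> c t0 by (intro add_pos_nonneg mult_nonneg_nonneg add_nonneg_nonneg) auto
  ultimately have "c * (2 * \<beta> + \<gamma> * (12 * x0^2 + 12 * c * t0)) \<le> vh * (2 * \<beta> + \<gamma> * (12 * x0^2 + 12 * c * t0))"
    unfolding G_fun_def by (simp add: algebra_simps power2_eq_square)
  then show False using pos c by (simp add: mult_le_cancel_right)
qed

lemma prob_measuresD:
  assumes "P \<in> prob_measures"
  shows "sets P = sets borel" "space P = UNIV" "prob_space P"
  using assms sets_eq_imp_space_eq[of P borel] unfolding prob_measures_def by auto

lemma abs_integral_le_bound:
  fixes X :: "'a::topological_space \<Rightarrow> real"
  assumes "P \<in> prob_measures" "\<And>w. \<bar>X w\<bar> \<le> C"
  shows "\<bar>\<integral>w. X w \<partial>P\<bar> \<le> C"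
proof -
  interpret prob_space P using prob_measuresD[OF assms(1)] by simp
  have C: "C \<ge> 0" by (rule order_trans[OF abs_ge_zero]) (rule assms(2))
  show ?thesis
  proof (cases "integrable P X")
    case True
    have "\<bar>\<integral>w. X w \<partial>P\<bar> \<le> (\<integral>w. \<bar>X w\<bar> \<partial>P)"
      by simp
    also have "\<dots> \<le> (\<integral>w. C \<partial>P)" using True assms(2) by (intro integral_mono) auto
    finally show ?thesis by (simp add: prob_space)
  qed (use C in \<open>simp add: not_integrable_integral_eq\<close>)
qed

lemma upper_exp_ge:
  assumes "\<P> \<subseteq> prob_measures" "P \<in> \<P>" "\<And>w. \<bar>X w\<bar> \<le> C"
  shows "(\<integral>w. X w \<partial>P) \<le> upper_exp \<P> X"
  unfolding upper_exp_def
proof (rule cSUP_upper[OF assms(2)])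
  have "(\<integral>w. X w \<partial>P') \<le> C" if "P' \<in> \<P>" for P'
    using abs_integral_le_bound[of P' X C] that assms by (auto simp: abs_le_iff)
  then show "bdd_above ((\<lambda>P. \<integral>w. X w \<partial>P) ` \<P>)" by (auto intro!: bdd_aboveI[of _ C])
qed

lemma abs_upper_exp_le:
  assumes "\<P> \<subseteq> prob_measures" "\<P> \<noteq> {}" "\<And>w. \<bar>X w\<bar> \<le> C"
  shows "\<bar>upper_exp \<P> X\<bar> \<le> C"
proof -
  obtain P where P: "P \<in> \<P>" using assms by blast
  have "upper_exp \<P> X \<le> C"
    unfolding upper_exp_def
  proof (rule cSUP_least[OF assms(2)])
    fix P' assume "P' \<in> \<P>"
    then have "\<bar>\<integral>w. X w \<partial>P'\<bar> \<le> C" using assms by (intro abs_integral_le_bound) auto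
    then show "(\<integral>w. X w \<partial>P') \<le> C" by simp
  qed
  moreover have "- C \<le> (\<integral>w. X w \<partial>P)" using abs_integral_le_bound[of P X C] assms P by (auto simp: abs_le_iff)
  moreover have "(\<integral>w. X w \<partial>P) \<le> upper_exp \<P> X" by (rule upper_exp_ge[OF assms(1) P assms(3)])
  ultimately show ?thesis by (simp add: abs_le_iff)
qed

text \<open>The comparison is read off at time 1 and position 0, where the solution is the upper
  expectation of \<open>\<phi> (\<xi> w)\<close> and the polynomial has the value on the
  right.\<close>

lemma G_normal_upper_exp_le:
  assumes \<P>: "\<P> \<subseteq> prob_measures" "\<P> \<noteq> {}"
    and normal: "G_normal \<P> vl vh \<xi>"
    and c: "0 < c" "vh < c" and \<beta>: "\<beta> > 0" and \<gamma>: "\<gamma> \<ge> 0"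
    and lip: "\<exists>K. K-lipschitz_on UNIV \<phi>" and C: "\<And>x. \<bar>\<phi> x\<bar> \<le> C"
    and \<phi>: "\<And>x. \<phi> x \<le> \<alpha> * x + \<beta> * x^2 + \<gamma> * x^4"
  shows "upper_exp \<P> (\<lambda>w. \<phi> (\<xi> w)) \<le> \<beta> * c + 3 * \<gamma> * c^2"
proof -
  have "viscosity_solution (G_fun vl vh) \<phi> (\<lambda>t x. upper_exp \<P> (\<lambda>w. \<phi> (x + sqrt t * \<xi> w)))"
  proof (rule normal[unfolded G_normal_def, rule_format], rule conjI)
    show "bounded (range \<phi>)" using C by (intro boundedI[of _ C]) auto
  qed (rule lip)
  then have "upper_exp \<P> (\<lambda>w. \<phi> (0 + sqrt 1 * \<xi> w)) \<le> heat_poly c \<alpha> \<beta> \<gamma> 1 0"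
    by (rule viscosity_solution_le_heat_poly[where M = C])
      (use c \<beta> \<gamma> \<phi> in \<open>auto intro!: abs_upper_exp_le[OF \<P>] C\<close>)
  then show ?thesis by (simp add: heat_poly_def)
qed

lemma integral_le_bound:
  fixes X :: "'a \<Rightarrow> real"
  assumes "prob_space P" "\<And>w. X w \<le> \<delta>" "0 \<le> \<delta>"
  shows "(\<integral>w. X w \<partial>P) \<le> \<delta>"
proof (cases "integrable P X")
  case True
  interpret prob_space P by fact
  have "(\<integral>w. X w \<partial>P) \<le> (\<integral>w. \<delta> \<partial>P)" using True assms(2) by (intro integral_mono) auto
  then show ?thesis by (simp add: prob_space)
qed (use assms(3) in \<open>simp add: not_integrable_integral_eq\<close>)

text \<open>Test functions have to be bounded, so moments are first available for truncated
  variables; monotone convergence removes the truncation.\<close>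

lemma integral_abs_le_of_trunc:
  fixes \<xi> :: "'a \<Rightarrow> real"
  assumes P: "prob_space P" and [measurable]: "\<xi> \<in> borel_measurable P"
    and le: "\<And>N::nat. (\<integral>w. (min \<bar>\<xi> w\<bar> (real N)) ^ k \<partial>P) \<le> D"
  shows "integrable P (\<lambda>w. \<bar>\<xi> w\<bar> ^ k)" "(\<integral>w. \<bar>\<xi> w\<bar> ^ k \<partial>P) \<le> D"
proof -
  interpret prob_space P by fact
  have int: "integrable P (\<lambda>w. (min \<bar>\<xi> w\<bar> (real N)) ^ k)" for N :: nat
  proof (rule integrable_const_bound[of _ "real N ^ k"])
    show "AE w in P. norm ((min \<bar>\<xi> w\<bar> (real N)) ^ k) \<le> real N ^ k"
      by (auto simp: power_abs intro!: power_mono)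
  qed measurable
  have mono: "mono (\<lambda>N. (min \<bar>\<xi> w\<bar> (real N)) ^ k)" for w
    by (auto intro!: monoI power_mono)
  have lim: "(\<lambda>N. (min \<bar>\<xi> w\<bar> (real N)) ^ k) \<longlonglongrightarrow> \<bar>\<xi> w\<bar> ^ k" for w
  proof (rule tendsto_eventually)
    obtain n0 :: nat where "\<bar>\<xi> w\<bar> \<le> real n0" using real_arch_simple by blast
    then show "\<forall>\<^sub>F N in sequentially. (min \<bar>\<xi> w\<bar> (real N)) ^ k = \<bar>\<xi> w\<bar> ^ k"
      by (auto intro!: eventually_sequentiallyI[of n0] simp: min_def)
  qed
  have inc: "incseq (\<lambda>N. (\<integral>w. (min \<bar>\<xi> w\<bar> (real N)) ^ k \<partial>P))"
    by (intro incseq_SucI integral_mono int power_mono) auto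
  obtain x where x: "(\<lambda>N. (\<integral>w. (min \<bar>\<xi> w\<bar> (real N)) ^ k \<partial>P)) \<longlonglongrightarrow> x"
    using incseq_convergent[OF inc] le by blast
  note * = integral_monotone_convergence_nonneg[OF int _ _ _ x, of "\<lambda>w. \<bar>\<xi> w\<bar> ^ k"]
  show "integrable P (\<lambda>w. \<bar>\<xi> w\<bar> ^ k)"
    by (rule *(1)) (use mono lim in auto)
  have "(\<integral>w. \<bar>\<xi> w\<bar> ^ k \<partial>P) = x"
    by (rule *(2)) (use mono lim in auto)
  then show "(\<integral>w. \<bar>\<xi> w\<bar> ^ k \<partial>P) \<le> D"
    using LIMSEQ_le_const2[OF x] le by blast
qed

lemma lipschitz_trunc_power:
  assumes "0 \<le> (N::real)"
  shows "(real k * N ^ (k - 1))-lipschitz_on UNIV (\<lambda>x::real. (min \<bar>x\<bar> N) ^ k)"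
proof (rule lipschitz_onI)
  fix x y :: real
  define a b where "a = min \<bar>x\<bar> N" and "b = min \<bar>y\<bar> N"
  have ab: "0 \<le> a" "0 \<le> b" "a \<le> N" "b \<le> N" unfolding a_def b_def using assms by auto
  have "\<bar>a ^ k - b ^ k\<bar> = \<bar>a - b\<bar> * \<bar>\<Sum>i<k. a ^ i * b ^ (k - Suc i)\<bar>"
    by (simp add: power_diff_sumr2 abs_mult mult.commute)
  also have "\<dots> \<le> \<bar>a - b\<bar> * (\<Sum>i<k. N ^ (k - 1))"
  proof (intro mult_left_mono)
    have "\<bar>\<Sum>i<k. a ^ i * b ^ (k - Suc i)\<bar> \<le> (\<Sum>i<k. \<bar>a ^ i * b ^ (k - Suc i)\<bar>)" by (rule sum_abs)
    also have "\<dots> \<le> (\<Sum>i<k. N ^ i * N ^ (k - Suc i))"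
      using ab by (intro sum_mono) (auto simp: abs_mult intro!: mult_mono power_mono)
    also have "\<dots> = (\<Sum>i<k. N ^ (k - 1))"
      by (intro sum.cong) (auto simp flip: power_add)
    finally show "\<bar>\<Sum>i<k. a ^ i * b ^ (k - Suc i)\<bar> \<le> (\<Sum>i<k. N ^ (k - 1))" .
  qed simp
  also have "\<dots> = real k * N ^ (k - 1) * \<bar>a - b\<bar>" by simp
  also have "\<dots> \<le> real k * N ^ (k - 1) * \<bar>x - y\<bar>"
    using assms by (intro mult_left_mono) (auto simp: a_def b_def min_def)
  finally show "dist ((min \<bar>x\<bar> N) ^ k) ((min \<bar>y\<bar> N) ^ k) \<le> real k * N ^ (k - 1) * dist x y"
    unfolding a_def b_def dist_real_def .
qed (use assms in simp)

context
  fixes \<P> :: "'a::topological_space measure set" and vl vh c :: real and \<xi> :: "'a \<Rightarrow> real"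
  assumes \<P>: "\<P> \<subseteq> prob_measures" "\<P> \<noteq> {}"
    and normal: "G_normal \<P> vl vh \<xi>"
    and c: "0 < c" "vh < c"
    and \<xi> [measurable]: "\<xi> \<in> borel_measurable borel"
begin

lemma upper_exp_trunc_square_le: "upper_exp \<P> (\<lambda>w. (min \<bar>\<xi> w\<bar> (real N)) ^ 2) \<le> c"
proof -
  have "(min \<bar>x\<bar> (real N)) ^ 2 \<le> \<bar>x\<bar> ^ 2" for x
    by (intro power_mono) auto
  then have "upper_exp \<P> (\<lambda>w. (\<lambda>x. (min \<bar>x\<bar> (real N)) ^ 2) (\<xi> w)) \<le> 1 * c + 3 * 0 * c^2"
    using lipschitz_trunc_power[of "real N" 2]
    by (intro G_normal_upper_exp_le[OF \<P> normal c, where C = "real N ^ 2" and \<alpha> = 0])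
      (auto simp: power_abs intro!: power_mono)
  then show ?thesis by simp
qed

lemma upper_exp_trunc_fourth_le: "upper_exp \<P> (\<lambda>w. (min \<bar>\<xi> w\<bar> (real N)) ^ 4) \<le> 4 * c^2"
proof -
  have "(min \<bar>x\<bar> (real N)) ^ 4 \<le> \<bar>x\<bar> ^ 4" for x
    by (intro power_mono) auto
  \<comment> \<open>A pure fourth power would have \<open>\<beta> = 0\<close>, but coercivity needs
    \<open>\<beta> > 0\<close>. The choice \<open>\<beta> = c\<close> gives
    \<open>c * c + 3 * c^2\<close>, hence the factor 4.\<close>
  then have "(min \<bar>x\<bar> (real N)) ^ 4 \<le> c * x^2 + x ^ 4" for x
    using c by (auto simp: power_even_abs intro!: add_increasing)
  then have "upper_exp \<P> (\<lambda>w. (\<lambda>x. (min \<bar>x\<bar> (real N)) ^ 4) (\<xi> w)) \<le> c * c + 3 * 1 * c^2"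
    using lipschitz_trunc_power[of "real N" 4] c
    by (intro G_normal_upper_exp_le[OF \<P> normal c, where C = "real N ^ 4" and \<alpha> = 0])
      (auto simp: power_abs intro!: power_mono)
  then show ?thesis by (simp add: power2_eq_square)
qed

text \<open>By \<open>(y + 2 * N)^2 \<ge> 0\<close>, clipping \<open>y\<close> at height
  \<open>N\<close> gives at most \<open>y + y^2 / (4 * N)\<close>, a polynomial without contribution
  of its linear part at the origin. Both signs \<open>s\<close> are needed: together they force mean
  zero as \<open>N\<close> grows.\<close>

lemma upper_exp_trunc_le:
  assumes s: "\<bar>s\<bar> = 1" and N: "N > 0"
  shows "upper_exp \<P> (\<lambda>w. max (- real N) (min (real N) (s * \<xi> w))) \<le> c / (4 * real N)"
proof -
  have "max (- real N) (min (real N) (s * x)) \<le> s * x + 1 / (4 * real N) * x^2 + 0 * x^4" for x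
  proof -
    define y where "y = s * x"
    have y: "y^2 = x^2" using s unfolding y_def by (simp add: power_mult_distrib abs_if split: if_splits) 
    have 0: "0 \<le> (y + 2 * real N)^2" by simp
    have "- real N \<le> y + y^2 / (4 * real N)"
      using N 0 by (simp add: field_simps power2_eq_square)
    moreover have "y \<le> y + y^2 / (4 * real N)" by simp
    ultimately have "max (- real N) (min (real N) y) \<le> y + y^2 / (4 * real N)" by linarith
    then show ?thesis using y unfolding y_def by simp
  qed
  then have "upper_exp \<P> (\<lambda>w. (\<lambda>x. max (- real N) (min (real N) (s * x))) (\<xi> w)) \<le> 1 / (4 * real N) * c + 3 * 0 * c^2"
  proof (intro G_normal_upper_exp_le[OF \<P> normal c, where C = "real N"])
    have "1-lipschitz_on UNIV (\<lambda>x. max (- real N) (min (real N) (s * x)))"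
    proof (rule lipschitz_onI)
      fix x y
      have "\<bar>max (- real N) (min (real N) (s * x)) - max (- real N) (min (real N) (s * y))\<bar> \<le> \<bar>s * x - s * y\<bar>"
        by (auto simp: max_def min_def)
      also have "\<dots> = \<bar>x - y\<bar>" using s by (metis abs_mult mult_1 right_diff_distrib)
      finally show "dist (max (- real N) (min (real N) (s * x))) (max (- real N) (min (real N) (s * y))) \<le> 1 * dist x y"
        by (simp add: dist_real_def)
    qed simp
    then show "\<exists>K. K-lipschitz_on UNIV (\<lambda>x. max (- real N) (min (real N) (s * x)))" by blast
  qed (use N in \<open>auto simp: abs_le_iff\<close>)
  then show ?thesis by simp
qed

lemma moments:
  assumes P: "P \<in> \<P>"
  shows "integrable P (\<lambda>w. (\<xi> w) ^ 2)" "(\<integral>w. (\<xi> w) ^ 2 \<partial>P) \<le> c"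
    "integrable P (\<lambda>w. (\<xi> w) ^ 4)" "(\<integral>w. (\<xi> w) ^ 4 \<partial>P) \<le> 4 * c^2"
    "integrable P \<xi>"
proof -
  have Pp: "P \<in> prob_measures" using P \<P> by auto
  interpret prob_space P using prob_measuresD(3)[OF Pp] .
  have [measurable_cong]: "sets P = sets borel" using prob_measuresD(1)[OF Pp] .
  have 2: "(\<integral>w. (min \<bar>\<xi> w\<bar> (real N)) ^ 2 \<partial>P) \<le> c" for N :: nat
    by (rule order_trans[OF upper_exp_ge[OF \<P>(1) P, of _ "real N ^ 2"] upper_exp_trunc_square_le[of N]])
      (auto simp: power_abs intro!: power_mono)
  have 4: "(\<integral>w. (min \<bar>\<xi> w\<bar> (real N)) ^ 4 \<partial>P) \<le> 4 * c^2" for N :: nat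
    by (rule order_trans[OF upper_exp_ge[OF \<P>(1) P, of _ "real N ^ 4"] upper_exp_trunc_fourth_le[of N]])
      (auto simp: power_abs intro!: power_mono)
  have \<xi>': "\<xi> \<in> borel_measurable P" by measurable
  show i2: "integrable P (\<lambda>w. (\<xi> w) ^ 2)" and "(\<integral>w. (\<xi> w) ^ 2 \<partial>P) \<le> c"
    using integral_abs_le_of_trunc[OF prob_space_axioms \<xi>' 2] by simp_all
  show "integrable P (\<lambda>w. (\<xi> w) ^ 4)" "(\<integral>w. (\<xi> w) ^ 4 \<partial>P) \<le> 4 * c^2"
    using integral_abs_le_of_trunc[OF prob_space_axioms \<xi>' 4] by (simp_all add: power_even_abs)
  show "integrable P \<xi>" using i2 \<xi>' by (rule square_integrable_imp_integrable[rotated])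
qed

end

section \<open>Independence of increments\<close>

text \<open>For fixed past the factor \<open>\<psi>\<close> is a number in \<open>[0, 1]\<close> and
  comes out of every single integral, so the inner upper expectation is at most
  \<open>\<delta>\<close>; here \<open>0 \<le> \<delta>\<close> is used. The upper expectation
  dominates the integral under \<open>P\<close>.\<close>

lemma independent_product_le:
  fixes \<P> :: "'a::topological_space measure set"
  assumes \<P>: "\<P> \<subseteq> prob_measures" "\<P> \<noteq> {}" and P: "P \<in> \<P>"
    and indep: "independent_from \<P> Y n X"
    and \<psi>: "\<And>x. 0 \<le> \<psi> x \<and> \<psi> x \<le> 1" "\<And>x y. \<bar>\<psi> x - \<psi> y\<bar> \<le> K * (\<Sum>i<n. \<bar>x i - y i\<bar>)"
    and \<kappa>: "\<And>x. \<bar>\<kappa> x\<bar> \<le> C" "\<And>x y. \<bar>\<kappa> x - \<kappa> y\<bar> \<le> L * \<bar>x - y\<bar>"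
    and le: "upper_exp \<P> (\<lambda>w. \<kappa> (Y w)) \<le> \<delta>" and \<delta>: "0 \<le> \<delta>"
  shows "(\<integral>w. \<psi> (\<lambda>i. X i w) * \<kappa> (Y w) \<partial>P) \<le> \<delta>"
proof -
  have C: "C \<ge> 0" by (rule order_trans[OF abs_ge_zero]) (rule \<kappa>(1))
  have bd: "\<bar>\<psi> x * \<kappa> y\<bar> \<le> C" for x y
    using mult_mono[of "\<psi> x" 1 "\<bar>\<kappa> y\<bar>" C] \<psi>(1)[of x] \<kappa>(1)[of y] C by (simp add: abs_mult)
  have "bounded_lipschitz n (\<lambda>x y. \<psi> x * \<kappa> y)"
    unfolding bounded_lipschitz_def
  proof (intro conjI exI allI)
    show "\<bar>\<psi> x * \<kappa> y\<bar> \<le> C" for x y by (rule bd)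
    fix x x' :: "nat \<Rightarrow> real" and y y' :: real
    let ?S = "\<Sum>i<n. \<bar>x i - x' i\<bar>"
    have S: "?S \<ge> 0" by (simp add: sum_nonneg)
    have "\<bar>\<psi> x * \<kappa> y - \<psi> x' * \<kappa> y'\<bar> = \<bar>(\<psi> x - \<psi> x') * \<kappa> y + \<psi> x' * (\<kappa> y - \<kappa> y')\<bar>"
      by (simp add: algebra_simps)
    also have "\<dots> \<le> \<bar>\<psi> x - \<psi> x'\<bar> * \<bar>\<kappa> y\<bar> + \<bar>\<psi> x'\<bar> * \<bar>\<kappa> y - \<kappa> y'\<bar>"
      by (rule order_trans[OF abs_triangle_ineq]) (simp add: abs_mult)
    also have "\<dots> \<le> (\<bar>K\<bar> * ?S) * C + 1 * (\<bar>L\<bar> * \<bar>y - y'\<bar>)"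
    proof (intro add_mono mult_mono)
      show "\<bar>\<psi> x - \<psi> x'\<bar> \<le> \<bar>K\<bar> * ?S"
        by (rule order_trans[OF \<psi>(2)]) (intro mult_right_mono S, simp)
      show "\<bar>\<kappa> y - \<kappa> y'\<bar> \<le> \<bar>L\<bar> * \<bar>y - y'\<bar>"
        by (rule order_trans[OF \<kappa>(2)]) (intro mult_right_mono, simp_all)
    qed (use \<psi>(1)[of x'] \<kappa>(1) S in auto)
    also have "\<dots> \<le> (\<bar>K\<bar> * C + \<bar>L\<bar>) * (?S + \<bar>y - y'\<bar>)"
      using S C by (simp add: algebra_simps mult_nonneg_nonneg)
    finally show "\<bar>\<psi> x * \<kappa> y - \<psi> x' * \<kappa> y'\<bar> \<le> (\<bar>K\<bar> * C + \<bar>L\<bar>) * (?S + \<bar>y - y'\<bar>)" .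
  qed
  then have eq: "upper_exp \<P> (\<lambda>w. \<psi> (\<lambda>i. X i w) * \<kappa> (Y w)) =
      upper_exp \<P> (\<lambda>w. upper_exp \<P> (\<lambda>w'. \<psi> (\<lambda>i. X i w) * \<kappa> (Y w')))"
    using indep unfolding independent_from_def by blast
  have inner: "upper_exp \<P> (\<lambda>w'. \<psi> x * \<kappa> (Y w')) \<le> \<delta>" for x
    unfolding upper_exp_def
  proof (rule cSUP_least[OF \<P>(2)])
    fix P' assume P': "P' \<in> \<P>"
    have "(\<integral>w'. \<kappa> (Y w') \<partial>P') \<le> \<delta>"
      using upper_exp_ge[OF \<P>(1) P', of "\<lambda>w. \<kappa> (Y w)" C] \<kappa>(1) le by simp
    then have "\<psi> x * (\<integral>w'. \<kappa> (Y w') \<partial>P') \<le> 1 * \<delta>"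
      using \<psi>(1)[of x] \<delta> by (meson mult_left_mono mult_right_mono order_trans)
    then show "(\<integral>w'. \<psi> x * \<kappa> (Y w') \<partial>P') \<le> \<delta>" by simp
  qed
  \<comment> \<open>Integrability of the inner upper expectation as a function of \<open>w\<close>
    is not known. If it fails, the integral has the default value 0, which
    \<open>0 \<le> \<delta>\<close> covers.\<close>
  have "upper_exp \<P> (\<lambda>w. upper_exp \<P> (\<lambda>w'. \<psi> (\<lambda>i. X i w) * \<kappa> (Y w'))) \<le> \<delta>"
    by (subst upper_exp_def, rule cSUP_least[OF \<P>(2)], rule integral_le_bound)
      (use prob_measuresD(3) \<P>(1) inner \<delta> in auto)
  moreover have "(\<integral>w. \<psi> (\<lambda>i. X i w) * \<kappa> (Y w) \<partial>P) \<le> upper_exp \<P> (\<lambda>w. \<psi> (\<lambda>i. X i w) * \<kappa> (Y w))"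
    by (rule upper_exp_ge[OF \<P>(1) P]) (rule bd)
  ultimately show ?thesis using eq by simp
qed

section \<open>Cylinder functions\<close>

text \<open>A finite set of times, in place of a sequence, lets products be formed over the union of
  the sets. The Lipschitz bound makes \<open>\<psi>\<close> depend on the coordinates in
  \<open>S\<close> only, and the range \<open>[0, 1]\<close> is stable under products and
  complements.\<close>

definition cylinder :: "real \<Rightarrow> (path \<Rightarrow> real) \<Rightarrow> bool" where
  "cylinder u h \<longleftrightarrow> (\<exists>S \<psi> K. finite S \<and> S \<subseteq> {0..u} \<and> (\<forall>x. 0 \<le> \<psi> x \<and> \<psi> x \<le> 1) \<and>
     (\<forall>x y. \<bar>\<psi> x - \<psi> y\<bar> \<le> K * (\<Sum>s\<in>S. \<bar>x s - y s\<bar>)) \<and> h = (\<lambda>w. \<psi> (\<lambda>s. B s w)))"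

lemma cylinder_bounds: "cylinder u h \<Longrightarrow> 0 \<le> h w \<and> h w \<le> 1"
  unfolding cylinder_def by auto

lemma cylinder_const: "0 \<le> c \<Longrightarrow> c \<le> 1 \<Longrightarrow> cylinder u (\<lambda>_. c)"
  unfolding cylinder_def by (intro exI[of _ "{}"] exI[of _ "\<lambda>_. c"] exI[of _ 0]) auto

lemma cylinder_compl: "cylinder u h \<Longrightarrow> cylinder u (\<lambda>w. 1 - h w)"
proof -
  assume "cylinder u h"
  then obtain S \<psi> K where *: "finite S" "S \<subseteq> {0..u}" "\<And>x. 0 \<le> \<psi> x \<and> \<psi> x \<le> 1"
    "\<And>x y. \<bar>\<psi> x - \<psi> y\<bar> \<le> K * (\<Sum>s\<in>S. \<bar>x s - y s\<bar>)" "h = (\<lambda>w. \<psi> (\<lambda>s. B s w))"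
    unfolding cylinder_def by blast
  then show ?thesis
    unfolding cylinder_def by (intro exI[of _ S] exI[of _ "\<lambda>x. 1 - \<psi> x"] exI[of _ K]) (auto simp: abs_minus_commute)
qed

lemma cylinder_mult: "cylinder u h \<Longrightarrow> cylinder u h' \<Longrightarrow> cylinder u (\<lambda>w. h w * h' w)"
proof -
  assume "cylinder u h" "cylinder u h'"
  then obtain S \<psi> K S' \<psi>' K' where 1: "finite S" "S \<subseteq> {0..u}" "\<And>x. 0 \<le> \<psi> x \<and> \<psi> x \<le> 1"
    "\<And>x y. \<bar>\<psi> x - \<psi> y\<bar> \<le> K * (\<Sum>s\<in>S. \<bar>x s - y s\<bar>)" "h = (\<lambda>w. \<psi> (\<lambda>s. B s w))"
    and 2: "finite S'" "S' \<subseteq> {0..u}" "\<And>x. 0 \<le> \<psi>' x \<and> \<psi>' x \<le> 1"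
    "\<And>x y. \<bar>\<psi>' x - \<psi>' y\<bar> \<le> K' * (\<Sum>s\<in>S'. \<bar>x s - y s\<bar>)" "h' = (\<lambda>w. \<psi>' (\<lambda>s. B s w))"
    unfolding cylinder_def by blast
  have lip: "\<bar>\<psi> x * \<psi>' x - \<psi> y * \<psi>' y\<bar> \<le> (\<bar>K\<bar> + \<bar>K'\<bar>) * (\<Sum>s\<in>S \<union> S'. \<bar>x s - y s\<bar>)" for x y
  proof -
    have "\<bar>\<psi> x * \<psi>' x - \<psi> y * \<psi>' y\<bar> = \<bar>(\<psi> x - \<psi> y) * \<psi>' x + \<psi> y * (\<psi>' x - \<psi>' y)\<bar>"
      by (simp add: algebra_simps)
    also have "\<dots> \<le> \<bar>\<psi> x - \<psi> y\<bar> * \<psi>' x + \<psi> y * \<bar>\<psi>' x - \<psi>' y\<bar>"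
      by (rule order_trans[OF abs_triangle_ineq]) (use 1(3) 2(3) in \<open>simp add: abs_mult\<close>)
    also have "\<dots> \<le> \<bar>\<psi> x - \<psi> y\<bar> * 1 + 1 * \<bar>\<psi>' x - \<psi>' y\<bar>"
      using 1(3) 2(3) by (intro add_mono mult_left_mono mult_right_mono) auto
    also have "\<dots> \<le> \<bar>K\<bar> * (\<Sum>s\<in>S \<union> S'. \<bar>x s - y s\<bar>) + \<bar>K'\<bar> * (\<Sum>s\<in>S \<union> S'. \<bar>x s - y s\<bar>)"
    proof -
      have "K * (\<Sum>s\<in>S. \<bar>x s - y s\<bar>) \<le> \<bar>K\<bar> * (\<Sum>s\<in>S \<union> S'. \<bar>x s - y s\<bar>)"
        using 1(1) 2(1) by (intro mult_mono sum_mono2 sum_nonneg) auto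
      moreover have "K' * (\<Sum>s\<in>S'. \<bar>x s - y s\<bar>) \<le> \<bar>K'\<bar> * (\<Sum>s\<in>S \<union> S'. \<bar>x s - y s\<bar>)"
        using 1(1) 2(1) by (intro mult_mono sum_mono2 sum_nonneg) auto
      ultimately show ?thesis
        using order_trans[OF 1(4)[of x y]] order_trans[OF 2(4)[of x y]] by (simp only: mult_1 mult_1_right add_mono)
    qed
    finally show ?thesis by (simp add: algebra_simps)
  qed
  show ?thesis
    unfolding cylinder_def
  proof (intro exI conjI)
    show "\<forall>x. 0 \<le> \<psi> x * \<psi>' x \<and> \<psi> x * \<psi>' x \<le> 1"
      using 1(3) 2(3) by (auto intro!: mult_le_one)
    show "\<forall>x y. \<bar>\<psi> x * \<psi>' x - \<psi> y * \<psi>' y\<bar> \<le> (\<bar>K\<bar> + \<bar>K'\<bar>) * (\<Sum>s\<in>S \<union> S'. \<bar>x s - y s\<bar>)"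
      using lip by blast
  qed (use 1 2 in auto)
qed

text \<open>A ramp that is 1 up to level \<open>c\<close> and falls to 0 with slope
  \<open>n\<close>; as \<open>n\<close> grows, these functions decrease to the indicator of the
  generating half space.\<close>

lemma cylinder_half_space:
  assumes "s \<in> {0..u}"
  shows "cylinder u (\<lambda>w. max 0 (min 1 (1 - real n * (B s w - c))))"
  unfolding cylinder_def
proof (intro exI conjI)
  show "\<forall>x y. \<bar>max 0 (min 1 (1 - real n * (x s - c))) - max 0 (min 1 (1 - real n * (y s - c)))\<bar>
      \<le> real n * (\<Sum>s\<in>{s}. \<bar>x s - y s\<bar>)"
  proof (intro allI)
    fix x y :: "real \<Rightarrow> real"
    have "\<bar>max 0 (min 1 (1 - real n * (x s - c))) - max 0 (min 1 (1 - real n * (y s - c)))\<bar>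
        \<le> \<bar>(1 - real n * (x s - c)) - (1 - real n * (y s - c))\<bar>"
      by (auto simp: max_def min_def)
    also have "\<dots> = \<bar>real n * (y s - x s)\<bar>" by (simp add: algebra_simps)
    also have "\<dots> = real n * \<bar>x s - y s\<bar>" by (simp add: abs_mult abs_minus_commute)
    finally show "\<bar>max 0 (min 1 (1 - real n * (x s - c))) - max 0 (min 1 (1 - real n * (y s - c)))\<bar>
      \<le> real n * (\<Sum>s\<in>{s}. \<bar>x s - y s\<bar>)" by simp
  qed
qed (use assms in auto)

text \<open>Independence is formulated for increasing sequences of times, so the set of times is
  sorted.\<close>

lemma cylinder_enum:
  assumes "cylinder u h"
  obtains n \<tau> \<psi> K where "\<And>i. i < n \<Longrightarrow> 0 \<le> \<tau> i \<and> \<tau> i \<le> u" "\<And>i j. i \<le> j \<Longrightarrow> j < n \<Longrightarrow> \<tau> i \<le> \<tau> j"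
    "\<And>x. 0 \<le> \<psi> x \<and> \<psi> x \<le> 1" "\<And>x y. \<bar>\<psi> x - \<psi> y\<bar> \<le> K * (\<Sum>i<n. \<bar>x i - y i\<bar>)"
    "h = (\<lambda>w. \<psi> (\<lambda>i::nat. B (\<tau> i) w))"
proof -
  obtain S \<psi> K where S: "finite S" "S \<subseteq> {0..u}" and \<psi>: "\<And>x. 0 \<le> \<psi> x \<and> \<psi> x \<le> 1"
    "\<And>x y. \<bar>\<psi> x - \<psi> y\<bar> \<le> K * (\<Sum>s\<in>S. \<bar>x s - y s\<bar>)" and h: "h = (\<lambda>w. \<psi> (\<lambda>s. B s w))"
    using assms unfolding cylinder_def by blast
  define l where "l = sorted_list_of_set S"
  define n where "n = length l"
  have l: "set l = S" "sorted l" "distinct l" unfolding l_def using S(1) by auto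
  have bij: "bij_betw (nth l) {..<n} S"
    using bij_betw_nth[OF l(3), of "{..<n}" S] l(1) unfolding n_def by auto
  define idx where "idx = inv_into {..<n} (nth l)"
  have idx: "idx (l ! i) = i" if "i < n" for i
    using bij that unfolding idx_def by (simp add: bij_betw_def inv_into_f_f)
  \<comment> \<open>Coordinates outside \<open>S\<close> are filled with 0; by the Lipschitz bound
    over \<open>S\<close> this does not change the value.\<close>
  define \<psi>' where "\<psi>' x = \<psi> (\<lambda>s. if s \<in> S then x (idx s) else 0)" for x
  have lS: "l ! i \<in> S" if "i < n" for i using that l(1) unfolding n_def by auto
  show ?thesis
  proof (rule that[of n "nth l" \<psi>' K])
    show "0 \<le> l ! i \<and> l ! i \<le> u" if "i < n" for i using lS[OF that] S(2) by auto
    show "l ! i \<le> l ! j" if "i \<le> j" "j < n" for i j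
      using l(2) that unfolding n_def by (simp add: sorted_nth_mono)
    show "0 \<le> \<psi>' x \<and> \<psi>' x \<le> 1" for x unfolding \<psi>'_def by (rule \<psi>)
    show "\<bar>\<psi>' x - \<psi>' y\<bar> \<le> K * (\<Sum>i<n. \<bar>x i - y i\<bar>)" for x y
    proof -
      have "(\<Sum>s\<in>S. \<bar>(if s \<in> S then x (idx s) else 0) - (if s \<in> S then y (idx s) else 0)\<bar>) = (\<Sum>s\<in>S. \<bar>x (idx s) - y (idx s)\<bar>)"
        by (intro sum.cong) auto
      also have "\<dots> = (\<Sum>i<n. \<bar>x (idx (l ! i)) - y (idx (l ! i))\<bar>)"
        by (rule sum.reindex_bij_betw[OF bij, symmetric])
      also have "\<dots> = (\<Sum>i<n. \<bar>x i - y i\<bar>)" using idx by (intro sum.cong) auto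
      finally have eq: "(\<Sum>s\<in>S. \<bar>(if s \<in> S then x (idx s) else 0) - (if s \<in> S then y (idx s) else 0)\<bar>) = (\<Sum>i<n. \<bar>x i - y i\<bar>)" .
      show ?thesis unfolding \<psi>'_def by (rule \<psi>(2)[of "\<lambda>s. if s \<in> S then x (idx s) else 0" "\<lambda>s. if s \<in> S then y (idx s) else 0", unfolded eq])
    qed
    show "h = (\<lambda>w. \<psi>' (\<lambda>i. B (l ! i) w))"
    proof
      fix w
      have "l ! idx s = s" if "s \<in> S" for s
        unfolding idx_def using bij that by (metis bij_betw_def f_inv_into_f)
      then have "(\<Sum>s\<in>S. \<bar>B s w - (if s \<in> S then B (l ! idx s) w else 0)\<bar>) = 0"
        by (intro sum.neutral) auto
      then have "\<bar>\<psi> (\<lambda>s. B s w) - \<psi>' (\<lambda>i. B (l ! i) w)\<bar> \<le> K * 0"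
        unfolding \<psi>'_def using \<psi>(2)[of "\<lambda>s. B s w" "\<lambda>s. if s \<in> S then B (l ! idx s) w else 0"] by simp
      then show "h w = \<psi>' (\<lambda>i. B (l ! i) w)" unfolding h by simp
    qed
  qed
qed

text \<open>The definition says nothing about measurability of \<open>\<psi>\<close>; it follows
  from continuity on the path space, since \<open>\<psi>\<close> is Lipschitz in finitely many
  coordinates.\<close>

lemma cylinder_measurable: "cylinder u h \<Longrightarrow> h \<in> borel_measurable borel"
proof -
  assume "cylinder u h"
  then obtain S \<psi> K where S: "finite S" "S \<subseteq> {0..u}" and \<psi>: "\<And>x. 0 \<le> \<psi> x \<and> \<psi> x \<le> 1"
    "\<And>x y. \<bar>\<psi> x - \<psi> y\<bar> \<le> K * (\<Sum>s\<in>S. \<bar>x s - y s\<bar>)" and h: "h = (\<lambda>w. \<psi> (\<lambda>s. B s w))"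
    unfolding cylinder_def by blast
  have "continuous_on UNIV h"
    unfolding continuous_on_open_vimage[OF open_UNIV]
  proof (intro allI impI)
    fix V :: "real set" assume V: "open V"
    show "open (h -` V \<inter> UNIV)"
      unfolding open_path_def
    proof
      fix w assume "w \<in> h -` V \<inter> UNIV"
      then obtain e where e: "e > 0" "\<And>y. \<bar>y - h w\<bar> < e \<Longrightarrow> y \<in> V"
        using V unfolding open_dist dist_real_def by auto
      define D where "D = \<bar>K\<bar> * real (card S) + 1"
      have D: "D > 0" "D > \<bar>K\<bar> * real (card S)" unfolding D_def by (auto intro: add_nonneg_pos)
      have "w' \<in> h -` V \<inter> UNIV" if w': "\<forall>s\<in>{0..max 0 u}. \<bar>B s w' - B s w\<bar> < e / D" for w'
      proof -
        have "\<bar>h w' - h w\<bar> \<le> K * (\<Sum>s\<in>S. \<bar>B s w' - B s w\<bar>)" unfolding h by (rule \<psi>)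
        also have "\<dots> \<le> \<bar>K\<bar> * (\<Sum>s\<in>S. e / D)"
        proof (intro mult_mono sum_mono)
          fix s assume "s \<in> S"
          then have "s \<in> {0..max 0 u}" using S(2) by auto
          then show "\<bar>B s w' - B s w\<bar> \<le> e / D" using w' by (auto intro: less_imp_le)
        qed (auto intro: sum_nonneg)
        also have "\<dots> = \<bar>K\<bar> * real (card S) * (e / D)" by simp
        also have "\<dots> < D * (e / D)" using D e by (intro mult_strict_right_mono) auto
        finally show ?thesis using e D by auto
      qed
      moreover have "e / D > 0" using e D by simp
      ultimately show "\<exists>r\<ge>0. \<exists>e>0. \<forall>w'. (\<forall>s\<in>{0..r}. \<bar>B s w' - B s w\<bar> < e) \<longrightarrow> w' \<in> h -` V \<inter> UNIV"
        by (intro exI[of _ "max 0 u"] conjI exI[of _ "e / D"] allI impI max.cobounded1)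
    qed
  qed
  then show ?thesis by (rule borel_measurable_continuous_onI)
qed

definition cylinder_approx :: "path measure \<Rightarrow> real \<Rightarrow> path set \<Rightarrow> bool" where
  "cylinder_approx P u A \<longleftrightarrow> A \<in> sets borel \<and> (\<forall>e>0. \<exists>h. cylinder u h \<and> (\<integral>w. \<bar>indicator A w - h w\<bar> \<partial>P) < e)"

context
  fixes P :: "path measure"
  assumes P: "P \<in> prob_measures"
begin

interpretation prob_space P using prob_measuresD(3)[OF P] .

lemma sets_P: "sets P = sets borel"
  using prob_measuresD(1)[OF P] .

lemma integrable_bounded01:
  assumes [measurable]: "h \<in> borel_measurable borel" and h: "\<And>w. \<bar>h w\<bar> \<le> (1::real)"
  shows "integrable P h"
proof -
  note [measurable_cong] = sets_P
  show ?thesis by (rule integrable_const_bound[of _ 1]) (use h in auto)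
qed

lemma integrable_indicator_diff:
  assumes h: "cylinder u h" and [measurable]: "A \<in> sets borel"
  shows "integrable P (\<lambda>w. indicator A w - h w)"
proof (rule integrable_bounded01)
  show "(\<lambda>w. indicator A w - h w) \<in> borel_measurable borel"
    using cylinder_measurable[OF h] by measurable
  show "\<bar>indicator A w - h w\<bar> \<le> 1" for w
    using cylinder_bounds[OF h, of w] by (auto simp: indicator_def abs_le_iff)
qed

text \<open>Induction over the generated sigma-algebra: ramps for the half spaces,
  \<open>1 - h\<close> for complements, and for countable unions first finite unions and then
  dominated convergence.\<close>

lemma cylinder_approx_sigma:
  assumes "A \<in> sigma_sets UNIV (half_spaces {0..u})"
  shows "cylinder_approx P u A"
proof -
  note [measurable_cong] = sets_P
  show ?thesis
    using assms
  proof induction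
    case (Basic A)
    then obtain s c where s: "s \<in> {0..u}" and A: "A = {w. B s w \<le> c}"
      by (auto simp: half_spaces_def)
    have [measurable]: "A \<in> sets borel" unfolding A by measurable
    define h where "h n w = max 0 (min 1 (1 - real n * (B s w - c)))" for n w
    have cyl: "cylinder u (h n)" for n unfolding h_def by (rule cylinder_half_space[OF s])
    have [measurable]: "h n \<in> borel_measurable borel" for n using cylinder_measurable[OF cyl] .
    have lim: "(\<lambda>n. h n w) \<longlonglongrightarrow> indicator A w" for w
    proof (cases "B s w \<le> c")
      case True
      then have "h n w = 1" for n unfolding h_def by (auto simp: max_def min_def mult_nonneg_nonpos)
      then show ?thesis using True unfolding A by simp
    next
      case False
      obtain n0 where n0: "1 / (B s w - c) \<le> real n0" using real_arch_simple by blast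
      have "h n w = 0" if "n \<ge> n0" for n
      proof -
        have "1 / (B s w - c) \<le> real n" using n0 that by linarith
        then have "1 \<le> real n * (B s w - c)" using False by (simp add: field_simps)
        then show ?thesis unfolding h_def by simp
      qed
      then have "(\<lambda>n. h n w) \<longlonglongrightarrow> 0" by (intro tendsto_eventually eventually_sequentiallyI)
      then show ?thesis using False unfolding A by simp
    qed
    have "(\<lambda>n. \<integral>w. \<bar>indicator A w - h n w\<bar> \<partial>P) \<longlonglongrightarrow> (\<integral>w. 0 \<partial>P)"
    proof (rule integral_dominated_convergence[where w = "\<lambda>_. 1"])
      have "(\<lambda>n. \<bar>indicator A w - h n w\<bar>) \<longlonglongrightarrow> \<bar>indicator A w - indicator A w\<bar>" for w
        by (intro tendsto_rabs tendsto_diff tendsto_const lim)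
      then show "AE w in P. (\<lambda>n. \<bar>indicator A w - h n w\<bar>) \<longlonglongrightarrow> 0" by simp
      show "AE w in P. norm \<bar>indicator A w - h n w\<bar> \<le> 1" for n
      proof (rule AE_I2)
        fix w show "norm \<bar>indicator A w - h n w\<bar> \<le> 1"
          using cylinder_bounds[OF cyl[of n], of w] by (auto simp: indicator_def abs_le_iff)
      qed
    qed auto
    then have *: "(\<lambda>n. \<integral>w. \<bar>indicator A w - h n w\<bar> \<partial>P) \<longlonglongrightarrow> 0" by simp
    have "\<exists>h. cylinder u h \<and> (\<integral>w. \<bar>indicator A w - h w\<bar> \<partial>P) < e" if e: "e > 0" for e
      using order_tendstoD(2)[OF * e] cyl by (auto simp: eventually_sequentially)
    then show ?case unfolding cylinder_approx_def by auto
  next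
    case Empty
    show ?case unfolding cylinder_approx_def by (auto intro!: exI[of _ "\<lambda>_. 0"] cylinder_const)
  next
    case (Compl A)
    have eq: "\<bar>indicator (UNIV - A) w - (1 - h w)\<bar> = \<bar>indicator A w - h w\<bar>" for h :: "path \<Rightarrow> real" and w
      by (auto simp: indicator_def)
    have "\<exists>h. cylinder u h \<and> (\<integral>w. \<bar>indicator (UNIV - A) w - h w\<bar> \<partial>P) < e" if e: "e > 0" for e
    proof -
      obtain h where "cylinder u h" "(\<integral>w. \<bar>indicator A w - h w\<bar> \<partial>P) < e"
        using Compl.IH e unfolding cylinder_approx_def by blast
      then show ?thesis by (intro exI[of _ "\<lambda>w. 1 - h w"]) (auto simp: eq cylinder_compl)
    qed
    then show ?case using Compl.IH unfolding cylinder_approx_def by auto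
  next
    case (Union A)
    have [measurable]: "A i \<in> sets borel" for i using Union.IH unfolding cylinder_approx_def by auto
    have fin: "cylinder_approx P u (\<Union>i<n. A i)" for n :: nat
    proof (induction n)
      case 0
      show ?case unfolding cylinder_approx_def by (auto intro!: exI[of _ "\<lambda>_. 0"] cylinder_const)
    next
      case (Suc n)
      define U where "U = (\<Union>i<n. A i)"
      have [measurable]: "U \<in> sets borel" unfolding U_def by measurable
      have "\<exists>h. cylinder u h \<and> (\<integral>w. \<bar>indicator (A n \<union> U) w - h w\<bar> \<partial>P) < e" if e: "e > 0" for e
      proof -
        obtain h where h: "cylinder u h" "(\<integral>w. \<bar>indicator U w - h w\<bar> \<partial>P) < e / 2"
          using Suc.IH e unfolding cylinder_approx_def U_def by (meson half_gt_zero)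
        obtain h' where h': "cylinder u h'" "(\<integral>w. \<bar>indicator (A n) w - h' w\<bar> \<partial>P) < e / 2"
          using Union.IH[of n] e unfolding cylinder_approx_def by (meson half_gt_zero)
        note [measurable] = cylinder_measurable[OF h(1)] cylinder_measurable[OF h'(1)]
        \<comment> \<open>Inclusion-exclusion as a product of complements: \<open>g\<close> stays in
          \<open>[0, 1]\<close>, and its error is at most the sum of the two errors.\<close>
        define g where "g w = 1 - (1 - h w) * (1 - h' w)" for w
        have "cylinder u g" unfolding g_def by (intro cylinder_compl cylinder_mult h h')
        note [measurable] = cylinder_measurable[OF this]
        have b: "0 \<le> h w \<and> h w \<le> 1" "0 \<le> h' w \<and> h' w \<le> 1" "0 \<le> g w \<and> g w \<le> 1" for w
          using cylinder_bounds h(1) h'(1) \<open>cylinder u g\<close> by blast+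
        have i1: "integrable P (\<lambda>w. \<bar>indicator U w - h w\<bar>)"
          by (rule integrable_abs[OF integrable_indicator_diff[OF h(1)]]) simp
        have i2: "integrable P (\<lambda>w. \<bar>indicator (A n) w - h' w\<bar>)"
          by (rule integrable_abs[OF integrable_indicator_diff[OF h'(1)]]) simp
        have i3: "integrable P (\<lambda>w. \<bar>indicator (A n \<union> U) w - g w\<bar>)"
          by (rule integrable_abs[OF integrable_indicator_diff[OF \<open>cylinder u g\<close>]]) simp
        have le: "\<bar>indicator (A n \<union> U) w - g w\<bar> \<le> \<bar>indicator U w - h w\<bar> + \<bar>indicator (A n) w - h' w\<bar>" for w
        proof -
          have "(1 - h w) * (1 - h' w) \<le> 1 - h w" "(1 - h w) * (1 - h' w) \<le> 1 - h' w" "0 \<le> (1 - h w) * (1 - h' w)" "0 \<le> h w * h' w"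
            using b(1,2)[of w] by (auto intro: mult_left_le mult_right_le_one_le mult_left_le_one_le)
          then show ?thesis using b(1,2)[of w] unfolding g_def by (auto simp: indicator_def algebra_simps)
        qed
        have "(\<integral>w. \<bar>indicator (A n \<union> U) w - g w\<bar> \<partial>P) \<le> (\<integral>w. \<bar>indicator U w - h w\<bar> + \<bar>indicator (A n) w - h' w\<bar> \<partial>P)"
          using le by (intro integral_mono Bochner_Integration.integrable_add i1 i2 i3)
        also have "\<dots> = (\<integral>w. \<bar>indicator U w - h w\<bar> \<partial>P) + (\<integral>w. \<bar>indicator (A n) w - h' w\<bar> \<partial>P)"
          by (rule Bochner_Integration.integral_add[OF i1 i2])
        also have "\<dots> < e" using h h' by simp
        finally show ?thesis using \<open>cylinder u g\<close> by blast
      qed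
      then show ?case unfolding cylinder_approx_def lessThan_Suc UN_insert U_def by auto
    qed
    define U where "U n = (\<Union>i<n. A i)" for n :: nat
    have [measurable]: "U n \<in> sets borel" for n unfolding U_def by measurable
    have "(\<lambda>n. \<integral>w. \<bar>indicator (\<Union>(range A)) w - indicator (U n) w\<bar> \<partial>P) \<longlonglongrightarrow> (\<integral>w. (0::real) \<partial>P)"
    proof (rule integral_dominated_convergence[where w = "\<lambda>_. 1"])
      show "AE w in P. (\<lambda>n. \<bar>indicator (\<Union>(range A)) w - indicator (U n) w\<bar> :: real) \<longlonglongrightarrow> 0"
      proof (intro AE_I2)
        fix w
        have "\<exists>n0. \<forall>n\<ge>n0. \<bar>indicator (\<Union>(range A)) w - indicator (U n) w\<bar> = (0::real)"
        proof (cases "w \<in> \<Union>(range A)")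
          case True
          then obtain i where "w \<in> A i" by auto
          then have "w \<in> U n" if "n \<ge> Suc i" for n using that unfolding U_def by auto
          then show ?thesis using True by (intro exI[of _ "Suc i"]) auto
        qed (auto simp: U_def)
        then show "(\<lambda>n. \<bar>indicator (\<Union>(range A)) w - indicator (U n) w\<bar> :: real) \<longlonglongrightarrow> 0"
          by (intro tendsto_eventually) (auto simp: eventually_sequentially)
      qed
      show "AE w in P. norm \<bar>indicator (\<Union>(range A)) w - indicator (U n) w :: real\<bar> \<le> 1" for n
        by (intro AE_I2) (auto simp: indicator_def)
    qed auto
    then have *: "(\<lambda>n. \<integral>w. \<bar>indicator (\<Union>(range A)) w - indicator (U n) w\<bar> \<partial>P) \<longlonglongrightarrow> (0::real)" by simp
    have "\<exists>h. cylinder u h \<and> (\<integral>w. \<bar>indicator (\<Union>(range A)) w - h w\<bar> \<partial>P) < e" if e: "e > 0" for e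
    proof -
      obtain n where n: "(\<integral>w. \<bar>indicator (\<Union>(range A)) w - indicator (U n) w\<bar> \<partial>P) < e / 2"
        using order_tendstoD(2)[OF *, of "e / 2"] e by (auto simp: eventually_sequentially)
      obtain h where h: "cylinder u h" "(\<integral>w. \<bar>indicator (U n) w - h w\<bar> \<partial>P) < e / 2"
        using fin[of n] e unfolding cylinder_approx_def U_def by (meson half_gt_zero)
      note [measurable] = cylinder_measurable[OF h(1)]
      note b = cylinder_bounds[OF h(1)]
      have i1: "integrable P (\<lambda>w. \<bar>indicator (\<Union>(range A)) w - indicator (U n) w\<bar> :: real)"
        by (rule integrable_bounded01) (auto split: split_indicator)
      have i2: "integrable P (\<lambda>w. \<bar>indicator (U n) w - h w\<bar>)"
        by (rule integrable_abs[OF integrable_indicator_diff[OF h(1)]]) simp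
      have i3: "integrable P (\<lambda>w. \<bar>indicator (\<Union>(range A)) w - h w\<bar>)"
        by (rule integrable_abs[OF integrable_indicator_diff[OF h(1)]]) simp
      have "(\<integral>w. \<bar>indicator (\<Union>(range A)) w - h w\<bar> \<partial>P) \<le>
          (\<integral>w. \<bar>indicator (\<Union>(range A)) w - indicator (U n) w\<bar> + \<bar>indicator (U n) w - h w\<bar> \<partial>P)"
        by (intro integral_mono Bochner_Integration.integrable_add i1 i2 i3) auto
      also have "\<dots> = (\<integral>w. \<bar>indicator (\<Union>(range A)) w - indicator (U n) w\<bar> \<partial>P) + (\<integral>w. \<bar>indicator (U n) w - h w\<bar> \<partial>P)"
        by (rule Bochner_Integration.integral_add[OF i1 i2])
      also have "\<dots> < e" using h n by simp
      finally show ?thesis using h by blast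
    qed
    then show ?case unfolding cylinder_approx_def by auto
  qed
qed

text \<open>Indicators of \<open>\<F>\<^sub>u\<close>-measurable sets are limits of cylinder functions in \<open>L^1\<close>, hence almost surely
  along a subsequence, so the sign condition passes to the limit by dominated convergence.\<close>

lemma integral_indicator_nonpos:
  assumes u: "0 \<le> u" and A: "A \<in> sets (path_filtration u)" and Z: "integrable P Z"
    and cyl: "\<And>h. cylinder u h \<Longrightarrow> (\<integral>w. h w * Z w \<partial>P) \<le> 0"
  shows "(\<integral>w. indicator A w * Z w \<partial>P) \<le> (0::real)"
proof -
  note [measurable_cong] = sets_P
  have "cylinder_approx P u A"
    using A cylinder_approx_sigma unfolding sets_path_filtration_eq[OF u] by blast
  then have [measurable]: "A \<in> sets borel" and "\<forall>n. \<exists>h. cylinder u h \<and> (\<integral>w. \<bar>indicator A w - h w\<bar> \<partial>P) < 1 / real (Suc n)"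
    unfolding cylinder_approx_def by auto
  then obtain h where h: "\<And>n. cylinder u (h n)" "\<And>n. (\<integral>w. \<bar>indicator A w - h n w\<bar> \<partial>P) < 1 / real (Suc n)"
    by metis
  note [measurable] = cylinder_measurable[OF h(1)]
  note b = cylinder_bounds[OF h(1)]
  have [measurable]: "Z \<in> borel_measurable P" using Z by auto
  have "\<exists>r::nat\<Rightarrow>nat. strict_mono r \<and> (AE w in P. (\<lambda>n. indicator A w - h (r n) w) \<longlonglongrightarrow> 0)"
  proof (rule tendsto_L1_AE_subseq)
    show "integrable P (\<lambda>w. indicator A w - h n w)" for n
    proof (rule integrable_bounded01)
      show "\<bar>indicator A w - h n w\<bar> \<le> 1" for w using b[of n w] by (auto simp: indicator_def abs_le_iff)
    qed measurable
    show "(\<lambda>n. \<integral>w. norm (indicator A w - h n w) \<partial>P) \<longlonglongrightarrow> 0"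
      by (rule tendsto_sandwich[OF _ _ tendsto_const LIMSEQ_Suc[OF lim_1_over_n]])
        (use h(2) in \<open>auto intro!: eventuallyI less_imp_le\<close>)
  qed
  then obtain r :: "nat \<Rightarrow> nat" where r: "AE w in P. (\<lambda>n. indicator A w - h (r n) w) \<longlonglongrightarrow> 0" by blast
  have "(\<lambda>n. \<integral>w. h (r n) w * Z w \<partial>P) \<longlonglongrightarrow> (\<integral>w. indicator A w * Z w \<partial>P)"
  proof (rule integral_dominated_convergence[where w = "\<lambda>w. \<bar>Z w\<bar>"])
    show "AE w in P. (\<lambda>n. h (r n) w * Z w) \<longlonglongrightarrow> indicator A w * Z w"
      using r
    proof eventually_elim
      case (elim w)
      have "(\<lambda>n. indicator A w - (indicator A w - h (r n) w)) \<longlonglongrightarrow> indicator A w - 0"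
        by (intro tendsto_diff tendsto_const elim)
      then show ?case by (intro tendsto_mult tendsto_const) simp
    qed
    show "AE w in P. norm (h (r n) w * Z w) \<le> \<bar>Z w\<bar>" for n
    proof (rule AE_I2)
      fix w show "norm (h (r n) w * Z w) \<le> \<bar>Z w\<bar>"
        using b[of "r n" w] by (simp add: abs_mult mult_left_le_one_le)
    qed
  qed (use Z in auto)
  then show ?thesis
    by (rule LIMSEQ_le_const2) (use cyl[OF h(1)] in auto)
qed

end

section \<open>Square integrable functions\<close>

lemma integrable_mult_L2:
  fixes X Y :: "'a \<Rightarrow> real"
  assumes [measurable]: "X \<in> borel_measurable M" "Y \<in> borel_measurable M"
    and "integrable M (\<lambda>w. (X w)^2)" "integrable M (\<lambda>w. (Y w)^2)"
  shows "integrable M (\<lambda>w. X w * Y w)"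
proof (rule Bochner_Integration.integrable_bound[where f = "\<lambda>w. (X w)^2 + (Y w)^2"])
  show "AE w in M. norm (X w * Y w) \<le> norm ((X w)^2 + (Y w)^2)"
  proof (rule AE_I2)
    fix w
    have "0 \<le> (\<bar>X w\<bar> - \<bar>Y w\<bar>)^2" by simp
    then have "2 * (\<bar>X w\<bar> * \<bar>Y w\<bar>) \<le> (X w)^2 + (Y w)^2" by (simp add: power2_diff)
    moreover have "0 \<le> \<bar>X w\<bar> * \<bar>Y w\<bar>" by simp
    ultimately have "\<bar>X w\<bar> * \<bar>Y w\<bar> \<le> (X w)^2 + (Y w)^2" by linarith
    then show "norm (X w * Y w) \<le> norm ((X w)^2 + (Y w)^2)" by (simp add: abs_mult)
  qed
qed (use assms in auto)

lemma integrable_add_L2: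
  fixes X Y :: "'a \<Rightarrow> real"
  assumes [measurable]: "X \<in> borel_measurable M" "Y \<in> borel_measurable M"
    and "integrable M (\<lambda>w. (X w)^2)" "integrable M (\<lambda>w. (Y w)^2)"
  shows "integrable M (\<lambda>w. (X w + Y w)^2)"
proof -
  have "integrable M (\<lambda>w. (X w)^2 + (Y w)^2 + 2 * (X w * Y w))"
    by (intro Bochner_Integration.integrable_add integrable_mult_right integrable_mult_L2 assms)
  then show ?thesis by (simp only: power2_sum mult.assoc)
qed

lemma integrable_sum_L2:
  fixes X :: "'i \<Rightarrow> 'a \<Rightarrow> real"
  assumes "finite I" "\<And>i. i \<in> I \<Longrightarrow> X i \<in> borel_measurable M" "\<And>i. i \<in> I \<Longrightarrow> integrable M (\<lambda>w. (X i w)^2)"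
  shows "integrable M (\<lambda>w. (\<Sum>i\<in>I. X i w)^2)"
  using assms
proof (induction I rule: finite_induct)
  case (insert i I)
  then show ?case
    by (simp add: sum.insert[OF insert(1,2)]) (intro integrable_add_L2 borel_measurable_sum, auto)
qed simp

lemma integrable_bounded_mult_L2:
  fixes X Y :: "'a \<Rightarrow> real"
  assumes [measurable]: "X \<in> borel_measurable M" "Y \<in> borel_measurable M"
    and X: "\<And>w. \<bar>X w\<bar> \<le> c" and Y: "integrable M (\<lambda>w. (Y w)^2)"
  shows "integrable M (\<lambda>w. (X w * Y w)^2)"
proof (rule Bochner_Integration.integrable_bound[where f = "\<lambda>w. c^2 * (Y w)^2"])
  show "AE w in M. norm ((X w * Y w)^2) \<le> norm (c^2 * (Y w)^2)"
  proof (rule AE_I2)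
    fix w
    have "\<bar>X w\<bar>^2 \<le> c^2" using X by (intro power_mono) auto
    then show "norm ((X w * Y w)^2) \<le> norm (c^2 * (Y w)^2)"
      by (simp add: power_mult_distrib mult_right_mono)
  qed
qed (use Y in auto)

section \<open>Increments under a fixed measure\<close>

text \<open>Testing with the event where the conditional expectation of \<open>Z\<close> is positive
  shows that this event is null; then \<open>h\<close> is pulled out. In this way \<open>h\<close>
  may be unbounded, as the positive part of a partial sum will be.\<close>

lemma (in sigma_finite_subalgebra) integral_mult_nonpos:
  assumes Z: "integrable M Z" and A: "\<And>A. A \<in> sets F \<Longrightarrow> (\<integral>w. indicator A w * Z w \<partial>M) \<le> (0::real)"
    and h: "h \<in> borel_measurable F" "\<And>w. 0 \<le> h w" and hZ: "integrable M (\<lambda>w. h w * Z w)"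
  shows "(\<integral>w. h w * Z w \<partial>M) \<le> 0"
proof -
  define R where "R = real_cond_exp M F Z"
  have [measurable]: "R \<in> borel_measurable F" "R \<in> borel_measurable M" unfolding R_def by auto
  have [measurable]: "Z \<in> borel_measurable M" using Z by auto
  have R: "integrable M R" unfolding R_def by (rule real_cond_exp_int(1)[OF Z])
  define A where "A = {w \<in> space M. R w > 0}"
  have "space F = space M" using subalg unfolding subalgebra_def by auto
  then have AF: "A \<in> sets F"     unfolding A_def using borel_measurable_less[OF borel_measurable_const[of 0] \<open>R \<in> borel_measurable F\<close>] by simp
  then have [measurable]: "A \<in> sets M" using subalg unfolding subalgebra_def by auto
  have int: "integrable M (\<lambda>w. indicator A w * Z w)" using integrable_mult_indicator[OF \<open>A \<in> sets M\<close> Z] by simp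
  have "(\<integral>w. indicator A w * R w \<partial>M) = (\<integral>w. indicator A w * Z w \<partial>M)"
    unfolding R_def by (rule real_cond_exp_intg(2)) (use int AF in auto)
  then have "(\<integral>w. indicator A w * R w \<partial>M) \<le> 0" using A[OF AF] by simp
  moreover have nn: "0 \<le> indicator A w * R w" for w by (auto simp: A_def indicator_def)
  moreover have i2: "integrable M (\<lambda>w. indicator A w * R w)" using integrable_mult_indicator[OF \<open>A \<in> sets M\<close> R] by simp
  ultimately have "(\<integral>w. indicator A w * R w \<partial>M) = 0" by (intro antisym integral_nonneg_AE) auto
  then have "AE w in M. indicator A w * R w = 0" using integral_nonneg_eq_0_iff_AE[OF i2] nn by auto
  then have neg: "AE w in M. R w \<le> 0" by (rule AE_mp) (auto intro!: AE_I2 simp: A_def indicator_def split: if_splits)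
  have "(\<integral>w. h w * Z w \<partial>M) = (\<integral>w. h w * R w \<partial>M)"
    unfolding R_def by (rule real_cond_exp_intg(2)[symmetric]) (use hZ h in auto)
  also have "\<dots> \<le> 0"
  proof -
    have "AE w in M. 0 \<le> - (h w * R w)" using neg by eventually_elim (use h in \<open>auto simp: mult_nonneg_nonpos\<close>)
    then have "0 \<le> (\<integral>w. - (h w * R w) \<partial>M)" by (rule integral_nonneg_AE)
    then show ?thesis by simp
  qed
  finally show ?thesis .
qed

lemma (in sigma_finite_subalgebra) integral_mult_eq_0:
  assumes Z: "integrable M Z" and A: "\<And>A. A \<in> sets F \<Longrightarrow> (\<integral>w. indicator A w * Z w \<partial>M) = (0::real)"
    and h [measurable]: "h \<in> borel_measurable F" and hZ: "integrable M (\<lambda>w. h w * Z w)"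
  shows "(\<integral>w. h w * Z w \<partial>M) = 0"
proof -
  have [measurable]: "Z \<in> borel_measurable M" using Z by auto
  have "AE w in M. real_cond_exp M F Z w = 0"
    by (rule real_cond_exp_charact[where g = "\<lambda>_. 0"]) (use A Z in \<open>auto simp: set_lebesgue_integral_def\<close>)
  moreover have "(\<integral>w. h w * Z w \<partial>M) = (\<integral>w. h w * real_cond_exp M F Z w \<partial>M)"
    by (rule real_cond_exp_intg(2)[symmetric]) (use hZ in auto)
  moreover have "(\<integral>w. h w * real_cond_exp M F Z w \<partial>M) = 0"
    by (rule integral_eq_zero_AE) (use calculation(1) in auto)
  ultimately show ?thesis by simp
qed

locale G_path =
  fixes \<sigma>l \<sigma>h :: real and \<P> :: "path measure set" and P :: "path measure"
  assumes sigma: "0 \<le> \<sigma>l" "\<sigma>l \<le> \<sigma>h" and G: "G_expectation \<sigma>l \<sigma>h \<P>" and P_in: "P \<in> \<P>"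
begin

lemma subset_prob_measures: "\<P> \<subseteq> prob_measures"
proof -
  have "\<P> \<subseteq> topspace weak_topology"
    using G unfolding G_expectation_def by (auto dest: compactin_subset_topspace)
  also have "\<dots> \<subseteq> prob_measures" unfolding weak_topology_def topology_generated_by_topspace by auto
  finally show ?thesis .
qed

lemma P_prob: "P \<in> prob_measures" and family_nonempty: "\<P> \<noteq> {}"
  using subset_prob_measures P_in by auto

sublocale prob_space P using prob_measuresD(3)[OF P_prob] .

lemma sets_P' [measurable_cong, simp]: "sets P = sets borel"
  using prob_measuresD(1)[OF P_prob] .

lemma space_P [simp]: "space P = UNIV"
  using prob_measuresD(2)[OF P_prob] .

text \<open>Any constant above \<open>\<sigma>h^2\<close> would do; strict inequality makes \<open>heat_poly\<close> a strict supersolution.\<close>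

definition C where "C = \<sigma>h^2 + 1"

lemma C_pos: "C > 0" unfolding C_def by (simp add: add_nonneg_pos)

lemma subalgebra_path_filtration: "0 \<le> u \<Longrightarrow> subalgebra P (path_filtration u)"
  using sets_path_filtration_subset[of u] by (simp add: subalgebra_def)

lemma sigma_finite_path_filtration: "0 \<le> u \<Longrightarrow> sigma_finite_subalgebra P (path_filtration u)"
  by (intro finite_measure_subalgebra_is_sigma_finite finite_measure_subalgebra.intro
      finite_measure_subalgebra_axioms.intro subalgebra_path_filtration) unfold_locales

lemma G_normal_increment: "0 \<le> s \<Longrightarrow> s \<le> u \<Longrightarrow> G_normal \<P> (\<sigma>l^2 * (u - s)) (\<sigma>h^2 * (u - s)) (\<lambda>w. B u w - B s w)"
proof -
  assume "0 \<le> s" "s \<le> u"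
  then have "G_normal \<P> (\<sigma>l^2 * (u - s)) (\<sigma>h^2 * (u - s)) (\<lambda>w. B (s + (u - s)) w - B s w)"
    using G unfolding G_expectation_def by (metis diff_ge_0_iff_ge)
  then show ?thesis by simp
qed

lemma independent_increment:
  assumes "0 \<le> s" "s \<le> u" and \<tau>: "\<And>i. i < n \<Longrightarrow> 0 \<le> \<tau> i \<and> \<tau> i \<le> s" "\<And>i j. i \<le> j \<Longrightarrow> j < n \<Longrightarrow> \<tau> i \<le> \<tau> j"
  shows "independent_from \<P> (\<lambda>w. B u w - B s w) n (\<lambda>i. B (\<tau> i))"
proof -
  have "\<forall>t\<ge>0. \<forall>s\<ge>0. \<forall>n \<tau>. (\<forall>i<n. 0 \<le> \<tau> i \<and> \<tau> i \<le> t) \<and> (\<forall>i j. i \<le> j \<and> j < n \<longrightarrow> \<tau> i \<le> \<tau> j) \<longrightarrow>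
      independent_from \<P> (\<lambda>w. B (t + s) w - B t w) n (\<lambda>i. B (\<tau> i))"
    using G unfolding G_expectation_def by blast
  from this[rule_format, of s "u - s" n \<tau>] show ?thesis using assms by simp
qed

lemma increment_moments_conj:
  assumes "0 \<le> s" "s \<le> u"
  shows "integrable P (\<lambda>w. (B u w - B s w)^2) \<and> (\<integral>w. (B u w - B s w)^2 \<partial>P) \<le> C * (u - s) \<and>
    integrable P (\<lambda>w. (B u w - B s w)^4) \<and> (\<integral>w. (B u w - B s w)^4 \<partial>P) \<le> 4 * C^2 * (u - s)^2"
proof (cases "s = u")
  \<comment> \<open>For \<open>s = u\<close> the constant \<open>C * (u - s)\<close> is 0, and the
    comparison with the heat polynomial needs a positive one; that case is settled directly.\<close>
  case False
  note n = G_normal_increment[OF assms]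
  have c: "0 < C * (u - s)" "\<sigma>h^2 * (u - s) < C * (u - s)"
    using False assms C_pos unfolding C_def by auto
  have "(\<lambda>w. B u w - B s w) \<in> borel_measurable borel" by measurable
  note m = moments[OF subset_prob_measures family_nonempty n c this P_in]
  have "4 * (C * (u - s))^2 = 4 * C^2 * (u - s)^2" by (simp add: power_mult_distrib)
  then show ?thesis using m(1-4) by (simp only: simp_thms)
next
  case True
  show ?thesis unfolding True by simp
qed

lemmas increment_moments = increment_moments_conj[THEN conjunct1]
  increment_moments_conj[THEN conjunct2, THEN conjunct1]
  increment_moments_conj[THEN conjunct2, THEN conjunct2, THEN conjunct1]
  increment_moments_conj[THEN conjunct2, THEN conjunct2, THEN conjunct2]


lemma increment_integrable: "0 \<le> s \<Longrightarrow> s \<le> u \<Longrightarrow> integrable P (\<lambda>w. B u w - B s w)"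
proof (rule square_integrable_imp_integrable)
  assume su: "0 \<le> s" "s \<le> u"
  show "(\<lambda>w. B u w - B s w) \<in> borel_measurable P" by measurable
  show "integrable P (\<lambda>w. (B u w - B s w)^2)" by (rule increment_moments(1)[OF su])
qed

lemma cylinder_trunc_le:
  assumes su: "0 \<le> s" "s \<le> u" and h: "cylinder s h"
    and \<kappa>: "\<And>x. \<bar>\<kappa> x\<bar> \<le> D" "\<And>x y. \<bar>\<kappa> x - \<kappa> y\<bar> \<le> L * \<bar>x - y\<bar>"
    and le: "upper_exp \<P> (\<lambda>w. \<kappa> (B u w - B s w)) \<le> \<delta>" and \<delta>: "0 \<le> \<delta>"
  shows "(\<integral>w. h w * \<kappa> (B u w - B s w) \<partial>P) \<le> \<delta>"
proof -
  obtain n \<tau> \<psi> K where 1: "\<And>i. i < n \<Longrightarrow> 0 \<le> \<tau> i \<and> \<tau> i \<le> s" "\<And>i j. i \<le> j \<Longrightarrow> j < n \<Longrightarrow> \<tau> i \<le> \<tau> j"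
    and 2: "\<And>x. 0 \<le> \<psi> x \<and> \<psi> x \<le> 1" "\<And>x y. \<bar>\<psi> x - \<psi> y\<bar> \<le> K * (\<Sum>i<n. \<bar>x i - y i\<bar>)"
    and hh: "h = (\<lambda>w. \<psi> (\<lambda>i::nat. B (\<tau> i) w))"
    by (rule cylinder_enum[OF h]) blast
  note ind = independent_increment[OF su 1]
  show ?thesis
    unfolding hh
    by (rule independent_product_le[OF subset_prob_measures family_nonempty P_in ind 2 \<kappa> le \<delta>])
qed

text \<open>Independence gives upper bounds only; the two signs of \<open>sg\<close> together yield
  the martingale equality. The truncation error \<open>C * (u - s) / (4 * N)\<close> vanishes as
  \<open>N\<close> grows, and the integrable increment dominates.\<close>

lemma cylinder_increment_le:
  assumes su: "0 \<le> s" "s < u" and h: "cylinder s h" and sg: "\<bar>sg\<bar> = 1"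
  shows "(\<integral>w. h w * (sg * (B u w - B s w)) \<partial>P) \<le> 0"
proof -
  define Y where "Y w = B u w - B s w" for w
  have [measurable]: "Y \<in> borel_measurable borel" "h \<in> borel_measurable borel"
    unfolding Y_def using cylinder_measurable[OF h] by measurable
  have Y: "integrable P Y" unfolding Y_def using su by (intro increment_integrable) auto
  have n: "G_normal \<P> (\<sigma>l^2 * (u - s)) (\<sigma>h^2 * (u - s)) Y"
    unfolding Y_def[abs_def] using su by (intro G_normal_increment) auto
  have c: "0 < C * (u - s)" "\<sigma>h^2 * (u - s) < C * (u - s)"
    using su C_pos unfolding C_def by auto
  define \<kappa> where "\<kappa> N x = max (- real N) (min (real N) (sg * x))" for N x
  have le: "(\<integral>w. h w * \<kappa> N (Y w) \<partial>P) \<le> C * (u - s) / (4 * real N)" if N: "N > 0" for N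
    unfolding Y_def
  proof (rule cylinder_trunc_le[where D = "real N" and L = 1, OF su(1) less_imp_le[OF su(2)] h])
    show "\<bar>\<kappa> N x\<bar> \<le> real N" for x unfolding \<kappa>_def by (auto simp: abs_le_iff)
    show "\<bar>\<kappa> N x - \<kappa> N y\<bar> \<le> 1 * \<bar>x - y\<bar>" for x y
    proof -
      have "\<bar>\<kappa> N x - \<kappa> N y\<bar> \<le> \<bar>sg * x - sg * y\<bar>" unfolding \<kappa>_def by (auto simp: max_def min_def)
      also have "\<dots> = \<bar>x - y\<bar>" using sg by (metis abs_mult mult_1 right_diff_distrib)
      finally show ?thesis by simp
    qed
    show "upper_exp \<P> (\<lambda>w. \<kappa> N (B u w - B s w)) \<le> C * (u - s) / (4 * real N)"
      using upper_exp_trunc_le[OF subset_prob_measures family_nonempty n c _ sg N] unfolding \<kappa>_def Y_def by simp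
  qed (use c in simp)
  have lim: "(\<lambda>N. \<integral>w. h w * \<kappa> N (Y w) \<partial>P) \<longlonglongrightarrow> (\<integral>w. h w * (sg * Y w) \<partial>P)"
  proof (rule integral_dominated_convergence[where w = "\<lambda>w. \<bar>Y w\<bar>"])
    show "AE w in P. (\<lambda>N. h w * \<kappa> N (Y w)) \<longlonglongrightarrow> h w * (sg * Y w)"
    proof (intro AE_I2 tendsto_mult tendsto_const)
      fix w
      obtain n0 :: nat where n0: "\<bar>sg * Y w\<bar> \<le> real n0" using real_arch_simple by blast
      show "(\<lambda>N. \<kappa> N (Y w)) \<longlonglongrightarrow> sg * Y w"
      proof (rule tendsto_eventually, rule eventually_sequentiallyI[of n0])
        fix N assume "n0 \<le> N"
        then have "\<bar>sg * Y w\<bar> \<le> real N" using n0 by (meson of_nat_mono order_trans)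
        then have "- real N \<le> sg * Y w" "sg * Y w \<le> real N" by linarith+
        then show "\<kappa> N (Y w) = sg * Y w" unfolding \<kappa>_def by simp
      qed
    qed
    show "AE w in P. norm (h w * \<kappa> N (Y w)) \<le> \<bar>Y w\<bar>" for N
    proof (rule AE_I2)
      fix w
      have "\<bar>\<kappa> N (Y w)\<bar> \<le> \<bar>sg * Y w\<bar>" unfolding \<kappa>_def by (auto simp: max_def min_def)
      also have "\<dots> = \<bar>Y w\<bar>" using sg by (simp add: abs_mult)
      finally show "norm (h w * \<kappa> N (Y w)) \<le> \<bar>Y w\<bar>"
        using cylinder_bounds[OF h, of w] mult_mono[of "h w" 1 "\<bar>\<kappa> N (Y w)\<bar>" "\<bar>Y w\<bar>"] by (simp add: abs_mult)
    qed
    show "(\<lambda>w. h w * \<kappa> N (Y w)) \<in> borel_measurable P" for N unfolding \<kappa>_def by measurable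
  qed (use Y in auto)
  have lim0: "(\<lambda>N. C * (u - s) / (4 * real N)) \<longlonglongrightarrow> 0"
    using tendsto_mult[OF tendsto_const[of "C * (u - s) / 4"] lim_1_over_n] by simp
  have "(\<integral>w. h w * (sg * Y w) \<partial>P) \<le> 0"
    by (rule LIMSEQ_le[OF lim lim0]) (use le in \<open>auto intro!: exI[of _ 1]\<close>)
  then show ?thesis unfolding Y_def .
qed

lemma cylinder_increment_square_le:
  assumes su: "0 \<le> s" "s < u" and h: "cylinder s h"
  shows "(\<integral>w. h w * ((B u w - B s w)^2 - C * (u - s)) \<partial>P) \<le> 0"
proof -
  define Y where "Y w = B u w - B s w" for w
  have [measurable]: "Y \<in> borel_measurable borel" "h \<in> borel_measurable borel"
    unfolding Y_def using cylinder_measurable[OF h] by measurable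
  have Y: "integrable P (\<lambda>w. (Y w)^2)" unfolding Y_def using su by (intro increment_moments) auto
  have n: "G_normal \<P> (\<sigma>l^2 * (u - s)) (\<sigma>h^2 * (u - s)) Y"
    unfolding Y_def[abs_def] using su by (intro G_normal_increment) auto
  define c where "c = C * (u - s)"
  have c: "0 < c" "\<sigma>h^2 * (u - s) < c"
    using su C_pos unfolding C_def c_def by auto
  define \<kappa> where "\<kappa> N x = (min \<bar>x\<bar> (real N))^2 - c" for N x
  have bd: "0 \<le> (min \<bar>x\<bar> (real N))^2" "(min \<bar>x\<bar> (real N))^2 \<le> (real N)^2" for x N
    by (auto intro!: power_mono)
  have le: "(\<integral>w. h w * \<kappa> N (Y w) \<partial>P) \<le> 0" for N
    unfolding Y_def
  proof (rule cylinder_trunc_le[where D = "real N ^ 2 + c" and L = "2 * real N ^ (2 - 1)", OF su(1) less_imp_le[OF su(2)] h])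
    show "\<bar>\<kappa> N x\<bar> \<le> real N ^ 2 + c" for x unfolding \<kappa>_def abs_le_iff using bd[of x N] c by linarith
    show "\<bar>\<kappa> N x - \<kappa> N y\<bar> \<le> 2 * real N ^ (2 - 1) * \<bar>x - y\<bar>" for x y
      using lipschitz_onD[OF lipschitz_trunc_power[of "real N" 2], of x y] unfolding \<kappa>_def dist_real_def by simp
    \<comment> \<open>Under each single measure the constant \<open>c\<close> splits off by
      linearity; the supremum is taken afterwards.\<close>
    show "upper_exp \<P> (\<lambda>w. \<kappa> N (B u w - B s w)) \<le> 0"
      unfolding upper_exp_def
    proof (rule cSUP_least[OF family_nonempty])
      fix P' assume P': "P' \<in> \<P>"
      then have pm: "P' \<in> prob_measures" using subset_prob_measures by auto
      interpret P': prob_space P' using prob_measuresD(3)[OF pm] .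
      have [measurable_cong]: "sets P' = sets borel" using prob_measuresD(1)[OF pm] .
      have "integrable P' (\<lambda>w. (min \<bar>Y w\<bar> (real N))^2)"
        by (rule P'.integrable_const_bound[of _ "(real N)^2"]) (use bd in auto)
      then have "(\<integral>w. \<kappa> N (Y w) \<partial>P') = (\<integral>w. (min \<bar>Y w\<bar> (real N))^2 \<partial>P') - c"
        unfolding \<kappa>_def by (simp add: P'.prob_space)
      also have "(\<integral>w. (min \<bar>Y w\<bar> (real N))^2 \<partial>P') \<le> c"
        by (rule order_trans[OF upper_exp_ge[OF subset_prob_measures P', of _ "real N ^ 2"]
              upper_exp_trunc_square_le[OF subset_prob_measures family_nonempty n c]]) (use bd in auto)
      finally show "(\<integral>w. \<kappa> N (B u w - B s w) \<partial>P') \<le> 0" unfolding Y_def by simp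
    qed
  qed simp
  have lim: "(\<lambda>N. \<integral>w. h w * \<kappa> N (Y w) \<partial>P) \<longlonglongrightarrow> (\<integral>w. h w * ((Y w)^2 - c) \<partial>P)"
  proof (rule integral_dominated_convergence[where w = "\<lambda>w. (Y w)^2 + c"])
    show "AE w in P. (\<lambda>N. h w * \<kappa> N (Y w)) \<longlonglongrightarrow> h w * ((Y w)^2 - c)"
    proof (intro AE_I2 tendsto_mult tendsto_const)
      fix w
      obtain n0 :: nat where n0: "\<bar>Y w\<bar> \<le> real n0" using real_arch_simple by blast
      show "(\<lambda>N. \<kappa> N (Y w)) \<longlonglongrightarrow> (Y w)^2 - c"
      proof (rule tendsto_eventually, rule eventually_sequentiallyI[of n0])
        fix N assume "n0 \<le> N"
        then have "\<bar>Y w\<bar> \<le> real N" using n0 by (meson of_nat_mono order_trans)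
        then show "\<kappa> N (Y w) = (Y w)^2 - c" unfolding \<kappa>_def by (simp add: min_absorb1)
      qed
    qed
    show "AE w in P. norm (h w * \<kappa> N (Y w)) \<le> (Y w)^2 + c" for N
    proof (rule AE_I2)
      fix w
      have "(min \<bar>Y w\<bar> (real N))^2 \<le> \<bar>Y w\<bar>^2" by (intro power_mono) auto
      then have "\<bar>\<kappa> N (Y w)\<bar> \<le> (Y w)^2 + c" unfolding \<kappa>_def using c bd(1)[of "Y w" N] by (auto simp: abs_le_iff)
      then show "norm (h w * \<kappa> N (Y w)) \<le> (Y w)^2 + c"
        using cylinder_bounds[OF h, of w] mult_mono[of "h w" 1 "\<bar>\<kappa> N (Y w)\<bar>" "(Y w)^2 + c"] by (simp add: abs_mult)
    qed
    show "(\<lambda>w. h w * \<kappa> N (Y w)) \<in> borel_measurable P" for N unfolding \<kappa>_def by measurable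
  qed (use Y in auto)
  have "(\<integral>w. h w * ((Y w)^2 - c) \<partial>P) \<le> 0"
    by (rule LIMSEQ_le_const2[OF lim]) (use le in auto)
  then show ?thesis unfolding Y_def c_def .
qed

text \<open>The martingale property under \<open>P\<close>: from cylinder functions to indicators by
  approximation in \<open>L^1\<close>, from indicators to \<open>h\<close> by conditional
  expectation.\<close>

lemma integral_mult_increment:
  assumes su: "0 \<le> s" "s \<le> u" and h: "h \<in> borel_measurable (path_filtration s)"
    and int: "integrable P (\<lambda>w. h w * (B u w - B s w))"
  shows "(\<integral>w. h w * (B u w - B s w) \<partial>P) = 0"
proof (cases "s = u")
  case False
  then have su': "s < u" using su by simp
  interpret F: sigma_finite_subalgebra P "path_filtration s" using sigma_finite_path_filtration[OF su(1)] .
  show ?thesis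
  proof (rule F.integral_mult_eq_0[OF increment_integrable[OF su] _ h int])
    fix A assume A: "A \<in> sets (path_filtration s)"
    have le: "(\<integral>w. indicator A w * (sg * (B u w - B s w)) \<partial>P) \<le> 0" if "\<bar>sg\<bar> = 1" for sg
      by (rule integral_indicator_nonpos[OF P_prob su(1) A])
        (use increment_integrable[OF su] cylinder_increment_le[OF su(1) su' _ that] in auto)
    show "(\<integral>w. indicator A w * (B u w - B s w) \<partial>P) = 0"
    proof -
      have "indicator A w * (-1 * (B u w - B s w)) = - (indicator A w * (B u w - B s w))" for w by (simp add: algebra_simps)
      then show ?thesis using le[of 1] le[of "-1"] by (simp only: integral_minus mult_1) simp
    qed
  qed
qed simp

lemma integral_mult_increment_square:
  assumes su: "0 \<le> s" "s \<le> u" and h: "h \<in> borel_measurable (path_filtration s)" "\<And>w. 0 \<le> h w"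
    and int: "integrable P (\<lambda>w. h w * ((B u w - B s w)^2 - C * (u - s)))"
  shows "(\<integral>w. h w * ((B u w - B s w)^2 - C * (u - s)) \<partial>P) \<le> 0"
proof (cases "s = u")
  case False
  then have su': "s < u" using su by simp
  interpret F: sigma_finite_subalgebra P "path_filtration s" using sigma_finite_path_filtration[OF su(1)] .
  have Z: "integrable P (\<lambda>w. (B u w - B s w)^2 - C * (u - s))"
    using increment_moments(1)[OF su] by simp
  show ?thesis
    by (rule F.integral_mult_nonpos[OF Z _ h int])
      (rule integral_indicator_nonpos[OF P_prob su(1) _ Z], assumption, rule cylinder_increment_square_le[OF su(1) su'])
qed simp

end

section \<open>Convergence in \<open>L^2\<close>\<close>

lemma ennreal_tendsto_0_of_square:
  fixes a :: "nat \<Rightarrow> ennreal"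
  assumes "(\<lambda>n. (a n)^2) \<longlonglongrightarrow> 0"
  shows "a \<longlonglongrightarrow> 0"
proof (rule order_tendstoI)
  fix e :: ennreal assume e: "0 < e"
  have "0 < e^2" using e by (simp add: power2_eq_square ennreal_zero_less_mult_iff)
  then have "\<forall>\<^sub>F n in sequentially. (a n)^2 < e^2" using order_tendstoD(2)[OF assms] by blast
  then show "\<forall>\<^sub>F n in sequentially. a n < e"
  proof eventually_elim
    case (elim n)
    then show ?case using power_mono[of e "a n" 2] by (meson leD leI zero_le)
  qed
qed simp

lemma nn_integral_square_sum_le:
  fixes X Y :: "'a \<Rightarrow> real"
  assumes [measurable]: "X \<in> borel_measurable M" "Y \<in> borel_measurable M"
  shows "(\<integral>\<^sup>+w. ennreal ((X w + Y w)^2) \<partial>M) \<le> 2 * (\<integral>\<^sup>+w. ennreal ((X w)^2) \<partial>M) + 2 * (\<integral>\<^sup>+w. ennreal ((Y w)^2) \<partial>M)"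
proof -
  have "(\<integral>\<^sup>+w. ennreal ((X w + Y w)^2) \<partial>M) \<le> (\<integral>\<^sup>+w. 2 * ennreal ((X w)^2) + 2 * ennreal ((Y w)^2) \<partial>M)"
  proof (rule nn_integral_mono)
    fix w
    have "(X w + Y w)^2 \<le> 2 * (X w)^2 + 2 * (Y w)^2"
      using zero_le_power2[of "X w - Y w"] by (simp add: power2_sum power2_diff)
    then have "ennreal ((X w + Y w)^2) \<le> ennreal (2 * (X w)^2 + 2 * (Y w)^2)" by (rule ennreal_leI)
    also have "\<dots> = 2 * ennreal ((X w)^2) + 2 * ennreal ((Y w)^2)"
      by (simp add: ennreal_plus ennreal_mult)
    finally show "ennreal ((X w + Y w)^2) \<le> 2 * ennreal ((X w)^2) + 2 * ennreal ((Y w)^2)" .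
  qed
  also have "\<dots> = 2 * (\<integral>\<^sup>+w. ennreal ((X w)^2) \<partial>M) + 2 * (\<integral>\<^sup>+w. ennreal ((Y w)^2) \<partial>M)"
    by (simp add: nn_integral_add nn_integral_cmult)
  finally show ?thesis .
qed

text \<open>Nonnegative integrals match the norms of the underlying definitions, which are infinite
  for functions that are not square integrable; integrability of the limit becomes a
  consequence.\<close>

definition L2_tendsto :: "'a measure \<Rightarrow> (nat \<Rightarrow> 'a \<Rightarrow> real) \<Rightarrow> ('a \<Rightarrow> real) \<Rightarrow> bool" where
  "L2_tendsto M X Y \<longleftrightarrow> (\<lambda>n. \<integral>\<^sup>+w. ennreal ((X n w - Y w)^2) \<partial>M) \<longlonglongrightarrow> 0"

lemma L2_tendsto_square_integrable:
  assumes lim: "L2_tendsto M X Y"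
    and X: "\<And>n. X n \<in> borel_measurable M" "\<And>n. integrable M (\<lambda>w. (X n w)^2)" and [measurable]: "Y \<in> borel_measurable M"
  shows "integrable M (\<lambda>w. (Y w)^2)"
proof -
  note [measurable] = X(1)
  obtain n where n: "(\<integral>\<^sup>+w. ennreal ((X n w - Y w)^2) \<partial>M) < 1"
    using order_tendstoD(2)[OF lim[unfolded L2_tendsto_def], of 1] by (auto simp: eventually_sequentially)
  have "(\<integral>\<^sup>+w. ennreal ((Y w)^2) \<partial>M) = (\<integral>\<^sup>+w. ennreal (((Y w - X n w) + X n w)^2) \<partial>M)" by simp
  also have "\<dots> \<le> 2 * (\<integral>\<^sup>+w. ennreal ((Y w - X n w)^2) \<partial>M) + 2 * (\<integral>\<^sup>+w. ennreal ((X n w)^2) \<partial>M)"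
    by (rule nn_integral_square_sum_le) auto
  also have "\<dots> < \<infinity>"
  proof -
    have "(\<integral>\<^sup>+w. ennreal ((Y w - X n w)^2) \<partial>M) < \<infinity>"
      using order.strict_trans[OF n, of \<infinity>] by (simp add: power2_commute)
    moreover have "(\<integral>\<^sup>+w. ennreal ((X n w)^2) \<partial>M) < \<infinity>"
      using X(2)[of n] by (simp add: nn_integral_eq_integral)
    ultimately show ?thesis by (simp add: ennreal_mult_less_top)
  qed
  finally show ?thesis by (intro integrableI_nonneg) auto
qed

lemma L2_tendsto_diff:
  assumes 1: "L2_tendsto M X X'" and 2: "L2_tendsto M Y Y'"
    and [measurable]: "\<And>n. X n \<in> borel_measurable M" "\<And>n. Y n \<in> borel_measurable M" "X' \<in> borel_measurable M" "Y' \<in> borel_measurable M"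
  shows "L2_tendsto M (\<lambda>n w. X n w - Y n w) (\<lambda>w. X' w - Y' w)"
  unfolding L2_tendsto_def
proof (rule tendsto_sandwich[OF _ _ tendsto_const])
  show "\<forall>\<^sub>F n in sequentially. (\<integral>\<^sup>+w. ennreal ((X n w - Y n w - (X' w - Y' w))^2) \<partial>M) \<le>
      2 * (\<integral>\<^sup>+w. ennreal ((X n w - X' w)^2) \<partial>M) + 2 * (\<integral>\<^sup>+w. ennreal ((Y n w - Y' w)^2) \<partial>M)"
  proof (intro always_eventually allI)
    fix n
    have "(\<integral>\<^sup>+w. ennreal ((X n w - Y n w - (X' w - Y' w))^2) \<partial>M) = (\<integral>\<^sup>+w. ennreal (((X n w - X' w) + (Y' w - Y n w))^2) \<partial>M)"
      by (simp add: algebra_simps)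
    also have "\<dots> \<le> 2 * (\<integral>\<^sup>+w. ennreal ((X n w - X' w)^2) \<partial>M) + 2 * (\<integral>\<^sup>+w. ennreal ((Y' w - Y n w)^2) \<partial>M)"
      by (rule nn_integral_square_sum_le) auto
    finally show "(\<integral>\<^sup>+w. ennreal ((X n w - Y n w - (X' w - Y' w))^2) \<partial>M) \<le>
      2 * (\<integral>\<^sup>+w. ennreal ((X n w - X' w)^2) \<partial>M) + 2 * (\<integral>\<^sup>+w. ennreal ((Y n w - Y' w)^2) \<partial>M)"
      by (simp add: power2_commute)
  qed
  have "(\<lambda>n. 2 * (\<integral>\<^sup>+w. ennreal ((X n w - X' w)^2) \<partial>M) + 2 * (\<integral>\<^sup>+w. ennreal ((Y n w - Y' w)^2) \<partial>M)) \<longlonglongrightarrow> 2 * 0 + 2 * 0"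
    using 1 2 unfolding L2_tendsto_def by (intro tendsto_add ennreal_tendsto_cmult) auto
  then show "(\<lambda>n. 2 * (\<integral>\<^sup>+w. ennreal ((X n w - X' w)^2) \<partial>M) + 2 * (\<integral>\<^sup>+w. ennreal ((Y n w - Y' w)^2) \<partial>M)) \<longlonglongrightarrow> 0" by simp
qed simp

lemma (in prob_space) nn_integral_abs_square_le:
  assumes [measurable]: "X \<in> borel_measurable M"
  shows "(\<integral>\<^sup>+w. ennreal \<bar>X w\<bar> \<partial>M)^2 \<le> (\<integral>\<^sup>+w. ennreal ((X w)^2) \<partial>M)"
proof -
  have "(\<integral>\<^sup>+w. ennreal \<bar>X w\<bar> * 1 \<partial>M)^2 \<le> (\<integral>\<^sup>+w. (ennreal \<bar>X w\<bar>)^2 \<partial>M) * (\<integral>\<^sup>+w. 1^2 \<partial>M)"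
    by (rule Cauchy_Schwarz_nn_integral) auto
  then show ?thesis by (simp add: emeasure_space_1 ennreal_power)
qed

lemma (in prob_space) L2_tendsto_L1:
  assumes lim: "L2_tendsto M X Y" and [measurable]: "\<And>n. X n \<in> borel_measurable M" "Y \<in> borel_measurable M"
  shows "(\<lambda>n. \<integral>\<^sup>+w. ennreal \<bar>X n w - Y w\<bar> \<partial>M) \<longlonglongrightarrow> 0"
proof (rule ennreal_tendsto_0_of_square, rule tendsto_sandwich[OF _ _ tendsto_const lim[unfolded L2_tendsto_def]])
  show "\<forall>\<^sub>F n in sequentially. (\<integral>\<^sup>+w. ennreal \<bar>X n w - Y w\<bar> \<partial>M)^2 \<le> (\<integral>\<^sup>+w. ennreal ((X n w - Y w)^2) \<partial>M)"
    by (intro always_eventually allI nn_integral_abs_square_le) auto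
qed simp

lemma (in prob_space) L2_tendsto_integral_mult:
  assumes lim: "L2_tendsto M X Y" and X: "\<And>n. X n \<in> borel_measurable M" "\<And>n. integrable M (\<lambda>w. (X n w)^2)"
    and Y [measurable]: "Y \<in> borel_measurable M"
    and \<xi> [measurable]: "\<xi> \<in> borel_measurable M" and c: "\<And>w. \<bar>\<xi> w\<bar> \<le> c"
  shows "(\<lambda>n. \<integral>w. \<xi> w * X n w \<partial>M) \<longlonglongrightarrow> (\<integral>w. \<xi> w * Y w \<partial>M)"
proof -
  note [measurable] = X(1)
  have c0: "0 \<le> c" by (rule order_trans[OF abs_ge_zero c])
  have iX: "integrable M (X n)" for n by (rule square_integrable_imp_integrable[OF X])
  have iY: "integrable M Y"
    by (rule square_integrable_imp_integrable[OF Y L2_tendsto_square_integrable[OF lim X Y]])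
  have bm: "integrable M (\<lambda>w. \<xi> w * Z w)" if "integrable M Z" for Z
  proof (rule Bochner_Integration.integrable_bound[OF integrable_mult_right[OF that, of c]])
    have "\<bar>\<xi> w\<bar> * \<bar>Z w\<bar> \<le> c * \<bar>Z w\<bar>" for w using c by (intro mult_right_mono) auto
    then show "AE w in M. norm (\<xi> w * Z w) \<le> norm (c * Z w)" using c0 by (simp add: abs_mult)
  qed (use that in auto)
  show ?thesis
  proof (rule tendsto_L1_int)
    show "(\<lambda>n. \<integral>\<^sup>+w. norm (\<xi> w * X n w - \<xi> w * Y w) \<partial>M) \<longlonglongrightarrow> 0"
    proof (rule tendsto_sandwich[OF _ _ tendsto_const])
      have "(\<lambda>n. ennreal c * (\<integral>\<^sup>+w. ennreal \<bar>X n w - Y w\<bar> \<partial>M)) \<longlonglongrightarrow> ennreal c * 0"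
        by (intro ennreal_tendsto_cmult L2_tendsto_L1 lim) auto
      then show "(\<lambda>n. ennreal c * (\<integral>\<^sup>+w. ennreal \<bar>X n w - Y w\<bar> \<partial>M)) \<longlonglongrightarrow> 0" by simp
      show "\<forall>\<^sub>F n in sequentially. (\<integral>\<^sup>+w. norm (\<xi> w * X n w - \<xi> w * Y w) \<partial>M) \<le> ennreal c * (\<integral>\<^sup>+w. ennreal \<bar>X n w - Y w\<bar> \<partial>M)"
      proof (intro always_eventually allI)
        fix n
        have "(\<integral>\<^sup>+w. norm (\<xi> w * X n w - \<xi> w * Y w) \<partial>M) \<le> (\<integral>\<^sup>+w. ennreal c * ennreal \<bar>X n w - Y w\<bar> \<partial>M)"
        proof (rule nn_integral_mono)
          fix w
          have "norm (\<xi> w * X n w - \<xi> w * Y w) = \<bar>\<xi> w\<bar> * \<bar>X n w - Y w\<bar>"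
            by (simp add: abs_mult flip: right_diff_distrib)
          also have "\<dots> \<le> c * \<bar>X n w - Y w\<bar>" using c by (intro mult_right_mono) auto
          finally show "ennreal (norm (\<xi> w * X n w - \<xi> w * Y w)) \<le> ennreal c * ennreal \<bar>X n w - Y w\<bar>"
            using c0 by (simp add: ennreal_leI flip: ennreal_mult)
        qed
        also have "\<dots> = ennreal c * (\<integral>\<^sup>+w. ennreal \<bar>X n w - Y w\<bar> \<partial>M)" by (rule nn_integral_cmult) auto
        finally show "(\<integral>\<^sup>+w. norm (\<xi> w * X n w - \<xi> w * Y w) \<partial>M) \<le> ennreal c * (\<integral>\<^sup>+w. ennreal \<bar>X n w - Y w\<bar> \<partial>M)" .
      qed
    qed simp
  qed (use bm iX iY in auto)
qed

lemma abs_powr_2 [simp]: "\<bar>x::real\<bar> powr 2 = x^2"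
  by (cases "x = 0") (auto simp: powr_numeral)

section \<open>Quadratic variation\<close>

definition grid :: "real \<Rightarrow> real \<Rightarrow> nat \<Rightarrow> nat \<Rightarrow> real" where
  "grid u v n i = u + real i * ((v - u) / real n)"

definition pvar :: "real \<Rightarrow> real \<Rightarrow> nat \<Rightarrow> path \<Rightarrow> real" where
  "pvar u v n w = (\<Sum>i<n. (B (grid u v n (Suc i)) w - B (grid u v n i) w)^2)"

lemma grid_0 [simp]: "grid u v n 0 = u" and grid_n: "n > 0 \<Longrightarrow> grid u v n n = v"
  unfolding grid_def by auto

lemma grid_Suc: "grid u v n (Suc i) = grid u v n i + (v - u) / real n"
  unfolding grid_def by (simp add: algebra_simps add_divide_distrib diff_divide_distrib)

lemma grid_mono: "u \<le> v \<Longrightarrow> i \<le> j \<Longrightarrow> grid u v n i \<le> grid u v n j"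
  unfolding grid_def by (intro add_left_mono mult_right_mono) auto

lemma grid_ge: "u \<le> v \<Longrightarrow> u \<le> grid u v n i"
  unfolding grid_def by simp

lemma grid_le: "u \<le> v \<Longrightarrow> i \<le> n \<Longrightarrow> grid u v n i \<le> v"
  using grid_mono[of u v i n n] grid_n[of n u v] by (cases "n = 0") auto

lemma measurable_pvar [measurable]: "pvar u v n \<in> borel_measurable borel"
  unfolding pvar_def by measurable

locale G_path_qv = G_path +
  fixes Q :: "real \<Rightarrow> path \<Rightarrow> real"
  assumes qv: "quadratic_variation \<P> Q"
begin

lemma measurable_Q: "0 \<le> t \<Longrightarrow> Q t \<in> borel_measurable borel"
  using qv unfolding quadratic_variation_def by blast

lemma nn_integral_le_Lp_norm_pow: "(\<integral>\<^sup>+w. ennreal ((X w)^2) \<partial>P) \<le> Lp_norm_pow \<P> 2 X"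
  unfolding Lp_norm_pow_def upper_nn_exp_def by (rule SUP_upper2[OF P_in]) simp

lemma AE_of_quasi_surely: "quasi_surely \<P> R \<Longrightarrow> AE w in P. R w"
proof -
  assume "quasi_surely \<P> R"
  then obtain A where A: "A \<in> sets borel" "capacity \<P> A = 0" "\<And>w. w \<notin> A \<Longrightarrow> R w"
    unfolding quasi_surely_def by blast
  have "emeasure P A \<le> capacity \<P> A" unfolding capacity_def by (rule SUP_upper[OF P_in])
  then have "A \<in> null_sets P" using A by (intro null_setsI) auto
  then show ?thesis by (rule AE_I') (use A(3) in auto)
qed

lemma qv_partition:
  assumes "0 \<le> t" "e > 0"
  obtains d where "d > 0" "\<And>n \<tau>. \<tau> 0 = 0 \<Longrightarrow> \<tau> n = t \<Longrightarrow> (\<And>i. i < n \<Longrightarrow> \<tau> i \<le> \<tau> (Suc i) \<and> \<tau> (Suc i) - \<tau> i < d) \<Longrightarrow>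
    (\<integral>\<^sup>+w. ennreal (((\<Sum>i<n. (B (\<tau> (Suc i)) w - B (\<tau> i) w)^2) - Q t w)^2) \<partial>P) < e"
proof -
  obtain d where d: "d > 0" "\<forall>n \<tau>. \<tau> 0 = 0 \<and> \<tau> n = t \<and> (\<forall>i<n. \<tau> i \<le> \<tau> (Suc i) \<and> \<tau> (Suc i) - \<tau> i < d) \<longrightarrow>
           Lp_norm_pow \<P> 2 (\<lambda>w. (\<Sum>i<n. (B (\<tau> (Suc i)) w - B (\<tau> i) w)\<^sup>2) - Q t w) < e"
    using qv assms unfolding quadratic_variation_def by blast
  show ?thesis
  proof (rule that[OF d(1)])
    fix n :: nat and \<tau> :: "nat \<Rightarrow> real"
    assume "\<tau> 0 = 0" "\<tau> n = t" "\<And>i. i < n \<Longrightarrow> \<tau> i \<le> \<tau> (Suc i) \<and> \<tau> (Suc i) - \<tau> i < d"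
    then have "Lp_norm_pow \<P> 2 (\<lambda>w. (\<Sum>i<n. (B (\<tau> (Suc i)) w - B (\<tau> i) w)\<^sup>2) - Q t w) < e"
      using d(2) by blast
    then show "(\<integral>\<^sup>+w. ennreal (((\<Sum>i<n. (B (\<tau> (Suc i)) w - B (\<tau> i) w)^2) - Q t w)^2) \<partial>P) < e"
      using nn_integral_le_Lp_norm_pow by (rule le_less_trans[rotated])
  qed
qed

lemma pvar_square_integrable:
  assumes "0 \<le> u" "u \<le> v"
  shows "integrable P (\<lambda>w. (pvar u v n w)^2)"
  unfolding pvar_def
proof (rule integrable_sum_L2)
  fix i assume "i \<in> {..<n}"
  have "integrable P (\<lambda>w. (B (grid u v n (Suc i)) w - B (grid u v n i) w)^4)"
    using assms grid_ge[OF assms(2), of n i] by (intro increment_moments grid_mono) auto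
  then show "integrable P (\<lambda>w. ((B (grid u v n (Suc i)) w - B (grid u v n i) w)\<^sup>2)\<^sup>2)" by simp
qed auto

lemma eventually_mesh: "0 \<le> c \<Longrightarrow> 0 < d \<Longrightarrow> \<forall>\<^sub>F n in sequentially. c / real n < d \<and> n > 0"
proof -
  assume "0 \<le> c" "0 < d"
  have "(\<lambda>n. c / real n) \<longlonglongrightarrow> 0" by (rule lim_const_over_n)
  then have "\<forall>\<^sub>F n in sequentially. c / real n < d" using \<open>0 < d\<close> by (rule order_tendstoD(2))
  then show ?thesis using eventually_gt_at_top[of 0] by (rule eventually_conj)
qed

lemma pvar_0_tendsto:
  assumes t: "0 \<le> t"
  shows "L2_tendsto P (pvar 0 t) (Q t)"
  unfolding L2_tendsto_def
proof (rule order_tendstoI)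
  fix e :: ennreal assume e: "0 < e"
  obtain d where d: "d > 0" "\<And>n \<tau>. \<tau> 0 = 0 \<Longrightarrow> \<tau> n = t \<Longrightarrow> (\<And>i. i < n \<Longrightarrow> \<tau> i \<le> \<tau> (Suc i) \<and> \<tau> (Suc i) - \<tau> i < d) \<Longrightarrow>
    (\<integral>\<^sup>+w. ennreal (((\<Sum>i<n. (B (\<tau> (Suc i)) w - B (\<tau> i) w)^2) - Q t w)^2) \<partial>P) < e"
    by (rule qv_partition[OF t e]) blast
  show "\<forall>\<^sub>F n in sequentially. (\<integral>\<^sup>+w. ennreal ((pvar 0 t n w - Q t w)^2) \<partial>P) < e"
    using eventually_mesh[OF t d(1)]
  proof eventually_elim
    case (elim n)
    show ?case
      unfolding pvar_def by (rule d(2)) (use elim t in \<open>auto simp: grid_n grid_Suc\<close>)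
  qed
qed simp

text \<open>The quadratic variation is defined through partitions that start at 0. Gluing partitions
  of \<open>[0, u]\<close> and \<open>[u, v]\<close> and subtracting the first part gives access to
  increments of \<open>Q\<close>.\<close>

lemma pvar_concat_tendsto:
  assumes u: "0 \<le> u" "u \<le> v"
  shows "L2_tendsto P (\<lambda>n w. pvar 0 u n w + pvar u v n w) (Q v)"
  unfolding L2_tendsto_def
proof (rule order_tendstoI)
  fix e :: ennreal assume e: "0 < e"
  have v: "0 \<le> v" using u by simp
  obtain d where d: "d > 0" "\<And>n \<tau>. \<tau> 0 = 0 \<Longrightarrow> \<tau> n = v \<Longrightarrow> (\<And>i. i < n \<Longrightarrow> \<tau> i \<le> \<tau> (Suc i) \<and> \<tau> (Suc i) - \<tau> i < d) \<Longrightarrow>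
    (\<integral>\<^sup>+w. ennreal (((\<Sum>i<n. (B (\<tau> (Suc i)) w - B (\<tau> i) w)^2) - Q v w)^2) \<partial>P) < e"
    by (rule qv_partition[OF v e]) blast
  have vu: "0 \<le> v - u" using u by simp
  show "\<forall>\<^sub>F n in sequentially. (\<integral>\<^sup>+w. ennreal ((pvar 0 u n w + pvar u v n w - Q v w)^2) \<partial>P) < e"
    using eventually_mesh[OF u(1) d(1)] eventually_mesh[OF vu d(1)]
  proof eventually_elim
    case (elim n)
    define \<tau> where "\<tau> i = (if i \<le> n then grid 0 u n i else grid u v n (i - n))" for i
    have 1: "\<tau> (Suc i) = grid 0 u n (Suc i)" "\<tau> i = grid 0 u n i" if "i < n" for i
      using that unfolding \<tau>_def by auto
    have 2: "\<tau> (n + i) = grid u v n i" for i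
      using elim unfolding \<tau>_def by (cases "i = 0") (auto simp: grid_n)
    then have 2: "\<tau> (n + i) = grid u v n i" "\<tau> (Suc (n + i)) = grid u v n (Suc i)" for i
      using 2[of "Suc i"] by auto
    have "(\<Sum>i<n + n. (B (\<tau> (Suc i)) w - B (\<tau> i) w)^2) = pvar 0 u n w + pvar u v n w" for w
    proof -
      have "{..<n + n} = {..<n} \<union> {n..<n + n}" by auto
      then have "(\<Sum>i<n + n. (B (\<tau> (Suc i)) w - B (\<tau> i) w)^2) =
        (\<Sum>i<n. (B (\<tau> (Suc i)) w - B (\<tau> i) w)^2) + (\<Sum>i=n..<n+n. (B (\<tau> (Suc i)) w - B (\<tau> i) w)^2)"
        by (simp add: sum.union_disjoint ivl_disj_int)
      also have "(\<Sum>i<n. (B (\<tau> (Suc i)) w - B (\<tau> i) w)^2) = pvar 0 u n w"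
        unfolding pvar_def by (intro sum.cong) (auto simp: 1)
      also have "(\<Sum>i=n..<n+n. (B (\<tau> (Suc i)) w - B (\<tau> i) w)^2) = (\<Sum>i=0..<n. (B (\<tau> (Suc (n + i))) w - B (\<tau> (n + i)) w)^2)"
        using sum.shift_bounds_nat_ivl[of "\<lambda>i. (B (\<tau> (Suc i)) w - B (\<tau> i) w)^2" 0 n n] by (simp add: add.commute)
      also have "\<dots> = pvar u v n w" unfolding pvar_def 2 by (simp add: atLeast0LessThan)
      finally show ?thesis .
    qed
    moreover have "(\<integral>\<^sup>+w. ennreal (((\<Sum>i<n+n. (B (\<tau> (Suc i)) w - B (\<tau> i) w)^2) - Q v w)^2) \<partial>P) < e"
    proof (rule d(2))
      show "\<tau> 0 = 0" unfolding \<tau>_def by simp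
      show "\<tau> (n + n) = v" using elim by (simp add: 2 grid_n)
      fix i assume "i < n + n"
      then consider "i < n" | j where "i = n + j" "j < n" by (metis add_less_cancel_left le_Suc_ex not_less)
      then show "\<tau> i \<le> \<tau> (Suc i) \<and> \<tau> (Suc i) - \<tau> i < d"
      proof cases
        case 1
        then show ?thesis using \<open>i < n \<Longrightarrow> \<tau> (Suc i) = grid 0 u n (Suc i)\<close> \<open>i < n \<Longrightarrow> \<tau> i = grid 0 u n i\<close> elim u
          by (simp add: grid_Suc)
      next
        case 2
        then show ?thesis using \<open>\<And>i. \<tau> (n + i) = grid u v n i\<close> \<open>\<And>i. \<tau> (Suc (n + i)) = grid u v n (Suc i)\<close> elim vu
          by (simp add: grid_Suc)
      qed
    qed
    ultimately show ?case by simp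
  qed
qed simp

lemma pvar_tendsto:
  assumes u: "0 \<le> u" "u \<le> v"
  shows "L2_tendsto P (pvar u v) (\<lambda>w. Q v w - Q u w)"
proof -
  have [measurable]: "Q v \<in> borel_measurable borel" "Q u \<in> borel_measurable borel" using u by (auto intro: measurable_Q)
  have "L2_tendsto P (\<lambda>n w. pvar 0 u n w + pvar u v n w - pvar 0 u n w) (\<lambda>w. Q v w - Q u w)"
    by (intro L2_tendsto_diff pvar_concat_tendsto pvar_0_tendsto u) auto
  then show ?thesis by simp
qed

lemma Q_increment_square_integrable:
  assumes u: "0 \<le> u" "u \<le> v"
  shows "integrable P (\<lambda>w. (Q v w - Q u w)^2)"
proof (rule L2_tendsto_square_integrable[OF pvar_tendsto[OF u]])
  have [measurable]: "Q v \<in> borel_measurable borel" "Q u \<in> borel_measurable borel" using u by (auto intro: measurable_Q)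
  show "(\<lambda>w. Q v w - Q u w) \<in> borel_measurable P" by measurable
qed (use pvar_square_integrable[OF u] in auto)

text \<open>The square of a telescoping sum is the sum of squares plus cross terms, each of which
  pairs an increment with its past and has mean zero. The left side does not depend on
  \<open>n\<close>, so \<open>pvar\<close> can later be replaced by its limit.\<close>

lemma pvar_martingale:
  assumes u: "0 \<le> u" "u \<le> v" and n: "n > 0"
    and \<xi>: "\<xi> \<in> borel_measurable (path_filtration u)" and c: "\<And>w. \<bar>\<xi> w\<bar> \<le> c"
  shows "(\<integral>w. \<xi> w * (B v w - B u w)^2 \<partial>P) = (\<integral>w. \<xi> w * pvar u v n w \<partial>P)"
proof -
  define b where "b i w = B (grid u v n i) w - B u w" for i w
  have [measurable]: "\<xi> \<in> borel_measurable borel" using measurable_path_filtration_borel[OF \<xi> u(1)] .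
  have [measurable]: "b i \<in> borel_measurable borel" for i unfolding b_def by measurable
  have g0: "0 \<le> grid u v n i" "u \<le> grid u v n i" "grid u v n i \<le> grid u v n (Suc i)" for i
    using grid_ge[OF u(2), of n i] u by (auto intro: grid_mono)
  have b2: "integrable P (\<lambda>w. (b i w)^2)" for i
    unfolding b_def using u g0[of i] by (intro increment_moments) auto
  have D2: "integrable P (\<lambda>w. (B (grid u v n (Suc i)) w - B (grid u v n i) w)^2)" for i
    using g0 by (intro increment_moments) auto
  have zero: "(\<integral>w. (\<xi> w * b i w) * (B (grid u v n (Suc i)) w - B (grid u v n i) w) \<partial>P) = 0" for i
  proof (rule integral_mult_increment[OF g0(1,3)])
    show "(\<lambda>w. \<xi> w * b i w) \<in> borel_measurable (path_filtration (grid u v n i))"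
      unfolding b_def
      by (intro borel_measurable_times borel_measurable_diff measurable_B_path_filtration
          measurable_path_filtration_mono[OF \<xi>] g0 u order_refl)
    show "integrable P (\<lambda>w. \<xi> w * b i w * (B (grid u v n (Suc i)) w - B (grid u v n i) w))"
      by (intro integrable_mult_L2 integrable_bounded_mult_L2[OF _ _ c] b2 D2) auto
  qed
  have int: "integrable P (\<lambda>w. \<xi> w * b i w * (B (grid u v n (Suc i)) w - B (grid u v n i) w))" for i
    by (intro integrable_mult_L2 integrable_bounded_mult_L2[OF _ _ c] b2 D2) auto
  have tele: "(b k w)^2 = (\<Sum>i<k. (B (grid u v n (Suc i)) w - B (grid u v n i) w)^2) +
      (\<Sum>i<k. 2 * (b i w * (B (grid u v n (Suc i)) w - B (grid u v n i) w)))" for k w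
    by (induction k) (simp_all add: b_def power2_eq_square algebra_simps)
  have eq: "\<xi> w * (B v w - B u w)^2 = \<xi> w * pvar u v n w + (\<Sum>i<n. 2 * (\<xi> w * b i w * (B (grid u v n (Suc i)) w - B (grid u v n i) w)))" for w
    using tele[of n w] n unfolding b_def pvar_def by (simp add: grid_n distrib_left sum_distrib_left mult.left_commute mult.assoc)
  have "integrable P (\<lambda>w. \<xi> w * pvar u v n w)"
  proof (rule integrable_mult_L2)
    show "integrable P (\<lambda>w. (\<xi> w)^2)"
    proof (rule integrable_const_bound[of _ "c^2"])
      have "\<bar>\<xi> w\<bar>^2 \<le> c^2" for w using c by (intro power_mono) auto
      then show "AE w in P. norm ((\<xi> w)^2) \<le> c^2" by simp
    qed measurable
  qed (use pvar_square_integrable[OF u] in auto)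
  then show ?thesis
    unfolding eq using int zero by (simp add: Bochner_Integration.integral_sum)
qed

lemma integral_mult_increment_square_eq:
  assumes u: "0 \<le> u" "u \<le> v" and \<xi>: "\<xi> \<in> borel_measurable (path_filtration u)" and c: "\<And>w. \<bar>\<xi> w\<bar> \<le> c"
  shows "(\<integral>w. \<xi> w * (B v w - B u w)^2 \<partial>P) = (\<integral>w. \<xi> w * (Q v w - Q u w) \<partial>P)"
proof -
  have [measurable]: "\<xi> \<in> borel_measurable borel" using measurable_path_filtration_borel[OF \<xi> u(1)] .
  have [measurable]: "Q v \<in> borel_measurable borel" "Q u \<in> borel_measurable borel" using u by (auto intro: measurable_Q)
  have "(\<lambda>n. \<integral>w. \<xi> w * pvar u v n w \<partial>P) \<longlonglongrightarrow> (\<integral>w. \<xi> w * (Q v w - Q u w) \<partial>P)"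
    by (rule L2_tendsto_integral_mult[OF pvar_tendsto[OF u] _ pvar_square_integrable[OF u] _ _ c]) auto
  moreover have "(\<lambda>n. \<integral>w. \<xi> w * pvar u v n w \<partial>P) \<longlonglongrightarrow> (\<integral>w. \<xi> w * (B v w - B u w)^2 \<partial>P)"
    by (rule tendsto_eventually, rule eventually_sequentiallyI[of 1]) (use pvar_martingale[OF u _ \<xi> c] in \<open>simp add: Suc_le_eq\<close>)
  ultimately show ?thesis by (rule LIMSEQ_unique[symmetric])
qed

end

section \<open>Lipschitz bound for the paths of the quadratic variation\<close>

lemma pos_part_square_le: "(max 0 (x + d))^2 \<le> (max 0 x)^2 + 2 * max 0 x * d + (d::real)^2"
proof (cases "0 \<le> x")
  case True
  have "(max 0 (x + d))^2 \<le> (x + d)^2"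
    by (simp add: max_def)
  also have "\<dots> = (max 0 x)^2 + 2 * max 0 x * d + d^2" using True by (simp add: power2_sum max_def)
  finally show ?thesis .
next
  case False
  then have "\<bar>max 0 (x + d)\<bar> \<le> \<bar>d\<bar>" by (auto simp: max_def)
  then have "\<bar>max 0 (x + d)\<bar>^2 \<le> \<bar>d\<bar>^2" by (intro power_mono) auto
  then show ?thesis using False by (simp add: max_def split: if_splits)
qed

context G_path_qv
begin

lemma prob_UNIV [simp]: "prob UNIV = 1"
  using prob_space by simp

text \<open>The sums \<open>S k\<close> of the centred squares behave like a supermartingale:
  weighted with the nonnegative \<open>max 0 (S k w)\<close>, the next term has mean at most 0. So
  the second moment of the positive part grows per step by at most that of one term, of order
  \<open>\<delta>^2\<close>; over \<open>n\<close> steps of length \<open>(v - u) / n\<close> this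
  adds up to order \<open>1 / n\<close>.\<close>

lemma pos_part_pvar_le:
  assumes u: "0 \<le> u" "u \<le> v" and n: "n > 0"
  shows "(\<integral>\<^sup>+w. ennreal ((max 0 (pvar u v n w - C * (v - u)))^2) \<partial>P) \<le> ennreal (10 * C^2 * (v - u)^2 / real n)"
proof -
  define \<delta> where "\<delta> = (v - u) / real n"
  have \<delta>: "0 \<le> \<delta>" unfolding \<delta>_def using u by simp
  define D where "D i w = (B (grid u v n (Suc i)) w - B (grid u v n i) w)^2 - C * \<delta>" for i w
  define S where "S k w = (\<Sum>i<k. D i w)" for k w
  have [measurable]: "D i \<in> borel_measurable borel" for i unfolding D_def by measurable
  have [measurable]: "S k \<in> borel_measurable borel" for k unfolding S_def by measurable
  have g: "0 \<le> grid u v n i" "grid u v n i \<le> grid u v n (Suc i)" "grid u v n (Suc i) - grid u v n i = \<delta>" for i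
    using grid_ge[OF u(2), of n i] u \<delta> by (auto simp: grid_Suc \<delta>_def)
  have D4: "integrable P (\<lambda>w. (B (grid u v n (Suc i)) w - B (grid u v n i) w)^4)"
    "(\<integral>w. (B (grid u v n (Suc i)) w - B (grid u v n i) w)^4 \<partial>P) \<le> 4 * C^2 * \<delta>^2" for i
    using increment_moments(3,4)[OF g(1,2)[of i]] unfolding g(3) by auto
  have D2i: "integrable P (\<lambda>w. (B (grid u v n (Suc i)) w - B (grid u v n i) w)^2)" for i
    by (rule increment_moments(1)[OF g(1,2)])
  have sq: "(D i w)^2 \<le> 2 * (B (grid u v n (Suc i)) w - B (grid u v n i) w)^4 + 2 * C^2 * \<delta>^2" for i w
  proof -
    define z where "z = (B (grid u v n (Suc i)) w - B (grid u v n i) w)^2"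
    have "(z - C * \<delta>)^2 \<le> 2 * z^2 + 2 * (C * \<delta>)^2"
      using zero_le_power2[of "z + C * \<delta>"] unfolding power2_sum power2_diff by linarith
    then show ?thesis unfolding D_def z_def by (simp add: power_mult_distrib)
  qed
  have Dint: "integrable P (\<lambda>w. (D i w)^2)" for i
  proof (rule Bochner_Integration.integrable_bound)
    show "integrable P (\<lambda>w. 2 * (B (grid u v n (Suc i)) w - B (grid u v n i) w)^4 + 2 * C^2 * \<delta>^2)"
      using D4(1)[of i] by (intro Bochner_Integration.integrable_add integrable_mult_right) auto
    show "AE w in P. norm ((D i w)^2) \<le> norm (2 * (B (grid u v n (Suc i)) w - B (grid u v n i) w)^4 + 2 * C^2 * \<delta>^2)"
      using order_trans[OF sq abs_ge_self] by (intro AE_I2) simp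
  qed measurable
  \<comment> \<open>The constant is \<open>2 * 4 + 2\<close>: twice the fourth moment bound
    \<open>4 * C^2 * \<delta>^2\<close> plus twice the square of
    \<open>C * \<delta>\<close>.\<close>
  have Dle: "(\<integral>w. (D i w)^2 \<partial>P) \<le> 10 * C^2 * \<delta>^2" for i
  proof -
    have "(\<integral>w. (D i w)^2 \<partial>P) \<le> (\<integral>w. 2 * (B (grid u v n (Suc i)) w - B (grid u v n i) w)^4 + 2 * C^2 * \<delta>^2 \<partial>P)"
      using D4(1)[of i] sq by (intro integral_mono Dint Bochner_Integration.integrable_add integrable_mult_right) auto
    also have "\<dots> = 2 * (\<integral>w. (B (grid u v n (Suc i)) w - B (grid u v n i) w)^4 \<partial>P) + 2 * C^2 * \<delta>^2"
      using D4(1)[of i] by (simp add: prob_space)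
    also have "\<dots> \<le> 10 * C^2 * \<delta>^2" using D4(2)[of i] by linarith
    finally show ?thesis .
  qed
  have Sint: "integrable P (\<lambda>w. (S k w)^2)" for k
    unfolding S_def by (intro integrable_sum_L2 Dint) auto
  have S': "integrable P (\<lambda>w. (max 0 (S k w))^2)" for k
    by (rule Bochner_Integration.integrable_bound[OF Sint[of k]]) (auto intro!: AE_I2 simp: max_def)
  have cross: "integrable P (\<lambda>w. max 0 (S k w) * D k w)" for k
    by (intro integrable_mult_L2 S' Dint) auto
  have neg: "(\<integral>w. max 0 (S k w) * D k w \<partial>P) \<le> 0" for k
  proof -
    have "(\<lambda>w. max 0 (S k w)) \<in> borel_measurable (path_filtration (grid u v n k))"
      unfolding S_def D_def
      using g grid_mono[OF u(2)] 
      by (intro borel_measurable_max borel_measurable_const borel_measurable_sum borel_measurable_diff borel_measurable_power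
          measurable_B_path_filtration) (auto simp: Suc_le_eq less_imp_le)
    then have "(\<integral>w. max 0 (S k w) * ((B (grid u v n (Suc k)) w - B (grid u v n k) w)^2 - C * (grid u v n (Suc k) - grid u v n k)) \<partial>P) \<le> 0"
      by (rule integral_mult_increment_square[OF g(1,2)]) (use cross[of k] in \<open>auto simp: D_def g(3)\<close>)
    then show ?thesis unfolding D_def g(3) .
  qed
  have step: "(\<integral>w. (max 0 (S k w))^2 \<partial>P) \<le> real k * (10 * C^2 * \<delta>^2)" for k
  proof (induction k)
    case 0
    show ?case unfolding S_def by simp
  next
    case (Suc k)
    have "(\<integral>w. (max 0 (S (Suc k) w))^2 \<partial>P) \<le> (\<integral>w. (max 0 (S k w))^2 + 2 * (max 0 (S k w) * D k w) + (D k w)^2 \<partial>P)"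
    proof (rule integral_mono[OF S'])
      show "integrable P (\<lambda>w. (max 0 (S k w))^2 + 2 * (max 0 (S k w) * D k w) + (D k w)^2)"
        by (intro Bochner_Integration.integrable_add integrable_mult_right S' cross Dint)
      show "(max 0 (S (Suc k) w))^2 \<le> (max 0 (S k w))^2 + 2 * (max 0 (S k w) * D k w) + (D k w)^2" for w
        using pos_part_square_le[of "S k w" "D k w"] unfolding S_def by (simp add: mult.assoc)
    qed
    also have "\<dots> = (\<integral>w. (max 0 (S k w))^2 \<partial>P) + 2 * (\<integral>w. max 0 (S k w) * D k w \<partial>P) + (\<integral>w. (D k w)^2 \<partial>P)"
      using S'[of k] cross[of k] Dint[of k] by simp
    also have "\<dots> \<le> real (Suc k) * (10 * C^2 * \<delta>^2)" using Suc.IH neg[of k] Dle[of k] by (simp add: algebra_simps)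
    finally show ?case .
  qed
  have "S n w = pvar u v n w - C * (v - u)" for w
    unfolding S_def D_def pvar_def \<delta>_def using n by (simp add: sum_subtractf)
  then have "(\<integral>\<^sup>+w. ennreal ((max 0 (pvar u v n w - C * (v - u)))^2) \<partial>P) = ennreal (\<integral>w. (max 0 (S n w))^2 \<partial>P)"
    using nn_integral_eq_integral[OF S'[of n]] by simp
  also have "\<dots> \<le> ennreal (10 * C^2 * (v - u)^2 / real n)"
  proof (rule ennreal_leI)
    have "real n * (10 * C^2 * ((v - u) / real n)^2) = 10 * C^2 * (v - u)^2 / real n"
      using n by (simp add: power_divide power2_eq_square)
    then show "(\<integral>w. (max 0 (S n w))^2 \<partial>P) \<le> 10 * C^2 * (v - u)^2 / real n"
      using step[of n] unfolding \<delta>_def by simp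
  qed
  finally show ?thesis .
qed

lemma AE_Q_increment_le:
  assumes u: "0 \<le> u" "u \<le> v"
  shows "AE w in P. Q v w - Q u w \<le> C * (v - u)"
proof -
  have [measurable]: "Q v \<in> borel_measurable borel" "Q u \<in> borel_measurable borel" using u by (auto intro: measurable_Q)
  define Y where "Y w = Q v w - Q u w - C * (v - u)" for w
  define S where "S n w = pvar u v n w - C * (v - u)" for n w
  have [measurable]: "Y \<in> borel_measurable borel" "S n \<in> borel_measurable borel" for n
    unfolding Y_def S_def by measurable
  have le: "(\<integral>\<^sup>+w. ennreal ((max 0 (Y w))^2) \<partial>P) \<le>
      2 * ennreal (10 * C^2 * (v - u)^2 / real n) + 2 * (\<integral>\<^sup>+w. ennreal ((pvar u v n w - (Q v w - Q u w))^2) \<partial>P)" if "n > 0" for n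
  proof -
    have "(\<integral>\<^sup>+w. ennreal ((max 0 (Y w))^2) \<partial>P) = (\<integral>\<^sup>+w. ennreal ((max 0 (S n w) + (max 0 (Y w) - max 0 (S n w)))^2) \<partial>P)" by simp
    also have "\<dots> \<le> 2 * (\<integral>\<^sup>+w. ennreal ((max 0 (S n w))^2) \<partial>P) + 2 * (\<integral>\<^sup>+w. ennreal ((max 0 (Y w) - max 0 (S n w))^2) \<partial>P)"
      by (rule nn_integral_square_sum_le) auto
    also have "\<dots> \<le> 2 * ennreal (10 * C^2 * (v - u)^2 / real n) + 2 * (\<integral>\<^sup>+w. ennreal ((pvar u v n w - (Q v w - Q u w))^2) \<partial>P)"
    proof (intro add_mono mult_left_mono nn_integral_mono ennreal_leI)
      show "(\<integral>\<^sup>+w. ennreal ((max 0 (S n w))^2) \<partial>P) \<le> ennreal (10 * C^2 * (v - u)^2 / real n)"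
        unfolding S_def by (rule pos_part_pvar_le[OF u that])
      fix w
      have "\<bar>max 0 (Y w) - max 0 (S n w)\<bar> \<le> \<bar>pvar u v n w - (Q v w - Q u w)\<bar>"
        unfolding Y_def S_def by (auto simp: max_def)
      then show "(max 0 (Y w) - max 0 (S n w))^2 \<le> (pvar u v n w - (Q v w - Q u w))^2"
        by (simp add: abs_le_square_iff)
    qed auto
    finally show ?thesis .
  qed
  have "(\<lambda>n. 2 * ennreal (10 * C^2 * (v - u)^2 / real n) + 2 * (\<integral>\<^sup>+w. ennreal ((pvar u v n w - (Q v w - Q u w))^2) \<partial>P)) \<longlonglongrightarrow> 2 * ennreal 0 + 2 * 0"
    using pvar_tendsto[OF u] unfolding L2_tendsto_def
    by (intro tendsto_add ennreal_tendsto_cmult tendsto_ennrealI lim_const_over_n) auto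
  then have "(\<integral>\<^sup>+w. ennreal ((max 0 (Y w))^2) \<partial>P) \<le> 2 * ennreal 0 + 2 * 0"
    by (rule LIMSEQ_le_const) (use le in \<open>auto intro!: exI[of _ 1]\<close>)
  then have "(\<integral>\<^sup>+w. ennreal ((max 0 (Y w))^2) \<partial>P) = 0" by simp
  then have "AE w in P. ennreal ((max 0 (Y w))^2) = 0" by (subst (asm) nn_integral_0_iff_AE) auto
  then show ?thesis
  proof eventually_elim
    case (elim w)
    then have "max 0 (Y w) = 0" by simp
    then show ?case unfolding Y_def by (simp add: max_def split: if_splits)
  qed
qed

text \<open>The null set in the Lipschitz estimate depends on the pair of times, so it is removed
  for rational pairs only; continuity extends the estimate in one time after the other.\<close>

lemma good_paths:
  obtains \<G> where "\<G> \<in> sets borel" "AE w in P. w \<in> \<G>"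
    "\<And>w. w \<in> \<G> \<Longrightarrow> continuous_on {0..} (\<lambda>t. Q t w)"
    "\<And>w. w \<in> \<G> \<Longrightarrow> mono_on {0..} (\<lambda>t. Q t w)"
    "\<And>w u v. w \<in> \<G> \<Longrightarrow> 0 \<le> u \<Longrightarrow> u \<le> v \<Longrightarrow> Q v w - Q u w \<le> C * (v - u)"
proof -
  obtain A where A: "A \<in> sets borel" "capacity \<P> A = 0"
    "\<And>w. w \<notin> A \<Longrightarrow> continuous_on {0..} (\<lambda>t. Q t w) \<and> mono_on {0..} (\<lambda>t. Q t w)"
    using qv unfolding quadratic_variation_def quasi_surely_def by blast
  have [measurable]: "A \<in> sets borel" by fact
  define I where "I = {(u, v). u \<in> \<rat> \<and> v \<in> \<rat> \<and> 0 \<le> u \<and> u \<le> (v::real)}"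
  have "countable (\<rat> \<times> \<rat> :: (real \<times> real) set)" by (intro countable_SIGMA countable_rat)
  then have I: "countable I" by (rule countable_subset[rotated]) (auto simp: I_def)
  define \<G> where "\<G> = {w \<in> space borel. w \<notin> A} \<inter> {w \<in> space borel. \<forall>(u, v)\<in>I. Q v w - Q u w \<le> C * (v - u)}"
  have "{w \<in> space borel. \<forall>(u, v)\<in>I. Q v w - Q u w \<le> C * (v - u)} \<in> sets borel"
  proof (rule sets.sets_Collect_countable_All'[OF _ I])
    fix i assume "i \<in> I"
    then have [measurable]: "Q (fst i) \<in> borel_measurable borel" "Q (snd i) \<in> borel_measurable borel"
      by (auto simp: I_def intro!: measurable_Q)
    have "{w \<in> space borel. Q (snd i) w - Q (fst i) w \<le> C * (snd i - fst i)} \<in> sets borel" by measurable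
    then show "{w \<in> space borel. case i of (u, v) \<Rightarrow> Q v w - Q u w \<le> C * (v - u)} \<in> sets borel"
      by (simp add: case_prod_beta)
  qed
  then have G1: "\<G> \<in> sets borel" unfolding \<G>_def by (intro sets.Int) auto
  have "AE w in P. w \<notin> A"
    using AE_of_quasi_surely[of "\<lambda>w. w \<notin> A"] A unfolding quasi_surely_def by blast
  moreover have "AE w in P. \<forall>(u, v)\<in>I. Q v w - Q u w \<le> C * (v - u)"
  proof (rule AE_ball_countable[OF I, THEN iffD2, rule_format])
    fix i assume "i \<in> I"
    then show "AE w in P. case i of (u, v) \<Rightarrow> Q v w - Q u w \<le> C * (v - u)"
      using AE_Q_increment_le by (auto simp: I_def)
  qed
  ultimately have G2: "AE w in P. w \<in> \<G>" unfolding \<G>_def by eventually_elim simp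
  show ?thesis
  proof (rule that[OF G1 G2])
    show cont: "continuous_on {0..} (\<lambda>t. Q t w)" if "w \<in> \<G>" for w using that A(3) unfolding \<G>_def by auto
    show "mono_on {0..} (\<lambda>t. Q t w)" if "w \<in> \<G>" for w using that A(3) unfolding \<G>_def by auto
    fix w u v assume w: "w \<in> \<G>" and uv: "0 \<le> u" "u \<le> (v::real)"
    have rat: "Q y w - Q x w \<le> C * (y - x)" if "x \<in> \<rat>" "y \<in> \<rat>" "0 \<le> x" "x \<le> y" for x y
      using w that unfolding \<G>_def I_def by auto
    have 1: "Q y w - C * y \<le> Q x w - C * x" if x: "x \<in> \<rat>" "0 \<le> x" "x \<le> y" for x y
    proof (rule le_on_rats[of x y "\<lambda>y. Q y w - C * y"])
      show "continuous_on {x..y} (\<lambda>y. Q y w - C * y)"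
        using x by (intro continuous_intros continuous_on_subset[OF cont[OF w]]) auto
      show "Q z w - C * z \<le> Q x w - C * x" if "z \<in> {x..y} \<inter> \<rat>" for z
        using rat[of x z] that x by (simp add: algebra_simps)
    qed (use x in auto)
    \<comment> \<open>The earlier time now varies, with a lower bound to be extended; the sign turns
      it into an upper bound, and the rational left end point is 0.\<close>
    have "- (Q u w - C * u) \<le> - (Q v w - C * v)"
    proof (rule le_on_rats[of 0 v "\<lambda>u. - (Q u w - C * u)"])
      show "continuous_on {0..v} (\<lambda>u. - (Q u w - C * u))"
        by (intro continuous_intros continuous_on_subset[OF cont[OF w]]) auto
      show "- (Q z w - C * z) \<le> - (Q v w - C * v)" if "z \<in> {0..v} \<inter> \<rat>" for z
        using 1[of z v] that by simp
    qed (use uv in auto)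
    then show "Q v w - Q u w \<le> C * (v - u)" by (simp add: algebra_simps)
  qed
qed

end

section \<open>Measurability of integrals against the quadratic variation\<close>

text \<open>Rounding \<open>r\<close> down to a grid leaves countably many sections, each
  measurable; continuity in \<open>r\<close> gives pointwise convergence as the grid is
  refined.\<close>

lemma borel_measurable_caratheodory:
  fixes h :: "real \<Rightarrow> 'a \<Rightarrow> real"
  assumes meas: "\<And>r. h r \<in> borel_measurable M" and cont: "\<And>x. x \<in> space M \<Longrightarrow> continuous_on UNIV (\<lambda>r. h r x)"
  shows "(\<lambda>(x, r). h r x) \<in> borel_measurable (M \<Otimes>\<^sub>M borel)"
proof (rule borel_measurable_LIMSEQ_real)
  fix n :: nat
  have [measurable]: "(\<lambda>z. h (real_of_int i / real (Suc n)) (fst z)) \<in> borel_measurable (M \<Otimes>\<^sub>M borel)" for i :: int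
    using meas by measurable
  show "(\<lambda>z. h (real_of_int \<lfloor>snd z * real (Suc n)\<rfloor> / real (Suc n)) (fst z)) \<in> borel_measurable (M \<Otimes>\<^sub>M borel)"
    by (rule measurable_compose_countable[where f = "\<lambda>i z. h (real_of_int i / real (Suc n)) (fst z)"]) measurable
next
  fix z assume "z \<in> space (M \<Otimes>\<^sub>M (borel :: real measure))"
  then have x: "fst z \<in> space M" by (auto simp: space_pair_measure)
  have lim: "(\<lambda>n. real_of_int \<lfloor>snd z * real (Suc n)\<rfloor> / real (Suc n)) \<longlonglongrightarrow> snd z"
  proof (rule tendsto_sandwich)
    show "\<forall>\<^sub>F n in sequentially. snd z - 1 / real (Suc n) \<le> real_of_int \<lfloor>snd z * real (Suc n)\<rfloor> / real (Suc n)"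
    proof (intro always_eventually allI)
      fix n
      have "snd z * real (Suc n) - 1 \<le> real_of_int \<lfloor>snd z * real (Suc n)\<rfloor>" by linarith
      then have "(snd z * real (Suc n) - 1) / real (Suc n) \<le> real_of_int \<lfloor>snd z * real (Suc n)\<rfloor> / real (Suc n)"
        by (rule divide_right_mono) simp
      then show "snd z - 1 / real (Suc n) \<le> real_of_int \<lfloor>snd z * real (Suc n)\<rfloor> / real (Suc n)"
        by (simp add: diff_divide_distrib del: of_nat_Suc)
    qed
    show "\<forall>\<^sub>F n in sequentially. real_of_int \<lfloor>snd z * real (Suc n)\<rfloor> / real (Suc n) \<le> snd z"
      by (intro always_eventually allI) (simp add: divide_le_eq del: of_nat_Suc)
    have "(\<lambda>n. snd z - 1 / real (Suc n)) \<longlonglongrightarrow> snd z - 0"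
      by (intro tendsto_diff tendsto_const LIMSEQ_Suc[OF lim_1_over_n])
    then show "(\<lambda>n. snd z - 1 / real (Suc n)) \<longlonglongrightarrow> snd z" by simp
  qed simp
  have "isCont (\<lambda>r. h r (fst z)) (snd z)" using cont[OF x] by (simp add: continuous_on_eq_continuous_at)
  then have "(\<lambda>n. h (real_of_int \<lfloor>snd z * real (Suc n)\<rfloor> / real (Suc n)) (fst z)) \<longlonglongrightarrow> h (snd z) (fst z)"
    using lim by (rule isCont_tendsto_compose)
  then show "(\<lambda>n. h (real_of_int \<lfloor>snd z * real (Suc n)\<rfloor> / real (Suc n)) (fst z)) \<longlonglongrightarrow> (case z of (x, r) \<Rightarrow> h r x)"
    by (simp add: case_prod_beta)
qed

lemma measurable_B_pair [measurable (raw)]: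
  assumes "f \<in> measurable M borel" "g \<in> measurable M borel"
  shows "(\<lambda>x. B (g x) (f x)) \<in> borel_measurable M"
proof -
  have "(\<lambda>(w, s). B s w) \<in> borel_measurable (borel \<Otimes>\<^sub>M borel)"
    by (rule borel_measurable_caratheodory) (auto intro: continuous_B)
  from measurable_compose[OF measurable_Pair[OF assms] this] show ?thesis by simp
qed

text \<open>A Lipschitz distribution function \<open>F\<close> is compared with \<open>C x\<close> through the complementary
  distribution function \<open>C x - F x\<close>.\<close>

lemma interval_measure_le_lborel:
  fixes F :: "real \<Rightarrow> real"
  assumes mono: "\<And>x y. x \<le> y \<Longrightarrow> F x \<le> F y" and cont: "continuous_on UNIV F"
    and lip: "\<And>x y. x \<le> y \<Longrightarrow> F y - F x \<le> C * (y - x)"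
    and A: "A \<in> sets borel"
  shows "measure (interval_measure F) (A \<inter> {a<..b}) \<le> C * measure lborel (A \<inter> {a<..b})"
proof -
  define G where "G x = C * x - F x" for x
  \<comment> \<open>On a bounded interval all three measures are finite, so that the induction can
    subtract in the step for complements.\<close>
  define I where "I = {a<..b}"
  have Gmono: "G x \<le> G y" if "x \<le> y" for x y using lip[OF that] unfolding G_def by (simp add: algebra_simps)
  have Gcont: "continuous_on UNIV G" unfolding G_def by (intro continuous_intros cont)
  have rc: "continuous (at_right x) F" "continuous (at_right x) G" for x
    using cont Gcont by (auto simp: continuous_on_eq_continuous_within continuous_within intro: tendsto_within_subset)
  have mF: "measure (interval_measure F) {x<..y} = (if x \<le> y then F y - F x else 0)" for x y
    using measure_interval_measure_Ioc[of x y F] mono rc by auto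
  have mG: "measure (interval_measure G) {x<..y} = (if x \<le> y then G y - G x else 0)" for x y
    using measure_interval_measure_Ioc[of x y G] Gmono rc by auto
  have fin: "emeasure (interval_measure F) (X \<inter> I) \<noteq> \<infinity>" "emeasure (interval_measure G) (X \<inter> I) \<noteq> \<infinity>"
    "emeasure lborel (X \<inter> I) \<noteq> \<infinity>" if "X \<in> sets borel" for X
  proof -
    have "emeasure (interval_measure F) I < \<infinity>" "emeasure (interval_measure G) I < \<infinity>" "emeasure lborel I < \<infinity>"
      unfolding I_def using emeasure_interval_measure_Ioc_eq[of F a b] emeasure_interval_measure_Ioc_eq[of G a b] mono Gmono rc
      by (cases "a \<le> b"; simp)+
    moreover have "emeasure M (X \<inter> I) \<le> emeasure M I" if "sets M = sets borel" for M
      using that \<open>X \<in> sets borel\<close> by (intro emeasure_mono) (auto simp: I_def)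
    ultimately show "emeasure (interval_measure F) (X \<inter> I) \<noteq> \<infinity>" "emeasure (interval_measure G) (X \<inter> I) \<noteq> \<infinity>"
      "emeasure lborel (X \<inter> I) \<noteq> \<infinity>"
      by (metis infinity_ennreal_def leD sets_interval_measure sets_lborel)+
  qed
  have stable: "Int_stable (range (\<lambda>(a, b). {a <.. b::real}))"
  proof (rule Int_stableI)
    fix X Y assume "X \<in> range (\<lambda>(a, b). {a <.. b::real})" "Y \<in> range (\<lambda>(a, b). {a <.. b::real})"
    then obtain a b c d where "X = {a<..b}" "Y = {c<..d}" by auto
    then have "X \<inter> Y = (\<lambda>(a, b). {a <.. b}) (max a c, min b d)" by auto
    then show "X \<inter> Y \<in> range (\<lambda>(a, b). {a <.. b::real})" by blast
  qed
  have closed: "range (\<lambda>(a, b). {a <.. b::real}) \<subseteq> Pow UNIV" by simp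
  have sigma: "A \<in> sigma_sets UNIV (range (\<lambda>(a, b). {a <.. b::real}))"
    using A by (subst (asm) borel_sigma_sets_Ioc) simp
  \<comment> \<open>On intervals the sum is \<open>C\<close> times the length by the definition of
    \<open>G\<close>; the identity spreads from this intersection-stable generator to all Borel
    sets. Dropping the nonnegative part of \<open>G\<close> then leaves the claim.\<close>
  from stable closed sigma have "measure (interval_measure F) (A \<inter> I) + measure (interval_measure G) (A \<inter> I) = C * measure lborel (A \<inter> I)"
  proof (induction rule: sigma_sets_induct_disjoint)
    case (basic X)
    then obtain x y where e: "X \<inter> I = {max x a<..min y b}" unfolding I_def by auto
    have "measure lborel {p<..q} = (if p \<le> q then q - p else 0)" for p q :: real by simp
    note mL = this
    show ?case unfolding e mF mG mL by (simp add: G_def algebra_simps)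
  next
    case (compl X)
    then have X: "X \<in> sets borel" by (subst borel_sigma_sets_Ioc) simp
    have eq: "(UNIV - X) \<inter> I = I - (X \<inter> I)" by auto
    have I: "I \<in> sets borel" unfolding I_def by simp
    have "measure M ((UNIV - X) \<inter> I) = measure M I - measure M (X \<inter> I)" if "sets M = sets borel" "emeasure M (UNIV \<inter> I) \<noteq> \<infinity>" for M
      unfolding eq using that X I by (intro measure_Diff) auto
    note diff = this
    have UNIV: "UNIV \<in> sets (borel :: real measure)" by simp
    note d = diff[OF sets_interval_measure fin(1)[OF UNIV]] diff[OF sets_interval_measure fin(2)[OF UNIV]]
      diff[OF sets_lborel fin(3)[OF UNIV]]
    have "measure (interval_measure F) ((UNIV - X) \<inter> I) + measure (interval_measure G) ((UNIV - X) \<inter> I) - C * measure lborel ((UNIV - X) \<inter> I)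
      = measure (interval_measure F) I + measure (interval_measure G) I - C * measure lborel I"
      using compl.IH by (simp only: d right_diff_distrib)
    also have "\<dots> = 0" unfolding I_def mF mG G_def by (simp add: algebra_simps)
    finally show ?case by simp
  next
    case (union X)
    then have X: "X i \<in> sets borel" for i by (subst borel_sigma_sets_Ioc) auto
    have I: "I \<in> sets borel" unfolding I_def by simp
    have eq: "\<Union>(range X) \<inter> I = (\<Union>i. X i \<inter> I)" by auto
    have "(\<lambda>i. measure M (X i \<inter> I)) sums measure M (\<Union>(range X) \<inter> I)" if "sets M = sets borel" "emeasure M (\<Union>(range X) \<inter> I) \<noteq> \<infinity>" for M
      unfolding eq
    proof (rule measure_UNION)
      show "range (\<lambda>i. X i \<inter> I) \<subseteq> sets M" using that X I by auto
      show "disjoint_family (\<lambda>i. X i \<inter> I)" using union(1) by (auto simp: disjoint_family_on_def)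
      show "emeasure M (\<Union>i. X i \<inter> I) \<noteq> \<infinity>" using that(2) unfolding eq .
    qed
    note s = this
    have U: "\<Union>(range X) \<in> sets borel" using X by auto
    have "(\<lambda>i. measure (interval_measure F) (X i \<inter> I) + measure (interval_measure G) (X i \<inter> I)) sums
        (measure (interval_measure F) (\<Union>(range X) \<inter> I) + measure (interval_measure G) (\<Union>(range X) \<inter> I))"
      by (intro sums_add s sets_interval_measure fin U)
    moreover have "(\<lambda>i. C * measure lborel (X i \<inter> I)) sums (C * measure lborel (\<Union>(range X) \<inter> I))"
      by (intro sums_mult s sets_lborel fin U)
    ultimately show ?case using union.IH by (simp only:) (rule sums_unique2)
  qed simp
  then show ?thesis using measure_nonneg[of "interval_measure G" "A \<inter> I"] unfolding I_def by linarith
qed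

locale G_path_kernel = G_path_qv +
  fixes \<G> :: "path set" and t :: real
  assumes t: "0 \<le> t" and \<G> [measurable]: "\<G> \<in> sets borel" and AE_\<G>: "AE w in P. w \<in> \<G>"
    and Q_cont: "\<And>w. w \<in> \<G> \<Longrightarrow> continuous_on {0..} (\<lambda>s. Q s w)"
    and Q_mono: "\<And>w. w \<in> \<G> \<Longrightarrow> mono_on {0..} (\<lambda>s. Q s w)"
    and Q_lip: "\<And>w u v. w \<in> \<G> \<Longrightarrow> 0 \<le> u \<Longrightarrow> u \<le> v \<Longrightarrow> Q v w - Q u w \<le> C * (v - u)"
begin

text \<open>The random measure d\<langle>B\<rangle> on \<open>[0, t]\<close>. On bad paths it is the
  zero measure, so that the mass is at most \<open>C * t\<close> and the kernel is measurable
  without exception.\<close>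

definition K :: "path \<Rightarrow> real measure" where
  "K w = (if w \<in> \<G> then density (interval_measure (\<lambda>s. Q (max 0 s) w)) (indicator {0..t}) else null_measure borel)"

lemma sets_K [simp, measurable_cong]: "sets (K w) = sets borel"
  unfolding K_def by simp

lemma space_K [simp]: "space (K w) = UNIV"
  using sets_eq_imp_space_eq[OF sets_K[of w]] by simp

lemma Q_ext:
  assumes "w \<in> \<G>"
  shows "x \<le> y \<Longrightarrow> Q (max 0 x) w \<le> Q (max 0 y) w" "continuous_on UNIV (\<lambda>s. Q (max 0 s) w)"
    "x \<le> y \<Longrightarrow> Q (max 0 y) w - Q (max 0 x) w \<le> C * (y - x)"
proof -
  show "x \<le> y \<Longrightarrow> Q (max 0 x) w \<le> Q (max 0 y) w"
    using Q_mono[OF assms] unfolding mono_on_def by auto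
  show "continuous_on UNIV (\<lambda>s. Q (max 0 s) w)"
    by (rule continuous_on_compose2[OF Q_cont[OF assms]]) (auto intro!: continuous_intros)
  assume "x \<le> y"
  then have "Q (max 0 y) w - Q (max 0 x) w \<le> C * (max 0 y - max 0 x)"
    by (intro Q_lip[OF assms]) auto
  also have "\<dots> \<le> C * (y - x)" using C_pos \<open>x \<le> y\<close> by (intro mult_left_mono) (auto simp: max_def)
  finally show "Q (max 0 y) w - Q (max 0 x) w \<le> C * (y - x)" .
qed

lemma emeasure_K:
  assumes "w \<in> \<G>" "A \<in> sets borel"
  shows "emeasure (K w) A = emeasure (interval_measure (\<lambda>s. Q (max 0 s) w)) (A \<inter> {0..t})"
  using assms unfolding K_def by (simp add: emeasure_restricted Int_commute)

lemma emeasure_K_atMost: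
  assumes w: "w \<in> \<G>"
  shows "emeasure (K w) {..x} = (if x < 0 then 0 else ennreal (Q (min x t) w - Q 0 w))"
proof -
  define M where "M = interval_measure (\<lambda>s. Q (max 0 s) w)"
  have "emeasure (K w) {..x} = emeasure M ({..x} \<inter> {0..t})"
    using w unfolding M_def by (simp add: emeasure_K)
  also have "\<dots> = (if x < 0 then 0 else ennreal (Q (min x t) w - Q 0 w))"
  proof (cases "x < 0")
    case False
    then have "{..x} \<inter> {0..t} = {0..min x t}" by auto
    moreover have "emeasure M {0..min x t} = ennreal (Q (max 0 (min x t)) w - Q (max 0 0) w)"
      unfolding M_def using False t Q_ext(1)[OF w] Q_ext(2)[OF w] by (intro emeasure_interval_measure_Icc) auto
    ultimately show ?thesis using False t by simp
  next
    case True
    then have "{..x} \<inter> {0..t} = {}" by auto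
    then show ?thesis using True by simp
  qed
  finally show ?thesis .
qed

lemma emeasure_K_UNIV_le: "emeasure (K w) UNIV \<le> ennreal (C * t)"
proof (cases "w \<in> \<G>")
  case True
  define M where "M = interval_measure (\<lambda>s. Q (max 0 s) w)"
  have "emeasure (K w) UNIV = emeasure M {0..t}"
    using True unfolding K_def M_def by (simp add: emeasure_density)
  also have "\<dots> = ennreal (Q t w - Q 0 w)"
    unfolding M_def using t Q_ext(1)[OF True] Q_ext(2)[OF True] by (subst emeasure_interval_measure_Icc) auto
  also have "\<dots> \<le> ennreal (C * t)" using Q_lip[OF True, of 0 t] t by (intro ennreal_leI) simp
  finally show ?thesis .
qed (simp add: K_def)

lemma finite_measure_K: "finite_measure (K w)"
proof
  have "emeasure (K w) UNIV < \<infinity>" using emeasure_K_UNIV_le[of w] by (rule le_less_trans) simp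
  then show "emeasure (K w) (space (K w)) \<noteq> \<infinity>" by simp
qed

lemma measure_K_ivl:
  assumes w: "w \<in> \<G>" and u: "0 \<le> u" "u \<le> v" "v \<le> t"
  shows "measure (K w) {u..<v} = Q v w - Q u w"
proof -
  define M where "M = interval_measure (\<lambda>s. Q (max 0 s) w)"
  have icc: "emeasure M {x..y} = ennreal (Q (max 0 y) w - Q (max 0 x) w)" if "x \<le> y" for x y
    unfolding M_def using that Q_ext(1)[OF w] Q_ext(2)[OF w] by (intro emeasure_interval_measure_Icc) auto
  have "emeasure (K w) {u..<v} = emeasure M ({u..<v} \<inter> {0..t})"
    using w unfolding M_def by (simp add: emeasure_K)
  also have "{u..<v} \<inter> {0..t} = {u..v} - {v..v}" using u by auto
  also have "emeasure M ({u..v} - {v..v}) = emeasure M {u..v} - emeasure M {v..v}"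
    using icc[of v v] u by (intro emeasure_Diff) (auto simp: M_def)
  also have "\<dots> = ennreal (Q v w - Q u w)" using icc[OF u(2)] icc[of v v] u by simp
  finally have "emeasure (K w) {u..<v} = ennreal (Q v w - Q u w)" .
  moreover have "Q u w \<le> Q v w" using Q_ext(1)[OF w u(2)] u by simp
  ultimately show ?thesis by (simp add: measure_def)
qed

lemma emeasure_K_le:
  assumes A: "A \<in> sets borel"
  shows "emeasure (K w) A \<le> ennreal C * emeasure lborel (A \<inter> {0..t})"
proof (cases "w \<in> \<G>")
  case True
  define M where "M = interval_measure (\<lambda>s. Q (max 0 s) w)"
  \<comment> \<open>The comparison is stated for intervals open on the left; starting at -1 keeps
    the point 0 inside.\<close>
  have "measure M ((A \<inter> {0..t}) \<inter> {-1<..t}) \<le> C * measure lborel ((A \<inter> {0..t}) \<inter> {-1<..t})"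
    unfolding M_def by (rule interval_measure_le_lborel) (use Q_ext[OF True] A in auto)
  moreover have "(A \<inter> {0..t}) \<inter> {-1<..t} = A \<inter> {0..t}" by auto
  ultimately have le: "measure M (A \<inter> {0..t}) \<le> C * measure lborel (A \<inter> {0..t})" by simp
  have eq: "emeasure (K w) A = emeasure M (A \<inter> {0..t})"
    using True A unfolding M_def by (simp add: emeasure_K)
  have fin: "emeasure M (A \<inter> {0..t}) \<noteq> \<infinity>"
    using finite_measure.emeasure_finite[OF finite_measure_K, of w A] eq by simp
  have finl: "emeasure lborel (A \<inter> {0..t}) \<noteq> \<infinity>"
    using emeasure_mono[of "A \<inter> {0..t}" "{0..t}" lborel] t by (auto simp: top_unique)
  have "emeasure M (A \<inter> {0..t}) = ennreal (measure M (A \<inter> {0..t}))"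
    using fin by (intro emeasure_eq_ennreal_measure) simp
  also have "\<dots> \<le> ennreal (C * measure lborel (A \<inter> {0..t}))" using le by (rule ennreal_leI)
  also have "\<dots> = ennreal C * emeasure lborel (A \<inter> {0..t})"
    using finl C_pos by (simp add: ennreal_mult emeasure_eq_ennreal_measure)
  finally show ?thesis unfolding eq .
qed (simp add: K_def)

text \<open>This turns convergence of simple processes in the dt norm into convergence in the norm
  of the isometry.\<close>

lemma nn_integral_K_le:
  assumes [measurable]: "h \<in> borel_measurable borel"
  shows "(\<integral>\<^sup>+s. h s \<partial>K w) \<le> ennreal C * (\<integral>\<^sup>+s\<in>{0..t}. h s \<partial>lborel)"
proof -
  define N where "N = density lborel (\<lambda>s. ennreal C * indicator {0..t} s)"
  have N: "emeasure N A = ennreal C * emeasure lborel (A \<inter> {0..t})" if "A \<in> sets borel" for A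
    using that unfolding N_def
    by (simp add: emeasure_density nn_integral_cmult mult.assoc indicator_inter_arith[symmetric] Int_commute)
  have "sets (K w) = sets N" unfolding N_def by simp
  moreover have "K w \<le> N" using emeasure_K_le N by (subst le_measure) (auto simp: N_def)
  ultimately have "(\<integral>\<^sup>+s. h s \<partial>K w) \<le> (\<integral>\<^sup>+s. h s \<partial>N)" by (rule nn_integral_mono_measure)
  also have "\<dots> = (\<integral>\<^sup>+s. ennreal C * (h s * indicator {0..t} s) \<partial>lborel)"
    unfolding N_def by (subst nn_integral_density) (auto simp: mult_ac)
  also have "\<dots> = ennreal C * (\<integral>\<^sup>+s\<in>{0..t}. h s \<partial>lborel)" by (rule nn_integral_cmult) auto
  finally show ?thesis .
qed

text \<open>Giry's sub-probability monad only covers kernels of mass at most one, hence the scaling.\<close>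

lemma measurable_nn_integral_K:
  assumes h: "(\<lambda>(x, s). h x s) \<in> borel_measurable (M \<Otimes>\<^sub>M borel)" and k [measurable]: "k \<in> measurable M borel"
  shows "(\<lambda>x. \<integral>\<^sup>+s. h x s \<partial>K (k x)) \<in> borel_measurable M"
proof -
  \<comment> \<open>The mass of \<open>K w\<close> is at most \<open>C * t\<close>; the summand 1
    keeps \<open>r\<close> positive when \<open>t = 0\<close>.\<close>
  define r where "r = 1 + C * t"
  have r: "r > 0" unfolding r_def using C_pos t by (simp add: add_pos_nonneg)
  define K' where "K' w = scale_measure (ennreal (1 / r)) (K w)" for w
  have K': "K' \<in> measurable borel (subprob_algebra borel)"
  proof (rule measurable_subprob_algebra_generated[where \<Omega> = UNIV and G = "range (\<lambda>a. {..a::real})"])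
    show "sets borel = sigma_sets UNIV (range (\<lambda>a. {..a::real}))" by (subst borel_eq_atMost) simp
    show "Int_stable (range (\<lambda>a. {..a::real}))" by (auto simp: Int_stable_def)
    show "subprob_space (K' w)" for w
    proof
      have "emeasure (K' w) (space (K' w)) \<le> ennreal (1 / r) * ennreal (C * t)"
        unfolding K'_def by (auto simp: space_scale_measure intro!: mult_left_mono emeasure_K_UNIV_le)
      also have "\<dots> = ennreal (1 / r * (C * t))" using r t C_pos by (intro ennreal_mult[symmetric]) auto
      also have "\<dots> \<le> ennreal 1" using r by (intro ennreal_leI) (simp add: r_def)
      finally show "emeasure (K' w) (space (K' w)) \<le> 1" by simp
    qed (simp add: K'_def space_scale_measure)
    show "sets (K' w) = sets borel" for w unfolding K'_def by simp
    have gen: "(\<lambda>w. emeasure (K' w) {..x}) \<in> borel_measurable borel" for x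
    proof -
      have [measurable]: "Q 0 \<in> borel_measurable borel" by (rule measurable_Q) simp
      have eq: "emeasure (K' w) {..x} = ennreal (1 / r) * (if w \<in> \<G> then (if x < 0 then 0 else ennreal (Q (min x t) w - Q 0 w)) else 0)" for w
        unfolding K'_def using emeasure_K_atMost[of w x] by (auto simp: K_def)
      show ?thesis
      proof (cases "x < 0")
        case True
        show ?thesis unfolding eq if_P[OF True] if_cancel by simp
      next
        case False
        then have [measurable]: "Q (min x t) \<in> borel_measurable borel" using t by (intro measurable_Q) auto
        show ?thesis unfolding eq if_not_P[OF False] by measurable
      qed
    qed
    show "(\<lambda>w. emeasure (K' w) A) \<in> borel_measurable borel" if "A \<in> range (\<lambda>a. {..a})" for A
      using that gen by auto
    \<comment> \<open>The whole line is not one of the generating half-lines, but the kernel lives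
      on \<open>[0, t]\<close>, so \<open>{..t}\<close> carries the full mass.\<close>
    have "emeasure (K' w) UNIV = emeasure (K' w) {..t}" for w
    proof (cases "w \<in> \<G>")
      case True
      have "emeasure (K w) {t<..} \<le> ennreal C * emeasure lborel ({t<..} \<inter> {0..t})" by (rule emeasure_K_le) simp
      also have "{t<..} \<inter> {0..t} = {}" by auto
      finally have 0: "emeasure (K w) {t<..} = 0" by simp
      have "emeasure (K w) UNIV = emeasure (K w) ({..t} \<union> {t<..})" by (rule arg_cong[where f = "emeasure (K w)"]) auto
      also have "\<dots> = emeasure (K w) {..t}" using 0 by (intro emeasure_Un_null_set) auto
      finally show ?thesis unfolding K'_def by simp
    qed (simp add: K'_def K_def)
    then show "(\<lambda>w. emeasure (K' w) UNIV) \<in> borel_measurable borel" using gen by simp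
  qed auto
  have hx: "h x \<in> borel_measurable borel" if "x \<in> space M" for x
    using measurable_compose[OF measurable_Pair1'[OF that] h] by simp
  have "(\<lambda>x. \<integral>\<^sup>+s. h x s \<partial>K' (k x)) \<in> borel_measurable M"
    by (rule nn_integral_measurable_subprob_algebra2[OF h measurable_compose[OF k K']])
  then have "(\<lambda>x. ennreal r * (\<integral>\<^sup>+s. h x s \<partial>K' (k x))) \<in> borel_measurable M" by measurable
  moreover have "ennreal r * (\<integral>\<^sup>+s. h x s \<partial>K' (k x)) = (\<integral>\<^sup>+s. h x s \<partial>K (k x))" if "x \<in> space M" for x
  proof -
    have "h x \<in> borel_measurable (K (k x))" using hx[OF that] by measurable
    then have "(\<integral>\<^sup>+s. h x s \<partial>K' (k x)) = ennreal (1 / r) * (\<integral>\<^sup>+s. h x s \<partial>K (k x))"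
      unfolding K'_def by (rule nn_integral_scale_measure)
    moreover have "ennreal r * ennreal (1 / r) = 1" using r by (simp flip: ennreal_mult)
    ultimately show ?thesis by (simp flip: mult.assoc)
  qed
  ultimately show ?thesis by (subst measurable_cong[of M _ "\<lambda>x. ennreal r * (\<integral>\<^sup>+s. h x s \<partial>K' (k x))"]) auto
qed

end

section \<open>The isometry for elementary integrals\<close>

context G_path_kernel
begin

lemma bounded_mult_square_integrable:
  assumes "X \<in> borel_measurable borel" "\<And>w. \<bar>X w\<bar> \<le> (c::real)" "0 \<le> u" "u \<le> v"
  shows "integrable P (\<lambda>w. (X w * (B v w - B u w))^2)"
  using assms by (intro integrable_bounded_mult_L2[of _ _ _ c] increment_moments) auto

lemma Q_bounded_integrable:
  assumes [measurable]: "X \<in> borel_measurable borel" and X: "\<And>w. \<bar>X w\<bar> \<le> (c::real)" and uv: "0 \<le> u" "u \<le> v"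
  shows "integrable P (\<lambda>w. X w * (Q v w - Q u w))"
proof -
  have [measurable]: "Q v \<in> borel_measurable borel" "Q u \<in> borel_measurable borel" using uv by (auto intro: measurable_Q)
  have "\<bar>X w\<bar>^2 \<le> c^2" for w using X by (intro power_mono) auto
  then have X2: "integrable P (\<lambda>w. (X w)^2)" by (intro integrable_const_bound[of _ "c^2"]) auto
  show ?thesis by (rule integrable_mult_L2[OF _ _ X2 Q_increment_square_integrable[OF uv]]) auto
qed

text \<open>For \<open>u' < v\<close> the first increment is split at \<open>u'\<close>, and the longer
  of the remaining ones at the smaller of the two right end points.\<close>

lemma elementary_covariance_ordered:
  assumes uv: "0 \<le> u" "u \<le> v" and uv': "0 \<le> u'" "u' \<le> v'" and uu': "u \<le> u'"
    and \<xi>: "\<xi> \<in> borel_measurable (path_filtration u)" "\<And>w. \<bar>\<xi> w\<bar> \<le> c"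
    and \<xi>': "\<xi>' \<in> borel_measurable (path_filtration u')" "\<And>w. \<bar>\<xi>' w\<bar> \<le> c'"
  shows "(\<integral>w. (\<xi> w * (B v w - B u w)) * (\<xi>' w * (B v' w - B u' w)) \<partial>P) =
    (\<integral>w. \<xi> w * \<xi>' w * (Q (max u' (min v v')) w - Q u' w) \<partial>P)"
proof -
  define h where "h w = \<xi> w * \<xi>' w" for w
  have h: "h \<in> borel_measurable (path_filtration s)" if "u' \<le> s" for s
    unfolding h_def
    using measurable_path_filtration_mono[OF \<xi>(1) uv(1), of s] measurable_path_filtration_mono[OF \<xi>'(1) uv'(1), of s] that uu'
    by auto
  have c: "0 \<le> c" "0 \<le> c'" using order_trans[OF abs_ge_zero \<xi>(2)] order_trans[OF abs_ge_zero \<xi>'(2)] by auto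
  have hb: "\<bar>h w\<bar> \<le> c * c'" for w unfolding h_def abs_mult using \<xi>(2) \<xi>'(2) c by (intro mult_mono) auto
  have [measurable]: "h \<in> borel_measurable borel"
    by (rule measurable_path_filtration_borel[OF h uv'(1)]) simp
  have zero: "(\<integral>w. (h w * (B x w - B y w)) * (B b w - B a w) \<partial>P) = 0"
    "integrable P (\<lambda>w. (h w * (B x w - B y w)) * (B b w - B a w))"
    if "0 \<le> y" "y \<le> x" "x \<le> a" "a \<le> b" "u' \<le> a" for x y a b
  proof -
    show int: "integrable P (\<lambda>w. (h w * (B x w - B y w)) * (B b w - B a w))"
      using that hb by (intro integrable_mult_L2 bounded_mult_square_integrable[of _ "c * c'"] increment_moments) auto
    show "(\<integral>w. (h w * (B x w - B y w)) * (B b w - B a w) \<partial>P) = 0"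
      using that by (intro integral_mult_increment int borel_measurable_times borel_measurable_diff h measurable_B_path_filtration) auto
  qed
  show ?thesis
  proof (cases "v \<le> u'")
    case True
    have "(\<integral>w. (\<xi> w * (B v w - B u w)) * (\<xi>' w * (B v' w - B u' w)) \<partial>P) = (\<integral>w. (h w * (B v w - B u w)) * (B v' w - B u' w) \<partial>P)"
      by (simp add: h_def mult_ac)
    also have "\<dots> = 0" using True uv uv' by (intro zero) auto
    finally show ?thesis using True uv' by (simp add: max_def min_def)
  next
    case False
    define m M where "m = min v v'" and "M = max v v'"
    have mM: "u' \<le> m" "m \<le> M" "0 \<le> m" unfolding m_def M_def using False uv uv' by auto
    \<comment> \<open>The two products pair increments over adjacent intervals and have mean zero;
      the overlap from \<open>u'\<close> to \<open>m\<close> contributes the square, whichever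
      interval ends first.\<close>
    have eq: "(\<xi> w * (B v w - B u w)) * (\<xi>' w * (B v' w - B u' w)) =
        (h w * (B u' w - B u w)) * (B v' w - B u' w) + (h w * (B m w - B u' w)) * (B M w - B m w) + h w * (B m w - B u' w)^2" for w
    proof (cases "v \<le> v'")
      case True
      then have "m = v" "M = v'" unfolding m_def M_def by auto
      then show ?thesis by (simp add: h_def power2_eq_square algebra_simps)
    next
      case False
      then have "m = v'" "M = v" unfolding m_def M_def by auto
      then show ?thesis by (simp add: h_def power2_eq_square algebra_simps)
    qed
    have i3: "integrable P (\<lambda>w. h w * (B m w - B u' w)^2)"
    proof -
      have "integrable P (\<lambda>w. (h w * (B m w - B u' w)) * (B m w - B u' w))"
        using mM uv' hb by (intro integrable_mult_L2 bounded_mult_square_integrable[of _ "c * c'"] increment_moments) auto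
      then show ?thesis by (simp add: power2_eq_square mult.assoc)
    qed
    have "(\<integral>w. (\<xi> w * (B v w - B u w)) * (\<xi>' w * (B v' w - B u' w)) \<partial>P) = 0 + 0 + (\<integral>w. h w * (B m w - B u' w)^2 \<partial>P)"
      unfolding eq using zero[OF uv(1) uu' order_refl uv'(2) order_refl] zero[OF uv'(1) mM(1) order_refl mM(2) mM(1)] i3
      by simp
    also have "\<dots> = (\<integral>w. h w * (Q m w - Q u' w) \<partial>P)"
      using integral_mult_increment_square_eq[OF uv'(1) mM(1) h hb] by simp
    finally show ?thesis using mM unfolding h_def m_def by (simp add: max_def)
  qed
qed

lemma elementary_covariance:
  assumes uv: "0 \<le> u" "u \<le> v" "v \<le> t" and uv': "0 \<le> u'" "u' \<le> v'" "v' \<le> t"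
    and \<xi>: "\<xi> \<in> borel_measurable (path_filtration u)" "\<And>w. \<bar>\<xi> w\<bar> \<le> c"
    and \<xi>': "\<xi>' \<in> borel_measurable (path_filtration u')" "\<And>w. \<bar>\<xi>' w\<bar> \<le> c'"
  shows "(\<integral>w. (\<xi> w * (B v w - B u w)) * (\<xi>' w * (B v' w - B u' w)) \<partial>P) =
    (\<integral>w. \<xi> w * \<xi>' w * measure (K w) ({u..<v} \<inter> {u'..<v'}) \<partial>P)"
    "integrable P (\<lambda>w. \<xi> w * \<xi>' w * measure (K w) ({u..<v} \<inter> {u'..<v'}))"
proof -
  define l where "l = max u u'"
  \<comment> \<open>The outer maximum makes \<open>r = l\<close> when the intervals are disjoint, so
    that the increment of \<open>Q\<close> is 0 then.\<close>
  define r where "r = max l (min v v')"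
  have lr: "0 \<le> l" "l \<le> r" "r \<le> t" unfolding l_def r_def using uv uv' by auto
  have [measurable]: "\<xi> \<in> borel_measurable borel" "\<xi>' \<in> borel_measurable borel"
    using measurable_path_filtration_borel[OF \<xi>(1) uv(1)] measurable_path_filtration_borel[OF \<xi>'(1) uv'(1)] by auto
  have [measurable]: "Q l \<in> borel_measurable borel" "Q r \<in> borel_measurable borel" using lr by (auto intro: measurable_Q)
  have set: "{u..<v} \<inter> {u'..<v'} = {l..<r}" unfolding l_def r_def by (auto simp: max_def min_def)
  have m: "measure (K w) ({u..<v} \<inter> {u'..<v'}) = (if w \<in> \<G> then Q r w - Q l w else 0)" for w
    unfolding set using measure_K_ivl[OF _ lr, of w] by (auto simp: K_def)
  have AE: "AE w in P. \<xi> w * \<xi>' w * measure (K w) ({u..<v} \<inter> {u'..<v'}) = \<xi> w * \<xi>' w * (Q r w - Q l w)"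
    using AE_\<G> unfolding m by eventually_elim simp
  have [measurable]: "(\<lambda>w. \<xi> w * \<xi>' w * measure (K w) ({u..<v} \<inter> {u'..<v'})) \<in> borel_measurable borel"
    unfolding m by measurable
  have c: "0 \<le> c" "0 \<le> c'" using order_trans[OF abs_ge_zero \<xi>(2)] order_trans[OF abs_ge_zero \<xi>'(2)] by auto
  have hb: "\<bar>\<xi> w * \<xi>' w\<bar> \<le> c * c'" for w unfolding abs_mult using \<xi>(2) \<xi>'(2) c by (intro mult_mono) auto
  have int: "integrable P (\<lambda>w. \<xi> w * \<xi>' w * (Q r w - Q l w))"
    by (rule Q_bounded_integrable[OF _ hb lr(1,2)]) measurable
  show "integrable P (\<lambda>w. \<xi> w * \<xi>' w * measure (K w) ({u..<v} \<inter> {u'..<v'}))"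
    using int by (rule integrable_cong_AE_imp) (use AE in \<open>auto simp del: Int_atLeastLessThan\<close>)
  have "(\<integral>w. (\<xi> w * (B v w - B u w)) * (\<xi>' w * (B v' w - B u' w)) \<partial>P) = (\<integral>w. \<xi> w * \<xi>' w * (Q r w - Q l w) \<partial>P)"
  proof (cases "u \<le> u'")
    case True
    then have "l = u'" unfolding l_def by simp
    then show ?thesis
      using elementary_covariance_ordered[OF uv(1,2) uv'(1,2) True \<xi> \<xi>'] unfolding r_def by simp
  next
    case False
    then have l: "l = u" unfolding l_def by simp
    have "(\<integral>w. (\<xi>' w * (B v' w - B u' w)) * (\<xi> w * (B v w - B u w)) \<partial>P) =
      (\<integral>w. \<xi>' w * \<xi> w * (Q (max u (min v' v)) w - Q u w) \<partial>P)"
      by (rule elementary_covariance_ordered[OF uv'(1,2) uv(1,2) _ \<xi>' \<xi>]) (use False in simp)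
    then show ?thesis unfolding l r_def by (simp add: mult_ac min.commute)
  qed
  also have "\<dots> = (\<integral>w. \<xi> w * \<xi>' w * measure (K w) ({u..<v} \<inter> {u'..<v'}) \<partial>P)"
    using AE by (intro integral_cong_AE) (auto simp del: Int_atLeastLessThan)
  finally show "(\<integral>w. (\<xi> w * (B v w - B u w)) * (\<xi>' w * (B v' w - B u' w)) \<partial>P) =
    (\<integral>w. \<xi> w * \<xi>' w * measure (K w) ({u..<v} \<inter> {u'..<v'}) \<partial>P)" .
qed

text \<open>Intervals may overlap and the index set is of any type, so that the difference of sums
  over two different partitions is again of this kind without passing to a common
  refinement.\<close>

definition elementary :: "'i set \<Rightarrow> ('i \<Rightarrow> real) \<Rightarrow> ('i \<Rightarrow> real) \<Rightarrow> ('i \<Rightarrow> path \<Rightarrow> real) \<Rightarrow> bool" where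
  "elementary I u v \<xi> \<longleftrightarrow> finite I \<and> (\<forall>i\<in>I. 0 \<le> u i \<and> u i \<le> v i \<and> v i \<le> t \<and> \<xi> i \<in> L_b (u i))"

definition elem_proc :: "'i set \<Rightarrow> ('i \<Rightarrow> real) \<Rightarrow> ('i \<Rightarrow> real) \<Rightarrow> ('i \<Rightarrow> path \<Rightarrow> real) \<Rightarrow> path \<Rightarrow> real \<Rightarrow> real" where
  "elem_proc I u v \<xi> w s = (\<Sum>i\<in>I. \<xi> i w * indicator {u i..<v i} s)"

definition elem_int :: "'i set \<Rightarrow> ('i \<Rightarrow> real) \<Rightarrow> ('i \<Rightarrow> real) \<Rightarrow> ('i \<Rightarrow> path \<Rightarrow> real) \<Rightarrow> path \<Rightarrow> real" where
  "elem_int I u v \<xi> w = (\<Sum>i\<in>I. \<xi> i w * (B (v i) w - B (u i) w))"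

lemma L_bD:
  assumes "X \<in> L_b s"
  shows "X \<in> borel_measurable (path_filtration s)" "\<exists>c. \<forall>w. \<bar>X w\<bar> \<le> c"
  using assms unfolding L_b_def bounded_iff by auto

text \<open>Overlapping intervals rule out orthogonality; both sides are expanded into double sums
  instead, and the covariances agree term by term.\<close>

lemma elementary_isometry:
  assumes el: "elementary I u v \<xi>"
  shows "(\<integral>\<^sup>+w. ennreal ((elem_int I u v \<xi> w)^2) \<partial>P) = (\<integral>\<^sup>+w. (\<integral>\<^sup>+s. ennreal ((elem_proc I u v \<xi> w s)^2) \<partial>K w) \<partial>P)"
proof -
  have fin: "finite I" using el unfolding elementary_def by simp
  have uv: "0 \<le> u i" "u i \<le> v i" "v i \<le> t" and Lb: "\<xi> i \<in> L_b (u i)" if "i \<in> I" for i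
    using el that unfolding elementary_def by auto
  have "\<forall>i\<in>I. \<exists>c. \<forall>w. \<bar>\<xi> i w\<bar> \<le> c" using L_bD(2)[OF Lb] by blast
  then obtain c where c: "\<And>i w. i \<in> I \<Longrightarrow> \<bar>\<xi> i w\<bar> \<le> c i" by metis
  have [measurable]: "\<xi> i \<in> borel_measurable borel" if "i \<in> I" for i
    using measurable_path_filtration_borel[OF L_bD(1)[OF Lb[OF that]] uv(1)[OF that]] .
  note cov = elementary_covariance[OF uv uv L_bD(1)[OF Lb] c L_bD(1)[OF Lb] c]
  define J where "J i j w = (\<xi> i w * (B (v i) w - B (u i) w)) * (\<xi> j w * (B (v j) w - B (u j) w))" for i j w
  define R where "R i j w = \<xi> i w * \<xi> j w * measure (K w) ({u i..<v i} \<inter> {u j..<v j})" for i j w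
  have Jint: "integrable P (J i j)" if "i \<in> I" "j \<in> I" for i j
    unfolding J_def using that uv c
    by (intro integrable_mult_L2 bounded_mult_square_integrable) auto
  have Rint: "integrable P (R i j)" if "i \<in> I" "j \<in> I" for i j
    unfolding R_def using cov(2)[OF that(1) that(1) that(1) that(2) that(2) that(2) that(1) that(1) that(2) that(2)] .
  have JR: "(\<integral>w. J i j w \<partial>P) = (\<integral>w. R i j w \<partial>P)" if "i \<in> I" "j \<in> I" for i j
    unfolding J_def R_def using cov(1)[OF that(1) that(1) that(1) that(2) that(2) that(2) that(1) that(1) that(2) that(2)] .
  have sq: "(elem_int I u v \<xi> w)^2 = (\<Sum>i\<in>I. \<Sum>j\<in>I. J i j w)" for w
    unfolding elem_int_def power2_eq_square sum_product J_def by simp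
  have inner: "(\<integral>\<^sup>+s. ennreal ((elem_proc I u v \<xi> w s)^2) \<partial>K w) = ennreal (\<Sum>i\<in>I. \<Sum>j\<in>I. R i j w)" 
    and nonneg: "0 \<le> (\<Sum>i\<in>I. \<Sum>j\<in>I. R i j w)" for w
  proof -
    interpret Kw: finite_measure "K w" by (rule finite_measure_K)
    have eq: "(elem_proc I u v \<xi> w s)^2 = (\<Sum>i\<in>I. \<Sum>j\<in>I. \<xi> i w * \<xi> j w * indicator ({u i..<v i} \<inter> {u j..<v j}) s)" for s
      unfolding elem_proc_def power2_eq_square sum_product
      by (intro sum.cong refl) (simp add: indicator_inter_arith mult_ac del: Int_atLeastLessThan)
    have int: "integrable (K w) (\<lambda>s. \<xi> i w * \<xi> j w * indicator ({u i..<v i} \<inter> {u j..<v j}) s)" for i j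
      by (intro integrable_mult_right) (auto intro!: integrable_real_indicator simp: Kw.emeasure_finite top.not_eq_extremum[symmetric])
    then have int2: "integrable (K w) (\<lambda>s. (elem_proc I u v \<xi> w s)^2)" unfolding eq by (intro Bochner_Integration.integrable_sum)
    have val: "(\<integral>s. (elem_proc I u v \<xi> w s)^2 \<partial>K w) = (\<Sum>i\<in>I. \<Sum>j\<in>I. R i j w)"
      unfolding eq using int by (simp add: Bochner_Integration.integral_sum R_def)
    show "(\<integral>\<^sup>+s. ennreal ((elem_proc I u v \<xi> w s)^2) \<partial>K w) = ennreal (\<Sum>i\<in>I. \<Sum>j\<in>I. R i j w)"
      using nn_integral_eq_integral[OF int2] val by simp
    show "0 \<le> (\<Sum>i\<in>I. \<Sum>j\<in>I. R i j w)"
      unfolding val[symmetric] by (rule integral_nonneg_AE) simp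
  qed
  have "(\<integral>\<^sup>+w. ennreal ((elem_int I u v \<xi> w)^2) \<partial>P) = ennreal (\<integral>w. (\<Sum>i\<in>I. \<Sum>j\<in>I. J i j w) \<partial>P)"
  proof -
    have "integrable P (\<lambda>w. (elem_int I u v \<xi> w)^2)" unfolding sq using Jint by (intro Bochner_Integration.integrable_sum)
    then have "(\<integral>\<^sup>+w. ennreal ((elem_int I u v \<xi> w)^2) \<partial>P) = ennreal (\<integral>w. (elem_int I u v \<xi> w)^2 \<partial>P)"
      by (rule nn_integral_eq_integral) simp
    then show ?thesis unfolding sq .
  qed
  also have "(\<integral>w. (\<Sum>i\<in>I. \<Sum>j\<in>I. J i j w) \<partial>P) = (\<integral>w. (\<Sum>i\<in>I. \<Sum>j\<in>I. R i j w) \<partial>P)"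
    using Jint Rint JR by (simp add: Bochner_Integration.integral_sum Bochner_Integration.integrable_sum)
  also have "ennreal \<dots> = (\<integral>\<^sup>+w. ennreal (\<Sum>i\<in>I. \<Sum>j\<in>I. R i j w) \<partial>P)"
    using nonneg Rint by (intro nn_integral_eq_integral[symmetric] Bochner_Integration.integrable_sum) auto
  finally show ?thesis unfolding inner .
qed

text \<open>The difference of two elementary integrals is again elementary, over the disjoint union of the index sets.\<close>

lemma elementary_isometry_diff:
  assumes 1: "elementary I u v \<xi>" and 2: "elementary I' u' v' \<xi>'"
  shows "(\<integral>\<^sup>+w. ennreal ((elem_int I u v \<xi> w - elem_int I' u' v' \<xi>' w)^2) \<partial>P) =
    (\<integral>\<^sup>+w. (\<integral>\<^sup>+s. ennreal ((elem_proc I u v \<xi> w s - elem_proc I' u' v' \<xi>' w s)^2) \<partial>K w) \<partial>P)"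
proof -
  define U where "U = case_sum u u'"
  define V where "V = case_sum v v'"
  define X where "X = case_sum \<xi> (\<lambda>i w. - \<xi>' i w)"
  have fin: "finite I" "finite I'" using 1 2 unfolding elementary_def by auto
  have "elementary (I <+> I') U V X"
    unfolding elementary_def
  proof (intro conjI ballI)
    fix i assume i: "i \<in> I <+> I'"
    show "0 \<le> U i" "U i \<le> V i" "V i \<le> t"
      using i 1 2 unfolding elementary_def U_def V_def by auto
    have neg: "(\<lambda>w. - Y w) \<in> L_b s" if "Y \<in> L_b s" for Y s
      using that unfolding L_b_def by (auto simp: bounded_iff)
    show "X i \<in> L_b (U i)"
      using i 1 2 neg unfolding elementary_def U_def X_def by auto
  qed (use fin in auto)
  moreover have "elem_int (I <+> I') U V X w = elem_int I u v \<xi> w - elem_int I' u' v' \<xi>' w" for w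
    unfolding elem_int_def U_def V_def X_def using fin by (simp add: sum.Plus sum_negf)
  moreover have "elem_proc (I <+> I') U V X w s = elem_proc I u v \<xi> w s - elem_proc I' u' v' \<xi>' w s" for w s
    unfolding elem_proc_def U_def V_def X_def sum.Plus[OF fin]
    by (simp only: o_def sum.case mult_minus_left sum_negf add_uminus_conv_diff)
  ultimately show ?thesis using elementary_isometry[of "I <+> I'" U V X] by simp
qed

lemma elementary_simple:
  assumes "simple_data t n \<tau> \<xi>"
  shows "elementary {..<n} \<tau> (\<lambda>j. \<tau> (Suc j)) \<xi>"
    "elem_int {..<n} \<tau> (\<lambda>j. \<tau> (Suc j)) \<xi> = simple_integral n \<tau> \<xi>"
    "elem_proc {..<n} \<tau> (\<lambda>j. \<tau> (Suc j)) \<xi> w s = simple_process n \<tau> \<xi> s w"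
proof -
  have s: "\<tau> 0 = 0" "\<tau> n = t" "\<And>j. j < n \<Longrightarrow> \<tau> j < \<tau> (Suc j)" "\<And>j. j < n \<Longrightarrow> \<xi> j \<in> L_b (\<tau> j)"
    using assms unfolding simple_data_def by auto
  have mono: "\<tau> i \<le> \<tau> j" if "i \<le> j" "j \<le> n" for i j
    using that
  proof (induction j)
    case (Suc j)
    then show ?case using s(3)[of j] by (cases "i = Suc j") (auto simp: le_Suc_eq intro: order_trans less_imp_le)
  qed auto
  show "elementary {..<n} \<tau> (\<lambda>j. \<tau> (Suc j)) \<xi>"
    unfolding elementary_def
  proof (intro conjI ballI)
    fix j assume j: "j \<in> {..<n}"
    show "0 \<le> \<tau> j" using mono[of 0 j] s(1) j by auto
    show "\<tau> j \<le> \<tau> (Suc j)" using s(3)[of j] j by auto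
    show "\<tau> (Suc j) \<le> t" using mono[of "Suc j" n] s(2) j by auto
    show "\<xi> j \<in> L_b (\<tau> j)" using s(4) j by auto
  qed simp
qed (auto simp: elem_int_def simple_integral_def elem_proc_def simple_process_def fun_eq_iff)

end

section \<open>Mollification of convex functions\<close>

text \<open>Subtracting \<open>c * u^2 / 2\<close> leaves a function with increasing derivative on
  the interval, which lies above its tangents. The hypothesis bounds difference quotients of
  \<open>h'\<close>, because a second derivative need not exist everywhere.\<close>

lemma remainder_ge:
  fixes h h' :: "real \<Rightarrow> real"
  assumes deriv: "\<And>x. (h has_real_derivative h' x) (at x)"
    and c: "\<And>x u. lo \<le> x \<Longrightarrow> x \<le> u \<Longrightarrow> u \<le> hi \<Longrightarrow> (u - x) * c \<le> h' u - h' x"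
    and xy: "lo \<le> x" "x \<le> hi" "lo \<le> y" "y \<le> hi"
  shows "(y - x)^2 / 2 * c \<le> h y - h x - h' x * (y - x)"
proof -
  define k where "k u = h u - c * u^2 / 2" for u
  define k' where "k' u = h' u - c * u" for u
  have k: "(k has_real_derivative k' u) (at u)" for u
    unfolding k_def k'_def by (auto intro!: derivative_eq_intros deriv)
  have mono: "k' u \<le> k' v" if "lo \<le> u" "u \<le> v" "v \<le> hi" for u v
    using c[OF that] unfolding k'_def by (simp add: algebra_simps)
  have "k x + k' x * (y - x) \<le> k y"
  proof (cases x y rule: linorder_cases)
    case less
    then obtain z where z: "x < z" "z < y" "k y - k x = (y - x) * k' z" using MVT2[OF less] k by blast
    have "(y - x) * k' x \<le> (y - x) * k' z" using z xy less by (intro mult_left_mono mono) auto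
    then show ?thesis using z by (simp add: algebra_simps)
  next
    case greater
    then obtain z where z: "y < z" "z < x" "k x - k y = (x - y) * k' z" using MVT2[OF greater] k by blast
    have "(x - y) * k' z \<le> (x - y) * k' x" using z xy greater by (intro mult_left_mono mono) auto
    then show ?thesis using z by (simp add: algebra_simps)
  qed simp
  then show ?thesis unfolding k_def k'_def by (simp add: power2_eq_square algebra_simps diff_divide_distrib add_divide_distrib)
qed

lemma remainder_le:
  fixes h h' :: "real \<Rightarrow> real"
  assumes deriv: "\<And>x. (h has_real_derivative h' x) (at x)"
    and c: "\<And>x u. lo \<le> x \<Longrightarrow> x \<le> u \<Longrightarrow> u \<le> hi \<Longrightarrow> h' u - h' x \<le> (u - x) * c"
    and xy: "lo \<le> x" "x \<le> hi" "lo \<le> y" "y \<le> hi"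
  shows "h y - h x - h' x * (y - x) \<le> (y - x)^2 / 2 * c"
proof -
  have "(y - x)^2 / 2 * (- c) \<le> - h y - - h x - - h' x * (y - x)"
    by (rule remainder_ge[where lo = lo and hi = hi]) (use c xy in \<open>auto intro!: derivative_eq_intros deriv simp: algebra_simps\<close>)
  then show ?thesis by simp
qed

text \<open>Only differences of values are used, so the choice of the additive constant does not
  matter.\<close>

definition antideriv :: "(real \<Rightarrow> real) \<Rightarrow> real \<Rightarrow> real" where
  "antideriv f = (SOME \<Phi>. \<forall>x. (\<Phi> has_real_derivative f x) (at x))"

lemma antideriv:
  assumes "continuous_on UNIV f"
  shows "(antideriv f has_real_derivative f x) (at x)"
proof -
  have "\<exists>F. \<forall>x. - \<infinity> < ereal x \<longrightarrow> ereal x < \<infinity> \<longrightarrow> (F has_vector_derivative f x) (at x)"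
    using assms by (intro einterval_antiderivative) (auto simp: continuous_on_eq_continuous_at)
  then have "\<exists>\<Phi>. \<forall>x. (\<Phi> has_real_derivative f x) (at x)"
    by (simp add: has_real_derivative_iff_has_vector_derivative)
  from someI_ex[OF this] show ?thesis unfolding antideriv_def by blast
qed

text \<open>The mean of \<open>f\<close> over \<open>(x - \<epsilon>, x + \<epsilon>)\<close>, that
  is, the convolution with the uniform density; written with an antiderivative, its derivative is
  immediate.\<close>

definition moll :: "(real \<Rightarrow> real) \<Rightarrow> real \<Rightarrow> real \<Rightarrow> real" where
  "moll f \<epsilon> x = (antideriv f (x + \<epsilon>) - antideriv f (x - \<epsilon>)) / (2 * \<epsilon>)"

definition moll' :: "(real \<Rightarrow> real) \<Rightarrow> real \<Rightarrow> real \<Rightarrow> real" where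
  "moll' f \<epsilon> x = (f (x + \<epsilon>) - f (x - \<epsilon>)) / (2 * \<epsilon>)"

text \<open>\<open>g\<close> selects a bounded subgradient of \<open>f\<close>; both the left derivative of a convex function and the sign
  function, as a subgradient of the distance to a point, are instances.\<close>

locale subgradient =
  fixes f g :: "real \<Rightarrow> real" and Kg :: real
  assumes sub: "\<And>x y. g x * (y - x) \<le> f y - f x" and bd: "\<And>x. \<bar>g x\<bar> \<le> Kg"
begin

lemma Kg_nonneg: "0 \<le> Kg"
  by (rule order_trans[OF abs_ge_zero bd])

lemma diff_le: "f y - f x \<le> g y * (y - x)"
  using sub[of y x] by (simp add: algebra_simps)

lemma g_mono: "x \<le> y \<Longrightarrow> g x \<le> g y"
proof (cases "x = y")
  case False
  assume "x \<le> y"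
  then have "0 < y - x" using False by simp
  moreover have "g x * (y - x) \<le> g y * (y - x)" using sub[of x y] diff_le[of y x] by linarith
  ultimately show ?thesis by (simp add: mult_le_cancel_right)
qed simp

lemma g_measurable [measurable]: "g \<in> borel_measurable borel"
  by (rule borel_measurable_mono) (auto intro!: monoI g_mono)

lemma f_lipschitz: "\<bar>f y - f x\<bar> \<le> Kg * \<bar>y - x\<bar>"
proof -
  have "\<bar>g z * (y - x)\<bar> \<le> Kg * \<bar>y - x\<bar>" for z unfolding abs_mult using bd by (intro mult_right_mono) auto
  from this[of x] this[of y] show ?thesis using sub[of x y] diff_le[of y x] by linarith
qed

lemma f_continuous: "continuous_on UNIV f"
proof -
  have "Kg-lipschitz_on UNIV f"
    by (rule lipschitz_onI) (use f_lipschitz Kg_nonneg in \<open>auto simp: dist_real_def\<close>)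
  then show ?thesis by (rule lipschitz_on_continuous_on)
qed

lemma f_measurable [measurable]: "f \<in> borel_measurable borel"
  by (rule borel_measurable_continuous_onI[OF f_continuous])

context
  fixes \<epsilon> :: real
  assumes \<epsilon>: "\<epsilon> > 0"
begin

lemma moll_deriv: "(moll f \<epsilon> has_real_derivative moll' f \<epsilon> x) (at x)"
proof -
  have 1: "((\<lambda>x. antideriv f (x + \<epsilon>)) has_real_derivative f (x + \<epsilon>)) (at x)"
    using antideriv[OF f_continuous, of "x + \<epsilon>"] by (simp add: DERIV_shift)
  have "((\<lambda>x. antideriv f (x + - \<epsilon>)) has_real_derivative f (x + - \<epsilon>)) (at x)"
    using antideriv[OF f_continuous, of "x + - \<epsilon>"] by (subst (asm) DERIV_shift)
  then have 2: "((\<lambda>x. antideriv f (x - \<epsilon>)) has_real_derivative f (x - \<epsilon>)) (at x)" by simp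
  show ?thesis unfolding moll_def[abs_def] moll'_def by (intro DERIV_cdivide DERIV_diff 1 2)
qed

lemma moll'_bounds: "g (x - \<epsilon>) \<le> moll' f \<epsilon> x" "moll' f \<epsilon> x \<le> g (x + \<epsilon>)"
proof -
  have "g (x - \<epsilon>) * (2 * \<epsilon>) \<le> f (x + \<epsilon>) - f (x - \<epsilon>)" using sub[of "x - \<epsilon>" "x + \<epsilon>"] by simp
  then show "g (x - \<epsilon>) \<le> moll' f \<epsilon> x" unfolding moll'_def using \<epsilon> by (simp add: field_simps)
  have "f (x + \<epsilon>) - f (x - \<epsilon>) \<le> g (x + \<epsilon>) * (2 * \<epsilon>)" using diff_le[of "x + \<epsilon>" "x - \<epsilon>"] by simp
  then show "moll' f \<epsilon> x \<le> g (x + \<epsilon>)" unfolding moll'_def using \<epsilon> by (simp add: field_simps)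
qed

lemma abs_moll'_le: "\<bar>moll' f \<epsilon> x\<bar> \<le> Kg"
  using moll'_bounds[of x] bd[of "x - \<epsilon>"] bd[of "x + \<epsilon>"] by linarith

lemma moll'_continuous: "continuous_on UNIV (moll' f \<epsilon>)"
  unfolding moll'_def using \<epsilon>
  by (intro continuous_intros continuous_on_compose2[OF f_continuous]) auto

lemma moll_continuous: "continuous_on UNIV (moll f \<epsilon>)"
  using moll_deriv by (meson DERIV_continuous continuous_at_imp_continuous_on)

lemma moll'_measurable [measurable]: "moll' f \<epsilon> \<in> borel_measurable borel"
  by (rule borel_measurable_continuous_onI[OF moll'_continuous])

lemma moll_measurable [measurable]: "moll f \<epsilon> \<in> borel_measurable borel"
  by (rule borel_measurable_continuous_onI[OF moll_continuous])

lemma moll_lipschitz: "\<bar>moll f \<epsilon> y - moll f \<epsilon> x\<bar> \<le> Kg * \<bar>y - x\<bar>"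
proof -
  have "\<bar>moll f \<epsilon> y - moll f \<epsilon> x\<bar> \<le> Kg * \<bar>y - x\<bar>" if xy: "x < y" for x y
  proof -
    obtain z where "moll f \<epsilon> y - moll f \<epsilon> x = (y - x) * moll' f \<epsilon> z" using MVT2[OF xy] moll_deriv by blast
    then show ?thesis using abs_moll'_le[of z] xy by (simp add: abs_mult mult.commute mult_right_mono)
  qed
  from this[of x y] this[of y x] show ?thesis by (cases x y rule: linorder_cases) (auto simp: abs_minus_commute)
qed

lemma moll_close: "\<bar>moll f \<epsilon> x - f x\<bar> \<le> Kg * \<epsilon>"
proof -
  have "x - \<epsilon> < x + \<epsilon>" using \<epsilon> by simp
  then obtain z where z: "x - \<epsilon> < z" "z < x + \<epsilon>" "antideriv f (x + \<epsilon>) - antideriv f (x - \<epsilon>) = ((x + \<epsilon>) - (x - \<epsilon>)) * f z"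
    using MVT2[of "x - \<epsilon>" "x + \<epsilon>" "antideriv f" f] antideriv[OF f_continuous] by blast
  then have "moll f \<epsilon> x = f z" unfolding moll_def using \<epsilon> by simp
  then have "\<bar>moll f \<epsilon> x - f x\<bar> \<le> Kg * \<bar>z - x\<bar>" using f_lipschitz by simp
  also have "\<dots> \<le> Kg * \<epsilon>" using z Kg_nonneg by (intro mult_left_mono) auto
  finally show ?thesis .
qed

text \<open>Upper and lower bounds for the second derivative of the mollified function while the
  argument stays in \<open>[lo, hi]\<close>. As \<open>g\<close> is monotone, values at the end
  points suffice, so the bounds depend measurably on the extremes of a path.\<close>

definition moll_up :: "real \<Rightarrow> real \<Rightarrow> real" where "moll_up lo hi = (g (hi + \<epsilon>) - g (lo - \<epsilon>)) / (2 * \<epsilon>)"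
definition moll_dn :: "real \<Rightarrow> real \<Rightarrow> real" where "moll_dn lo hi = (g (lo + \<epsilon>) - g (hi - \<epsilon>)) / (2 * \<epsilon>)"

lemma moll'_increment:
  assumes "lo \<le> x" "x \<le> u" "u \<le> hi"
  shows "(u - x) * moll_dn lo hi \<le> moll' f \<epsilon> u - moll' f \<epsilon> x" "moll' f \<epsilon> u - moll' f \<epsilon> x \<le> (u - x) * moll_up lo hi"
proof -
  have 1: "(u - x) * g (lo + s) \<le> f (u + s) - f (x + s)" "f (u + s) - f (x + s) \<le> (u - x) * g (hi + s)" for s
  proof -
    have "(u - x) * g (lo + s) \<le> (u - x) * g (x + s)" using assms by (intro mult_left_mono g_mono) auto
    also have "\<dots> \<le> f (u + s) - f (x + s)" using sub[of "x + s" "u + s"] by (simp add: mult.commute)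
    finally show "(u - x) * g (lo + s) \<le> f (u + s) - f (x + s)" .
    have "f (u + s) - f (x + s) \<le> (u - x) * g (u + s)" using diff_le[of "u + s" "x + s"] by (simp add: mult.commute)
    also have "\<dots> \<le> (u - x) * g (hi + s)" using assms by (intro mult_left_mono g_mono) auto
    finally show "f (u + s) - f (x + s) \<le> (u - x) * g (hi + s)" .
  qed
  have eq: "moll' f \<epsilon> u - moll' f \<epsilon> x = ((f (u + \<epsilon>) - f (x + \<epsilon>)) - (f (u - \<epsilon>) - f (x - \<epsilon>))) / (2 * \<epsilon>)"
    unfolding moll'_def by (simp add: diff_divide_distrib)
  have "(u - x) * (g (lo + \<epsilon>) - g (hi - \<epsilon>)) \<le> (f (u + \<epsilon>) - f (x + \<epsilon>)) - (f (u - \<epsilon>) - f (x - \<epsilon>))"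
    using 1(1)[of \<epsilon>] 1(2)[of "- \<epsilon>"] by (simp add: right_diff_distrib)
  then have "(u - x) * (g (lo + \<epsilon>) - g (hi - \<epsilon>)) / (2 * \<epsilon>) \<le> ((f (u + \<epsilon>) - f (x + \<epsilon>)) - (f (u - \<epsilon>) - f (x - \<epsilon>))) / (2 * \<epsilon>)"
    using \<epsilon> by (intro divide_right_mono) auto
  then show "(u - x) * moll_dn lo hi \<le> moll' f \<epsilon> u - moll' f \<epsilon> x"
    unfolding eq by (simp add: moll_dn_def)
  have "(f (u + \<epsilon>) - f (x + \<epsilon>)) - (f (u - \<epsilon>) - f (x - \<epsilon>)) \<le> (u - x) * (g (hi + \<epsilon>) - g (lo - \<epsilon>))"
    using 1(2)[of \<epsilon>] 1(1)[of "- \<epsilon>"] by (simp add: right_diff_distrib)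
  then have "((f (u + \<epsilon>) - f (x + \<epsilon>)) - (f (u - \<epsilon>) - f (x - \<epsilon>))) / (2 * \<epsilon>) \<le> (u - x) * (g (hi + \<epsilon>) - g (lo - \<epsilon>)) / (2 * \<epsilon>)"
    using \<epsilon> by (intro divide_right_mono) auto
  then show "moll' f \<epsilon> u - moll' f \<epsilon> x \<le> (u - x) * moll_up lo hi"
    unfolding eq by (simp add: moll_up_def)
qed

definition rem :: "real \<Rightarrow> real \<Rightarrow> real" where
  "rem x y = moll f \<epsilon> y - moll f \<epsilon> x - moll' f \<epsilon> x * (y - x)"

lemma rem_bounds:
  assumes "lo \<le> x" "x \<le> hi" "lo \<le> y" "y \<le> hi"
  shows "(y - x)^2 / 2 * moll_dn lo hi \<le> rem x y" "rem x y \<le> (y - x)^2 / 2 * moll_up lo hi"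
  unfolding rem_def
  using remainder_ge[OF moll_deriv moll'_increment(1) assms] remainder_le[OF moll_deriv moll'_increment(2) assms] by auto

text \<open>The second derivative of \<open>moll f \<epsilon>\<close> wherever \<open>g\<close> is
  continuous at both shifted points.\<close>

definition dens :: "real \<Rightarrow> real" where "dens x = (g (x + \<epsilon>) - g (x - \<epsilon>)) / (2 * \<epsilon>)"

lemma dens_nonneg: "0 \<le> dens x"
  unfolding dens_def using \<epsilon> by (intro divide_nonneg_pos) (auto intro: g_mono)

lemma dens_measurable [measurable]: "dens \<in> borel_measurable borel"
  unfolding dens_def by measurable

lemma dens_bounds:
  assumes "lo \<le> x" "x \<le> hi"
  shows "moll_dn lo hi \<le> dens x" "dens x \<le> moll_up lo hi"
proof -
  have "g (lo + \<epsilon>) \<le> g (x + \<epsilon>)" "g (x - \<epsilon>) \<le> g (hi - \<epsilon>)" "g (x + \<epsilon>) \<le> g (hi + \<epsilon>)" "g (lo - \<epsilon>) \<le> g (x - \<epsilon>)"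
    using assms by (auto intro!: g_mono)
  then show "moll_dn lo hi \<le> dens x" "dens x \<le> moll_up lo hi"
    unfolding moll_dn_def moll_up_def dens_def using \<epsilon> by (auto intro!: divide_right_mono)
qed

lemma abs_up_dn_le: "\<bar>moll_up lo hi\<bar> \<le> Kg / \<epsilon>" "\<bar>moll_dn lo hi\<bar> \<le> Kg / \<epsilon>" "\<bar>dens x\<bar> \<le> Kg / \<epsilon>"
proof -
  have "\<bar>(g a - g b) / (2 * \<epsilon>)\<bar> \<le> Kg / \<epsilon>" for a b
  proof -
    have "\<bar>g a - g b\<bar> \<le> 2 * Kg" using bd[of a] bd[of b] by linarith
    then have "\<bar>g a - g b\<bar> / (2 * \<epsilon>) \<le> 2 * Kg / (2 * \<epsilon>)" using \<epsilon> by (intro divide_right_mono) auto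
    then show ?thesis using \<epsilon> by simp
  qed
  then show "\<bar>moll_up lo hi\<bar> \<le> Kg / \<epsilon>" "\<bar>moll_dn lo hi\<bar> \<le> Kg / \<epsilon>" "\<bar>dens x\<bar> \<le> Kg / \<epsilon>"
    unfolding moll_up_def moll_dn_def dens_def by auto
qed

lemma up_dn_small:
  assumes c: "isCont g (x + \<epsilon>)" "isCont g (x - \<epsilon>)" and \<eta>: "\<eta> > 0"
  obtains \<delta> where "\<delta> > 0" "\<And>lo hi. x - \<delta> \<le> lo \<Longrightarrow> lo \<le> x + \<delta> \<Longrightarrow> x - \<delta> \<le> hi \<Longrightarrow> hi \<le> x + \<delta> \<Longrightarrow>
    moll_up lo hi - moll_dn lo hi \<le> \<eta>"
proof -
  \<comment> \<open>Four values of \<open>g\<close> enter, each with error \<open>\<eta>'\<close>,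
    and the quotient divides by \<open>2 * \<epsilon>\<close>.\<close>
  define \<eta>' where "\<eta>' = \<eta> * \<epsilon> / 2"
  have \<eta>': "\<eta>' > 0" unfolding \<eta>'_def using \<eta> \<epsilon> by simp
  obtain d1 where d1: "d1 > 0" "\<And>y. \<bar>y - (x + \<epsilon>)\<bar> < d1 \<Longrightarrow> \<bar>g y - g (x + \<epsilon>)\<bar> < \<eta>'"
    using c(1) \<eta>' unfolding continuous_at_eps_delta dist_real_def by blast
  obtain d2 where d2: "d2 > 0" "\<And>y. \<bar>y - (x - \<epsilon>)\<bar> < d2 \<Longrightarrow> \<bar>g y - g (x - \<epsilon>)\<bar> < \<eta>'"
    using c(2) \<eta>' unfolding continuous_at_eps_delta dist_real_def by blast
  define \<delta> where "\<delta> = min d1 d2 / 2"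
  show ?thesis
  proof (rule that[of \<delta>])
    show "\<delta> > 0" unfolding \<delta>_def using d1 d2 by simp
    fix lo hi assume h: "x - \<delta> \<le> lo" "lo \<le> x + \<delta>" "x - \<delta> \<le> hi" "hi \<le> x + \<delta>"
    have "\<delta> < d1" "\<delta> < d2" unfolding \<delta>_def using d1 d2 by auto
    then have "\<bar>g (hi + \<epsilon>) - g (x + \<epsilon>)\<bar> < \<eta>'" "\<bar>g (lo + \<epsilon>) - g (x + \<epsilon>)\<bar> < \<eta>'"
      "\<bar>g (hi - \<epsilon>) - g (x - \<epsilon>)\<bar> < \<eta>'" "\<bar>g (lo - \<epsilon>) - g (x - \<epsilon>)\<bar> < \<eta>'"
      using h by (auto intro!: d1(2) d2(2))
    then have "(g (hi + \<epsilon>) - g (lo - \<epsilon>)) - (g (lo + \<epsilon>) - g (hi - \<epsilon>)) \<le> 4 * \<eta>'" by linarith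
    then have "((g (hi + \<epsilon>) - g (lo - \<epsilon>)) - (g (lo + \<epsilon>) - g (hi - \<epsilon>))) / (2 * \<epsilon>) \<le> 4 * \<eta>' / (2 * \<epsilon>)"
      using \<epsilon> by (intro divide_right_mono) auto
    also have "4 * \<eta>' / (2 * \<epsilon>) = \<eta>" unfolding \<eta>'_def using \<epsilon> by simp
    finally show "moll_up lo hi - moll_dn lo hi \<le> \<eta>"
      unfolding moll_up_def moll_dn_def by (simp add: diff_divide_distrib)
  qed
qed

end

lemma moll'_tendsto:
  assumes "isCont g x"
  shows "(\<lambda>n. moll' f (1 / real (Suc n)) x) \<longlonglongrightarrow> g x"
proof (rule tendsto_sandwich)
  have l: "(\<lambda>n. x - 1 / real (Suc n)) \<longlonglongrightarrow> x - 0" "(\<lambda>n. x + 1 / real (Suc n)) \<longlonglongrightarrow> x + 0"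
    by (intro tendsto_intros LIMSEQ_Suc[OF lim_1_over_n])+
  show "(\<lambda>n. g (x - 1 / real (Suc n))) \<longlonglongrightarrow> g x" "(\<lambda>n. g (x + 1 / real (Suc n))) \<longlonglongrightarrow> g x"
    using isCont_tendsto_compose[OF assms] l by simp_all
qed (auto intro!: always_eventually moll'_bounds simp del: of_nat_Suc)

lemma countable_discont: "countable {x. \<not> isCont g x}"
  by (rule mono_ctble_discont) (auto intro!: monoI g_mono)

end

section \<open>Extremal values of a path on an interval\<close>

text \<open>The supremum runs over rational proportions of the interval: a countable index set that
  is independent of the end points, which may be irrational.\<close>

definition hi :: "real \<Rightarrow> real \<Rightarrow> path \<Rightarrow> real" where
  "hi u v w = (SUP q\<in>{0..1} \<inter> \<rat>. B (u + q * (v - u)) w)"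

definition lo :: "real \<Rightarrow> real \<Rightarrow> path \<Rightarrow> real" where
  "lo u v w = - (SUP q\<in>{0..1} \<inter> \<rat>. - B (u + q * (v - u)) w)"

lemma bdd_above_path:
  "bdd_above ((\<lambda>q. c * B (u + q * (v - u)) w) ` ({0..1} \<inter> \<rat>))"
proof -
  have "compact ((\<lambda>q. c * B (u + q * (v - u)) w) ` {0..1})"
    by (intro compact_continuous_image continuous_intros) auto
  then have "bdd_above ((\<lambda>q. c * B (u + q * (v - u)) w) ` {0..1})"
    by (intro bounded_imp_bdd_above compact_imp_bounded)
  then show ?thesis by (rule bdd_above_mono) auto
qed

lemma countable_unit_rats: "countable ({0..1} \<inter> \<rat> :: real set)"
  by (rule countable_Int2[OF countable_rat])

lemma measurable_hi [measurable]: "hi u v \<in> borel_measurable borel"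
  unfolding hi_def[abs_def] using bdd_above_path[of 1 u v]
  by (intro borel_measurable_cSUP countable_unit_rats) auto

lemma measurable_lo [measurable]: "lo u v \<in> borel_measurable borel"
proof -
  have "(\<lambda>w. SUP q\<in>{0..1} \<inter> \<rat>. - B (u + q * (v - u)) w) \<in> borel_measurable borel"
    using bdd_above_path[of "-1" u v] by (intro borel_measurable_cSUP countable_unit_rats) auto
  then show "lo u v \<in> borel_measurable borel" unfolding lo_def[abs_def] by measurable
qed

lemma path_le_SUP:
  assumes s: "s \<in> {u..v}"
  shows "c * B s w \<le> (SUP q\<in>{0..1} \<inter> \<rat>. c * B (u + q * (v - u)) w)"
proof -
  define q where "q = (if u = v then 0 else (s - u) / (v - u))"
  have q: "q \<in> {0..1}" "s = u + q * (v - u)" unfolding q_def using s by (auto simp: divide_le_eq_1)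
  have "c * B (u + q * (v - u)) w \<le> (SUP q\<in>{0..1} \<inter> \<rat>. c * B (u + q * (v - u)) w)"
  proof (rule le_on_rats[of 0 1 "\<lambda>q. c * B (u + q * (v - u)) w" _ q])
    show "continuous_on {0..1} (\<lambda>q. c * B (u + q * (v - u)) w)" by (intro continuous_intros)
    show "c * B (u + x * (v - u)) w \<le> (SUP q\<in>{0..1} \<inter> \<rat>. c * B (u + q * (v - u)) w)" if "x \<in> {0..1} \<inter> \<rat>" for x
      by (rule cSUP_upper[OF that bdd_above_path])
  qed (use q in auto)
  then show ?thesis unfolding q(2)[symmetric] .
qed

lemma path_bounds: "s \<in> {u..v} \<Longrightarrow> lo u v w \<le> B s w" "s \<in> {u..v} \<Longrightarrow> B s w \<le> hi u v w"
  using path_le_SUP[of s u v "-1" w] path_le_SUP[of s u v 1 w] unfolding lo_def hi_def by auto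

lemma lo_hi_near:
  assumes uv: "u \<le> v" and near: "\<And>s. s \<in> {u..v} \<Longrightarrow> \<bar>B s w - x\<bar> \<le> \<delta>"
  shows "x - \<delta> \<le> lo u v w" "lo u v w \<le> x + \<delta>" "x - \<delta> \<le> hi u v w" "hi u v w \<le> x + \<delta>"
proof -
  have ne: "{0..1} \<inter> \<rat> \<noteq> ({} :: real set)" by (metis Int_iff Rats_0 atLeastAtMost_iff empty_iff order_refl zero_le_one)
  have in_ivl: "u + q * (v - u) \<in> {u..v}" if "q \<in> {0..1}" for q
  proof -
    have "q * (v - u) \<le> 1 * (v - u)" using that uv by (intro mult_right_mono) auto
    then show ?thesis using that uv by auto
  qed
  have "hi u v w \<le> x + \<delta>" unfolding hi_def
    by (intro cSUP_least[OF ne]) (use near[OF in_ivl] in \<open>force simp: abs_le_iff\<close>)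
  moreover have "(SUP q\<in>{0..1} \<inter> \<rat>. - B (u + q * (v - u)) w) \<le> - (x - \<delta>)"
    by (intro cSUP_least[OF ne]) (use near[OF in_ivl] in \<open>force simp: abs_le_iff\<close>)
  ultimately show "x - \<delta> \<le> lo u v w" "lo u v w \<le> x + \<delta>" "x - \<delta> \<le> hi u v w" "hi u v w \<le> x + \<delta>"
    using path_bounds[of u u v w] near[of u] uv unfolding lo_def by auto
qed

section \<open>Integrals against the quadratic variation\<close>

lemma grid_locate:
  assumes s: "0 \<le> s" "s < t" and N: "N > 0"
  obtains j where "j < N" "grid 0 t N j \<le> s" "s < grid 0 t N (Suc j)"
    "\<And>a. (\<Sum>i<N. a i * indicator {grid 0 t N i..<grid 0 t N (Suc i)} s) = (a j :: real)"
proof -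
  define j where "j = nat \<lfloor>s * real N / t\<rfloor>"
  have t: "t > 0" using s by simp
  have j: "real j \<le> s * real N / t" "s * real N / t < real j + 1"
    unfolding j_def using s t by (auto simp: of_nat_nat)
  have l: "grid 0 t N j \<le> s" using j(1) t N unfolding grid_def by (simp add: field_simps)
  have r: "s < grid 0 t N (Suc j)" using j(2) t N unfolding grid_def by (simp add: field_simps)
  have "real j < real N"
  proof -
    have "s * real N / t < real N" using s t N by (simp add: divide_less_eq mult.commute)
    then show ?thesis using j(1) by linarith
  qed
  then have jN: "j < N" by simp
  have out: "indicator {grid 0 t N i..<grid 0 t N (Suc i)} s = (0::real)" if "i \<noteq> j" for i
  proof (cases "i < j")
    case True
    then have "grid 0 t N (Suc i) \<le> grid 0 t N j" using t by (intro grid_mono) auto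
    then show ?thesis using l by simp
  next
    case False
    then have "grid 0 t N (Suc j) \<le> grid 0 t N i" using t that by (intro grid_mono) auto
    then show ?thesis using r by simp
  qed
  have "(\<Sum>i<N. a i * indicator {grid 0 t N i..<grid 0 t N (Suc i)} s) = a j" for a :: "nat \<Rightarrow> real"
  proof -
    have "(\<Sum>i<N. a i * indicator {grid 0 t N i..<grid 0 t N (Suc i)} s) = (\<Sum>i<N. if i = j then a j else 0)"
      using out l r by (intro sum.cong) auto
    also have "\<dots> = a j" using jN by simp
    finally show ?thesis .
  qed
  then show ?thesis using that jN l r by blast
qed

context G_path_kernel
begin

text \<open>The integral of \<open>\<phi> (B s w)\<close> with respect to d\<langle>B\<rangle> over
  \<open>[0, t]\<close>.\<close>

definition KI :: "(real \<Rightarrow> real) \<Rightarrow> path \<Rightarrow> real" where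
  "KI \<phi> w = (\<integral>s. \<phi> (B s w) \<partial>K w)"

text \<open>The half-open grid cells do not cover the time \<open>t\<close>; as a single point it
  has measure 0.\<close>

lemma K_AE_range: "AE s in K w. 0 \<le> s \<and> s < t"
proof (rule AE_I[where N = "- {0..<t}"])
  have "emeasure (K w) (- {0..<t}) \<le> ennreal C * emeasure lborel (- {0..<t} \<inter> {0..t})" by (rule emeasure_K_le) simp
  also have "- {0..<t} \<inter> {0..t} = {t}" using t by auto
  finally show "emeasure (K w) (- {0..<t}) = 0" by simp
qed auto

lemma integrable_K_bounded:
  assumes "\<And>s. \<bar>h s\<bar> \<le> (c::real)" and "h \<in> borel_measurable borel"
  shows "integrable (K w) h"
proof -
  interpret Kw: finite_measure "K w" by (rule finite_measure_K)
  show ?thesis by (rule Kw.integrable_const_bound[of _ c]) (use assms in auto)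
qed

lemma nn_integral_KI:
  assumes [measurable]: "\<phi> \<in> borel_measurable borel" and \<phi>: "\<And>x. 0 \<le> \<phi> x" "\<And>x. \<phi> x \<le> c"
  shows "(\<integral>\<^sup>+s. ennreal (\<phi> (B s w)) \<partial>K w) = ennreal (KI \<phi> w)"
  unfolding KI_def
proof (rule nn_integral_eq_integral)
  show "integrable (K w) (\<lambda>s. \<phi> (B s w))"
    using \<phi> by (intro integrable_K_bounded[of _ c]) (auto simp: abs_le_iff intro: order_trans[of _ 0])
qed (use \<phi> in auto)

lemma KI_nonneg: "(\<And>x. 0 \<le> \<phi> x) \<Longrightarrow> 0 \<le> KI \<phi> w"
  unfolding KI_def by (intro integral_nonneg_AE) auto

lemma measurable_KI [measurable]:
  assumes [measurable]: "\<phi> \<in> borel_measurable borel" and \<phi>: "\<And>x. 0 \<le> \<phi> x"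
  shows "KI \<phi> \<in> borel_measurable borel"
proof -
  have "(\<lambda>w. \<integral>\<^sup>+s. ennreal (\<phi> (B s w)) \<partial>K w) \<in> borel_measurable borel"
    by (rule measurable_nn_integral_K[where k = "\<lambda>w. w"]) measurable
  then have "(\<lambda>w. enn2real (\<integral>\<^sup>+s. ennreal (\<phi> (B s w)) \<partial>K w)) \<in> borel_measurable borel" by measurable
  moreover have "KI \<phi> w = enn2real (\<integral>\<^sup>+s. ennreal (\<phi> (B s w)) \<partial>K w)" for w
    unfolding KI_def using \<phi> by (intro integral_eq_nn_integral) auto
  ultimately show ?thesis by (simp cong: measurable_cong)
qed

text \<open>The masses of all \<open>K w\<close> are at most \<open>C * t\<close>, so constants
  dominate the inner and the outer integral alike.\<close>

lemma iterated_dominated: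
  fixes h :: "nat \<Rightarrow> path \<Rightarrow> real \<Rightarrow> real"
  assumes meas: "\<And>n. (\<lambda>(w, s). h n w s) \<in> borel_measurable (borel \<Otimes>\<^sub>M borel)"
    and bound: "\<And>n w s. \<bar>h n w s\<bar> \<le> c"
    and lim: "AE w in P. AE s in K w. (\<lambda>n. h n w s) \<longlonglongrightarrow> 0"
  shows "(\<lambda>n. \<integral>\<^sup>+w. (\<integral>\<^sup>+s. ennreal \<bar>h n w s\<bar> \<partial>K w) \<partial>P) \<longlonglongrightarrow> 0"
proof -
  have [measurable]: "(\<lambda>s. h n w s) \<in> borel_measurable borel" for n w
    using measurable_compose[OF measurable_Pair1'[of w borel] meas[of n]] by simp
  have [measurable]: "(\<lambda>w. \<integral>\<^sup>+s. ennreal \<bar>h n w s\<bar> \<partial>K w) \<in> borel_measurable borel" for n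
    using meas[of n] by (intro measurable_nn_integral_K[where k = "\<lambda>w. w"]) (auto simp: case_prod_beta)
  have c: "0 \<le> c" by (rule order_trans[OF abs_ge_zero bound])
  have fin: "(\<integral>\<^sup>+s. ennreal c \<partial>K w) \<le> ennreal c * ennreal (C * t)" for w
    using emeasure_K_UNIV_le[of w] by (simp add: mult_left_mono)
  have "(\<lambda>n. \<integral>\<^sup>+w. (\<integral>\<^sup>+s. ennreal \<bar>h n w s\<bar> \<partial>K w) \<partial>P) \<longlonglongrightarrow> (\<integral>\<^sup>+w. 0 \<partial>P)"
  proof (rule nn_integral_dominated_convergence[where w = "\<lambda>_. ennreal c * ennreal (C * t)"])
    show "AE w in P. (\<integral>\<^sup>+s. ennreal \<bar>h n w s\<bar> \<partial>K w) \<le> ennreal c * ennreal (C * t)" for n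
    proof (rule AE_I2)
      fix w
      have "(\<integral>\<^sup>+s. ennreal \<bar>h n w s\<bar> \<partial>K w) \<le> (\<integral>\<^sup>+s. ennreal c \<partial>K w)"
        using bound by (intro nn_integral_mono ennreal_leI)
      also note fin
      finally show "(\<integral>\<^sup>+s. ennreal \<bar>h n w s\<bar> \<partial>K w) \<le> ennreal c * ennreal (C * t)" .
    qed
    show "AE w in P. (\<lambda>n. \<integral>\<^sup>+s. ennreal \<bar>h n w s\<bar> \<partial>K w) \<longlonglongrightarrow> 0"
      using lim
    proof eventually_elim
      case (elim w)
      have "(\<lambda>n. \<integral>\<^sup>+s. ennreal \<bar>h n w s\<bar> \<partial>K w) \<longlonglongrightarrow> (\<integral>\<^sup>+s. 0 \<partial>K w)"
      proof (rule nn_integral_dominated_convergence[where w = "\<lambda>_. ennreal c"])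
        show "AE s in K w. (\<lambda>n. ennreal \<bar>h n w s\<bar>) \<longlonglongrightarrow> 0"
          using elim by eventually_elim (metis ennreal_0 tendsto_ennrealI tendsto_rabs_zero)
        show "(\<integral>\<^sup>+s. ennreal c \<partial>K w) < \<infinity>"
          using fin[of w] by (rule le_less_trans) (simp add: ennreal_mult_less_top)
      qed (use bound in \<open>auto intro!: AE_I2 ennreal_leI\<close>)
      then show ?case by simp
    qed
    show "(\<integral>\<^sup>+w. ennreal c * ennreal (C * t) \<partial>P) < \<infinity>"
      using emeasure_space_1 by (simp add: ennreal_mult_less_top ennreal_mult_eq_top_iff)
  qed auto
  then show ?thesis by simp
qed

end

section \<open>Ito's formula for mollified convex functions\<close>

text \<open>Here \<open>m\<close> is the level of a coarse grid and \<open>n\<close> that of a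
  refinement: the coarse error is made small first, then for this fixed \<open>m\<close> the fine
  error vanishes.\<close>

lemma ennreal_tendsto_0_double_limit:
  fixes x :: "nat \<Rightarrow> ennreal" and a :: "nat \<Rightarrow> ennreal" and b :: "nat \<Rightarrow> nat \<Rightarrow> ennreal"
  assumes le: "\<And>m n. m \<le> n \<Longrightarrow> x n \<le> a m + b m n" and a: "a \<longlonglongrightarrow> 0" and b: "\<And>m. b m \<longlonglongrightarrow> 0"
  shows "x \<longlonglongrightarrow> 0"
proof (rule order_tendstoI)
  fix e :: ennreal assume e: "0 < e"
  obtain d where d: "d > 0" "d + d < e"
  proof (cases e)
    case (real r)
    then have "r > 0" using e by simp
    then have "ennreal (r / 3) > 0" "ennreal (r / 3) + ennreal (r / 3) < e"
      unfolding real by (simp_all add: ennreal_less_iff flip: ennreal_plus)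
    then show ?thesis by (rule that)
  next
    case top
    then show ?thesis by (intro that[of 1]) auto
  qed
  obtain m where m: "a m < d" using order_tendstoD(2)[OF a d(1)] by (auto simp: eventually_sequentially)
  show "\<forall>\<^sub>F n in sequentially. x n < e"
    using order_tendstoD(2)[OF b[of m] d(1)] eventually_ge_at_top[of m]
  proof eventually_elim
    case (elim n)
    have "x n \<le> a m + b m n" by (rule le[OF elim(2)])
    also have "\<dots> \<le> d + d" using m elim by (intro add_mono) auto
    also have "\<dots> < e" by (rule d)
    finally show ?case .
  qed
qed simp

lemma grid_refine:
  assumes "N > 0" "M > 0"
  shows "grid 0 t (N * M) (j * M + l) = grid (grid 0 t N j) (grid 0 t N (Suc j)) M l"
proof -
  have "grid 0 t N (Suc j) - grid 0 t N j = t / real N" unfolding grid_Suc by simp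
  then show ?thesis using assms unfolding grid_def by (simp add: field_simps)
qed

lemma sum_blocks: "(\<Sum>i<N * M. \<phi> i) = (\<Sum>j<N. \<Sum>l<M. \<phi> (j * M + l :: nat) :: real)"
proof -
  have "(\<Sum>j<N. \<Sum>l<M. \<phi> (j * M + l)) = (\<Sum>j<N. sum \<phi> {j * M..<j * M + M})"
  proof (rule sum.cong[OF refl])
    fix j
    show "(\<Sum>l<M. \<phi> (j * M + l)) = sum \<phi> {j * M..<j * M + M}"
      using sum.shift_bounds_nat_ivl[of \<phi> 0 "j * M" M] by (simp add: add.commute atLeast0LessThan)
  qed
  then show ?thesis using sum.nat_group[of \<phi> M N] by simp
qed

text \<open>The local time does not occur here; \<open>atomless\<close> is what is needed of it and
  is derived from its existence later. The locale is instantiated both with the given convex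
  function and with the distance to a point.\<close>

locale G_path_ito = G_path_kernel \<sigma>l \<sigma>h \<P> P Q \<G> t + subgradient f g Kg
  for \<sigma>l \<sigma>h \<P> P Q \<G> t f g Kg +
  fixes \<epsilon> :: real
  assumes \<epsilon>: "\<epsilon> > 0" and atomless: "\<And>a. AE w in P. emeasure (K w) {s. B s w = a} = 0"
begin

definition Rem :: "nat \<Rightarrow> path \<Rightarrow> real" where
  "Rem n w = (\<Sum>i<n. rem \<epsilon> (B (grid 0 t n i) w) (B (grid 0 t n (Suc i)) w))"

text \<open>The gap between the bounds for the second derivative on the coarse cell around
  \<open>s\<close>, a step function in time. Its integral controls the error of freezing the second
  derivative on coarse cells.\<close>

definition dW :: "nat \<Rightarrow> path \<Rightarrow> real \<Rightarrow> real" where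
  "dW N w s = (\<Sum>j<N. (moll_up \<epsilon> (lo (grid 0 t N j) (grid 0 t N (Suc j)) w) (hi (grid 0 t N j) (grid 0 t N (Suc j)) w) -
     moll_dn \<epsilon> (lo (grid 0 t N j) (grid 0 t N (Suc j)) w) (hi (grid 0 t N j) (grid 0 t N (Suc j)) w)) *
     indicator {grid 0 t N j..<grid 0 t N (Suc j)} s)"

lemma grid_t: "0 \<le> grid 0 t N j" "grid 0 t N j \<le> grid 0 t N (Suc j)" "j < N \<Longrightarrow> grid 0 t N (Suc j) \<le> t"
  using grid_ge[OF t] grid_le[OF t] t by (auto intro: grid_mono)

text \<open>The monotone \<open>g\<close> has countably many discontinuities; the levels at distance
  \<open>\<epsilon>\<close> from them are still countable, and each level set is null.\<close>

lemma AE_continuity: "AE w in P. AE s in K w. isCont g (B s w + \<epsilon>) \<and> isCont g (B s w - \<epsilon>)"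
proof -
  define D where "D = (\<lambda>x. x - \<epsilon>) ` {x. \<not> isCont g x} \<union> (\<lambda>x. x + \<epsilon>) ` {x. \<not> isCont g x}"
  have D: "countable D" unfolding D_def using countable_discont by auto
  have "AE w in P. \<forall>a\<in>D. emeasure (K w) {s. B s w = a} = 0"
    using atomless by (intro AE_ball_countable[OF D, THEN iffD2] ballI)
  then show ?thesis
  proof eventually_elim
    case (elim w)
    have null: "{s. B s w = a} \<in> null_sets (K w)" if "a \<in> D" for a
      using elim that by (intro null_setsI) (auto simp: pred_def[symmetric])
    have "(\<Union>a\<in>D. {s. B s w = a}) \<in> null_sets (K w)"
      using D null by (intro null_sets_UN') auto
    moreover have "B s w \<in> D" if "\<not> (isCont g (B s w + \<epsilon>) \<and> isCont g (B s w - \<epsilon>))" for s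
    proof -
      have "B s w + \<epsilon> - \<epsilon> \<in> D \<or> B s w - \<epsilon> + \<epsilon> \<in> D"
        using that unfolding D_def by blast
      then show ?thesis by simp
    qed
    then have "{s \<in> space (K w). \<not> (isCont g (B s w + \<epsilon>) \<and> isCont g (B s w - \<epsilon>))} \<subseteq> (\<Union>a\<in>D. {s. B s w = a})"
      by blast
    ultimately show ?case by (rule AE_I')
  qed
qed

lemma dW_measurable: "(\<lambda>(w, s). dW N w s) \<in> borel_measurable (borel \<Otimes>\<^sub>M borel)"
  unfolding dW_def moll_up_def[OF \<epsilon>] moll_dn_def[OF \<epsilon>] by measurable

lemma lo_le_hi: "u \<le> v \<Longrightarrow> lo u v w \<le> hi u v w"
  using path_bounds[of u u v w] by simp

lemma dW_bounds: "0 \<le> dW N w s" "\<bar>dW N w s\<bar> \<le> 2 * (Kg / \<epsilon>)"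
proof -
  have a: "0 \<le> moll_up \<epsilon> (lo u v w) (hi u v w) - moll_dn \<epsilon> (lo u v w) (hi u v w)"
    "moll_up \<epsilon> (lo u v w) (hi u v w) - moll_dn \<epsilon> (lo u v w) (hi u v w) \<le> 2 * (Kg / \<epsilon>)" if "u \<le> v" for u v
    using dens_bounds[OF \<epsilon> order_refl lo_le_hi[OF that, of w]]
      abs_up_dn_le(1)[OF \<epsilon>, of "lo u v w" "hi u v w"] abs_up_dn_le(2)[OF \<epsilon>, of "lo u v w" "hi u v w"]
    by linarith+
  show nn: "0 \<le> dW N w s" unfolding dW_def by (intro sum_nonneg mult_nonneg_nonneg a grid_t) auto
  have Kg: "0 \<le> 2 * (Kg / \<epsilon>)" using Kg_nonneg \<epsilon> by simp
  show "\<bar>dW N w s\<bar> \<le> 2 * (Kg / \<epsilon>)"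
  proof (cases "0 \<le> s \<and> s < t \<and> N > 0")
    case True
    then have s: "0 \<le> s" "s < t" "N > 0" by auto
    obtain j where j: "\<And>a. (\<Sum>i<N. a i * indicator {grid 0 t N i..<grid 0 t N (Suc i)} s) = (a j :: real)"
      by (rule grid_locate[OF s]) (rule that)
    have "dW N w s = moll_up \<epsilon> (lo (grid 0 t N j) (grid 0 t N (Suc j)) w) (hi (grid 0 t N j) (grid 0 t N (Suc j)) w) -
     moll_dn \<epsilon> (lo (grid 0 t N j) (grid 0 t N (Suc j)) w) (hi (grid 0 t N j) (grid 0 t N (Suc j)) w)"
      unfolding dW_def by (rule j)
    then show ?thesis using a[OF grid_t(2)] nn by simp
  next
    case False
    have "dW N w s = 0"
      unfolding dW_def
    proof (rule sum.neutral, safe)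
      fix j assume j: "j < N"
      then have "s \<notin> {grid 0 t N j..<grid 0 t N (Suc j)}" using False grid_t(1)[of N j] grid_t(3)[OF j] by auto
      then show "(moll_up \<epsilon> (lo (grid 0 t N j) (grid 0 t N (Suc j)) w) (hi (grid 0 t N j) (grid 0 t N (Suc j)) w) -
         moll_dn \<epsilon> (lo (grid 0 t N j) (grid 0 t N (Suc j)) w) (hi (grid 0 t N j) (grid 0 t N (Suc j)) w)) *
         indicator {grid 0 t N j..<grid 0 t N (Suc j)} s = 0" by simp
    qed
    then show ?thesis using Kg by simp
  qed
qed

lemma dW_tendsto:
  assumes s: "0 \<le> s" "s < t" and c: "isCont g (B s w + \<epsilon>)" "isCont g (B s w - \<epsilon>)"
  shows "(\<lambda>N. dW N w s) \<longlonglongrightarrow> 0"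
proof (rule LIMSEQ_I)
  fix \<eta> :: real assume \<eta>: "\<eta> > 0"
  obtain \<delta> where \<delta>: "\<delta> > 0" "\<And>lo hi. B s w - \<delta> \<le> lo \<Longrightarrow> lo \<le> B s w + \<delta> \<Longrightarrow> B s w - \<delta> \<le> hi \<Longrightarrow> hi \<le> B s w + \<delta> \<Longrightarrow>
    moll_up \<epsilon> lo hi - moll_dn \<epsilon> lo hi \<le> \<eta> / 2"
    using up_dn_small[OF \<epsilon> c, of "\<eta> / 2"] \<eta> by (metis half_gt_zero)
  have "isCont (\<lambda>s. B s w) s" using continuous_B[of w] by (simp add: continuous_on_eq_continuous_at)
  then obtain r where r: "r > 0" "\<And>s'. \<bar>s' - s\<bar> < r \<Longrightarrow> \<bar>B s' w - B s w\<bar> < \<delta>"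
    using \<delta>(1) unfolding continuous_at_eps_delta dist_real_def by blast
  obtain n0 where n0: "\<And>N. N \<ge> n0 \<Longrightarrow> t / real N < r \<and> N > 0"
    using eventually_mesh[OF t r(1)] unfolding eventually_sequentially by blast
  show "\<exists>n0. \<forall>N\<ge>n0. norm (dW N w s - 0) < \<eta>"
  proof (intro exI allI impI)
    fix N assume N: "n0 \<le> N"
    obtain j where j: "j < N" "grid 0 t N j \<le> s" "s < grid 0 t N (Suc j)"
      "\<And>a. (\<Sum>i<N. a i * indicator {grid 0 t N i..<grid 0 t N (Suc i)} s) = (a j :: real)"
      by (rule grid_locate[OF s n0[OF N, THEN conjunct2]]) (rule that)
    have near: "\<bar>B s' w - B s w\<bar> \<le> \<delta>" if "s' \<in> {grid 0 t N j..grid 0 t N (Suc j)}" for s'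
    proof -
      have "grid 0 t N (Suc j) - grid 0 t N j < r" using n0[OF N] unfolding grid_Suc by simp
      then have "\<bar>s' - s\<bar> < r" using that j(2,3) by auto
      then show ?thesis using r(2)[of s'] by simp
    qed
    have "dW N w s \<le> \<eta> / 2"
      unfolding dW_def j(4) using lo_hi_near[OF grid_t(2) near] by (intro \<delta>(2))
    then show "norm (dW N w s - 0) < \<eta>" using dW_bounds(1)[of N w s] \<eta> by simp
  qed
qed

lemma dW_integral_tendsto: "(\<lambda>N. \<integral>\<^sup>+w. (\<integral>\<^sup>+s. ennreal \<bar>dW N w s\<bar> \<partial>K w) \<partial>P) \<longlonglongrightarrow> 0"
proof (rule iterated_dominated[OF dW_measurable dW_bounds(2)])
  show "AE w in P. AE s in K w. (\<lambda>N. dW N w s) \<longlonglongrightarrow> 0"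
    using AE_continuity
  proof eventually_elim
    case (elim w)
    show ?case using elim K_AE_range[of w] by eventually_elim (auto intro: dW_tendsto)
  qed
qed

text \<open>On each of \<open>N\<close> coarse cells, refined into \<open>M\<close> pieces, the
  remainders lie between half the bounds times the realised variation. Replacing the latter by the
  increment of \<open>Q\<close> costs the second sum. The integral of the second derivative lies
  between the corresponding sums with \<open>Q\<close>, so only the gap \<open>dW\<close>
  remains.\<close>

lemma Rem_diff_le:
  assumes w: "w \<in> \<G>" and N: "N > 0" and M: "M > 0"
  shows "ennreal \<bar>Rem (N * M) w - KI (dens \<epsilon>) w / 2\<bar> \<le> (\<integral>\<^sup>+s. ennreal \<bar>dW N w s\<bar> \<partial>K w) +
    (\<Sum>j<N. ennreal (Kg / \<epsilon>) * ennreal \<bar>pvar (grid 0 t N j) (grid 0 t N (Suc j)) M w - (Q (grid 0 t N (Suc j)) w - Q (grid 0 t N j) w)\<bar>)"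
proof -
  define G where "G = grid 0 t N"
  define lw where "lw j = lo (G j) (G (Suc j)) w" for j
  define hw where "hw j = hi (G j) (G (Suc j)) w" for j
  define up where "up j = moll_up \<epsilon> (lw j) (hw j)" for j
  define dn where "dn j = moll_dn \<epsilon> (lw j) (hw j)" for j
  define p where "p j = pvar (G j) (G (Suc j)) M w" for j
  define q where "q j = Q (G (Suc j)) w - Q (G j) w" for j
  have g: "0 \<le> G j" "G j \<le> G (Suc j)" "j < N \<Longrightarrow> G (Suc j) \<le> t" for j
    unfolding G_def by (rule grid_t)+
  have q: "measure (K w) {G j..<G (Suc j)} = q j" if "j < N" for j
    unfolding q_def using measure_K_ivl[OF w g(1,2) g(3)[OF that]] .
  have ub: "\<bar>up j\<bar> \<le> Kg / \<epsilon>" "\<bar>dn j\<bar> \<le> Kg / \<epsilon>" for j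
    unfolding up_def dn_def using abs_up_dn_le[OF \<epsilon>] by auto
  define r where "r j l = rem \<epsilon> (B (grid (G j) (G (Suc j)) M l) w) (B (grid (G j) (G (Suc j)) M (Suc l)) w)" for j l
  have rem_eq: "Rem (N * M) w = (\<Sum>j<N. \<Sum>l<M. r j l)"
    unfolding Rem_def sum_blocks r_def G_def
    using grid_refine[OF N M, of t] by (simp add: add_Suc_right[symmetric] del: add_Suc_right)
  have block: "p j / 2 * dn j \<le> (\<Sum>l<M. r j l)" "(\<Sum>l<M. r j l) \<le> p j / 2 * up j" for j
  proof -
    have in_ivl: "grid (G j) (G (Suc j)) M l \<in> {G j..G (Suc j)}" if "l \<le> M" for l
      using grid_ge[OF g(2)] grid_le[OF g(2) that] by auto
    have b: "(B (grid (G j) (G (Suc j)) M (Suc l)) w - B (grid (G j) (G (Suc j)) M l) w)^2 / 2 * dn j \<le> r j l"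
      "r j l \<le> (B (grid (G j) (G (Suc j)) M (Suc l)) w - B (grid (G j) (G (Suc j)) M l) w)^2 / 2 * up j" if "l < M" for l
      unfolding r_def dn_def up_def lw_def hw_def using that
      by (intro rem_bounds[OF \<epsilon>] path_bounds in_ivl; simp)+
    have "p j / 2 * dn j = (\<Sum>l<M. (B (grid (G j) (G (Suc j)) M (Suc l)) w - B (grid (G j) (G (Suc j)) M l) w)^2 / 2 * dn j)"
      unfolding p_def pvar_def by (simp add: sum_distrib_right sum_divide_distrib)
    also have "\<dots> \<le> (\<Sum>l<M. r j l)" using b by (intro sum_mono) auto
    finally show "p j / 2 * dn j \<le> (\<Sum>l<M. r j l)" .
    have "(\<Sum>l<M. r j l) \<le> (\<Sum>l<M. (B (grid (G j) (G (Suc j)) M (Suc l)) w - B (grid (G j) (G (Suc j)) M l) w)^2 / 2 * up j)"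
      using b by (intro sum_mono) auto
    also have "\<dots> = p j / 2 * up j"
      unfolding p_def pvar_def by (simp add: sum_distrib_right sum_divide_distrib)
    finally show "(\<Sum>l<M. r j l) \<le> p j / 2 * up j" .
  qed
  define E where "E = (\<Sum>j<N. Kg / \<epsilon> * \<bar>p j - q j\<bar>)"
  have close: "\<bar>p j / 2 * a - q j / 2 * a\<bar> \<le> Kg / \<epsilon> * \<bar>p j - q j\<bar> / 2" if "\<bar>a\<bar> \<le> Kg / \<epsilon>" for a j
  proof -
    have "\<bar>p j / 2 * a - q j / 2 * a\<bar> = \<bar>a\<bar> * \<bar>p j - q j\<bar> / 2"
    proof -
      have "p j / 2 * a - q j / 2 * a = a * (p j - q j) / 2" by (simp add: field_simps)
      then show ?thesis by (simp only: abs_mult abs_divide abs_numeral)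
    qed
    also have "\<dots> \<le> Kg / \<epsilon> * \<bar>p j - q j\<bar> / 2" using that by (intro divide_right_mono mult_right_mono) auto
    finally show ?thesis .
  qed
  have Rem_ge: "(\<Sum>j<N. q j / 2 * dn j) - E / 2 \<le> Rem (N * M) w"
  proof -
    have "(\<Sum>j<N. q j / 2 * dn j) - E / 2 = (\<Sum>j<N. q j / 2 * dn j - Kg / \<epsilon> * \<bar>p j - q j\<bar> / 2)"
      unfolding E_def by (simp add: sum_subtractf sum_divide_distrib)
    also have "\<dots> \<le> (\<Sum>j<N. \<Sum>l<M. r j l)"
    proof (intro sum_mono)
      fix j show "q j / 2 * dn j - Kg / \<epsilon> * \<bar>p j - q j\<bar> / 2 \<le> (\<Sum>l<M. r j l)"
        using close[OF ub(2)[of j], of j] block(1)[of j] by linarith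
    qed
    finally show ?thesis unfolding rem_eq .
  qed
  have Rem_le: "Rem (N * M) w \<le> (\<Sum>j<N. q j / 2 * up j) + E / 2"
  proof -
    have "(\<Sum>j<N. \<Sum>l<M. r j l) \<le> (\<Sum>j<N. q j / 2 * up j + Kg / \<epsilon> * \<bar>p j - q j\<bar> / 2)"
    proof (intro sum_mono)
      fix j show "(\<Sum>l<M. r j l) \<le> q j / 2 * up j + Kg / \<epsilon> * \<bar>p j - q j\<bar> / 2"
        using close[OF ub(1)[of j], of j] block(2)[of j] by linarith
    qed
    also have "\<dots> = (\<Sum>j<N. q j / 2 * up j) + E / 2"
      unfolding E_def by (simp add: sum.distrib sum_divide_distrib)
    finally show ?thesis unfolding rem_eq .
  qed
  have step: "integrable (K w) (\<lambda>s. \<Sum>j<N. a j * indicator {G j..<G (Suc j)} s)"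
    "(\<integral>s. (\<Sum>j<N. a j * indicator {G j..<G (Suc j)} s) \<partial>K w) = (\<Sum>j<N. a j * q j)" for a :: "nat \<Rightarrow> real"
  proof -
    interpret Kw: finite_measure "K w" by (rule finite_measure_K)
    have i: "integrable (K w) (\<lambda>s. a j * indicator {G j..<G (Suc j)} s)" for j
      by (intro integrable_mult_right Kw.integrable_const_bound[of _ 1]) auto
    show "integrable (K w) (\<lambda>s. \<Sum>j<N. a j * indicator {G j..<G (Suc j)} s)"
      by (rule Bochner_Integration.integrable_sum) (rule i)
    have "(\<integral>s. (\<Sum>j<N. a j * indicator {G j..<G (Suc j)} s) \<partial>K w) = (\<Sum>j<N. \<integral>s. a j * indicator {G j..<G (Suc j)} s \<partial>K w)"
      using i by (rule Bochner_Integration.integral_sum)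
    also have "\<dots> = (\<Sum>j<N. a j * q j)"
      using q by (intro sum.cong) auto
    finally show "(\<integral>s. (\<Sum>j<N. a j * indicator {G j..<G (Suc j)} s) \<partial>K w) = (\<Sum>j<N. a j * q j)" .
  qed
  have di: "integrable (K w) (\<lambda>s. dens \<epsilon> (B s w))"
    using abs_up_dn_le(3)[OF \<epsilon>] dens_measurable[OF \<epsilon>] by (intro integrable_K_bounded[of _ "Kg / \<epsilon>"]) auto
  have KI_ge: "(\<Sum>j<N. dn j * q j) \<le> KI (dens \<epsilon>) w" and KI_le: "KI (dens \<epsilon>) w \<le> (\<Sum>j<N. up j * q j)"
  proof -
    have AE: "AE s in K w. (\<Sum>j<N. dn j * indicator {G j..<G (Suc j)} s) \<le> dens \<epsilon> (B s w) \<and>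
      dens \<epsilon> (B s w) \<le> (\<Sum>j<N. up j * indicator {G j..<G (Suc j)} s)"
      using K_AE_range[of w]
    proof eventually_elim
      case (elim s)
      then have s: "0 \<le> s" "s < t" by auto
      obtain j where j: "j < N" "G j \<le> s" "s < G (Suc j)"
        "\<And>a. (\<Sum>i<N. a i * indicator {G i..<G (Suc i)} s) = (a j :: real)"
        by (rule grid_locate[OF s N, folded G_def]) (rule that)
      have "lw j \<le> B s w" "B s w \<le> hw j" unfolding lw_def hw_def using j by (auto intro!: path_bounds)
      then show ?case unfolding j(4) dn_def up_def using dens_bounds[OF \<epsilon>] by blast
    qed
    show "(\<Sum>j<N. dn j * q j) \<le> KI (dens \<epsilon>) w"
      unfolding KI_def step(2)[symmetric] using AE by (intro integral_mono_AE step di) auto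
    show "KI (dens \<epsilon>) w \<le> (\<Sum>j<N. up j * q j)"
      unfolding KI_def step(2)[symmetric] using AE by (intro integral_mono_AE step di) auto
  qed
  have dWeq: "dW N w = (\<lambda>s. \<Sum>j<N. (up j - dn j) * indicator {G j..<G (Suc j)} s)"
    unfolding dW_def up_def dn_def lw_def hw_def G_def ..
  have D: "(\<integral>\<^sup>+s. ennreal \<bar>dW N w s\<bar> \<partial>K w) = ennreal (\<Sum>j<N. (up j - dn j) * q j)"
  proof -
    have "(\<integral>\<^sup>+s. ennreal \<bar>dW N w s\<bar> \<partial>K w) = (\<integral>\<^sup>+s. ennreal (dW N w s) \<partial>K w)"
      using dW_bounds(1) by simp
    also have "\<dots> = ennreal (\<integral>s. dW N w s \<partial>K w)"
      unfolding dWeq using dW_bounds(1)[of N w] by (intro nn_integral_eq_integral step) (auto simp: dWeq)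
    finally show ?thesis unfolding dWeq step(2) .
  qed
  have Dnn: "0 \<le> (\<Sum>j<N. (up j - dn j) * q j)"
  proof -
    have "0 \<le> (\<integral>s. dW N w s \<partial>K w)" using dW_bounds(1) by (intro integral_nonneg_AE) auto
    then show ?thesis unfolding dWeq step(2) .
  qed
  have Enn: "0 \<le> E" unfolding E_def using Kg_nonneg \<epsilon> by (intro sum_nonneg) auto
  have e1: "(\<Sum>j<N. q j / 2 * dn j) = (\<Sum>j<N. dn j * q j) / 2" "(\<Sum>j<N. q j / 2 * up j) = (\<Sum>j<N. up j * q j) / 2"
    by (simp_all add: sum_divide_distrib mult.commute)
  have e2: "(\<Sum>j<N. (up j - dn j) * q j) = (\<Sum>j<N. up j * q j) - (\<Sum>j<N. dn j * q j)"
    by (simp add: left_diff_distrib sum_subtractf)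
  \<comment> \<open>Both quantities lie between the half sums, up to \<open>E / 2\<close>, so the
    distance is at most half the gap plus \<open>E / 2\<close>; twice that is stated.\<close>
  have "\<bar>Rem (N * M) w - KI (dens \<epsilon>) w / 2\<bar> \<le> (\<Sum>j<N. (up j - dn j) * q j) + E"
    using Rem_ge Rem_le KI_ge KI_le Enn Dnn unfolding e1 e2 abs_le_iff by linarith
  then have "ennreal \<bar>Rem (N * M) w - KI (dens \<epsilon>) w / 2\<bar> \<le> ennreal ((\<Sum>j<N. (up j - dn j) * q j) + E)" by (rule ennreal_leI)
  also have "\<dots> = (\<integral>\<^sup>+s. ennreal \<bar>dW N w s\<bar> \<partial>K w) + ennreal E" unfolding D using Dnn Enn by (rule ennreal_plus)
  also have "ennreal E = (\<Sum>j<N. ennreal (Kg / \<epsilon>) * ennreal \<bar>p j - q j\<bar>)"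
  proof -
    have k: "0 \<le> Kg / \<epsilon>" using Kg_nonneg \<epsilon> by simp
    have "ennreal E = (\<Sum>j<N. ennreal (Kg / \<epsilon> * \<bar>p j - q j\<bar>))"
      unfolding E_def by (rule sum_ennreal[symmetric]) (intro mult_nonneg_nonneg k abs_ge_zero)
    also have "\<dots> = (\<Sum>j<N. ennreal (Kg / \<epsilon>) * ennreal \<bar>p j - q j\<bar>)"
      by (intro sum.cong refl ennreal_mult k abs_ge_zero)
    finally show ?thesis .
  qed
  finally show ?thesis unfolding p_def q_def G_def .
qed

lemma measurable_Rem [measurable]: "Rem n \<in> borel_measurable borel"
  unfolding Rem_def[abs_def] rem_def[OF \<epsilon>] using moll_measurable[OF \<epsilon>] moll'_measurable[OF \<epsilon>] by measurable

lemma measurable_KI_dens [measurable]: "KI (dens \<epsilon>) \<in> borel_measurable borel"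
  by (intro measurable_KI dens_measurable \<epsilon> dens_nonneg)

text \<open>Dyadic grids are nested, so level \<open>n\<close> refines every cell of level
  \<open>m\<close> into \<open>2 ^ (n - m)\<close> pieces. For fixed \<open>m\<close> the variations
  on the finitely many cells converge; the gap vanishes with \<open>m\<close>.\<close>

lemma Rem_tendsto: "(\<lambda>n. \<integral>\<^sup>+w. ennreal \<bar>Rem (2 ^ n) w - KI (dens \<epsilon>) w / 2\<bar> \<partial>P) \<longlonglongrightarrow> 0"
proof (rule ennreal_tendsto_0_double_limit)
  define p where "p m n j w = \<bar>pvar (grid 0 t (2^m) j) (grid 0 t (2^m) (Suc j)) (2 ^ (n - m)) w -
     (Q (grid 0 t (2^m) (Suc j)) w - Q (grid 0 t (2^m) j) w)\<bar>" for m n j w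
  have [measurable]: "Q (grid 0 t (2^m) j) \<in> borel_measurable borel" for m j
    by (rule measurable_Q[OF grid_t(1)])
  have [measurable]: "p m n j \<in> borel_measurable borel" for m n j unfolding p_def by measurable
  have [measurable]: "(\<lambda>w. \<integral>\<^sup>+s. ennreal \<bar>dW N w s\<bar> \<partial>K w) \<in> borel_measurable borel" for N
    using dW_measurable[of N] by (intro measurable_nn_integral_K[where k = "\<lambda>w. w"]) (auto simp: case_prod_beta)
  show "(\<integral>\<^sup>+w. ennreal \<bar>Rem (2 ^ n) w - KI (dens \<epsilon>) w / 2\<bar> \<partial>P) \<le>
    (\<integral>\<^sup>+w. (\<integral>\<^sup>+s. ennreal \<bar>dW (2 ^ m) w s\<bar> \<partial>K w) \<partial>P) + (\<Sum>j<2^m. ennreal (Kg / \<epsilon>) * (\<integral>\<^sup>+w. ennreal (p m n j w) \<partial>P))"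
    if "m \<le> n" for m n
  proof -
    have "(2::nat) ^ n = 2 ^ m * 2 ^ (n - m)" using that by (simp flip: power_add)
    then have "(\<integral>\<^sup>+w. ennreal \<bar>Rem (2 ^ n) w - KI (dens \<epsilon>) w / 2\<bar> \<partial>P) \<le>
      (\<integral>\<^sup>+w. (\<integral>\<^sup>+s. ennreal \<bar>dW (2 ^ m) w s\<bar> \<partial>K w) + (\<Sum>j<2^m. ennreal (Kg / \<epsilon>) * ennreal (p m n j w)) \<partial>P)"
      using AE_\<G> Rem_diff_le[of _ "2 ^ m" "2 ^ (n - m)"] unfolding p_def
      by (intro nn_integral_mono_AE) (auto elim!: eventually_mono)
    also have "\<dots> = (\<integral>\<^sup>+w. (\<integral>\<^sup>+s. ennreal \<bar>dW (2 ^ m) w s\<bar> \<partial>K w) \<partial>P) + (\<Sum>j<2^m. ennreal (Kg / \<epsilon>) * (\<integral>\<^sup>+w. ennreal (p m n j w) \<partial>P))"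
      by (simp add: nn_integral_add nn_integral_sum nn_integral_cmult)
    finally show ?thesis .
  qed
  show "(\<lambda>m. \<integral>\<^sup>+w. (\<integral>\<^sup>+s. ennreal \<bar>dW (2 ^ m) w s\<bar> \<partial>K w) \<partial>P) \<longlonglongrightarrow> 0"
    using LIMSEQ_subseq_LIMSEQ[OF dW_integral_tendsto, of "\<lambda>m. 2 ^ m"] by (simp add: o_def strict_mono_def)
  show "(\<lambda>n. \<Sum>j<2^m. ennreal (Kg / \<epsilon>) * (\<integral>\<^sup>+w. ennreal (p m n j w) \<partial>P)) \<longlonglongrightarrow> 0" for m
  proof -
    have "(\<lambda>n. \<integral>\<^sup>+w. ennreal (p m n j w) \<partial>P) \<longlonglongrightarrow> 0" for j
    proof -
      have "(\<lambda>M. \<integral>\<^sup>+w. ennreal \<bar>pvar (grid 0 t (2^m) j) (grid 0 t (2^m) (Suc j)) M w -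
         (Q (grid 0 t (2^m) (Suc j)) w - Q (grid 0 t (2^m) j) w)\<bar> \<partial>P) \<longlonglongrightarrow> 0"
        by (intro L2_tendsto_L1 pvar_tendsto grid_t) measurable
      moreover have "filterlim (\<lambda>n. 2 ^ (n - m) :: nat) at_top sequentially"
      proof (rule filterlim_at_top_mono[of "\<lambda>n. n - m"])
        show "filterlim (\<lambda>n. n - m) at_top sequentially" by (rule filterlim_minus_const_nat_at_top)
      qed (auto intro!: always_eventually less_imp_le simp: less_exp)
      ultimately show ?thesis unfolding p_def by (rule filterlim_compose)
    qed
    then have "(\<lambda>n. \<Sum>j<2^m. ennreal (Kg / \<epsilon>) * (\<integral>\<^sup>+w. ennreal (p m n j w) \<partial>P)) \<longlonglongrightarrow> (\<Sum>j<(2::nat)^m. ennreal (Kg / \<epsilon>) * 0)"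
      by (intro tendsto_sum ennreal_tendsto_cmult) auto
    then show ?thesis by simp
  qed
qed

end

lemma ennreal_square_sum_le: "(x + y)^2 \<le> 2 * x^2 + 2 * (y::ennreal)^2"
proof (cases x; cases y)
  fix a b :: real assume ab: "0 \<le> a" "x = ennreal a" "0 \<le> b" "y = ennreal b"
  have "(a + b)^2 \<le> 2 * a^2 + 2 * b^2"
    using zero_le_power2[of "a - b"] unfolding power2_sum power2_diff by linarith
  then have "ennreal ((a + b)^2) \<le> ennreal (2 * a^2 + 2 * b^2)" by (rule ennreal_leI)
  then show ?thesis using ab by (simp add: ennreal_power[symmetric] ennreal_plus ennreal_mult)
qed (auto simp: power2_eq_square ennreal_mult_top ennreal_top_mult)

lemma nn_integral_abs_triangle:
  fixes X Y Z :: "'a \<Rightarrow> real"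
  assumes [measurable]: "X \<in> borel_measurable M" "Y \<in> borel_measurable M" "Z \<in> borel_measurable M"
  shows "(\<integral>\<^sup>+w. ennreal \<bar>X w - Z w\<bar> \<partial>M) \<le> (\<integral>\<^sup>+w. ennreal \<bar>X w - Y w\<bar> \<partial>M) + (\<integral>\<^sup>+w. ennreal \<bar>Y w - Z w\<bar> \<partial>M)"
proof -
  have "(\<integral>\<^sup>+w. ennreal \<bar>X w - Z w\<bar> \<partial>M) \<le> (\<integral>\<^sup>+w. ennreal \<bar>X w - Y w\<bar> + ennreal \<bar>Y w - Z w\<bar> \<partial>M)"
    by (intro nn_integral_mono) (simp flip: ennreal_plus)
  also have "\<dots> = (\<integral>\<^sup>+w. ennreal \<bar>X w - Y w\<bar> \<partial>M) + (\<integral>\<^sup>+w. ennreal \<bar>Y w - Z w\<bar> \<partial>M)"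
    by (rule nn_integral_add) auto
  finally show ?thesis .
qed

section \<open>Distance between a stochastic integral and an elementary one\<close>

context G_path_kernel
begin



text \<open>The squared norm with respect to \<open>P\<close> and d\<langle>B\<rangle>, the right
  side of the isometry.\<close>

definition EK :: "(path \<Rightarrow> real \<Rightarrow> real) \<Rightarrow> ennreal" where
  "EK h = (\<integral>\<^sup>+w. (\<integral>\<^sup>+s. ennreal ((h w s)^2) \<partial>K w) \<partial>P)"

lemma EK_sum_le:
  assumes h: "(\<lambda>(w, s). h w s) \<in> borel_measurable (borel \<Otimes>\<^sub>M borel)" and h': "(\<lambda>(w, s). h' w s) \<in> borel_measurable (borel \<Otimes>\<^sub>M borel)"
  shows "EK (\<lambda>w s. h w s + h' w s) \<le> 2 * EK h + 2 * EK h'"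
proof -
  have m: "(\<lambda>s. k w s) \<in> borel_measurable borel" if "(\<lambda>(w, s). k w s) \<in> borel_measurable (borel \<Otimes>\<^sub>M borel)" for k :: "path \<Rightarrow> real \<Rightarrow> real" and w
    using measurable_compose[OF measurable_Pair1'[of w borel] that] by simp
  note [measurable] = m[OF h] m[OF h']
  have [measurable]: "(\<lambda>w. \<integral>\<^sup>+s. ennreal ((h w s)^2) \<partial>K w) \<in> borel_measurable borel"
    "(\<lambda>w. \<integral>\<^sup>+s. ennreal ((h' w s)^2) \<partial>K w) \<in> borel_measurable borel"
    using h h' by (intro measurable_nn_integral_K[where k = "\<lambda>w. w"]; simp add: case_prod_beta)+
  have "EK (\<lambda>w s. h w s + h' w s) \<le>
      (\<integral>\<^sup>+w. 2 * (\<integral>\<^sup>+s. ennreal ((h w s)^2) \<partial>K w) + 2 * (\<integral>\<^sup>+s. ennreal ((h' w s)^2) \<partial>K w) \<partial>P)"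
    unfolding EK_def by (intro nn_integral_mono nn_integral_square_sum_le) auto
  also have "\<dots> = 2 * EK h + 2 * EK h'"
    unfolding EK_def by (simp add: nn_integral_add nn_integral_cmult)
  finally show ?thesis .
qed

lemma EK_bound:
  assumes "\<And>w s. \<bar>h w s\<bar> \<le> c"
  shows "EK h \<le> ennreal (c^2 * (C * t))"
proof -
  have c: "0 \<le> c" by (rule order_trans[OF abs_ge_zero assms])
  have "(\<integral>\<^sup>+s. ennreal ((h w s)^2) \<partial>K w) \<le> ennreal (c^2 * (C * t))" for w
  proof -
    have "(h w s)^2 \<le> c^2" for s using power_mono[OF assms[of w s], of 2] by simp
    then have "(\<integral>\<^sup>+s. ennreal ((h w s)^2) \<partial>K w) \<le> (\<integral>\<^sup>+s. ennreal (c^2) \<partial>K w)"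
      by (intro nn_integral_mono ennreal_leI)
    also have "\<dots> \<le> ennreal (c^2) * ennreal (C * t)" using emeasure_K_UNIV_le[of w] by (simp add: mult_left_mono)
    also have "\<dots> = ennreal (c^2 * (C * t))" using C_pos t by (intro ennreal_mult[symmetric]) auto
    finally show ?thesis .
  qed
  then have "EK h \<le> (\<integral>\<^sup>+w. ennreal (c^2 * (C * t)) \<partial>P)" unfolding EK_def by (intro nn_integral_mono)
  then show ?thesis using emeasure_space_1 by simp
qed

lemma EK_tendsto_0:
  assumes meas: "\<And>n. (\<lambda>(w, s). h n w s) \<in> borel_measurable (borel \<Otimes>\<^sub>M borel)"
    and bound: "\<And>n w s. \<bar>h n w s\<bar> \<le> c"
    and lim: "AE w in P. AE s in K w. (\<lambda>n. h n w s) \<longlonglongrightarrow> 0"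
  shows "(\<lambda>n. EK (h n)) \<longlonglongrightarrow> 0"
proof -
  have "(\<lambda>n. \<integral>\<^sup>+w. (\<integral>\<^sup>+s. ennreal \<bar>(h n w s)^2\<bar> \<partial>K w) \<partial>P) \<longlonglongrightarrow> 0"
  proof (rule iterated_dominated[where c = "c^2"])
    show "(\<lambda>(w, s). (h n w s)^2) \<in> borel_measurable (borel \<Otimes>\<^sub>M borel)" for n
      using meas[of n] by (simp add: case_prod_beta)
    show "\<bar>(h n w s)^2\<bar> \<le> c^2" for n w s using power_mono[OF bound[of n w s], of 2] by simp
    have "(\<lambda>n. (x n)^2) \<longlonglongrightarrow> 0" if "x \<longlonglongrightarrow> 0" for x :: "nat \<Rightarrow> real"
      using tendsto_power[OF that, of 2] by simp
    note sq = this
    show "AE w in P. AE s in K w. (\<lambda>n. (h n w s)^2) \<longlonglongrightarrow> 0"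
      using lim by (rule eventually_mono) (auto elim!: eventually_mono intro: sq)
  qed
  then show ?thesis unfolding EK_def by simp
qed

lemma simple_process_measurable:
  assumes "simple_data t n \<tau> \<xi>"
  shows "(\<lambda>(w, s). simple_process n \<tau> \<xi> s w) \<in> borel_measurable (borel \<Otimes>\<^sub>M borel)"
    "simple_integral n \<tau> \<xi> \<in> borel_measurable borel"
proof -
  have el: "elementary {..<n} \<tau> (\<lambda>j. \<tau> (Suc j)) \<xi>" by (rule elementary_simple(1)[OF assms])
  have m: "\<xi> j \<in> borel_measurable borel" if "j < n" for j
    using el that measurable_path_filtration_borel[OF L_bD(1)] unfolding elementary_def by auto
  show "(\<lambda>(w, s). simple_process n \<tau> \<xi> s w) \<in> borel_measurable (borel \<Otimes>\<^sub>M borel)"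
    unfolding simple_process_def case_prod_beta
  proof (rule borel_measurable_sum)
    fix j assume "j \<in> {..<n}"
    then have [measurable]: "\<xi> j \<in> borel_measurable borel" using m by simp
    show "(\<lambda>x. \<xi> j (fst x) * indicator {\<tau> j..<\<tau> (Suc j)} (snd x)) \<in> borel_measurable (borel \<Otimes>\<^sub>M borel)" by measurable
  qed
  show "simple_integral n \<tau> \<xi> \<in> borel_measurable borel"
    unfolding simple_integral_def[abs_def]
  proof (rule borel_measurable_sum)
    fix j assume "j \<in> {..<n}"
    then have [measurable]: "\<xi> j \<in> borel_measurable borel" using m by simp
    show "(\<lambda>w. \<xi> j w * (B (\<tau> (Suc j)) w - B (\<tau> j) w)) \<in> borel_measurable borel" by measurable
  qed
qed

text \<open>The simple processes that define the integral converge in the dt norm uniformly over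
  \<open>\<P>\<close>, hence under \<open>P\<close> in \<open>EK\<close> by domination; the isometry
  for differences passes to the limit. Splitting squares twice accounts for the factor 4.\<close>

lemma stoch_integral_distance:
  fixes \<eta> :: "path \<Rightarrow> real \<Rightarrow> real"
  assumes int: "has_stoch_integral \<P> t (\<lambda>s w. \<eta> w s) Y"
    and \<eta>: "(\<lambda>(w, s). \<eta> w s) \<in> borel_measurable (borel \<Otimes>\<^sub>M borel)"
    and el: "elementary I u v \<xi>" 
    and pm: "(\<lambda>(w, s). elem_proc I u v \<xi> w s) \<in> borel_measurable (borel \<Otimes>\<^sub>M borel)"
    and im [measurable]: "elem_int I u v \<xi> \<in> borel_measurable borel"
  shows "(\<integral>\<^sup>+w. ennreal ((Y w - elem_int I u v \<xi> w)^2) \<partial>P) \<le> 4 * EK (\<lambda>w s. \<eta> w s - elem_proc I u v \<xi> w s)"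
proof -
  obtain n \<tau> \<zeta> where sd: "\<And>k. simple_data t (n k) (\<tau> k) (\<zeta> k)"
    and lim1: "(\<lambda>k. M_norm_pow \<P> 2 t (\<lambda>s w. simple_process (n k) (\<tau> k) (\<zeta> k) s w - \<eta> w s)) \<longlonglongrightarrow> 0"
    and lim2: "(\<lambda>k. Lp_norm_pow \<P> 2 (\<lambda>w. simple_integral (n k) (\<tau> k) (\<zeta> k) w - Y w)) \<longlonglongrightarrow> 0"
    and [measurable]: "Y \<in> borel_measurable borel"
    using int unfolding has_stoch_integral_def by blast
  define \<theta> where "\<theta> k w s = simple_process (n k) (\<tau> k) (\<zeta> k) s w" for k w s
  define S where "S k = simple_integral (n k) (\<tau> k) (\<zeta> k)" for k
  have \<theta>m: "(\<lambda>(w, s). \<theta> k w s) \<in> borel_measurable (borel \<Otimes>\<^sub>M borel)" and [measurable]: "S k \<in> borel_measurable borel" for k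
    unfolding \<theta>_def S_def using simple_process_measurable[OF sd] by auto
  define \<Theta> where "\<Theta> w s = elem_proc I u v \<xi> w s" for w s
  have pm': "(\<lambda>(w, s). \<Theta> w s) \<in> borel_measurable (borel \<Otimes>\<^sub>M borel)" using pm unfolding \<Theta>_def .
  define Z where "Z = elem_int I u v \<xi>"
  have [measurable]: "Z \<in> borel_measurable borel" unfolding Z_def by measurable
  have diffm: "(\<lambda>(w, s). \<theta> k w s - \<eta> w s) \<in> borel_measurable (borel \<Otimes>\<^sub>M borel)"
    "(\<lambda>(w, s). \<eta> w s - \<Theta> w s) \<in> borel_measurable (borel \<Otimes>\<^sub>M borel)" for k
    using \<theta>m[of k] \<eta> pm' by (simp_all add: case_prod_beta)
  have le: "(\<integral>\<^sup>+w. ennreal ((Y w - Z w)^2) \<partial>P) \<le> 2 * Lp_norm_pow \<P> 2 (\<lambda>w. S k w - Y w) +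
      4 * (ennreal C * M_norm_pow \<P> 2 t (\<lambda>s w. \<theta> k w s - \<eta> w s)) + 4 * EK (\<lambda>w s. \<eta> w s - \<Theta> w s)" for k
  proof -
    have 1: "(\<integral>\<^sup>+w. ennreal ((Y w - Z w)^2) \<partial>P) \<le> 2 * (\<integral>\<^sup>+w. ennreal ((Y w - S k w)^2) \<partial>P) + 2 * (\<integral>\<^sup>+w. ennreal ((S k w - Z w)^2) \<partial>P)"
      using nn_integral_square_sum_le[of "\<lambda>w. Y w - S k w" P "\<lambda>w. S k w - Z w"] by simp
    have 2: "(\<integral>\<^sup>+w. ennreal ((Y w - S k w)^2) \<partial>P) \<le> Lp_norm_pow \<P> 2 (\<lambda>w. S k w - Y w)"
      using nn_integral_le_Lp_norm_pow[of "\<lambda>w. S k w - Y w"] by (simp add: power2_commute)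
    have 3: "(\<integral>\<^sup>+w. ennreal ((S k w - Z w)^2) \<partial>P) = EK (\<lambda>w s. \<theta> k w s - \<Theta> w s)"
      using elementary_isometry_diff[OF elementary_simple(1)[OF sd] el]
      unfolding EK_def S_def \<theta>_def Z_def \<Theta>_def elementary_simple(2)[OF sd] elementary_simple(3)[OF sd] .
    have "EK (\<lambda>w s. \<theta> k w s - \<Theta> w s) = EK (\<lambda>w s. (\<theta> k w s - \<eta> w s) + (\<eta> w s - \<Theta> w s))" by simp
    also have "\<dots> \<le> 2 * EK (\<lambda>w s. \<theta> k w s - \<eta> w s) + 2 * EK (\<lambda>w s. \<eta> w s - \<Theta> w s)"
      by (rule EK_sum_le[OF diffm])
    finally have 4: "EK (\<lambda>w s. \<theta> k w s - \<Theta> w s) \<le> 2 * EK (\<lambda>w s. \<theta> k w s - \<eta> w s) + 2 * EK (\<lambda>w s. \<eta> w s - \<Theta> w s)" .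
    have 5: "EK (\<lambda>w s. \<theta> k w s - \<eta> w s) \<le> ennreal C * M_norm_pow \<P> 2 t (\<lambda>s w. \<theta> k w s - \<eta> w s)"
    proof -
      define H where "H w = (\<integral>\<^sup>+s\<in>{0..t}. ennreal ((\<theta> k w s - \<eta> w s)^2) \<partial>lborel)" for w
      have "(\<lambda>(w, s). ennreal ((\<theta> k w s - \<eta> w s)^2) * indicator {0..t} s) \<in> borel_measurable (borel \<Otimes>\<^sub>M lborel)"
        using diffm(1)[of k] by (simp add: case_prod_beta)
      then have [measurable]: "H \<in> borel_measurable borel"
        unfolding H_def[abs_def] using lborel.borel_measurable_nn_integral[of "\<lambda>w s. ennreal ((\<theta> k w s - \<eta> w s)^2) * indicator {0..t} s" borel] by simp
      have sm: "(\<lambda>s. \<theta> k w s - \<eta> w s) \<in> borel_measurable borel" for w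
        using measurable_compose[OF measurable_Pair1'[of w borel] diffm(1)[of k]] by simp
      have "EK (\<lambda>w s. \<theta> k w s - \<eta> w s) \<le> (\<integral>\<^sup>+w. ennreal C * H w \<partial>P)"
        unfolding EK_def H_def
        by (intro nn_integral_mono nn_integral_K_le measurable_compose[OF sm, of "\<lambda>x. ennreal (x^2)"]) measurable
      also have "\<dots> = ennreal C * (\<integral>\<^sup>+w. H w \<partial>P)" by (rule nn_integral_cmult) measurable
      also have "(\<integral>\<^sup>+w. H w \<partial>P) \<le> M_norm_pow \<P> 2 t (\<lambda>s w. \<theta> k w s - \<eta> w s)"
        unfolding M_norm_pow_def upper_nn_exp_def H_def by (rule SUP_upper2[OF P_in]) simp
      finally show ?thesis by (simp add: mult_left_mono)
    qed
    have "(\<integral>\<^sup>+w. ennreal ((Y w - Z w)^2) \<partial>P) \<le> 2 * Lp_norm_pow \<P> 2 (\<lambda>w. S k w - Y w) +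
      2 * (2 * (ennreal C * M_norm_pow \<P> 2 t (\<lambda>s w. \<theta> k w s - \<eta> w s)) + 2 * EK (\<lambda>w s. \<eta> w s - \<Theta> w s))"
      by (rule order_trans[OF 1], unfold 3) (intro add_mono mult_left_mono 2 order_trans[OF 4] 5; simp)
    also have "\<dots> = 2 * Lp_norm_pow \<P> 2 (\<lambda>w. S k w - Y w) +
      4 * (ennreal C * M_norm_pow \<P> 2 t (\<lambda>s w. \<theta> k w s - \<eta> w s)) + 4 * EK (\<lambda>w s. \<eta> w s - \<Theta> w s)"
      by (simp add: distrib_left mult.assoc[symmetric] add.assoc)
    finally show ?thesis .
  qed
  have "(\<lambda>k. 2 * Lp_norm_pow \<P> 2 (\<lambda>w. S k w - Y w) +
      4 * (ennreal C * M_norm_pow \<P> 2 t (\<lambda>s w. \<theta> k w s - \<eta> w s)) + 4 * EK (\<lambda>w s. \<eta> w s - \<Theta> w s)) \<longlonglongrightarrow>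
      2 * 0 + 4 * (ennreal C * 0) + 4 * EK (\<lambda>w s. \<eta> w s - \<Theta> w s)"
    using lim1 lim2 unfolding S_def \<theta>_def
    by (intro tendsto_add ennreal_tendsto_cmult tendsto_const) (auto simp: ennreal_mult_less_top)
  then have "(\<integral>\<^sup>+w. ennreal ((Y w - Z w)^2) \<partial>P) \<le> 2 * 0 + 4 * (ennreal C * 0) + 4 * EK (\<lambda>w s. \<eta> w s - \<Theta> w s)"
    by (rule LIMSEQ_le_const) (use le in auto)
  then show ?thesis unfolding Z_def \<Theta>_def by simp
qed

end

section \<open>Ito's formula and a uniform bound\<close>

context G_path_ito
begin

text \<open>Sums with the integrand at left end points: this makes them elementary integrals, and up
  to the Taylor remainders they telescope.\<close>

definition Sig :: "nat \<Rightarrow> path \<Rightarrow> real" where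
  "Sig n = elem_int {..<n} (grid 0 t n) (\<lambda>i. grid 0 t n (Suc i)) (\<lambda>i w. moll' f \<epsilon> (B (grid 0 t n i) w))"

definition Thet :: "nat \<Rightarrow> path \<Rightarrow> real \<Rightarrow> real" where
  "Thet n = elem_proc {..<n} (grid 0 t n) (\<lambda>i. grid 0 t n (Suc i)) (\<lambda>i w. moll' f \<epsilon> (B (grid 0 t n i) w))"

text \<open>The value that Ito's formula assigns to the stochastic integral of
  \<open>moll' f \<epsilon> (B s w)\<close>, defined pathwise so that no integral of this process
  has to be constructed.\<close>

definition J :: "path \<Rightarrow> real" where
  "J w = moll f \<epsilon> (B t w) - moll f \<epsilon> 0 - KI (dens \<epsilon>) w / 2"

lemmas moll_meas [measurable] = moll_measurable[OF \<epsilon>] moll'_measurable[OF \<epsilon>]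

lemma measurable_Sig [measurable]: "Sig n \<in> borel_measurable borel"
  unfolding Sig_def elem_int_def[abs_def] by measurable

lemma measurable_J [measurable]: "J \<in> borel_measurable borel"
  unfolding J_def[abs_def] by measurable

lemma Thet_measurable: "(\<lambda>(w, s). Thet n w s) \<in> borel_measurable (borel \<Otimes>\<^sub>M borel)"
  unfolding Thet_def elem_proc_def by measurable

lemma elementary_Sig: "elementary {..<n} (grid 0 t n) (\<lambda>i. grid 0 t n (Suc i)) (\<lambda>i w. moll' f \<epsilon> (B (grid 0 t n i) w))"
  unfolding elementary_def
proof (intro conjI ballI)
  fix i assume i: "i \<in> {..<n}"
  show "(\<lambda>w. moll' f \<epsilon> (B (grid 0 t n i) w)) \<in> L_b (grid 0 t n i)"
    unfolding L_b_def
  proof (safe)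
    show "(\<lambda>w. moll' f \<epsilon> (B (grid 0 t n i) w)) \<in> borel_measurable (path_filtration (grid 0 t n i))"
      by (rule measurable_compose[OF measurable_B_path_filtration[OF grid_t(1) order_refl]]) measurable
    show "bounded (range (\<lambda>w. moll' f \<epsilon> (B (grid 0 t n i) w)))"
      using abs_moll'_le[OF \<epsilon>] by (intro boundedI[of _ Kg]) auto
  qed
qed (auto simp: grid_t)

lemma Sig_eq: "n > 0 \<Longrightarrow> Sig n w = moll f \<epsilon> (B t w) - moll f \<epsilon> 0 - Rem n w"
proof -
  assume n: "n > 0"
  have "Rem n w + Sig n w = (\<Sum>i<n. moll f \<epsilon> (B (grid 0 t n (Suc i)) w) - moll f \<epsilon> (B (grid 0 t n i) w))"
    unfolding Rem_def Sig_def elem_int_def rem_def[OF \<epsilon>] by (simp flip: sum.distrib)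
  also have "\<dots> = moll f \<epsilon> (B t w) - moll f \<epsilon> 0"
    using n sum_lessThan_telescope[of "\<lambda>i. moll f \<epsilon> (B (grid 0 t n i) w)" n] by (simp add: grid_n)
  finally show ?thesis by simp
qed

lemma Sig_tendsto: "(\<lambda>n. \<integral>\<^sup>+w. ennreal \<bar>Sig (2 ^ n) w - J w\<bar> \<partial>P) \<longlonglongrightarrow> 0"
proof -
  have "\<bar>Sig (2 ^ n) w - J w\<bar> = \<bar>Rem (2 ^ n) w - KI (dens \<epsilon>) w / 2\<bar>" for n w
    unfolding J_def using Sig_eq[of "2 ^ n" w] by simp
  then show ?thesis using Rem_tendsto by simp
qed

lemma Thet_bound: "\<bar>Thet n w s\<bar> \<le> Kg"
proof (cases "0 \<le> s \<and> s < t \<and> n > 0")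
  case True
  then have s: "0 \<le> s" "s < t" "n > 0" by auto
  obtain j where j: "\<And>a. (\<Sum>i<n. a i * indicator {grid 0 t n i..<grid 0 t n (Suc i)} s) = (a j :: real)"
    by (rule grid_locate[OF s]) (rule that)
  show ?thesis unfolding Thet_def elem_proc_def j by (rule abs_moll'_le[OF \<epsilon>])
next
  case False
  have "Thet n w s = 0"
    unfolding Thet_def elem_proc_def
  proof (rule sum.neutral, safe)
    fix j assume j: "j < n"
    then have "s \<notin> {grid 0 t n j..<grid 0 t n (Suc j)}" using False grid_t(1)[of n j] grid_t(3)[OF j] by auto
    then show "moll' f \<epsilon> (B (grid 0 t n j) w) * indicator {grid 0 t n j..<grid 0 t n (Suc j)} s = 0" by simp
  qed
  then show ?thesis using Kg_nonneg by simp
qed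

lemma Thet_tendsto:
  assumes s: "0 \<le> s" "s < t"
  shows "(\<lambda>n. Thet n w s - moll' f \<epsilon> (B s w)) \<longlonglongrightarrow> 0"
proof (rule LIMSEQ_I)
  fix \<eta> :: real assume \<eta>: "\<eta> > 0"
  have "continuous_on UNIV (\<lambda>s. moll' f \<epsilon> (B s w))"
    by (rule continuous_on_compose2[OF moll'_continuous[OF \<epsilon>] continuous_B]) auto
  then have "isCont (\<lambda>s. moll' f \<epsilon> (B s w)) s" by (simp add: continuous_on_eq_continuous_at)
  then obtain r where r: "r > 0" "\<And>s'. \<bar>s' - s\<bar> < r \<Longrightarrow> \<bar>moll' f \<epsilon> (B s' w) - moll' f \<epsilon> (B s w)\<bar> < \<eta>"
    using \<eta> unfolding continuous_at_eps_delta dist_real_def by blast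
  obtain n0 where n0: "\<And>N. N \<ge> n0 \<Longrightarrow> t / real N < r \<and> N > 0"
    using eventually_mesh[OF t r(1)] unfolding eventually_sequentially by blast
  show "\<exists>n0. \<forall>N\<ge>n0. norm (Thet N w s - moll' f \<epsilon> (B s w) - 0) < \<eta>"
  proof (intro exI allI impI)
    fix N assume N: "n0 \<le> N"
    obtain j where j: "j < N" "grid 0 t N j \<le> s" "s < grid 0 t N (Suc j)"
      "\<And>a. (\<Sum>i<N. a i * indicator {grid 0 t N i..<grid 0 t N (Suc i)} s) = (a j :: real)"
      by (rule grid_locate[OF s n0[OF N, THEN conjunct2]]) (rule that)
    have "grid 0 t N (Suc j) - grid 0 t N j < r" using n0[OF N] unfolding grid_Suc by simp
    then have "\<bar>grid 0 t N j - s\<bar> < r" using j(2,3) by auto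
    then show "norm (Thet N w s - moll' f \<epsilon> (B s w) - 0) < \<eta>"
      unfolding Thet_def elem_proc_def j(4) using r(2) by simp
  qed
qed

lemma moll'_B_measurable: "(\<lambda>(w, s). moll' f \<epsilon> (B s w)) \<in> borel_measurable (borel \<Otimes>\<^sub>M borel)"
  by measurable

lemma EK_Thet_tendsto: "(\<lambda>n. EK (\<lambda>w s. Thet n w s - moll' f \<epsilon> (B s w))) \<longlonglongrightarrow> 0"
proof (rule EK_tendsto_0)
  show "(\<lambda>(w, s). Thet n w s - moll' f \<epsilon> (B s w)) \<in> borel_measurable (borel \<Otimes>\<^sub>M borel)" for n
    using Thet_measurable[of n] moll'_B_measurable by (simp add: case_prod_beta)
  show "\<bar>Thet n w s - moll' f \<epsilon> (B s w)\<bar> \<le> 2 * Kg" for n w s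
    using Thet_bound[of n w s] abs_moll'_le[OF \<epsilon>, of "B s w"] by linarith
  show "AE w in P. AE s in K w. (\<lambda>n. Thet n w s - moll' f \<epsilon> (B s w)) \<longlonglongrightarrow> 0"
    by (intro AE_I2 eventually_mono[OF K_AE_range]) (auto intro: Thet_tendsto)
qed

text \<open>Elementary sums link the two sides: they are close to \<open>Y\<close> by the isometry
  and to \<open>J\<close> by Taylor expansion, the latter in \<open>L^1\<close> only. The constant
  is \<open>2 * 4 * 2\<close>, from the square of a sum, the distance estimate and splitting
  \<open>EK\<close>.\<close>

lemma Ito_distance:
  fixes \<eta> :: "path \<Rightarrow> real \<Rightarrow> real"
  assumes int: "has_stoch_integral \<P> t (\<lambda>s w. \<eta> w s) Y"
    and \<eta>: "(\<lambda>(w, s). \<eta> w s) \<in> borel_measurable (borel \<Otimes>\<^sub>M borel)"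
  shows "(\<integral>\<^sup>+w. ennreal \<bar>Y w - J w\<bar> \<partial>P)^2 \<le> 16 * EK (\<lambda>w s. \<eta> w s - moll' f \<epsilon> (B s w))"
proof -
  have [measurable]: "Y \<in> borel_measurable borel" using int unfolding has_stoch_integral_def by blast
  define a where "a n = (\<integral>\<^sup>+w. ennreal \<bar>Sig (2 ^ n) w - J w\<bar> \<partial>P)" for n
  define b where "b n = EK (\<lambda>w s. Thet (2 ^ n) w s - moll' f \<epsilon> (B s w))" for n
  define e where "e = EK (\<lambda>w s. \<eta> w s - moll' f \<epsilon> (B s w))"
  have le: "(\<integral>\<^sup>+w. ennreal \<bar>Y w - J w\<bar> \<partial>P)^2 \<le> 16 * e + 16 * b n + 2 * (a n)^2" for n
  proof -
    have "(\<integral>\<^sup>+w. ennreal \<bar>Y w - J w\<bar> \<partial>P)^2 \<le> ((\<integral>\<^sup>+w. ennreal \<bar>Y w - Sig (2 ^ n) w\<bar> \<partial>P) + a n)^2"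
      unfolding a_def by (intro power_mono nn_integral_abs_triangle) auto
    also have "\<dots> \<le> 2 * (\<integral>\<^sup>+w. ennreal \<bar>Y w - Sig (2 ^ n) w\<bar> \<partial>P)^2 + 2 * (a n)^2" by (rule ennreal_square_sum_le)
    also have "(\<integral>\<^sup>+w. ennreal \<bar>Y w - Sig (2 ^ n) w\<bar> \<partial>P)^2 \<le> (\<integral>\<^sup>+w. ennreal ((Y w - Sig (2 ^ n) w)^2) \<partial>P)"
      by (rule nn_integral_abs_square_le) measurable
    also have "\<dots> \<le> 4 * EK (\<lambda>w s. \<eta> w s - Thet (2 ^ n) w s)"
      unfolding Sig_def Thet_def
      by (rule stoch_integral_distance[OF int \<eta> elementary_Sig])
        (use Thet_measurable[of "2 ^ n"] measurable_Sig[of "2 ^ n"] in \<open>auto simp: Thet_def Sig_def\<close>)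
    also have "EK (\<lambda>w s. \<eta> w s - Thet (2 ^ n) w s) = EK (\<lambda>w s. (\<eta> w s - moll' f \<epsilon> (B s w)) + (moll' f \<epsilon> (B s w) - Thet (2 ^ n) w s))"
      by simp
    also have "\<dots> \<le> 2 * e + 2 * EK (\<lambda>w s. moll' f \<epsilon> (B s w) - Thet (2 ^ n) w s)"
      unfolding e_def using \<eta> moll'_B_measurable Thet_measurable[of "2 ^ n"] by (intro EK_sum_le) (simp_all add: case_prod_beta)
    also have "EK (\<lambda>w s. moll' f \<epsilon> (B s w) - Thet (2 ^ n) w s) = b n"
      unfolding b_def EK_def by (simp add: power2_commute)
    finally show ?thesis by (simp add: mult_left_mono distrib_left mult.assoc[symmetric])
  qed
  have a0: "(\<lambda>n. (a n)^2) \<longlonglongrightarrow> 0"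
  proof (rule tendsto_sandwich[OF _ _ tendsto_const])
    have "\<forall>\<^sub>F n in sequentially. a n < 1" using order_tendstoD(2)[OF Sig_tendsto, of 1] unfolding a_def by simp
    then show "\<forall>\<^sub>F n in sequentially. (a n)^2 \<le> a n"
    proof eventually_elim
      case (elim n)
      then show ?case using mult_left_mono[of "a n" 1 "a n"] by (simp add: power2_eq_square)
    qed
    show "a \<longlonglongrightarrow> 0" using Sig_tendsto unfolding a_def .
  qed simp
  have b0: "b \<longlonglongrightarrow> 0"
    unfolding b_def using LIMSEQ_subseq_LIMSEQ[OF EK_Thet_tendsto, of "\<lambda>n. 2 ^ n"] by (simp add: o_def strict_mono_def)
  have "(\<lambda>n. 16 * e + 16 * b n + 2 * (a n)^2) \<longlonglongrightarrow> 16 * e + 16 * 0 + 2 * 0"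
    using a0 b0 by (intro tendsto_add tendsto_const ennreal_tendsto_cmult) auto
  then have "(\<integral>\<^sup>+w. ennreal \<bar>Y w - J w\<bar> \<partial>P)^2 \<le> 16 * e + 16 * 0 + 2 * 0"
    by (rule LIMSEQ_le_const) (use le in auto)
  then show ?thesis unfolding e_def by simp
qed

text \<open>The bound does not involve \<open>\<epsilon>\<close>: solved for the second-order term,
  Ito's formula leaves a Lipschitz function of \<open>B t\<close> and an elementary integral with
  integrand bounded by \<open>Kg\<close>. Applied to the distance to a point it will bound the
  approximate local times uniformly.\<close>

lemma nn_integral_KI_dens_le: "(\<integral>\<^sup>+w. ennreal (KI (dens \<epsilon>) w / 2) \<partial>P) \<le> ennreal (Kg * (1 + C * t) + (1 + Kg^2 * (C * t)))"
proof -
  have abs_le: "\<bar>x\<bar> \<le> 1 + x^2" for x :: real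
  proof -
    have "0 \<le> (\<bar>x\<bar> - 1)^2" by simp
    moreover have "0 \<le> x^2" by simp
    moreover have "(\<bar>x\<bar> - 1)^2 = x^2 - 2 * \<bar>x\<bar> + 1" by (simp add: power2_diff)
    ultimately show ?thesis by linarith
  qed
  have L1: "(\<integral>\<^sup>+w. ennreal \<bar>X w\<bar> \<partial>P) \<le> 1 + (\<integral>\<^sup>+w. ennreal ((X w)^2) \<partial>P)" if [measurable]: "X \<in> borel_measurable borel" for X
  proof -
    have "(\<integral>\<^sup>+w. ennreal \<bar>X w\<bar> \<partial>P) \<le> (\<integral>\<^sup>+w. 1 + ennreal ((X w)^2) \<partial>P)"
      using abs_le by (intro nn_integral_mono) (metis ennreal_1 ennreal_leI ennreal_plus zero_le_one zero_le_power2)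
    also have "\<dots> = 1 + (\<integral>\<^sup>+w. ennreal ((X w)^2) \<partial>P)"
      using emeasure_space_1 by (simp add: nn_integral_add)
    finally show ?thesis .
  qed
  have Bt: "(\<integral>\<^sup>+w. ennreal \<bar>moll f \<epsilon> (B t w) - moll f \<epsilon> 0\<bar> \<partial>P) \<le> ennreal (Kg * (1 + C * t))"
  proof -
    have "(\<integral>\<^sup>+w. ennreal ((B t w)^2) \<partial>P) = ennreal (\<integral>w. (B t w - B 0 w)^2 \<partial>P)"
      using nn_integral_eq_integral[OF increment_moments(1)[OF order_refl t]] by simp
    also have "\<dots> \<le> ennreal (C * t)" using increment_moments(2)[OF order_refl t] by (intro ennreal_leI) simp
    finally have B2: "(\<integral>\<^sup>+w. ennreal ((B t w)^2) \<partial>P) \<le> ennreal (C * t)" .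
    have "(\<integral>\<^sup>+w. ennreal \<bar>moll f \<epsilon> (B t w) - moll f \<epsilon> 0\<bar> \<partial>P) \<le> (\<integral>\<^sup>+w. ennreal Kg * ennreal \<bar>B t w\<bar> \<partial>P)"
      using moll_lipschitz[OF \<epsilon>, of _ 0] Kg_nonneg by (intro nn_integral_mono) (simp add: ennreal_leI flip: ennreal_mult)
    also have "\<dots> = ennreal Kg * (\<integral>\<^sup>+w. ennreal \<bar>B t w\<bar> \<partial>P)" by (rule nn_integral_cmult) measurable
    also have "\<dots> \<le> ennreal Kg * (1 + ennreal (C * t))"
      by (intro mult_left_mono order_trans[OF L1] add_left_mono B2) auto
    also have "\<dots> = ennreal (Kg * (1 + C * t))"
      using Kg_nonneg C_pos t by (simp add: ennreal_mult ennreal_plus flip: ennreal_1)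
    finally show ?thesis .
  qed
  have S: "(\<integral>\<^sup>+w. ennreal \<bar>Sig n w\<bar> \<partial>P) \<le> ennreal (1 + Kg^2 * (C * t))" for n
  proof -
    have "(\<integral>\<^sup>+w. ennreal ((Sig n w)^2) \<partial>P) = EK (Thet n)"
      using elementary_isometry[OF elementary_Sig] unfolding Sig_def Thet_def EK_def .
    also have "\<dots> \<le> ennreal (Kg^2 * (C * t))" by (rule EK_bound[OF Thet_bound])
    finally have "(\<integral>\<^sup>+w. ennreal \<bar>Sig n w\<bar> \<partial>P) \<le> 1 + ennreal (Kg^2 * (C * t))"
      by (intro order_trans[OF L1] add_left_mono) auto
    then show ?thesis using C_pos t by (simp add: ennreal_plus)
  qed
  have le: "(\<integral>\<^sup>+w. ennreal (KI (dens \<epsilon>) w / 2) \<partial>P) \<le>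
     (\<integral>\<^sup>+w. ennreal \<bar>Rem (2 ^ n) w - KI (dens \<epsilon>) w / 2\<bar> \<partial>P) + (ennreal (Kg * (1 + C * t)) + ennreal (1 + Kg^2 * (C * t)))" for n
  proof -
    have "KI (dens \<epsilon>) w / 2 \<le> \<bar>Rem (2 ^ n) w - KI (dens \<epsilon>) w / 2\<bar> + (\<bar>moll f \<epsilon> (B t w) - moll f \<epsilon> 0\<bar> + \<bar>Sig (2 ^ n) w\<bar>)" for w
    proof -
      have "Sig (2 ^ n) w = moll f \<epsilon> (B t w) - moll f \<epsilon> 0 - Rem (2 ^ n) w" by (rule Sig_eq) simp
      then show ?thesis by linarith
    qed
    then have "(\<integral>\<^sup>+w. ennreal (KI (dens \<epsilon>) w / 2) \<partial>P) \<le>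
      (\<integral>\<^sup>+w. ennreal \<bar>Rem (2 ^ n) w - KI (dens \<epsilon>) w / 2\<bar> + (ennreal \<bar>moll f \<epsilon> (B t w) - moll f \<epsilon> 0\<bar> + ennreal \<bar>Sig (2 ^ n) w\<bar>) \<partial>P)"
      by (intro nn_integral_mono) (simp add: ennreal_leI flip: ennreal_plus)
    also have "\<dots> = (\<integral>\<^sup>+w. ennreal \<bar>Rem (2 ^ n) w - KI (dens \<epsilon>) w / 2\<bar> \<partial>P) +
      ((\<integral>\<^sup>+w. ennreal \<bar>moll f \<epsilon> (B t w) - moll f \<epsilon> 0\<bar> \<partial>P) + (\<integral>\<^sup>+w. ennreal \<bar>Sig (2 ^ n) w\<bar> \<partial>P))"
      by (simp add: nn_integral_add)
    also have "\<dots> \<le> (\<integral>\<^sup>+w. ennreal \<bar>Rem (2 ^ n) w - KI (dens \<epsilon>) w / 2\<bar> \<partial>P) + (ennreal (Kg * (1 + C * t)) + ennreal (1 + Kg^2 * (C * t)))"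
      by (intro add_left_mono add_mono Bt S)
    finally show ?thesis .
  qed
  have "(\<lambda>n. (\<integral>\<^sup>+w. ennreal \<bar>Rem (2 ^ n) w - KI (dens \<epsilon>) w / 2\<bar> \<partial>P) + (ennreal (Kg * (1 + C * t)) + ennreal (1 + Kg^2 * (C * t))))
    \<longlonglongrightarrow> 0 + (ennreal (Kg * (1 + C * t)) + ennreal (1 + Kg^2 * (C * t)))"
    by (intro tendsto_add tendsto_const Rem_tendsto)
  then have "(\<integral>\<^sup>+w. ennreal (KI (dens \<epsilon>) w / 2) \<partial>P) \<le> 0 + (ennreal (Kg * (1 + C * t)) + ennreal (1 + Kg^2 * (C * t)))"
    by (rule LIMSEQ_le_const) (use le in auto)
  then show ?thesis using Kg_nonneg C_pos t by (simp add: ennreal_plus)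
qed

end

section \<open>One-sided derivatives of a convex function\<close>

lemma tendsto_at_left_mono:
  fixes F :: "real \<Rightarrow> real"
  assumes mono: "\<And>y z. y < z \<Longrightarrow> z < x \<Longrightarrow> F y \<le> F z" and bdd: "bdd_above (F ` {..<x})"
  shows "(F \<longlongrightarrow> Sup (F ` {..<x})) (at_left x)"
proof (rule order_tendstoI)
  have ne: "F ` {..<x} \<noteq> {}" by auto
  fix a assume "a < Sup (F ` {..<x})"
  then obtain y where y: "y < x" "a < F y" using less_cSup_iff[OF ne bdd] by auto
  then have "a < F z" if "y < z" "z < x" for z using mono[OF that] by simp
  then show "\<forall>\<^sub>F z in at_left x. a < F z" using y by (auto simp: eventually_at_left[OF y(1)])
next
  fix a assume a: "Sup (F ` {..<x}) < a"
  have "F z < a" if "z < x" for z using cSup_upper[OF _ bdd, of "F z"] that a by (auto intro: le_less_trans)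
  then show "\<forall>\<^sub>F z in at_left x. F z < a" by (auto simp: eventually_at_filter)
qed

lemma tendsto_at_right_mono:
  fixes F :: "real \<Rightarrow> real"
  assumes mono: "\<And>y z. x < y \<Longrightarrow> y < z \<Longrightarrow> F y \<le> F z" and bdd: "bdd_below (F ` {x<..})"
  shows "(F \<longlongrightarrow> Inf (F ` {x<..})) (at_right x)"
proof (rule order_tendstoI)
  have ne: "F ` {x<..} \<noteq> {}" by auto
  fix a assume "Inf (F ` {x<..}) < a"
  then obtain y where y: "x < y" "F y < a" using cInf_less_iff[OF ne bdd] by auto
  then have "F z < a" if "x < z" "z < y" for z using mono[OF that] by simp
  then show "\<forall>\<^sub>F z in at_right x. F z < a" using y by (auto simp: eventually_at_right[OF y(1)])
next
  fix a assume a: "a < Inf (F ` {x<..})"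
  have "a < F z" if "x < z" for z using cInf_lower[OF _ bdd, of "F z"] that a by (auto intro: less_le_trans)
  then show "\<forall>\<^sub>F z in at_right x. a < F z" by (auto simp: eventually_at_filter)
qed

locale convex_function =
  fixes f :: "real \<Rightarrow> real" and Kg :: real
  assumes convex: "convex_on UNIV f" and right_bd: "\<And>x. \<bar>right_deriv f x\<bar> \<le> Kg"
begin

definition slope :: "real \<Rightarrow> real \<Rightarrow> real" where "slope x y = (f y - f x) / (y - x)"

lemma slope_sym: "slope x y = slope y x"
  unfolding slope_def by (metis minus_diff_eq minus_divide_divide)

lemma slope_mono:
  assumes "y < z" "y \<noteq> x" "z \<noteq> x"
  shows "slope x y \<le> slope x z"
proof -
  have three: "slope a b \<le> slope a c" "slope a c \<le> slope b c" if "a < b" "b < c" for a b c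
    using convex_on_slope_le[OF convex UNIV_I UNIV_I that] slope_sym unfolding slope_def by (metis minus_diff_eq minus_divide_divide)+
  consider "x < y" | "y < x" "x < z" | "z < x" using assms by linarith
  then show ?thesis
  proof cases
    case 1
    then show ?thesis using three(1)[of x y z] assms by simp
  next
    case 2
    have "slope y x \<le> slope x z" using three[OF 2] by simp
    then show ?thesis by (simp add: slope_sym)
  next
    case 3
    then show ?thesis using three(2)[of y z x] assms slope_sym by metis
  qed
qed

definition L :: "real \<Rightarrow> real" where "L x = Sup (slope x ` {..<x})"

lemma slope_bdd_above: "bdd_above (slope x ` {..<x})"
  by (intro bdd_aboveI[of _ "slope x (x + 1)"]) (auto intro!: slope_mono)

lemma slope_bdd_below: "bdd_below (slope x ` {x<..})"
  by (intro bdd_belowI[of _ "slope x (x - 1)"]) (auto intro!: slope_mono)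

lemma has_left_deriv: "(f has_real_derivative L x) (at_left x)"
  unfolding has_field_derivative_iff L_def
  using tendsto_at_left_mono[of x "slope x"] slope_bdd_above[of x] slope_mono[of _ _ x]
  by (simp add: slope_def[abs_def])

lemma left_deriv_eq: "left_deriv f x = L x"
proof (rule vector_derivative_within)
  show "at_left x \<noteq> bot" by (rule trivial_limit_at_left_real)
  show "(f has_vector_derivative L x) (at_left x)"
    using has_left_deriv[of x] by (simp add: has_real_derivative_iff_has_vector_derivative)
qed

lemma right_deriv_eq: "right_deriv f x = Inf (slope x ` {x<..})"
proof (rule vector_derivative_within)
  show "at_right x \<noteq> bot" by (rule trivial_limit_at_right_real)
  have "(slope x \<longlongrightarrow> Inf (slope x ` {x<..})) (at_right x)"
    by (rule tendsto_at_right_mono) (auto intro!: slope_mono slope_bdd_below)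
  then have "(f has_real_derivative Inf (slope x ` {x<..})) (at_right x)"
    unfolding has_field_derivative_iff by (simp add: slope_def[abs_def])
  then show "(f has_vector_derivative Inf (slope x ` {x<..})) (at_right x)"
    by (simp add: has_real_derivative_iff_has_vector_derivative)
qed

lemma slope_le_L: "y < x \<Longrightarrow> slope x y \<le> L x"
  unfolding L_def by (intro cSup_upper slope_bdd_above) auto

lemma L_le_slope: "x < y \<Longrightarrow> L x \<le> slope x y"
  unfolding L_def by (intro cSup_least) (auto intro!: slope_mono)

text \<open>The left derivative at \<open>x\<close> lies between the right derivatives at
  \<open>x - 1\<close> and at \<open>x\<close>, by way of the slope of the chord.\<close>

lemma L_bounds: "\<bar>L x\<bar> \<le> Kg"
proof -
  have "L x \<le> right_deriv f x"
    unfolding right_deriv_eq by (intro cInf_greatest) (auto intro!: L_le_slope)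
  moreover have "right_deriv f (x - 1) \<le> slope (x - 1) x"
    unfolding right_deriv_eq by (intro cInf_lower slope_bdd_below) auto
  moreover have "slope (x - 1) x \<le> L x" using slope_le_L[of "x - 1" x] by (simp add: slope_sym)
  ultimately show ?thesis using right_bd[of x] right_bd[of "x - 1"] by linarith
qed

sublocale subgradient f L Kg
proof
  show "\<bar>L x\<bar> \<le> Kg" for x by (rule L_bounds)
  show "L x * (y - x) \<le> f y - f x" for x y
  proof (cases x y rule: linorder_cases)
    case less
    then show ?thesis using L_le_slope[OF less] by (simp add: slope_def field_simps)
  next
    case greater
    then show ?thesis using slope_le_L[OF greater] by (simp add: slope_def field_simps)
  qed simp
qed

text \<open>As a supremum of slopes, each continuous in the moving point, \<open>L\<close> is lower
  semicontinuous; monotonicity gives the other half from the left.\<close>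

lemma L_left_continuous: "(L \<longlongrightarrow> L x) (at_left x)"
proof (rule order_tendstoI)
  fix a assume "a < L x"
  then obtain y where y: "y < x" "a < slope x y"
    unfolding L_def using less_cSup_iff[of "slope x ` {..<x}" a] slope_bdd_above by auto
  have "isCont (\<lambda>z. slope z y) x"
    unfolding slope_def using f_continuous y by (intro continuous_intros) (auto simp: continuous_on_eq_continuous_at)
  then have "((\<lambda>z. slope z y) \<longlongrightarrow> slope x y) (at_left x)"
    unfolding isCont_def by (rule filterlim_at_split[THEN iffD1, THEN conjunct1])
  then have "\<forall>\<^sub>F z in at_left x. a < slope z y" using y(2) by (rule order_tendstoD)
  moreover have "\<forall>\<^sub>F z in at_left x. y < z" using y(1) by (auto simp: eventually_at_left[OF y(1)])
  ultimately show "\<forall>\<^sub>F z in at_left x. a < L z"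
    by eventually_elim (meson less_le_trans slope_le_L)
next
  fix a assume "L x < a"
  then have "L z < a" if "z < x" for z using g_mono[of z x] that by simp
  then show "\<forall>\<^sub>F z in at_left x. L z < a" by (auto simp: eventually_at_filter)
qed

abbreviation "\<mu> \<equiv> second_deriv_measure f"

text \<open>Interval measures are built from right-continuous functions on intervals closed at the
  right; the reflection \<open>R\<close> has this form, and its measure is pushed back by negation.
  Half-open intervals form an intersection-stable generator, which gives the uniqueness that the
  definite description requires.\<close>

lemma second_deriv_measure:
  "sets \<mu> = sets borel" "a < b \<Longrightarrow> emeasure \<mu> {a..<b} = ennreal (L b - L a)"
proof -
  define R where "R x = - L (- x)" for x
  define \<nu> where "\<nu> = distr (interval_measure R) borel uminus"
  have R_mono: "R x \<le> R y" if "x \<le> y" for x y unfolding R_def using that by (auto intro!: g_mono)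
  have R_cont: "continuous (at_right x) R" for x
  proof -
    have "filterlim uminus (at_left (- x)) (at_right x)"
      unfolding at_right_minus by (simp add: filterlim_def filtermap_filtermap)
    then have "((\<lambda>y. - L (- y)) \<longlongrightarrow> - L (- x)) (at_right x)"
      by (intro tendsto_minus filterlim_compose[OF L_left_continuous])
    then show ?thesis unfolding continuous_within R_def .
  qed
  have "sets \<nu> = sets borel \<and> (\<forall>a b. a < b \<longrightarrow> emeasure \<nu> {a..<b} = ennreal (left_deriv f b - left_deriv f a))"
  proof (intro conjI allI impI)
    fix a b :: real assume ab: "a < b"
    have "uminus -` {a..<b} = {- b<..- a}" by auto
    then have "emeasure \<nu> {a..<b} = emeasure (interval_measure R) {- b<..- a}"
      unfolding \<nu>_def by (simp add: emeasure_distr)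
    also have "\<dots> = ennreal (R (- a) - R (- b))"
      using ab R_mono R_cont by (intro emeasure_interval_measure_Ioc) auto
    finally show "emeasure \<nu> {a..<b} = ennreal (left_deriv f b - left_deriv f a)"
      unfolding left_deriv_eq R_def by simp
  qed (simp add: \<nu>_def)
  note \<nu> = this
  have "second_deriv_measure f = \<nu>"
    unfolding second_deriv_measure_def
  proof (rule the_equality)
    show "sets \<nu> = sets borel \<and> (\<forall>a b. a < b \<longrightarrow> emeasure \<nu> {a..<b} = ennreal (left_deriv f b - left_deriv f a))"
      by (rule \<nu>)
  next
    fix \<rho> :: "real measure"
    assume \<rho>: "sets \<rho> = sets borel \<and> (\<forall>a b. a < b \<longrightarrow> emeasure \<rho> {a..<b} = ennreal (left_deriv f b - left_deriv f a))"
    have s: "sets borel = sigma_sets UNIV (range (\<lambda>(a, b). {a ..< b :: real}))"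
      by (subst borel_eq_atLeastLessThan) simp
    show "\<rho> = \<nu>"
    proof (rule measure_eqI_generator_eq[where \<Omega> = UNIV and E = "range (\<lambda>(a, b). {a ..< b :: real})" and A = "\<lambda>i. {- real i..<real i}"])
      show "Int_stable (range (\<lambda>(a, b). {a ..< b :: real}))"
      proof (rule Int_stableI)
        fix X Y assume "X \<in> range (\<lambda>(a, b). {a ..< b :: real})" "Y \<in> range (\<lambda>(a, b). {a ..< b :: real})"
        then obtain a b c d where "X = {a..<b}" "Y = {c..<d}" by auto
        then have "X \<inter> Y = (\<lambda>(a, b). {a ..< b}) (max a c, min b d)" by auto
        then show "X \<inter> Y \<in> range (\<lambda>(a, b). {a ..< b :: real})" by blast
      qed
      show "emeasure \<rho> X = emeasure \<nu> X" if X: "X \<in> range (\<lambda>(a, b). {a ..< b :: real})" for X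
      proof -
        obtain a b where "X = {a..<b}" using X by auto
        then show ?thesis using \<rho> \<nu> by (cases "a < b") auto
      qed
      show "(\<Union>i. {- real i..<real i}) = UNIV"
      proof (intro set_eqI iffI UNIV_I)
        fix x :: real
        obtain n :: nat where "\<bar>x\<bar> < real n" using reals_Archimedean2 by blast
        then show "x \<in> (\<Union>i. {- real i..<real i})" by (intro UN_I[of n]) auto
      qed
      show "emeasure \<rho> {- real i..<real i} \<noteq> \<infinity>" for i
        using \<rho> by (cases "i = 0") auto
    qed (use s \<rho> \<nu> in auto)
  qed
  then show "sets \<mu> = sets borel" "a < b \<Longrightarrow> emeasure \<mu> {a..<b} = ennreal (L b - L a)"
    using \<nu> by (auto simp: left_deriv_eq)
qed

lemma sets_\<mu> [measurable_cong, simp]: "sets \<mu> = sets borel"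
  by (rule second_deriv_measure)

lemma space_\<mu> [simp]: "space \<mu> = UNIV"
  using sets_eq_imp_space_eq[OF sets_\<mu>] by simp

sublocale \<mu>: finite_measure \<mu>
proof
  have "(SUP i. emeasure \<mu> {- real i..<real i}) = emeasure \<mu> (\<Union>i. {- real i..<real i})"
    by (rule SUP_emeasure_incseq) (auto simp: incseq_def)
  moreover have "(\<Union>i. {- real i..<real i}) = UNIV"
  proof (intro set_eqI iffI UNIV_I)
    fix x :: real
    obtain n :: nat where "\<bar>x\<bar> < real n" using reals_Archimedean2 by blast
    then show "x \<in> (\<Union>i. {- real i..<real i})" by (intro UN_I[of n]) auto
  qed
  moreover have "(SUP i. emeasure \<mu> {- real i..<real i}) \<le> ennreal (2 * Kg)"
  proof (rule SUP_least)
    fix i :: nat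
    show "emeasure \<mu> {- real i..<real i} \<le> ennreal (2 * Kg)"
    proof (cases "i = 0")
      case False
      have "L (real i) - L (- real i) \<le> 2 * Kg" using L_bounds[of "real i"] L_bounds[of "- real i"] by linarith
      then show ?thesis using second_deriv_measure(2)[of "- real i" "real i"] False by (simp add: ennreal_leI)
    qed simp
  qed
  ultimately have "emeasure \<mu> UNIV \<le> ennreal (2 * Kg)" by simp
  then have "emeasure \<mu> UNIV < \<infinity>" by (rule le_less_trans) simp
  then show "emeasure \<mu> (space \<mu>) \<noteq> \<infinity>" by simp
qed

lemma emeasure_\<mu>_singleton:
  assumes c: "isCont L x"
  shows "emeasure \<mu> {x} = 0"
proof -
  have "emeasure \<mu> {x} \<le> ennreal (L (x + 1 / real (Suc n)) - L x)" for n
  proof -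
    have "emeasure \<mu> {x} \<le> emeasure \<mu> {x..<x + 1 / real (Suc n)}" by (intro emeasure_mono) auto
    then show ?thesis using second_deriv_measure(2)[of x "x + 1 / real (Suc n)"] by simp
  qed
  moreover have "(\<lambda>n. ennreal (L (x + 1 / real (Suc n)) - L x)) \<longlonglongrightarrow> ennreal (L x - L x)"
  proof (intro tendsto_ennrealI tendsto_diff tendsto_const isCont_tendsto_compose[OF c])
    have "(\<lambda>n. x + 1 / real (Suc n)) \<longlonglongrightarrow> x + 0" by (intro tendsto_intros LIMSEQ_Suc[OF lim_1_over_n])
    then show "(\<lambda>n. x + 1 / real (Suc n)) \<longlonglongrightarrow> x" by simp
  qed
  ultimately have "emeasure \<mu> {x} \<le> ennreal (L x - L x)" by (intro LIMSEQ_le_const) auto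
  then show ?thesis by simp
qed

text \<open>The measure is given on intervals closed at the left, while the local time uses open
  ones; they differ by a possible atom, absent where \<open>L\<close> is continuous.\<close>

lemma emeasure_\<mu>_open_interval:
  assumes \<epsilon>: "\<epsilon> > 0" and c: "isCont L (x - \<epsilon>)"
  shows "emeasure \<mu> {x - \<epsilon><..<x + \<epsilon>} = ennreal (L (x + \<epsilon>) - L (x - \<epsilon>))"
proof -
  have "{x - \<epsilon>..<x + \<epsilon>} = {x - \<epsilon><..<x + \<epsilon>} \<union> {x - \<epsilon>}" using \<epsilon> by auto
  moreover have "emeasure \<mu> ({x - \<epsilon><..<x + \<epsilon>} \<union> {x - \<epsilon>}) = emeasure \<mu> {x - \<epsilon><..<x + \<epsilon>}"
    using emeasure_\<mu>_singleton[OF c] by (intro emeasure_Un_null_set) auto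
  ultimately show ?thesis using second_deriv_measure(2)[of "x - \<epsilon>" "x + \<epsilon>"] \<epsilon> by simp
qed

end

section \<open>Approximation of the local time\<close>

locale G_path_local_time = G_path_kernel +
  fixes Lt :: "real \<Rightarrow> real \<Rightarrow> path \<Rightarrow> real" and N :: "path set"
  assumes lt: "local_time \<P> Q Lt" and N [measurable]: "N \<in> sets borel" and AE_N: "AE w in P. w \<notin> N"
    and Lt_cont: "\<And>w. w \<notin> N \<Longrightarrow> continuous_on (UNIV \<times> {0..}) (\<lambda>(a, t). Lt a t w)"
begin

definition LE :: "real \<Rightarrow> real \<Rightarrow> path \<Rightarrow> real" where
  "LE \<epsilon> a = KI (\<lambda>x. indicator {a - \<epsilon><..<a + \<epsilon>} x / (2 * \<epsilon>))"

text \<open>Setting the local time to 0 on \<open>N\<close> makes it continuous in the level for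
  every path, which gives joint measurability.\<close>

definition Lam :: "real \<Rightarrow> path \<Rightarrow> real" where
  "Lam a w = (if w \<in> N then 0 else Lt a t w)"

lemma measurable_LE [measurable]: "\<epsilon> > 0 \<Longrightarrow> LE \<epsilon> a \<in> borel_measurable borel"
  unfolding LE_def by (rule measurable_KI) auto

lemma LE_bounds:
  assumes \<epsilon>: "\<epsilon> > 0"
  shows "0 \<le> LE \<epsilon> a w" "LE \<epsilon> a w \<le> C * t / (2 * \<epsilon>)"
proof -
  show nn: "0 \<le> LE \<epsilon> a w" unfolding LE_def using \<epsilon> by (intro KI_nonneg) auto
  have "ennreal (LE \<epsilon> a w) = (\<integral>\<^sup>+s. ennreal (indicator {a - \<epsilon><..<a + \<epsilon>} (B s w) / (2 * \<epsilon>)) \<partial>K w)"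
    unfolding LE_def using \<epsilon> by (subst nn_integral_KI[where c = "1 / (2 * \<epsilon>)"]) (auto split: split_indicator)
  also have "\<dots> \<le> (\<integral>\<^sup>+s. ennreal (1 / (2 * \<epsilon>)) \<partial>K w)"
    using \<epsilon> by (intro nn_integral_mono ennreal_leI) (auto split: split_indicator)
  also have "\<dots> \<le> ennreal (1 / (2 * \<epsilon>)) * ennreal (C * t)"
    using emeasure_K_UNIV_le[of w] by (simp add: mult_left_mono)
  also have "\<dots> = ennreal (C * t / (2 * \<epsilon>))" using \<epsilon> C_pos t by (subst ennreal_mult[symmetric]) auto
  finally show "LE \<epsilon> a w \<le> C * t / (2 * \<epsilon>)" using C_pos t \<epsilon> by (simp add: ennreal_le_iff)
qed

lemma LE_eq:
  assumes w: "w \<in> \<G>"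
  shows "1 / (2 * \<epsilon>) * qv_integral Q t (\<lambda>s w. indicator {a - \<epsilon><..<a + \<epsilon>} (B s w)) w = LE \<epsilon> a w"
proof -
  define M where "M = interval_measure (\<lambda>s. Q (max 0 s) w)"
  have K: "K w = density M (\<lambda>s. ennreal (indicator {0..t} s))"
    using w unfolding K_def M_def by (simp add: ennreal_indicator)
  have [measurable]: "(\<lambda>s. indicator {a - \<epsilon><..<a + \<epsilon>} (B s w) / (2 * \<epsilon>)) \<in> borel_measurable M"
    unfolding M_def by measurable
  have "LE \<epsilon> a w = (\<integral>s. indicator {0..t} s *\<^sub>R (indicator {a - \<epsilon><..<a + \<epsilon>} (B s w) / (2 * \<epsilon>)) \<partial>M)"
    unfolding LE_def KI_def K by (rule integral_density) (auto simp: M_def)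
  also have "\<dots> = (\<integral>s. 1 / (2 * \<epsilon>) * (indicator {0..t} s *\<^sub>R indicator {a - \<epsilon><..<a + \<epsilon>} (B s w)) \<partial>M)"
    by (rule Bochner_Integration.integral_cong) auto
  also have "\<dots> = 1 / (2 * \<epsilon>) * qv_integral Q t (\<lambda>s w. indicator {a - \<epsilon><..<a + \<epsilon>} (B s w)) w"
    unfolding qv_integral_def set_lebesgue_integral_def M_def by simp
  finally show ?thesis by simp
qed

lemma measurable_Lt: "Lt a t \<in> borel_measurable borel"
  using lt t unfolding local_time_def by blast

lemma measurable_Lam [measurable]: "Lam a \<in> borel_measurable borel"
  unfolding Lam_def[abs_def] using measurable_Lt[of a] by measurable

lemma continuous_Lam: "continuous_on UNIV (\<lambda>a. Lam a w)"
proof (cases "w \<in> N")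
  case False
  have "continuous_on UNIV (\<lambda>a. (\<lambda>(a, t). Lt a t w) (a, t))"
    by (rule continuous_on_compose2[OF Lt_cont[OF False]]) (use t in \<open>auto intro!: continuous_intros\<close>)
  then show ?thesis using False unfolding Lam_def by simp
qed (simp add: Lam_def)

lemma Lam_measurable_pair: "(\<lambda>(w, a). Lam a w) \<in> borel_measurable (borel \<Otimes>\<^sub>M borel)"
  by (rule borel_measurable_caratheodory) (auto intro: continuous_Lam)

definition e :: "nat \<Rightarrow> real" where "e k = 1 / real (Suc k)"

lemma e_pos: "e k > 0" and e_tendsto: "e \<longlonglongrightarrow> 0"
  unfolding e_def[abs_def] using LIMSEQ_Suc[OF lim_1_over_n] by auto

lemma LE_tendsto: "L2_tendsto P (\<lambda>k. LE (e k) a) (Lam a)"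
  unfolding L2_tendsto_def
proof (rule tendsto_sandwich[OF _ _ tendsto_const])
  define X where "X \<epsilon> w = 1 / (2 * \<epsilon>) * qv_integral Q t (\<lambda>s w. indicator {a - \<epsilon><..<a + \<epsilon>} (B s w)) w - Lt a t w" for \<epsilon> w
  have "((\<lambda>\<epsilon>. Lp_norm_pow \<P> 2 (X \<epsilon>)) \<longlongrightarrow> 0) (at_right 0)"
    using lt t unfolding local_time_def X_def by blast
  moreover have "filterlim e (at_right 0) sequentially"
    unfolding filterlim_at using e_tendsto by (auto simp: e_pos less_imp_neq[OF e_pos, symmetric])
  ultimately show "(\<lambda>k. Lp_norm_pow \<P> 2 (X (e k))) \<longlonglongrightarrow> 0" by (rule filterlim_compose)
  show "\<forall>\<^sub>F k in sequentially. (\<integral>\<^sup>+w. ennreal ((LE (e k) a w - Lam a w)^2) \<partial>P) \<le> Lp_norm_pow \<P> 2 (X (e k))"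
  proof (intro always_eventually allI)
    fix k
    have "AE w in P. X (e k) w = LE (e k) a w - Lam a w"
      using AE_\<G> AE_N
    proof eventually_elim
      case (elim w)
      then show ?case unfolding X_def LE_eq[OF elim(1)] by (simp add: Lam_def)
    qed
    then have "(\<integral>\<^sup>+w. ennreal ((LE (e k) a w - Lam a w)^2) \<partial>P) = (\<integral>\<^sup>+w. ennreal ((X (e k) w)^2) \<partial>P)"
      by (intro nn_integral_cong_AE) (auto elim!: eventually_mono)
    also have "\<dots> \<le> Lp_norm_pow \<P> 2 (X (e k))" by (rule nn_integral_le_Lp_norm_pow)
    finally show "(\<integral>\<^sup>+w. ennreal ((LE (e k) a w - Lam a w)^2) \<partial>P) \<le> Lp_norm_pow \<P> 2 (X (e k))" .
  qed
qed simp

lemma LE_tendsto_L1: "(\<lambda>k. \<integral>\<^sup>+w. ennreal \<bar>LE (e k) a w - Lam a w\<bar> \<partial>P) \<longlonglongrightarrow> 0"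
  using e_pos by (intro L2_tendsto_L1 LE_tendsto) measurable

lemma nn_integral_Lam_finite: "(\<integral>\<^sup>+w. ennreal \<bar>Lam a w\<bar> \<partial>P) < \<infinity>"
proof -
  have "integrable P (\<lambda>w. (Lam a w)^2)"
  proof (rule L2_tendsto_square_integrable[OF LE_tendsto])
    show "LE (e k) a \<in> borel_measurable P" for k using e_pos by measurable
    show "integrable P (\<lambda>w. (LE (e k) a w)^2)" for k
    proof (rule integrable_const_bound[of _ "(C * t / (2 * e k))^2"])
      have "(LE (e k) a w)^2 \<le> (C * t / (2 * e k))^2" for w
        using LE_bounds[OF e_pos[of k]] by (intro power_mono) auto
      then show "AE w in P. norm ((LE (e k) a w)^2) \<le> (C * t / (2 * e k))^2" by simp
      show "(\<lambda>w. (LE (e k) a w)^2) \<in> borel_measurable P" using e_pos by measurable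
    qed
  qed measurable
  then have "integrable P (Lam a)" by (rule square_integrable_imp_integrable[rotated]) measurable
  then show ?thesis unfolding integrable_iff_bounded by simp
qed

text \<open>A level set of positive \<open>d\<langle>B\<rangle>\<close>-measure would make the local time infinite.\<close>

lemma atomless: "AE w in P. emeasure (K w) {s. B s w = a} = 0"
proof -
  define A where "A w = (\<integral>\<^sup>+s. indicator {a} (B s w) \<partial>K w)" for w
  have A: "A w = emeasure (K w) {s. B s w = a}" for w
  proof -
    have "A w = (\<integral>\<^sup>+s. indicator {s. B s w = a} s \<partial>K w)"
      unfolding A_def by (rule nn_integral_cong) (auto split: split_indicator)
    also have "\<dots> = emeasure (K w) {s. B s w = a}"
      by (rule nn_integral_indicator) (simp, measurable)
    finally show ?thesis .
  qed
  have [measurable]: "A \<in> borel_measurable borel"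
    unfolding A_def by (rule measurable_nn_integral_K[where k = "\<lambda>w. w"]) measurable
  \<comment> \<open>The indicator of the level is at most \<open>2 * e k\<close> times the quotient
    that defines the local time. The mean of the quotient stays bounded, so the factor
    \<open>2 * e k\<close> sends the right side to 0.\<close>
  have le: "(\<integral>\<^sup>+w. A w \<partial>P) \<le> ennreal (2 * e k) * ((\<integral>\<^sup>+w. ennreal \<bar>LE (e k) a w - Lam a w\<bar> \<partial>P) + (\<integral>\<^sup>+w. ennreal \<bar>Lam a w\<bar> \<partial>P))" for k
  proof -
    have [measurable]: "LE (e k) a \<in> borel_measurable borel" using e_pos by measurable
    have "A w \<le> ennreal (2 * e k) * (ennreal \<bar>LE (e k) a w - Lam a w\<bar> + ennreal \<bar>Lam a w\<bar>)" for w
    proof -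
      have "A w \<le> (\<integral>\<^sup>+s. ennreal (2 * e k) * ennreal (indicator {a - e k<..<a + e k} (B s w) / (2 * e k)) \<partial>K w)"
        unfolding A_def
      proof (rule nn_integral_mono)
        fix s
        have "indicator {a} (B s w) \<le> (2 * e k) * (indicator {a - e k<..<a + e k} (B s w) / (2 * e k) :: real)"
          using e_pos[of k] by (auto split: split_indicator)
        then have "ennreal (indicator {a} (B s w)) \<le> ennreal ((2 * e k) * (indicator {a - e k<..<a + e k} (B s w) / (2 * e k)))"
          by (rule ennreal_leI)
        then show "indicator {a} (B s w) \<le> ennreal (2 * e k) * ennreal (indicator {a - e k<..<a + e k} (B s w) / (2 * e k))"
          using e_pos[of k] by (subst ennreal_mult[symmetric]) (auto simp: ennreal_indicator)
      qed
      also have "\<dots> = ennreal (2 * e k) * (\<integral>\<^sup>+s. ennreal (indicator {a - e k<..<a + e k} (B s w) / (2 * e k)) \<partial>K w)"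
        by (rule nn_integral_cmult) measurable
      also have "(\<integral>\<^sup>+s. ennreal (indicator {a - e k<..<a + e k} (B s w) / (2 * e k)) \<partial>K w) = ennreal (LE (e k) a w)"
        unfolding LE_def using e_pos[of k] by (intro nn_integral_KI[where c = "1 / (2 * e k)"]) (auto split: split_indicator)
      also have "\<dots> \<le> ennreal \<bar>LE (e k) a w - Lam a w\<bar> + ennreal \<bar>Lam a w\<bar>"
        by (simp add: ennreal_leI flip: ennreal_plus)
      finally show ?thesis by (simp add: mult_left_mono)
    qed
    then have "(\<integral>\<^sup>+w. A w \<partial>P) \<le> (\<integral>\<^sup>+w. ennreal (2 * e k) * (ennreal \<bar>LE (e k) a w - Lam a w\<bar> + ennreal \<bar>Lam a w\<bar>) \<partial>P)"
      by (rule nn_integral_mono)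
    also have "\<dots> = ennreal (2 * e k) * ((\<integral>\<^sup>+w. ennreal \<bar>LE (e k) a w - Lam a w\<bar> \<partial>P) + (\<integral>\<^sup>+w. ennreal \<bar>Lam a w\<bar> \<partial>P))"
      by (simp add: nn_integral_cmult nn_integral_add)
    finally show ?thesis .
  qed
  have "(\<lambda>k. ennreal (2 * e k) * ((\<integral>\<^sup>+w. ennreal \<bar>LE (e k) a w - Lam a w\<bar> \<partial>P) + (\<integral>\<^sup>+w. ennreal \<bar>Lam a w\<bar> \<partial>P))) \<longlonglongrightarrow>
      ennreal (2 * 0) * (0 + (\<integral>\<^sup>+w. ennreal \<bar>Lam a w\<bar> \<partial>P))"
    using nn_integral_Lam_finite[of a]
    by (intro tendsto_mult_ennreal tendsto_ennrealI tendsto_mult tendsto_const e_tendsto tendsto_add LE_tendsto_L1) auto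
  then have "(\<integral>\<^sup>+w. A w \<partial>P) \<le> ennreal (2 * 0) * (0 + (\<integral>\<^sup>+w. ennreal \<bar>Lam a w\<bar> \<partial>P))"
    by (rule LIMSEQ_le_const) (use le in auto)
  then have "(\<integral>\<^sup>+w. A w \<partial>P) = 0" by simp
  then have "AE w in P. A w = 0" by (subst (asm) nn_integral_0_iff_AE) auto
  then show ?thesis unfolding A .
qed

text \<open>The bound of \<open>nn_integral_KI_dens_le\<close> for a subgradient bounded by
  1.\<close>

definition c0 where "c0 = (1 + C * t) + (1 + C * t)"



text \<open>Half the mollified second derivative of the distance to \<open>a\<close> is
  \<open>1 / (2 * \<epsilon>)\<close> on the interval around \<open>a\<close>. The right end point
  also belongs to its support, hence an inequality between integrands.\<close>

lemma nn_integral_LE_le: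
  assumes \<epsilon>: "\<epsilon> > 0"
  shows "(\<integral>\<^sup>+w. ennreal (LE \<epsilon> a w) \<partial>P) \<le> ennreal c0"
proof -
  define g where "g x = (if x \<le> a then - 1 else 1 :: real)" for x :: real
  interpret A: G_path_ito \<sigma>l \<sigma>h \<P> P Q \<G> t "\<lambda>x. \<bar>x - a\<bar>" g 1 \<epsilon>
    by unfold_locales (auto simp: g_def \<epsilon> atomless)
  have "LE \<epsilon> a w \<le> KI (A.dens \<epsilon>) w / 2" for w
  proof -
    have "indicator {a - \<epsilon><..<a + \<epsilon>} x / (2 * \<epsilon>) \<le> A.dens \<epsilon> x / 2" for x
      using \<epsilon> A.dens_nonneg[OF \<epsilon>, of x] unfolding A.dens_def[OF \<epsilon>] g_def
      by (auto simp: field_simps split: split_indicator)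
    then have "LE \<epsilon> a w \<le> (\<integral>s. A.dens \<epsilon> (B s w) / 2 \<partial>K w)"
      unfolding LE_def KI_def using \<epsilon> A.abs_up_dn_le(3)[OF \<epsilon>] A.dens_measurable[OF \<epsilon>]
      by (intro integral_mono integrable_divide integrable_K_bounded[of _ "1 / \<epsilon>"] integrable_K_bounded[of _ "1 / (2 * \<epsilon>)"])
        (auto split: split_indicator)
    then show ?thesis unfolding KI_def by simp
  qed
  then have "(\<integral>\<^sup>+w. ennreal (LE \<epsilon> a w) \<partial>P) \<le> (\<integral>\<^sup>+w. ennreal (KI (A.dens \<epsilon>) w / 2) \<partial>P)"
    by (intro nn_integral_mono ennreal_leI)
  also have "\<dots> \<le> ennreal c0"
    using A.nn_integral_KI_dens_le unfolding c0_def by simp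
  finally show ?thesis .
qed

lemma nn_integral_Lam_le: "(\<integral>\<^sup>+w. ennreal \<bar>Lam a w\<bar> \<partial>P) \<le> ennreal c0"
proof -
  have le: "(\<integral>\<^sup>+w. ennreal \<bar>Lam a w\<bar> \<partial>P) \<le> (\<integral>\<^sup>+w. ennreal \<bar>LE (e k) a w - Lam a w\<bar> \<partial>P) + ennreal c0" for k
  proof -
    have [measurable]: "LE (e k) a \<in> borel_measurable borel" using e_pos by measurable
    have "(\<integral>\<^sup>+w. ennreal \<bar>Lam a w\<bar> \<partial>P) \<le> (\<integral>\<^sup>+w. ennreal \<bar>LE (e k) a w - Lam a w\<bar> + ennreal (LE (e k) a w) \<partial>P)"
    proof (rule nn_integral_mono)
      fix w
      have "0 \<le> LE (e k) a w" by (rule LE_bounds(1)[OF e_pos])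
      moreover from this have "\<bar>Lam a w\<bar> \<le> \<bar>LE (e k) a w - Lam a w\<bar> + LE (e k) a w" by linarith
      ultimately show "ennreal \<bar>Lam a w\<bar> \<le> ennreal \<bar>LE (e k) a w - Lam a w\<bar> + ennreal (LE (e k) a w)"
        by (simp add: ennreal_leI flip: ennreal_plus)
    qed
    also have "\<dots> = (\<integral>\<^sup>+w. ennreal \<bar>LE (e k) a w - Lam a w\<bar> \<partial>P) + (\<integral>\<^sup>+w. ennreal (LE (e k) a w) \<partial>P)"
      by (rule nn_integral_add) measurable
    also have "\<dots> \<le> (\<integral>\<^sup>+w. ennreal \<bar>LE (e k) a w - Lam a w\<bar> \<partial>P) + ennreal c0"
      by (intro add_left_mono nn_integral_LE_le e_pos)
    finally show ?thesis .
  qed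
  have "(\<lambda>k. (\<integral>\<^sup>+w. ennreal \<bar>LE (e k) a w - Lam a w\<bar> \<partial>P) + ennreal c0) \<longlonglongrightarrow> 0 + ennreal c0"
    by (intro tendsto_add tendsto_const LE_tendsto_L1)
  then have "(\<integral>\<^sup>+w. ennreal \<bar>Lam a w\<bar> \<partial>P) \<le> 0 + ennreal c0"
    by (rule LIMSEQ_le_const) (use le in auto)
  then show ?thesis by simp
qed

lemma LE_measurable_pair:
  assumes \<epsilon>: "\<epsilon> > 0"
  shows "(\<lambda>(w, a). LE \<epsilon> a w) \<in> borel_measurable (borel \<Otimes>\<^sub>M borel)"
proof -
  have "(\<lambda>x. \<integral>\<^sup>+s. ennreal (indicator {snd x - \<epsilon><..<snd x + \<epsilon>} (B s (fst x)) / (2 * \<epsilon>)) \<partial>K (fst x)) \<in> borel_measurable (borel \<Otimes>\<^sub>M borel)"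
  proof (rule measurable_nn_integral_K)
    have eq: "indicator {snd x - \<epsilon><..<snd x + \<epsilon>} (B s (fst x)) =
        (if snd x - \<epsilon> < B s (fst x) \<and> B s (fst x) < snd x + \<epsilon> then 1 else 0 :: real)" for x s by auto
    show "(\<lambda>(x, s). ennreal (indicator {snd x - \<epsilon><..<snd x + \<epsilon>} (B s (fst x)) / (2 * \<epsilon>))) \<in> borel_measurable ((borel \<Otimes>\<^sub>M borel) \<Otimes>\<^sub>M borel)"
      unfolding eq by measurable
  qed measurable
  then have "(\<lambda>x. enn2real (\<integral>\<^sup>+s. ennreal (indicator {snd x - \<epsilon><..<snd x + \<epsilon>} (B s (fst x)) / (2 * \<epsilon>)) \<partial>K (fst x))) \<in> borel_measurable (borel \<Otimes>\<^sub>M borel)"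
    by measurable
  moreover have "LE \<epsilon> a w = enn2real (\<integral>\<^sup>+s. ennreal (indicator {a - \<epsilon><..<a + \<epsilon>} (B s w) / (2 * \<epsilon>)) \<partial>K w)" for a w
    unfolding LE_def KI_def using \<epsilon> by (intro integral_eq_nn_integral) auto
  ultimately show ?thesis by (simp add: case_prod_beta)
qed

end

text \<open>For nonnegative times the filtration consists of Borel sets; below 0 the event is
  empty.\<close>

lemma stopping_time_measurable:
  assumes "stopping_time path_filtration \<sigma>" "\<And>w. 0 \<le> \<sigma> w"
  shows "\<sigma> \<in> borel_measurable borel"
proof (rule borel_measurable_iff_le[THEN iffD2], rule allI)
  fix c
  show "{w \<in> space borel. \<sigma> w \<le> c} \<in> sets borel"
  proof (cases "0 \<le> c")
    case True
    have "{w \<in> space (path_filtration c). \<sigma> w \<le> c} \<in> sets (path_filtration c)"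
      using assms(1) unfolding stopping_time_def pred_def by blast
    then show ?thesis using sets_path_filtration_subset[OF True] by auto
  next
    case False
    then have "{w \<in> space borel. \<sigma> w \<le> c} = {}" using assms(2) by (auto simp: not_le intro: less_le_trans)
    then show ?thesis by (metis sets.empty_sets)
  qed
qed

section \<open>The Ito-Tanaka formula under a fixed measure\<close>

locale G_path_tanaka = G_path_local_time \<sigma>l \<sigma>h \<P> P Q \<G> t Lt N + convex_function f Kg
  for \<sigma>l \<sigma>h \<P> P Q \<G> t Lt N f Kg +
  fixes T :: real and X :: "path \<Rightarrow> real"
  assumes tT: "t \<le> T" and X: "has_local_stoch_integral \<P> T t (\<lambda>s w. left_deriv f (B s w)) X"
begin

lemma ito: "G_path_ito \<sigma>l \<sigma>h \<P> P Q \<G> t f L Kg (e k)"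
  by unfold_locales (auto simp: e_pos atomless)

definition Jk :: "nat \<Rightarrow> path \<Rightarrow> real" where
  "Jk k w = moll f (e k) (B t w) - moll f (e k) 0 - KI (dens (e k)) w / 2"

lemma measurable_Jk [measurable]: "Jk k \<in> borel_measurable borel"
  unfolding Jk_def[abs_def]
  using moll_measurable[OF e_pos[of k]] measurable_KI[OF dens_measurable[OF e_pos] dens_nonneg[OF e_pos], of k]
  by measurable

lemma measurable_X [measurable]: "X \<in> borel_measurable borel"
  using X unfolding has_local_stoch_integral_def by blast

definition \<Delta> :: "nat \<Rightarrow> ennreal" where "\<Delta> k = EK (\<lambda>w s. L (B s w) - moll' f (e k) (B s w))"

text \<open>Convergence holds where \<open>L\<close> is continuous; the exceptional levels are
  countable, and the path spends no d\<langle>B\<rangle>-time there.\<close>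

lemma \<Delta>_tendsto: "\<Delta> \<longlonglongrightarrow> 0"
  unfolding \<Delta>_def
proof (rule EK_tendsto_0)
  show "(\<lambda>(w, s). L (B s w) - moll' f (e k) (B s w)) \<in> borel_measurable (borel \<Otimes>\<^sub>M borel)" for k
    using moll'_measurable[OF e_pos[of k]] by measurable
  show "\<bar>L (B s w) - moll' f (e k) (B s w)\<bar> \<le> 2 * Kg" for k w s
    using abs_moll'_le[OF e_pos[of k], of "B s w"] L_bounds[of "B s w"] by linarith
  have "AE w in P. \<forall>a\<in>{x. \<not> isCont L x}. emeasure (K w) {s. B s w = a} = 0"
    using atomless by (intro AE_ball_countable[OF countable_discont, THEN iffD2] ballI)
  then show "AE w in P. AE s in K w. (\<lambda>k. L (B s w) - moll' f (e k) (B s w)) \<longlonglongrightarrow> 0"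
  proof eventually_elim
    case (elim w)
    have null: "{s. B s w = a} \<in> null_sets (K w)" if "a \<in> {x. \<not> isCont L x}" for a
      using elim that by (intro null_setsI) (auto simp: pred_def[symmetric])
    have "(\<Union>a\<in>{x. \<not> isCont L x}. {s. B s w = a}) \<in> null_sets (K w)"
      using countable_discont null by (intro null_sets_UN') auto
    then have "AE s in K w. isCont L (B s w)" by (rule AE_I') auto
    then show ?case
    proof eventually_elim
      case (elim s)
      have "(\<lambda>k. L (B s w) - moll' f (e k) (B s w)) \<longlonglongrightarrow> L (B s w) - L (B s w)"
        unfolding e_def by (intro tendsto_diff tendsto_const moll'_tendsto elim)
      then show ?case by simp
    qed
  qed
qed

text \<open>Ito's formula is compared with the integrals \<open>Y m\<close> of the cut-off
  processes. The error splits into that of the cut-off, which vanishes because \<open>L\<close> is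
  bounded, and \<open>\<Delta> k\<close>; the factor 32 is \<open>16 * 2\<close>. The strict
  inequality absorbs the cut-off error for large \<open>m\<close>.\<close>

lemma X_distance:
  assumes r: "0 \<le> r" and small: "32 * \<Delta> k < (ennreal r)^2"
  shows "(\<integral>\<^sup>+w. ennreal \<bar>X w - Jk k w\<bar> \<partial>P) \<le> ennreal r"
proof -
  interpret I: G_path_ito \<sigma>l \<sigma>h \<P> P Q \<G> t f L Kg "e k" by (rule ito)
  obtain \<sigma> Y where loc: "localizing \<P> 2 T (\<lambda>s w. left_deriv f (B s w)) \<sigma>"
    and Y: "\<And>m. has_stoch_integral \<P> t (cut_off (\<sigma> m) (\<lambda>s w. left_deriv f (B s w))) (Y m)"
    and lim: "quasi_surely \<P> (\<lambda>w. (\<lambda>m. Y m w) \<longlonglongrightarrow> X w)"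
    using X unfolding has_local_stoch_integral_def by blast
  have [measurable]: "\<sigma> m \<in> borel_measurable borel" for m
    using loc unfolding localizing_def by (intro stopping_time_measurable) auto
  have [measurable]: "Y m \<in> borel_measurable borel" for m
    using Y[of m] unfolding has_stoch_integral_def by blast
  have \<sigma>_lim: "AE w in P. (\<lambda>m. \<sigma> m w) \<longlonglongrightarrow> T"
    using AE_of_quasi_surely[of "\<lambda>w. incseq (\<lambda>m. \<sigma> m w) \<and> (\<lambda>m. \<sigma> m w) \<longlonglongrightarrow> T"] loc unfolding localizing_def by auto
  define \<eta> where "\<eta> m w s = L (B s w) * indicator {0..\<sigma> m w} s" for m w s
  have cut: "cut_off (\<sigma> m) (\<lambda>s w. left_deriv f (B s w)) = (\<lambda>s w. \<eta> m w s)" for m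
    unfolding cut_off_def \<eta>_def left_deriv_eq by (intro ext) simp
  have ind: "indicator {0..\<sigma> m w} s = (if 0 \<le> s \<and> s \<le> \<sigma> m w then 1 else 0 :: real)" for m w s by auto
  have \<eta>m: "(\<lambda>(w, s). \<eta> m w s) \<in> borel_measurable (borel \<Otimes>\<^sub>M borel)" for m
    unfolding \<eta>_def ind by measurable
  have Lm: "(\<lambda>(w, s). L (B s w)) \<in> borel_measurable (borel \<Otimes>\<^sub>M borel)" by measurable
  define c where "c m = EK (\<lambda>w s. \<eta> m w s - L (B s w))" for m
  have dm: "(\<lambda>(w, s). \<eta> m w s - L (B s w)) \<in> borel_measurable (borel \<Otimes>\<^sub>M borel)" for m
    using \<eta>m[of m] Lm by (simp add: case_prod_beta)
  have c0: "c \<longlonglongrightarrow> 0"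
    unfolding c_def
  proof (rule EK_tendsto_0[OF dm])
    show "\<bar>\<eta> m w s - L (B s w)\<bar> \<le> Kg" for m w s
      using L_bounds[of "B s w"] Kg_nonneg unfolding \<eta>_def ind by auto
    show "AE w in P. AE s in K w. (\<lambda>m. \<eta> m w s - L (B s w)) \<longlonglongrightarrow> 0"
      using \<sigma>_lim
    proof eventually_elim
      case (elim w)
      show ?case using K_AE_range[of w]
      proof eventually_elim
        case s: (elim s)
        \<comment> \<open>Almost every time for \<open>K w\<close> is strictly below
          \<open>t\<close>, hence below \<open>T\<close>; so the cut-off is eventually inactive even
          if \<open>t = T\<close> and no \<open>\<sigma> m\<close> reaches \<open>T\<close>.\<close>
        then have "s < T" using tT by simp
        then have "\<forall>\<^sub>F m in sequentially. s < \<sigma> m w" using elim by (rule order_tendstoD(1)[rotated])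
        then have "\<forall>\<^sub>F m in sequentially. \<eta> m w s - L (B s w) = 0"
          by eventually_elim (use s in \<open>auto simp: \<eta>_def\<close>)
        then show ?case by (rule tendsto_eventually)
      qed
    qed
  qed
  have sq: "(\<integral>\<^sup>+w. ennreal \<bar>Y m w - Jk k w\<bar> \<partial>P)^2 \<le> 32 * c m + 32 * \<Delta> k" for m
  proof -
    have "(\<integral>\<^sup>+w. ennreal \<bar>Y m w - Jk k w\<bar> \<partial>P)^2 \<le> 16 * EK (\<lambda>w s. \<eta> m w s - moll' f (e k) (B s w))"
      using I.Ito_distance[OF Y[of m, unfolded cut] \<eta>m] unfolding I.J_def Jk_def .
    also have "EK (\<lambda>w s. \<eta> m w s - moll' f (e k) (B s w)) = EK (\<lambda>w s. (\<eta> m w s - L (B s w)) + (L (B s w) - moll' f (e k) (B s w)))" by simp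
    also have "\<dots> \<le> 2 * c m + 2 * \<Delta> k"
      unfolding c_def \<Delta>_def using Lm I.moll'_B_measurable by (intro EK_sum_le dm) (simp add: case_prod_beta)
    finally show ?thesis by (simp add: mult_left_mono distrib_left mult.assoc[symmetric])
  qed
  have "(\<lambda>m. 32 * c m + 32 * \<Delta> k) \<longlonglongrightarrow> 32 * 0 + 32 * \<Delta> k"
    by (intro tendsto_add tendsto_const ennreal_tendsto_cmult c0) auto
  then have "\<forall>\<^sub>F m in sequentially. 32 * c m + 32 * \<Delta> k < (ennreal r)^2"
    using small by (intro order_tendstoD(2)) auto
  then have ev: "\<forall>\<^sub>F m in sequentially. (\<integral>\<^sup>+w. ennreal \<bar>Y m w - Jk k w\<bar> \<partial>P) \<le> ennreal r"
  proof eventually_elim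
    case (elim m)
    then have lt: "(\<integral>\<^sup>+w. ennreal \<bar>Y m w - Jk k w\<bar> \<partial>P)^2 < (ennreal r)^2" using sq[of m] by (rule le_less_trans[rotated])
    show ?case
    proof (rule ccontr)
      assume "\<not> (\<integral>\<^sup>+w. ennreal \<bar>Y m w - Jk k w\<bar> \<partial>P) \<le> ennreal r"
      then have "(ennreal r)^2 \<le> (\<integral>\<^sup>+w. ennreal \<bar>Y m w - Jk k w\<bar> \<partial>P)^2" by (intro power_mono) auto
      then show False using lt by simp
    qed
  qed
  \<comment> \<open>The localized integral is only an almost sure limit of the \<open>Y m\<close>;
    Fatou's lemma carries the bound over.\<close>
  have "(\<integral>\<^sup>+w. ennreal \<bar>X w - Jk k w\<bar> \<partial>P) = (\<integral>\<^sup>+w. liminf (\<lambda>m. ennreal \<bar>Y m w - Jk k w\<bar>) \<partial>P)"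
  proof (rule nn_integral_cong_AE)
    show "AE w in P. ennreal \<bar>X w - Jk k w\<bar> = liminf (\<lambda>m. ennreal \<bar>Y m w - Jk k w\<bar>)"
      using AE_of_quasi_surely[OF lim]
    proof eventually_elim
      case (elim w)
      have "(\<lambda>m. ennreal \<bar>Y m w - Jk k w\<bar>) \<longlonglongrightarrow> ennreal \<bar>X w - Jk k w\<bar>"
        by (intro tendsto_ennrealI tendsto_rabs tendsto_diff tendsto_const elim)
      then show ?case by (metis lim_imp_Liminf trivial_limit_sequentially)
    qed
  qed
  also have "\<dots> \<le> liminf (\<lambda>m. \<integral>\<^sup>+w. ennreal \<bar>Y m w - Jk k w\<bar> \<partial>P)"
    by (rule nn_integral_liminf) measurable
  also have "\<dots> \<le> limsup (\<lambda>m. \<integral>\<^sup>+w. ennreal \<bar>Y m w - Jk k w\<bar> \<partial>P)" by (rule Liminf_le_Limsup) simp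
  also have "\<dots> \<le> ennreal r" by (rule Limsup_bounded[OF ev])
  finally show ?thesis .
qed

lemma X_tendsto: "(\<lambda>k. \<integral>\<^sup>+w. ennreal \<bar>X w - Jk k w\<bar> \<partial>P) \<longlonglongrightarrow> 0"
proof (rule order_tendstoI)
  fix y :: ennreal assume y: "0 < y"
  obtain r where r: "0 < r" "ennreal r < y"
  proof (cases y)
    case (real r)
    then show ?thesis using y by (intro that[of "r / 2"]) (auto simp: ennreal_less_iff)
  next
    case top
    then show ?thesis by (intro that[of 1]) auto
  qed
  have "(\<lambda>k. 32 * \<Delta> k) \<longlonglongrightarrow> 32 * 0" by (intro ennreal_tendsto_cmult \<Delta>_tendsto) simp
  then have "\<forall>\<^sub>F k in sequentially. 32 * \<Delta> k < (ennreal r)^2"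
    using r(1) by (intro order_tendstoD(2)) (auto simp: ennreal_power)
  then show "\<forall>\<^sub>F k in sequentially. (\<integral>\<^sup>+w. ennreal \<bar>X w - Jk k w\<bar> \<partial>P) < y"
  proof eventually_elim
    case (elim k)
    then show ?case using X_distance[of r k] r by (auto intro: le_less_trans)
  qed
qed simp

end

section \<open>Integration over the levels and passage to the limit\<close>

context G_path_tanaka
begin

interpretation PM: pair_sigma_finite P \<mu>
  by (intro pair_sigma_finite.intro) unfold_locales

lemma \<mu>_finite: "emeasure \<mu> UNIV < \<top>"
  using \<mu>.emeasure_finite[of UNIV] unfolding infinity_ennreal_def by (simp only: less_top)

text \<open>The level \<open>a\<close> is within \<open>e k\<close> of \<open>B s w\<close> exactly
  if the path is within \<open>e k\<close> of \<open>a\<close>, so Fubini exchanges time and level.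
  The inner \<open>\<mu>\<close>-mass is \<open>2 * e k\<close> times the second derivative, up to
  atoms that almost every time avoids.\<close>

lemma KI_dens_eq: "AE w in P. ennreal (KI (dens (e k)) w) = (\<integral>\<^sup>+a. ennreal (LE (e k) a w) \<partial>\<mu>)"
proof -
  interpret I: G_path_ito \<sigma>l \<sigma>h \<P> P Q \<G> t f L Kg "e k" by (rule ito)
  have \<epsilon>: "e k > 0" by (rule e_pos)
  show ?thesis
    using I.AE_continuity
  proof eventually_elim
    case (elim w)
    interpret Kw: finite_measure "K w" by (rule finite_measure_K)
    interpret KM: pair_sigma_finite "K w" \<mu>
      by (intro pair_sigma_finite.intro) unfold_locales
    have ind: "indicator {a - e k<..<a + e k} (B s w) = indicator {B s w - e k<..<B s w + e k} a" for a s
      by (auto split: split_indicator)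
    have "ennreal (KI (dens (e k)) w) = (\<integral>\<^sup>+s. ennreal (dens (e k) (B s w)) \<partial>K w)"
    proof (rule nn_integral_KI[symmetric])
      show "dens (e k) x \<le> Kg / e k" for x using abs_up_dn_le(3)[OF \<epsilon>, of x] by simp
    qed (use dens_measurable[OF \<epsilon>] dens_nonneg[OF \<epsilon>] in auto)
    also have "\<dots> = (\<integral>\<^sup>+s. (\<integral>\<^sup>+a. ennreal (indicator {a - e k<..<a + e k} (B s w) / (2 * e k)) \<partial>\<mu>) \<partial>K w)"
    proof (rule nn_integral_cong_AE)
      show "AE s in K w. ennreal (dens (e k) (B s w)) = (\<integral>\<^sup>+a. ennreal (indicator {a - e k<..<a + e k} (B s w) / (2 * e k)) \<partial>\<mu>)"
        using elim
      proof eventually_elim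
        case (elim s)
        have "(\<integral>\<^sup>+a. ennreal (indicator {a - e k<..<a + e k} (B s w) / (2 * e k)) \<partial>\<mu>)
          = (\<integral>\<^sup>+a. ennreal (1 / (2 * e k)) * indicator {B s w - e k<..<B s w + e k} a \<partial>\<mu>)"
          unfolding ind by (rule nn_integral_cong) (auto split: split_indicator)
        also have "\<dots> = ennreal (1 / (2 * e k)) * emeasure \<mu> {B s w - e k<..<B s w + e k}"
          by (rule nn_integral_cmult_indicator) simp
        also have "\<dots> = ennreal (1 / (2 * e k)) * ennreal (L (B s w + e k) - L (B s w - e k))"
          using elim by (subst emeasure_\<mu>_open_interval[OF \<epsilon>]) auto
        also have "\<dots> = ennreal (dens (e k) (B s w))"
        proof -
          have "L (B s w - e k) \<le> L (B s w + e k)" using \<epsilon> by (intro g_mono) simp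
          then show ?thesis unfolding dens_def[OF \<epsilon>] using \<epsilon> by (subst ennreal_mult[symmetric]) auto
        qed
        finally show ?case by simp
      qed
    qed
    also have "\<dots> = (\<integral>\<^sup>+a. (\<integral>\<^sup>+s. ennreal (indicator {a - e k<..<a + e k} (B s w) / (2 * e k)) \<partial>K w) \<partial>\<mu>)"
    proof (rule KM.Fubini'[symmetric])
      have eq: "indicator {a - e k<..<a + e k} (B s w) =
        (if a - e k < B s w \<and> B s w < a + e k then 1 else 0 :: real)" for a s by auto
      show "(\<lambda>(s, a). ennreal (indicator {a - e k<..<a + e k} (B s w) / (2 * e k))) \<in> borel_measurable (K w \<Otimes>\<^sub>M \<mu>)"
        unfolding eq by measurable
    qed
    also have "\<dots> = (\<integral>\<^sup>+a. ennreal (LE (e k) a w) \<partial>\<mu>)"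
      unfolding LE_def using \<epsilon>
      by (intro nn_integral_cong nn_integral_KI[where c = "1 / (2 * e k)"]) (auto split: split_indicator)
    finally show ?case .
  qed
qed

lemma LE_Lam_measurable:
  "(\<lambda>(w, a). ennreal \<bar>LE (e k) a w - Lam a w\<bar>) \<in> borel_measurable (P \<Otimes>\<^sub>M \<mu>)"
  "(\<lambda>(w, a). ennreal \<bar>Lam a w\<bar>) \<in> borel_measurable (P \<Otimes>\<^sub>M \<mu>)"
proof -
  have eq: "sets (P \<Otimes>\<^sub>M \<mu>) = sets (borel \<Otimes>\<^sub>M borel)" by (rule sets_pair_measure_cong) auto
  note m = LE_measurable_pair[OF e_pos[of k]] Lam_measurable_pair
  have "(\<lambda>(w, a). ennreal \<bar>LE (e k) a w - Lam a w\<bar>) \<in> borel_measurable (borel \<Otimes>\<^sub>M borel)"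
    "(\<lambda>(w, a). ennreal \<bar>Lam a w\<bar>) \<in> borel_measurable (borel \<Otimes>\<^sub>M borel)"
    using m by (simp_all add: case_prod_beta)
  then show "(\<lambda>(w, a). ennreal \<bar>LE (e k) a w - Lam a w\<bar>) \<in> borel_measurable (P \<Otimes>\<^sub>M \<mu>)"
    "(\<lambda>(w, a). ennreal \<bar>Lam a w\<bar>) \<in> borel_measurable (P \<Otimes>\<^sub>M \<mu>)"
    using measurable_cong_sets[OF eq refl] by auto
qed

text \<open>The means of the local time are bounded uniformly in the level, and \<open>\<mu>\<close>
  has finite mass because the derivative is bounded.\<close>

lemma AE_integrable_Lam: "AE w in P. integrable \<mu> (\<lambda>a. Lam a w)"
proof -
  have "(\<integral>\<^sup>+w. (\<integral>\<^sup>+a. ennreal \<bar>Lam a w\<bar> \<partial>\<mu>) \<partial>P) = (\<integral>\<^sup>+a. (\<integral>\<^sup>+w. ennreal \<bar>Lam a w\<bar> \<partial>P) \<partial>\<mu>)"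
    by (rule PM.Fubini'[symmetric]) (rule LE_Lam_measurable)
  also have "\<dots> \<le> (\<integral>\<^sup>+a. ennreal c0 \<partial>\<mu>)" by (intro nn_integral_mono nn_integral_Lam_le)
  also have "\<dots> < \<infinity>" using \<mu>_finite by (simp add: ennreal_mult_less_top)
  finally have "AE w in P. (\<integral>\<^sup>+a. ennreal \<bar>Lam a w\<bar> \<partial>\<mu>) \<noteq> \<infinity>"
    using \<mu>.borel_measurable_nn_integral[of "\<lambda>w a. ennreal \<bar>Lam a w\<bar>" P] LE_Lam_measurable(2)
    by (intro nn_integral_PInf_AE) auto
  then show ?thesis
  proof eventually_elim
    case (elim w)
    have "(\<lambda>a. Lam a w) \<in> borel_measurable \<mu>"
      using borel_measurable_continuous_onI[OF continuous_Lam] by measurable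
    then show ?case using elim by (intro integrableI_bounded) (auto simp: less_top)
  qed
qed

definition D :: "nat \<Rightarrow> ennreal" where
  "D k = (\<integral>\<^sup>+w. (\<integral>\<^sup>+a. ennreal \<bar>LE (e k) a w - Lam a w\<bar> \<partial>\<mu>) \<partial>P)"

text \<open>For each level the inner integral tends to 0 by the definition of the local time. The
  uniform bound \<open>c0\<close> supplies a constant majorant, integrable for the finite
  \<open>\<mu>\<close>.\<close>

lemma D_tendsto: "D \<longlonglongrightarrow> 0"
proof -
  have D: "D k = (\<integral>\<^sup>+a. (\<integral>\<^sup>+w. ennreal \<bar>LE (e k) a w - Lam a w\<bar> \<partial>P) \<partial>\<mu>)" for k
    unfolding D_def by (rule PM.Fubini'[symmetric]) (rule LE_Lam_measurable)
  have "(\<lambda>k. \<integral>\<^sup>+a. (\<integral>\<^sup>+w. ennreal \<bar>LE (e k) a w - Lam a w\<bar> \<partial>P) \<partial>\<mu>) \<longlonglongrightarrow> (\<integral>\<^sup>+a. 0 \<partial>\<mu>)"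
  proof (rule nn_integral_dominated_convergence[where w = "\<lambda>_. ennreal c0 + ennreal c0"])
    show "(\<lambda>a. \<integral>\<^sup>+w. ennreal \<bar>LE (e k) a w - Lam a w\<bar> \<partial>P) \<in> borel_measurable \<mu>" for k
      using borel_measurable_nn_integral[of "\<lambda>a w. ennreal \<bar>LE (e k) a w - Lam a w\<bar>" \<mu>]
        measurable_pair_swap[OF LE_Lam_measurable(1)[of k]] by (simp add: case_prod_beta)
    show "AE a in \<mu>. (\<integral>\<^sup>+w. ennreal \<bar>LE (e k) a w - Lam a w\<bar> \<partial>P) \<le> ennreal c0 + ennreal c0" for k
    proof (rule AE_I2)
      fix a
      have [measurable]: "LE (e k) a \<in> borel_measurable borel" using e_pos by measurable
      have "(\<integral>\<^sup>+w. ennreal \<bar>LE (e k) a w - Lam a w\<bar> \<partial>P) \<le> (\<integral>\<^sup>+w. ennreal (LE (e k) a w) + ennreal \<bar>Lam a w\<bar> \<partial>P)"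
      proof (rule nn_integral_mono)
        fix w
        have "0 \<le> LE (e k) a w" by (rule LE_bounds(1)[OF e_pos])
        moreover from this have "\<bar>LE (e k) a w - Lam a w\<bar> \<le> LE (e k) a w + \<bar>Lam a w\<bar>" by linarith
        ultimately show "ennreal \<bar>LE (e k) a w - Lam a w\<bar> \<le> ennreal (LE (e k) a w) + ennreal \<bar>Lam a w\<bar>"
          by (simp add: ennreal_leI flip: ennreal_plus)
      qed
      also have "\<dots> = (\<integral>\<^sup>+w. ennreal (LE (e k) a w) \<partial>P) + (\<integral>\<^sup>+w. ennreal \<bar>Lam a w\<bar> \<partial>P)"
        by (rule nn_integral_add) measurable
      also have "\<dots> \<le> ennreal c0 + ennreal c0"
        by (intro add_mono nn_integral_LE_le nn_integral_Lam_le e_pos)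
      finally show "(\<integral>\<^sup>+w. ennreal \<bar>LE (e k) a w - Lam a w\<bar> \<partial>P) \<le> ennreal c0 + ennreal c0" .
    qed
    show "(\<integral>\<^sup>+a. ennreal c0 + ennreal c0 \<partial>\<mu>) < \<infinity>"
      using \<mu>_finite by (simp add: ennreal_mult_less_top)
    show "AE a in \<mu>. (\<lambda>k. \<integral>\<^sup>+w. ennreal \<bar>LE (e k) a w - Lam a w\<bar> \<partial>P) \<longlonglongrightarrow> 0"
      by (intro AE_I2 LE_tendsto_L1)
  qed auto
  then show ?thesis unfolding D[abs_def] by simp
qed

lemma measurable_integral_Lam [measurable]: "(\<lambda>w. \<integral>a. Lam a w \<partial>\<mu>) \<in> borel_measurable borel"
proof (rule \<mu>.borel_measurable_lebesgue_integral)
  have "sets (borel \<Otimes>\<^sub>M \<mu>) = sets (borel \<Otimes>\<^sub>M borel :: (path \<times> real) measure)"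
    by (rule sets_pair_measure_cong) auto
  then show "(\<lambda>(w, a). Lam a w) \<in> borel_measurable (borel \<Otimes>\<^sub>M \<mu>)"
    using Lam_measurable_pair measurable_cong_sets by blast
qed

lemma AE_KI_dens_diff:
  "AE w in P. ennreal \<bar>KI (dens (e k)) w - (\<integral>a. Lam a w \<partial>\<mu>)\<bar> \<le> (\<integral>\<^sup>+a. ennreal \<bar>LE (e k) a w - Lam a w\<bar> \<partial>\<mu>)"
  using KI_dens_eq[of k] AE_integrable_Lam
proof eventually_elim
  case (elim w)
  have nn: "0 \<le> LE (e k) a w" for a by (rule LE_bounds(1)[OF e_pos])
  have nn': "0 \<le> KI (dens (e k)) w" by (intro KI_nonneg dens_nonneg e_pos)
  have "(\<lambda>a. LE (e k) a w) \<in> borel_measurable borel"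
    using measurable_compose[OF measurable_Pair1'[of w borel] LE_measurable_pair[OF e_pos[of k]]] by simp
  then have m: "(\<lambda>a. LE (e k) a w) \<in> borel_measurable \<mu>" by measurable
  have i: "integrable \<mu> (\<lambda>a. LE (e k) a w)"
    using m nn elim(1) by (intro integrableI_nonneg) (auto simp flip: elim(1))
  have "ennreal (\<integral>a. LE (e k) a w \<partial>\<mu>) = ennreal (KI (dens (e k)) w)"
    unfolding elim(1) using nn by (intro nn_integral_eq_integral[symmetric] i) auto
  moreover have "0 \<le> (\<integral>a. LE (e k) a w \<partial>\<mu>)" using nn by (intro integral_nonneg_AE) auto
  ultimately have "(\<integral>a. LE (e k) a w \<partial>\<mu>) = KI (dens (e k)) w" using nn' by (simp add: ennreal_inj)
  then have "KI (dens (e k)) w - (\<integral>a. Lam a w \<partial>\<mu>) = (\<integral>a. LE (e k) a w - Lam a w \<partial>\<mu>)"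
    using i elim(2) by simp
  then show ?case
    using integral_norm_bound_ennreal[of \<mu> "\<lambda>a. LE (e k) a w - Lam a w"] i elim(2) by simp
qed

lemma tanaka: "AE w in P. f (B t w) = f 0 + X w + 1/2 * (\<integral>a. Lam a w \<partial>\<mu>)"
proof -
  define Z where "Z w = f (B t w) - f 0 - X w - 1/2 * (\<integral>a. Lam a w \<partial>\<mu>)" for w
  have [measurable]: "Z \<in> borel_measurable borel" unfolding Z_def by measurable
  have le: "(\<integral>\<^sup>+w. ennreal \<bar>Z w\<bar> \<partial>P) \<le> (\<integral>\<^sup>+w. ennreal \<bar>X w - Jk k w\<bar> \<partial>P) + ennreal (2 * (Kg * e k)) + D k" for k
  proof -
    have [measurable]: "(\<lambda>w. \<integral>\<^sup>+a. ennreal \<bar>LE (e k) a w - Lam a w\<bar> \<partial>\<mu>) \<in> borel_measurable P"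
      using \<mu>.borel_measurable_nn_integral[of "\<lambda>w a. ennreal \<bar>LE (e k) a w - Lam a w\<bar>" P] LE_Lam_measurable(1)[of k] by simp
    have "AE w in P. ennreal \<bar>Z w\<bar> \<le> ennreal \<bar>X w - Jk k w\<bar> + ennreal (2 * (Kg * e k)) + (\<integral>\<^sup>+a. ennreal \<bar>LE (e k) a w - Lam a w\<bar> \<partial>\<mu>)"
      using AE_KI_dens_diff[of k]
    proof eventually_elim
      case (elim w)
      have K0: "0 \<le> 2 * (Kg * e k)" using Kg_nonneg e_pos[of k] by simp
      \<comment> \<open>Mollification changes \<open>f\<close> by at most \<open>Kg * e k\<close> at
        each of the two points \<open>B t w\<close> and 0; the last term enters with weight 1/2,
        which is bounded by 1.\<close>
      have "\<bar>Z w\<bar> \<le> \<bar>X w - Jk k w\<bar> + 2 * (Kg * e k) + \<bar>KI (dens (e k)) w - (\<integral>a. Lam a w \<partial>\<mu>)\<bar>"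
        using moll_close[OF e_pos[of k], of "B t w"] moll_close[OF e_pos[of k], of 0]
        unfolding Z_def Jk_def by (simp add: abs_le_iff) linarith
      then have "ennreal \<bar>Z w\<bar> \<le> ennreal (\<bar>X w - Jk k w\<bar> + 2 * (Kg * e k) + \<bar>KI (dens (e k)) w - (\<integral>a. Lam a w \<partial>\<mu>)\<bar>)"
        by (rule ennreal_leI)
      also have "\<dots> = ennreal \<bar>X w - Jk k w\<bar> + ennreal (2 * (Kg * e k)) + ennreal \<bar>KI (dens (e k)) w - (\<integral>a. Lam a w \<partial>\<mu>)\<bar>"
        using K0 by (subst ennreal_plus) (auto simp: ennreal_plus)
      also have "\<dots> \<le> ennreal \<bar>X w - Jk k w\<bar> + ennreal (2 * (Kg * e k)) + (\<integral>\<^sup>+a. ennreal \<bar>LE (e k) a w - Lam a w\<bar> \<partial>\<mu>)"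
        by (intro add_left_mono elim)
      finally show ?case .
    qed
    then have "(\<integral>\<^sup>+w. ennreal \<bar>Z w\<bar> \<partial>P) \<le>
        (\<integral>\<^sup>+w. ennreal \<bar>X w - Jk k w\<bar> + ennreal (2 * (Kg * e k)) + (\<integral>\<^sup>+a. ennreal \<bar>LE (e k) a w - Lam a w\<bar> \<partial>\<mu>) \<partial>P)"
      by (rule nn_integral_mono_AE)
    also have "\<dots> = (\<integral>\<^sup>+w. ennreal \<bar>X w - Jk k w\<bar> \<partial>P) + ennreal (2 * (Kg * e k)) + D k"
      unfolding D_def using emeasure_space_1 by (simp add: nn_integral_add)
    finally show ?thesis .
  qed
  have "(\<lambda>k. (\<integral>\<^sup>+w. ennreal \<bar>X w - Jk k w\<bar> \<partial>P) + ennreal (2 * (Kg * e k)) + D k) \<longlonglongrightarrow> 0 + ennreal (2 * (Kg * 0)) + 0"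
    by (intro tendsto_add X_tendsto tendsto_ennrealI tendsto_mult tendsto_const e_tendsto D_tendsto)
  then have "(\<integral>\<^sup>+w. ennreal \<bar>Z w\<bar> \<partial>P) \<le> 0 + ennreal (2 * (Kg * 0)) + 0"
    by (rule LIMSEQ_le_const) (use le in auto)
  then have "(\<integral>\<^sup>+w. ennreal \<bar>Z w\<bar> \<partial>P) = 0" by simp
  then have "AE w in P. ennreal \<bar>Z w\<bar> = 0" by (subst (asm) nn_integral_0_iff_AE) auto
  then show ?thesis
  proof eventually_elim
    case (elim w)
    then have "Z w = 0" by simp
    then show ?case unfolding Z_def by simp
  qed
qed

end

section \<open>The theorem\<close>

theorem theorem6p1:
  fixes \<sigma>l \<sigma>h T :: real
    and \<P> :: "path measure set"
    and Q :: "real \<Rightarrow> path \<Rightarrow> real"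
    and L :: "real \<Rightarrow> real \<Rightarrow> path \<Rightarrow> real"
    and f :: "real \<Rightarrow> real"
    and I :: "real \<Rightarrow> path \<Rightarrow> real"
  assumes "0 \<le> \<sigma>l" and "\<sigma>l \<le> \<sigma>h"
    and "G_expectation \<sigma>l \<sigma>h \<P>"
    and "quadratic_variation \<P> Q"
    and "local_time \<P> Q L"
    and "T > 0"
    and "convex_on UNIV f"
    and "bounded (range (right_deriv f))"
    and "(\<lambda>s w. left_deriv f (B s w)) \<in> M_omega \<P> 2 T"
    and "\<And>t. t \<in> {0..T} \<Longrightarrow> has_local_stoch_integral \<P> T t (\<lambda>s w. left_deriv f (B s w)) (I t)"
  shows "\<forall>t\<in>{0..T}. quasi_surely \<P> (\<lambda>w.
           integrable (second_deriv_measure f) (\<lambda>a. L a t w) \<and>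
           f (B t w) = f 0 + I t w + 1/2 * (\<integral>a. L a t w \<partial>second_deriv_measure f))"
proof
  fix t assume t: "t \<in> {0..T}"
  obtain Kg where Kg: "\<And>x. \<bar>right_deriv f x\<bar> \<le> Kg"
    using assms(8) unfolding bounded_iff by auto
  obtain N where N: "N \<in> sets borel" "capacity \<P> N = 0"
    and Lcont: "\<And>w. w \<notin> N \<Longrightarrow> continuous_on (UNIV \<times> {0..}) (\<lambda>(a, t). L a t w)"
    using assms(5) unfolding local_time_def quasi_surely_def by blast
  interpret F: convex_function f Kg using assms(7) Kg by unfold_locales
  define \<Lambda> where "\<Lambda> a w = (if w \<in> N then 0 else L a t w)" for a w
  \<comment> \<open>A quasi-sure statement asks for one Borel polar set, the same for all measures.
    With \<open>\<Lambda>\<close>, which is continuous in the level for every path, the event in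
    question becomes Borel.\<close>
  define R where "R w \<longleftrightarrow> integrable (second_deriv_measure f) (\<lambda>a. \<Lambda> a w) \<and>
    f (B t w) = f 0 + I t w + 1/2 * (\<integral>a. \<Lambda> a w \<partial>second_deriv_measure f)" for w
  have L_meas: "L a t \<in> borel_measurable borel" for a
    using assms(5) t unfolding local_time_def by auto
  have [measurable]: "I t \<in> borel_measurable borel"
    using assms(10)[OF t] unfolding has_local_stoch_integral_def by blast
  have \<Lambda>_cont: "continuous_on UNIV (\<lambda>a. \<Lambda> a w)" for w
  proof (cases "w \<in> N")
    case False
    have "continuous_on UNIV (\<lambda>a. (\<lambda>(a, t). L a t w) (a, t))"
      by (rule continuous_on_compose2[OF Lcont[OF False]]) (use t in \<open>auto intro!: continuous_intros\<close>)
    then show ?thesis using False unfolding \<Lambda>_def by simp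
  qed (simp add: \<Lambda>_def)
  have [measurable]: "(\<lambda>w. \<Lambda> a w) \<in> borel_measurable borel" for a
    unfolding \<Lambda>_def using L_meas[of a] N(1) by measurable
  have pair: "(\<lambda>(w, a). \<Lambda> a w) \<in> borel_measurable (borel \<Otimes>\<^sub>M second_deriv_measure f)"
  proof -
    have "sets (borel \<Otimes>\<^sub>M second_deriv_measure f) = sets (borel \<Otimes>\<^sub>M borel :: (path \<times> real) measure)"
      by (rule sets_pair_measure_cong) auto
    moreover have "(\<lambda>(w, a). \<Lambda> a w) \<in> borel_measurable (borel \<Otimes>\<^sub>M borel)"
      by (rule borel_measurable_caratheodory) (auto intro: \<Lambda>_cont)
    ultimately show ?thesis using measurable_cong_sets by blast
  qed
  have R_meas: "{w. \<not> R w} \<in> sets borel"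
  proof -
    have [measurable]: "(\<lambda>w. \<integral>a. \<Lambda> a w \<partial>second_deriv_measure f) \<in> borel_measurable borel"
      by (rule F.\<mu>.borel_measurable_lebesgue_integral[OF pair])
    have [measurable]: "(\<lambda>w. \<integral>\<^sup>+a. ennreal \<bar>\<Lambda> a w\<bar> \<partial>second_deriv_measure f) \<in> borel_measurable borel"
      using pair by (intro F.\<mu>.borel_measurable_nn_integral) (simp add: case_prod_beta)
    have "(\<lambda>a. \<Lambda> a w) \<in> borel_measurable (second_deriv_measure f)" for w
      using borel_measurable_continuous_onI[OF \<Lambda>_cont[of w]] by measurable
    \<comment> \<open>Integrability is rewritten as finiteness of a nonnegative integral, which
      depends measurably on the path.\<close>
    then have "R w \<longleftrightarrow> (\<integral>\<^sup>+a. ennreal \<bar>\<Lambda> a w\<bar> \<partial>second_deriv_measure f) < \<infinity> \<and>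
      f (B t w) = f 0 + I t w + 1/2 * (\<integral>a. \<Lambda> a w \<partial>second_deriv_measure f)" for w
      unfolding R_def integrable_iff_bounded by simp
    moreover have "{w \<in> space borel. \<not> ((\<integral>\<^sup>+a. ennreal \<bar>\<Lambda> a w\<bar> \<partial>second_deriv_measure f) < \<infinity> \<and>
      f (B t w) = f 0 + I t w + 1/2 * (\<integral>a. \<Lambda> a w \<partial>second_deriv_measure f))} \<in> sets borel"
      using F.f_measurable by measurable
    ultimately show ?thesis by simp
  qed
  \<comment> \<open>The good set \<open>\<G>\<close> is chosen anew for each measure; the event
    \<open>N \<union> {w. \<not> R w}\<close> is not, so its capacity is a supremum of
    zeros.\<close>
  have null: "emeasure P (N \<union> {w. \<not> R w}) = 0" if P: "P \<in> \<P>" for P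
  proof -
    interpret GP: G_path_qv \<sigma>l \<sigma>h \<P> P Q using assms(1-4) P by unfold_locales
    obtain \<G> where \<G>: "\<G> \<in> sets borel" "AE w in P. w \<in> \<G>"
      "\<And>w. w \<in> \<G> \<Longrightarrow> continuous_on {0..} (\<lambda>t. Q t w)" "\<And>w. w \<in> \<G> \<Longrightarrow> mono_on {0..} (\<lambda>t. Q t w)"
      "\<And>w u v. w \<in> \<G> \<Longrightarrow> 0 \<le> u \<Longrightarrow> u \<le> v \<Longrightarrow> Q v w - Q u w \<le> GP.C * (v - u)"
      by (rule GP.good_paths) blast
    have AE_N: "AE w in P. w \<notin> N"
      using GP.AE_of_quasi_surely[of "\<lambda>w. w \<notin> N"] N unfolding quasi_surely_def by blast
    interpret T: G_path_tanaka \<sigma>l \<sigma>h \<P> P Q \<G> t L N f Kg T "I t"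
      using t \<G> assms(5) N(1) AE_N Lcont assms(10)[OF t] by unfold_locales auto
    have "AE w in P. w \<notin> N \<union> {w. \<not> R w}"
      using T.tanaka T.AE_integrable_Lam AE_N
      by eventually_elim (simp add: R_def T.Lam_def[abs_def] \<Lambda>_def)
    then show ?thesis
      using R_meas N(1) by (subst (asm) AE_iff_null_sets[symmetric]) auto
  qed
  show "quasi_surely \<P> (\<lambda>w. integrable (second_deriv_measure f) (\<lambda>a. L a t w) \<and>
           f (B t w) = f 0 + I t w + 1/2 * (\<integral>a. L a t w \<partial>second_deriv_measure f))"
    unfolding quasi_surely_def
  proof (intro bexI[of _ "N \<union> {w. \<not> R w}"] conjI allI impI)
    show "capacity \<P> (N \<union> {w. \<not> R w}) = 0"
      unfolding capacity_def using null by (simp add: SUP_constant bot_ennreal)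
    fix w assume "w \<notin> N \<union> {w. \<not> R w}"
    then have w: "w \<notin> N" "R w" by auto
    have "\<Lambda> a w = L a t w" for a using w(1) unfolding \<Lambda>_def by simp
    then show "integrable (second_deriv_measure f) (\<lambda>a. L a t w)"
      "f (B t w) = f 0 + I t w + 1/2 * (\<integral>a. L a t w \<partial>second_deriv_measure f)"
      using w(2) unfolding R_def by simp_all
  qed (use R_meas N(1) in auto)
qed

end
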